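(* Let $\mathbf{X}=(X_t)_{t\ge0}$ be a spectrally positive Lévy process of unbounded variation with Laplace exponent $\varphi$ such that $\theta_1=0$ and $\varphi'(0)=0$. Suppose that $\sigma=0$ and $\varphi\in\mathrm{WLSC}(\alpha,c,x_0)\cap\mathrm{WUSC}(\beta,C,x_0)$ for some $c\in(0,1]$, $C\ge1$, $x_0\ge0$ and $1<\alpha\le\beta<2$. Assume also that the Lévy measure $\nu(dx)$ has an almost monotone density $\nu(x)$. Then there is $x_1\in(0,\infty]$ such that for all $t\in(0,1/\Phi(x_0))$ and $x\in(-\infty,x_1)$, $$p(t,x)\approx\begin{cases}\big(t\varphi''(w)\big)^{-1/2}\exp\big\{-t\big(w\varphi'(w)-\varphi(w)\big)\big\}, & \text{if } x\varphi^{-1}(1/t)\le-1,\\ \varphi^{-1}(1/t), & \text{if } -1<x\varphi^{-1}(1/t)\le1,\\ t x^{-1}\varphi(1/x), & \text{if } x\varphi^{-1}(1/t)>1,\end{cases}$$ where $w=(\varphi')^{-1}(-x/t)$. If $x_0=0$ then $x_1=\infty$.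
   Context: A spectrally positive Lévy process is a Lévy process on $\mathbb{R}$ with only positive jumps. There are $\sigma\ge 0$, $b\in\mathbb{R}$ and a $\sigma$-finite measure $\nu$ on $(0,\infty)$ with $\int_{(0,\infty)}(1\wedge x^2)\,\nu(dx)<\infty$ such that the Laplace exponent $\varphi$, defined by $\mathbb{E}e^{-\lambda X_t}=e^{t\varphi(\lambda)}$ for $\lambda\ge0$, equals $$\varphi(\lambda)=\sigma^2\lambda^2-b\lambda+\int_{(0,\infty)}\big(e^{-\lambda x}-1+\lambda x\mathbf{1}_{x<1}\big)\,\nu(dx).$$ Unbounded (infinite) variation means that $\sigma>0$ or $\int_{(0,1)}x\,\nu(dx)=\infty$. $\theta_1=\inf\{s>0:\varphi'(s)>0\}$, and $\varphi'(0)$ means $\varphi'(0^+)$. When $\theta_1=0$ and $\varphi'(0)=0$, both $\varphi$ and $\varphi'$ are strictly increasing bijections of $[0,\infty)$; $\varphi^{-1}$ and $(\varphi')^{-1}$ are their inverses. Scaling: a nonnegative function $f$ belongs to $\mathrm{WLSC}(\alpha,c,x_0)$ if $f(\lambda x)\ge c\lambda^{\alpha}f(x)$ for all $\lambda\ge1$, $x>x_0$; it belongs to $\mathrm{WUSC}(\beta,C,x_0)$ if $f(\lambda x)\le C\lambda^{\beta}f(x)$ for all $\lambda\ge1$, $x>x_0$. Almost monotone density: there is $C_0\ge1$ with $\nu(y)\le C_0\nu(x)$ for all $y\ge x>0$. $\Phi(x)=x^2\varphi''(x)$ for $x>0$. Conventions: $\Phi(0)=\Phi(0^+)=0$ and $1/0=\infty$.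 Under these assumptions the law of $X_t$ is absolutely continuous for every $t>0$; $p(t,\cdot)$ denotes the continuous version of its density. The symbol $\approx$ means that the quotient of the two sides stays between two positive constants not depending on $t$ and $x$ in the indicated range. *)

theory Defs
  imports "HOL-Probability.Probability"
begin

text \<open>Time is \<open>[0,\<infinity>)\<close>, embedded in the reals; \<open>X t\<close> is irrelevant for \<open>t < 0\<close>.\<close>

definition independent_increments :: "'a measure \<Rightarrow> (real \<Rightarrow> 'a \<Rightarrow> real) \<Rightarrow> bool" where
  "independent_increments M X \<longleftrightarrow>
     (\<forall>(n::nat) (s::nat \<Rightarrow> real). 0 \<le> s 0 \<and> (\<forall>i<n. s i \<le> s (Suc i)) \<longrightarrow>
        prob_space.indep_vars M (\<lambda>_. borel) (\<lambda>i \<omega>. X (s (Suc i)) \<omega> - X (s i) \<omega>) {..<n})"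

definition stationary_increments :: "'a measure \<Rightarrow> (real \<Rightarrow> 'a \<Rightarrow> real) \<Rightarrow> bool" where
  "stationary_increments M X \<longleftrightarrow>
     (\<forall>s\<ge>0. \<forall>h\<ge>0. distr M borel (\<lambda>\<omega>. X (s + h) \<omega> - X s \<omega>) = distr M borel (X h))"

definition cadlag :: "(real \<Rightarrow> real) \<Rightarrow> bool" where
  "cadlag f \<longleftrightarrow> (\<forall>t\<ge>0. (f \<longlongrightarrow> f t) (at_right t)) \<and> (\<forall>t>0. \<exists>l. (f \<longlongrightarrow> l) (at_left t))"

definition levy_process :: "'a measure \<Rightarrow> (real \<Rightarrow> 'a \<Rightarrow> real) \<Rightarrow> bool" where
  "levy_process M X \<longleftrightarrow>
     prob_space M \<and> (\<forall>t\<ge>0. X t \<in> borel_measurable M) \<and>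
     (AE \<omega> in M. X 0 \<omega> = 0) \<and>
     independent_increments M X \<and> stationary_increments M X \<and>
     (AE \<omega> in M. cadlag (\<lambda>t. X t \<omega>))"

definition spectrally_positive_levy_process :: "'a measure \<Rightarrow> (real \<Rightarrow> 'a \<Rightarrow> real) \<Rightarrow> bool" where
  "spectrally_positive_levy_process M X \<longleftrightarrow>
     levy_process M X \<and>
     (AE \<omega> in M. \<forall>t>0. \<forall>l. ((\<lambda>s. X s \<omega>) \<longlongrightarrow> l) (at_left t) \<longrightarrow> l \<le> X t \<omega>)"

text \<open>A measure on \<open>(0,\<infinity>)\<close> is encoded as a Borel measure on the line that is null on \<open>(-\<infinity>,0]\<close>.\<close>

definition positive_levy_measure :: "real measure \<Rightarrow> bool" where
  "positive_levy_measure \<nu> \<longleftrightarrow>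
     sets \<nu> = sets borel \<and> sigma_finite_measure \<nu> \<and> emeasure \<nu> {..0} = 0 \<and>
     (\<integral>\<^sup>+x\<in>{0<..}. ennreal (min 1 (x\<^sup>2)) \<partial>\<nu>) < \<infinity>"

text \<open>The exponent is meaningful for \<open>u \<ge> 0\<close> only.\<close>

definition levy_khintchine_exponent :: "real \<Rightarrow> real \<Rightarrow> real measure \<Rightarrow> real \<Rightarrow> real" where
  "levy_khintchine_exponent \<sigma> b \<nu> u =
     \<sigma>\<^sup>2 * u\<^sup>2 - b * u +
     (LINT x:{0<..}|\<nu>. (exp (- u * x) - 1 + u * x * (if x < 1 then 1 else 0)))"

definition has_laplace_exponent ::
    "'a measure \<Rightarrow> (real \<Rightarrow> 'a \<Rightarrow> real) \<Rightarrow> (real \<Rightarrow> real) \<Rightarrow> bool" where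
  "has_laplace_exponent M X \<phi> \<longleftrightarrow>
     (\<forall>t\<ge>0. \<forall>u\<ge>0. integrable M (\<lambda>\<omega>. exp (- u * X t \<omega>)) \<and>
        (LINT \<omega>|M. exp (- u * X t \<omega>)) = exp (t * \<phi> u))"

definition has_characteristics ::
    "'a measure \<Rightarrow> (real \<Rightarrow> 'a \<Rightarrow> real) \<Rightarrow> (real \<Rightarrow> real) \<Rightarrow> real \<Rightarrow> real \<Rightarrow> real measure \<Rightarrow> bool" where
  "has_characteristics M X \<phi> \<sigma> b \<nu> \<longleftrightarrow>
     0 \<le> \<sigma> \<and> positive_levy_measure \<nu> \<and> has_laplace_exponent M X \<phi> \<and>
     (\<forall>u\<ge>0. \<phi> u = levy_khintchine_exponent \<sigma> b \<nu> u)"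

definition unbounded_variation :: "real \<Rightarrow> real measure \<Rightarrow> bool" where
  "unbounded_variation \<sigma> \<nu> \<longleftrightarrow> \<sigma> > 0 \<or> (\<integral>\<^sup>+x\<in>{0<..<1}. ennreal x \<partial>\<nu>) = \<infinity>"

text \<open>The infimum is taken in the extended reals, so that it is \<open>\<infinity>\<close> for the empty set.\<close>

definition theta1 :: "(real \<Rightarrow> real) \<Rightarrow> ereal" where
  "theta1 \<phi> = Inf (ereal ` {s. 0 < s \<and> 0 < deriv \<phi> s})"

text \<open>The derivative on \<open>[0,\<infinity>)\<close>, with \<open>\<phi>'(0) = \<phi>'(0+)\<close>.\<close>

definition deriv0 :: "(real \<Rightarrow> real) \<Rightarrow> real \<Rightarrow> real" where
  "deriv0 \<phi> s = (if s = 0 then Lim (at_right 0) (deriv \<phi>) else deriv \<phi> s)"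

abbreviation halfline_inv :: "(real \<Rightarrow> real) \<Rightarrow> real \<Rightarrow> real" where
  "halfline_inv f \<equiv> the_inv_into {0..} f"

definition WLSC :: "real \<Rightarrow> real \<Rightarrow> real \<Rightarrow> (real \<Rightarrow> real) set" where
  "WLSC \<alpha> c x0 = {f. (\<forall>x\<ge>0. 0 \<le> f x) \<and>
     (\<forall>u\<ge>1. \<forall>x>x0. f (u * x) \<ge> c * u powr \<alpha> * f x)}"

definition WUSC :: "real \<Rightarrow> real \<Rightarrow> real \<Rightarrow> (real \<Rightarrow> real) set" where
  "WUSC \<beta> C x0 = {f. (\<forall>x\<ge>0. 0 \<le> f x) \<and>
     (\<forall>u\<ge>1. \<forall>x>x0. f (u * x) \<le> C * u powr \<beta> * f x)}"

definition has_almost_monotone_density :: "real measure \<Rightarrow> bool" where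
  "has_almost_monotone_density \<nu> \<longleftrightarrow>
     (\<exists>n C0. n \<in> borel_measurable borel \<and> (\<forall>x>0. 0 \<le> n x) \<and>
        \<nu> = density lborel (\<lambda>x. ennreal (n x) * indicator {0<..} x) \<and>
        1 \<le> C0 \<and> (\<forall>x>0. \<forall>y\<ge>x. n y \<le> C0 * n x))"

text \<open>The convention \<open>\<Phi>(0) = \<Phi>(0+) = 0\<close>; in \<^typ>\<open>ereal\<close>, \<open>1 / 0 = \<infinity>\<close>.\<close>

definition Phi :: "(real \<Rightarrow> real) \<Rightarrow> real \<Rightarrow> real" where
  "Phi \<phi> x = (if x = 0 then 0 else x\<^sup>2 * deriv (deriv \<phi>) x)"

text \<open>A continuous density is unique, so the description is proper whenever one exists.\<close>

definition continuous_density :: "'a measure \<Rightarrow> ('a \<Rightarrow> real) \<Rightarrow> real \<Rightarrow> real" where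
  "continuous_density M Y =
     (THE f. continuous_on UNIV f \<and> (\<forall>x. 0 \<le> f x) \<and> distributed M lborel Y (\<lambda>x. ennreal (f x)))"

end

theory Submission
  imports Defs "HOL-Complex_Analysis.Complex_Analysis" "HOL-Real_Asymp.Real_Asymp"
begin

text \<open>
  The process enters only through the Laplace transforms of its one-dimensional laws; everything
  else is a study of an inverse Laplace integral.  As \<open>\<phi>'(0+) = 0\<close> and there is no Gaussian part,
  monotone convergence shows that the jumps of size at least \<open>1\<close> have mean \<open>-b\<close>, so that the drift
  cancels the truncation of the compensator and \<open>\<phi>\<close> equals
  \<open>\<psi>(v) = \<integral> (exp (-v y) - 1 + v y) n(y) dy\<close> (\<open>levy_density_of_characteristics\<close>).  By the identity
  theorem \<open>exp (t \<psi>(z))\<close> is the complex Laplace transform of \<open>X\<^sub>t\<close> for \<open>Re z > 0\<close>, and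
  \<open>p(t,x) = (1 / 2 \<pi> i) \<integral> exp (z x + t \<psi>(z)) dz\<close>, taken along any vertical line in the right half-plane,
  is the continuous density (\<open>complex_laplace\<close>, \<open>inv_laplace_shift\<close>, \<open>distributed_p\<close>).

  The scaling conditions are used as follows.  Up to constants \<open>\<psi>(v)\<close> is the sum of \<open>v\<^sup>2\<close> times the
  second moment of the jumps below \<open>1/v\<close> and \<open>v\<close> times the first moment of those above.  Since
  \<open>\<alpha> > 1\<close>, the first summand alone is comparable with \<open>\<psi>(v)\<close> (\<open>small_moment_ge\<close>); it controls the
  oscillating part of the exponent, whence
  \<open>\<psi>(w) - Re \<psi>(w + i u) \<ge> \<kappa> \<psi>(w) min ((u/w)\<^sup>2) (\<bar>u\<bar>/w)\<close> (\<open>kappa_near\<close>).  Since \<open>\<beta> < 2\<close>, that second moment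
  is carried by jumps of size comparable with \<open>1/v\<close>, and as the density is almost monotone this
  means \<open>n(y) \<approx> \<psi>(1/y) / y\<close> (\<open>density_le\<close>, \<open>density_ge\<close>).

  Write \<open>r = \<psi>\<^sup>-\<^sup>1(1/t)\<close>; the mass of \<open>X\<^sub>t\<close> sits on the scale \<open>1/r\<close>.  To the left, where jumps do not help, one
  integrates along the line through the real saddle point \<open>w\<close>, the solution of \<open>\<psi>'(w) = -x/t\<close>.  If
  \<open>t \<psi>(w)\<close> is large, the integrand is a Gaussian peak with negligible tails (\<open>left_saddle\<close>); otherwise
  \<open>x\<close> is of order \<open>1/r\<close> and the target is of order \<open>r\<close>, as is the density (\<open>core_left\<close>).  To the right the
  cheapest way is one big jump.  Remove the jumps beyond some \<open>d\<close>: the exponent of the rest is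
  entire, so that the line of integration can be moved to \<open>Re z < 0\<close>, which gives exponential decay;
  the removed jumps come back as a Poisson series of positive terms (\<open>series\<close>).  For the upper bound
  \<open>d = x/4\<close>: the term without big jumps is at most of the order of the target, and all others together are bounded by \<open>t\<close> times
  the supremum of \<open>n\<close> beyond \<open>d\<close> (\<open>p_upper_right\<close>).  For the lower bound \<open>d = 1/r\<close> and only the term with exactly
  one big jump is kept; the small jumps are handled by the saddle point estimate at a point
  a few multiples of \<open>1/r\<close> to the left of the origin (\<open>one_jump_lower\<close>).  The same bound covers the middle
  region.

  If \<open>x\<^sub>0 > 0\<close>, these arguments need \<open>r\<close> above a multiple of \<open>x\<^sub>0\<close>.  The remaining times lie in a compact subset of
  \<open>(0,\<infinity>)\<close>.  There the saddle point still handles the far left, while on compact sets of \<open>(t,x)\<close> both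
  sides lie between positive constants; positivity of \<open>p\<close> comes from iterating the Chapman-Kolmogorov
  identity (\<open>p_pos_compact\<close>, \<open>local_estimate\<close>).
\<close>

section \<open>Differentiation under the integral sign\<close>

lemma has_field_derivative_integral:
  fixes g g' :: "'k::{real_normed_field,banach,second_countable_topology} \<Rightarrow> 'a \<Rightarrow> 'k"
  assumes S: "open S" "convex S" "z \<in> S"
    and int: "\<And>x. x \<in> S \<Longrightarrow> integrable M (g x)"
    and der: "\<And>x y. x \<in> S \<Longrightarrow> y \<in> space M \<Longrightarrow> ((\<lambda>x. g x y) has_field_derivative g' x y) (at x)"
    and bound: "\<And>x y. x \<in> S \<Longrightarrow> y \<in> space M \<Longrightarrow> norm (g' x y) \<le> D y"
    and D: "integrable M D"
    and meas: "g' z \<in> borel_measurable M"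
  shows "((\<lambda>x. \<integral>y. g x y \<partial>M) has_field_derivative (\<integral>y. g' z y \<partial>M)) (at z)"
proof -
  have "((\<lambda>x. ((\<integral>y. g x y \<partial>M) - (\<integral>y. g z y \<partial>M)) / (x - z)) \<longlongrightarrow> (\<integral>y. g' z y \<partial>M)) (at z within S)"
    unfolding tendsto_at_iff_sequentially
  proof (intro allI impI)
    fix X assume X: "\<forall>i. X i \<in> S - {z}" "X \<longlonglongrightarrow> z"
    have eq: "((\<integral>y. g (X i) y \<partial>M) - (\<integral>y. g z y \<partial>M)) / (X i - z) = (\<integral>y. (g (X i) y - g z y) / (X i - z) \<partial>M)" for i
      using X int[of "X i"] int[OF S(3)] by (subst integral_divide_zero) (auto simp: Bochner_Integration.integral_diff)
    have "(\<lambda>i. \<integral>y. (g (X i) y - g z y) / (X i - z) \<partial>M) \<longlonglongrightarrow> (\<integral>y. g' z y \<partial>M)"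
    proof (rule integral_dominated_convergence[where w=D])
      show "AE y in M. (\<lambda>i. (g (X i) y - g z y) / (X i - z)) \<longlonglongrightarrow> g' z y"
      proof (rule AE_I2)
        fix y assume y: "y \<in> space M"
        from der[OF S(3) y] have "((\<lambda>x. (g x y - g z y) / (x - z)) \<longlongrightarrow> g' z y) (at z within UNIV)"
          by (simp add: has_field_derivative_iff)
        then show "(\<lambda>i. (g (X i) y - g z y) / (X i - z)) \<longlonglongrightarrow> g' z y"
          unfolding tendsto_at_iff_sequentially using X by (auto simp: o_def)
      qed
      show "AE y in M. norm ((g (X i) y - g z y) / (X i - z)) \<le> D y" for i
      proof (rule AE_I2)
        fix y assume y: "y \<in> space M"
        have "norm (g (X i) y - g z y) \<le> D y * norm (X i - z)"
          by (rule field_differentiable_bound[OF S(2), where f'="\<lambda>x. g' x y"])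
             (use X S der bound y in \<open>auto intro: has_field_derivative_at_within\<close>)
        then show "norm ((g (X i) y - g z y) / (X i - z)) \<le> D y"
          using X by (auto simp: norm_divide divide_simps)
      qed
      show "(\<lambda>y. (g (X i) y - g z y) / (X i - z)) \<in> borel_measurable M" for i
        by (intro borel_measurable_integrable integrable_divide_zero Bochner_Integration.integrable_diff int) (use X S in auto)
    qed (use D meas in auto)
    then show "((\<lambda>x. ((\<integral>y. g x y \<partial>M) - (\<integral>y. g z y \<partial>M)) / (x - z)) \<circ> X) \<longlonglongrightarrow> (\<integral>y. g' z y \<partial>M)"
      unfolding o_def eq .
  qed
  then show ?thesis
    unfolding at_within_open[OF S(3,1)] has_field_derivative_iff .
qed

section \<open>The inverse Fourier integral\<close>

definition inv_fourier :: "(real \<Rightarrow> complex) \<Rightarrow> real \<Rightarrow> complex" where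
  "inv_fourier h x = (\<integral>u. iexp (u * x) * h u \<partial>lborel) / (2 * pi)"

lemma integrable_iexp_mult:
  assumes "integrable M h" "f \<in> borel_measurable M"
  shows "integrable M (\<lambda>u. iexp (f u) * h u)"
  using assms(1)
  by (rule Bochner_Integration.integrable_bound) (use assms in \<open>auto simp: norm_mult\<close>)

lemma norm_inv_fourier_le: 
  assumes "integrable lborel h"
  shows "norm (inv_fourier h x) \<le> (\<integral>u. norm (h u) \<partial>lborel) / (2 * pi)"
proof -
  have "norm (\<integral>u. iexp (u * x) * h u \<partial>lborel) \<le> (\<integral>u. norm (iexp (u * x) * h u) \<partial>lborel)"
    by (rule integral_norm_bound)
  then show ?thesis
    by (simp add: inv_fourier_def norm_divide norm_mult divide_right_mono)
qed

lemma continuous_inv_fourier: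
  assumes "integrable lborel h"
  shows "continuous_on UNIV (inv_fourier h)"
proof (rule continuous_on_sequentiallyI)
  fix X :: "nat \<Rightarrow> real" and a assume X: "X \<longlonglongrightarrow> a"
  have "(\<lambda>i. \<integral>u. iexp (u * X i) * h u \<partial>lborel) \<longlonglongrightarrow> (\<integral>u. iexp (u * a) * h u \<partial>lborel)"
    by (rule integral_dominated_convergence[where w="\<lambda>u. norm (h u)"])
       (use assms borel_measurable_integrable[OF assms] X in \<open>auto simp: norm_mult intro!: AE_I2 tendsto_intros isCont_tendsto_compose[of _ "iexp"]\<close>)
  then show "(\<lambda>i. inv_fourier h (X i)) \<longlonglongrightarrow> inv_fourier h a"
    unfolding inv_fourier_def by (intro tendsto_intros) auto
qed

lemma measurable_inv_fourier [measurable]: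
  "integrable lborel h \<Longrightarrow> inv_fourier h \<in> borel_measurable borel"
  by (intro borel_measurable_continuous_onI continuous_inv_fourier)

text \<open>Multiplication of the transform by the Fourier transform of a measure \<open>q
  dM\<close> becomes convolution with that measure. This one identity serves the compound Poisson
  series and the semigroup property.\<close>

lemma inv_fourier_mult_transform:
  fixes M :: "real measure" and q :: "real \<Rightarrow> real"
  assumes "sigma_finite_measure M" and sM [measurable_cong]: "sets M = sets borel"
    and q: "integrable M q" and h: "integrable lborel h"
  shows "inv_fourier (\<lambda>u. h u * (\<integral>y. of_real (q y) * iexp (- (u * y)) \<partial>M)) x
       = (\<integral>y. of_real (q y) * inv_fourier h (x - y) \<partial>M)"
proof -
  interpret M: sigma_finite_measure M by fact
  interpret pair_sigma_finite lborel M ..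
  note [measurable] = borel_measurable_integrable[OF q] borel_measurable_integrable[OF h]
  have int: "integrable (lborel \<Otimes>\<^sub>M M) (\<lambda>(u,y). iexp (u * (x - y)) * h u * of_real (q y))"
  proof (rule Fubini_integrable)
    show "(\<lambda>(u,y). iexp (u * (x - y)) * h u * of_real (q y)) \<in> borel_measurable (lborel \<Otimes>\<^sub>M M)"
      by measurable
    have "(\<lambda>u. \<integral>y. norm (case (u,y) of (u,y) \<Rightarrow> iexp (u * (x - y)) * h u * of_real (q y)) \<partial>M)
        = (\<lambda>u. norm (h u) * (\<integral>y. norm (q y) \<partial>M))"
      by (simp add: norm_mult)
    then show "integrable lborel (\<lambda>u. \<integral>y. norm (case (u,y) of (u,y) \<Rightarrow> iexp (u * (x - y)) * h u * of_real (q y)) \<partial>M)"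
      using h by simp
    show "AE u in lborel. integrable M (\<lambda>y. case (u,y) of (u,y) \<Rightarrow> iexp (u * (x - y)) * h u * of_real (q y))"
    proof (rule AE_I2)
      fix u :: real
      have "integrable M (\<lambda>y. iexp (u * (x - y)) * (complex_of_real (q y) * h u))"
        by (rule integrable_iexp_mult) (use q in auto)
      then show "integrable M (\<lambda>y. case (u,y) of (u,y) \<Rightarrow> iexp (u * (x - y)) * h u * of_real (q y))"
        by (simp add: mult_ac)
    qed
  qed
  have "(\<integral>u. iexp (u * x) * (h u * (\<integral>y. of_real (q y) * iexp (- (u * y)) \<partial>M)) \<partial>lborel)
      = (\<integral>u. (\<integral>y. iexp (u * (x - y)) * h u * of_real (q y) \<partial>M) \<partial>lborel)"
  proof (rule Bochner_Integration.integral_cong[OF refl])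
    fix u :: real
    have "iexp (u * x) * (h u * (\<integral>y. of_real (q y) * iexp (- (u * y)) \<partial>M))
        = (\<integral>y. iexp (u * x) * h u * (of_real (q y) * iexp (- (u * y))) \<partial>M)"
      by (subst integral_mult_right_zero) (simp only: mult.assoc)
    also have "\<dots> = (\<integral>y. iexp (u * (x - y)) * h u * of_real (q y) \<partial>M)"
      by (intro Bochner_Integration.integral_cong) (auto simp: algebra_simps exp_diff exp_minus field_simps)
    finally show "iexp (u * x) * (h u * (\<integral>y. of_real (q y) * iexp (- (u * y)) \<partial>M)) = (\<integral>y. iexp (u * (x - y)) * h u * of_real (q y) \<partial>M)" .
  qed
  also have "\<dots> = (\<integral>y. (\<integral>u. iexp (u * (x - y)) * h u * of_real (q y) \<partial>lborel) \<partial>M)"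
    using Fubini_integral[OF int] by simp
  also have "\<dots> = (\<integral>y. (2 * pi) * (of_real (q y) * inv_fourier h (x - y)) \<partial>M)"
    by (intro Bochner_Integration.integral_cong) (auto simp: inv_fourier_def)
  also have "\<dots> = (2 * pi) * (\<integral>y. of_real (q y) * inv_fourier h (x - y) \<partial>M)"
    by (rule integral_mult_right_zero)
  finally show ?thesis by (simp add: inv_fourier_def)
qed

section \<open>Multipliers that preserve positivity\<close>

text \<open>Positivity of inverse transforms of \<open>exp (t \<psi>)\<close> is obtained without
  constructing the underlying infinitely divisible laws: call \<open>L\<close> a positive multiplier
  if multiplication by \<open>L\<close> keeps inverse transforms nonnegative. The class contains
  transforms of positive measures by \<open>inv_fourier_mult_transform\<close> and is closed under
  products, sums and bounded limits, hence under \<open>exp\<close>.\<close>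

definition pos_multiplier :: "(real \<Rightarrow> complex) \<Rightarrow> bool" where
  "pos_multiplier L \<longleftrightarrow> L \<in> borel_measurable borel \<and> (\<exists>B. \<forall>u. norm (L u) \<le> B) \<and>
     (\<forall>h. integrable lborel h \<and> (\<forall>x. inv_fourier h x \<in> \<real>\<^sub>\<ge>\<^sub>0) \<longrightarrow> (\<forall>x. inv_fourier (\<lambda>u. h u * L u) x \<in> \<real>\<^sub>\<ge>\<^sub>0))"

lemma integrable_mult_bounded:
  fixes h L :: "real \<Rightarrow> complex"
  assumes "integrable lborel h" "L \<in> borel_measurable borel" "\<And>u. norm (L u) \<le> B"
  shows "integrable lborel (\<lambda>u. h u * L u)"
proof (rule Bochner_Integration.integrable_bound)
  show "integrable lborel (\<lambda>u. of_real B * h u)" using assms by simp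
  show "AE u in lborel. norm (h u * L u) \<le> norm (of_real B * h u)"
  proof (rule AE_I2)
    fix u
    have "norm (h u * L u) \<le> norm (h u) * B"
      by (simp add: norm_mult mult_left_mono assms)
    also have "\<dots> \<le> norm (of_real B * h u)" by (simp add: norm_mult mult.commute mult_left_mono mult_right_mono)
    finally show "norm (h u * L u) \<le> norm (of_real B * h u)" .
  qed
qed (use assms borel_measurable_integrable[OF assms(1)] in measurable)

lemma pos_multiplier_integrable: "pos_multiplier L \<Longrightarrow> integrable lborel h \<Longrightarrow> integrable lborel (\<lambda>u. h u * L u)"
  using integrable_mult_bounded unfolding pos_multiplier_def by blast

lemma pos_multiplier_measurable: "pos_multiplier L \<Longrightarrow> L \<in> borel_measurable borel"
  unfolding pos_multiplier_def by blast

lemma pos_multiplier_mult: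
  assumes "pos_multiplier L1" "pos_multiplier L2" shows "pos_multiplier (\<lambda>u. L1 u * L2 u)"
proof -
  obtain B1 B2 where B: "\<And>u. norm (L1 u) \<le> B1" "\<And>u. norm (L2 u) \<le> B2"
    using assms unfolding pos_multiplier_def by blast
  have "norm (L1 u * L2 u) \<le> B1 * B2" for u
    unfolding norm_mult using B[of u] norm_ge_zero[of "L1 u"] by (intro mult_mono) (linarith | simp)+
  moreover have "inv_fourier (\<lambda>u. h u * (L1 u * L2 u)) x \<in> \<real>\<^sub>\<ge>\<^sub>0"
    if "integrable lborel h" "\<forall>x. inv_fourier h x \<in> \<real>\<^sub>\<ge>\<^sub>0" for h x
    using that assms pos_multiplier_integrable[OF assms(1) that(1)] unfolding pos_multiplier_def mult.assoc[symmetric] by blast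
  moreover have "(\<lambda>u. L1 u * L2 u) \<in> borel_measurable borel"
    using assms by (intro borel_measurable_times borel_measurable_add pos_multiplier_measurable)
  ultimately show ?thesis unfolding pos_multiplier_def by blast
qed

lemma inv_fourier_add: "integrable lborel f \<Longrightarrow> integrable lborel g \<Longrightarrow> inv_fourier (\<lambda>u. f u + g u) x = inv_fourier f x + inv_fourier g x"
  unfolding inv_fourier_def distrib_left
  by (subst Bochner_Integration.integral_add[OF integrable_iexp_mult integrable_iexp_mult]) (simp_all add: add_divide_distrib)

lemma inv_fourier_cmult: "inv_fourier (\<lambda>u. c * f u) x = c * inv_fourier f x"
proof -
  have "(\<integral>u. iexp (u * x) * (c * f u) \<partial>lborel) = (\<integral>u. c * (iexp (u * x) * f u) \<partial>lborel)"
    by (simp add: mult_ac)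
  then show ?thesis by (simp add: inv_fourier_def)
qed

lemma pos_multiplier_add:
  assumes "pos_multiplier L1" "pos_multiplier L2" shows "pos_multiplier (\<lambda>u. L1 u + L2 u)"
proof -
  obtain B1 B2 where B: "\<And>u. norm (L1 u) \<le> B1" "\<And>u. norm (L2 u) \<le> B2"
    using assms unfolding pos_multiplier_def by blast
  have "norm (L1 u + L2 u) \<le> B1 + B2" for u
    using B[of u] norm_triangle_ineq[of "L1 u" "L2 u"] by linarith
  moreover have "inv_fourier (\<lambda>u. h u * (L1 u + L2 u)) x \<in> \<real>\<^sub>\<ge>\<^sub>0"
    if "integrable lborel h" "\<forall>x. inv_fourier h x \<in> \<real>\<^sub>\<ge>\<^sub>0" for h x
    using that assms pos_multiplier_integrable[OF assms(1) that(1)] pos_multiplier_integrable[OF assms(2) that(1)]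
    unfolding pos_multiplier_def by (simp add: distrib_left inv_fourier_add)
  moreover have "(\<lambda>u. L1 u + L2 u) \<in> borel_measurable borel"
    using assms by (intro borel_measurable_times borel_measurable_add pos_multiplier_measurable)
  ultimately show ?thesis unfolding pos_multiplier_def by blast
qed

lemma pos_multiplier_const: "0 \<le> c \<Longrightarrow> pos_multiplier (\<lambda>u. complex_of_real c)"
  unfolding pos_multiplier_def
  by (auto simp: mult.commute[of _ "complex_of_real c"] inv_fourier_cmult intro!: exI[of _ c])

text \<open>A character translates the inverse transform; here it represents a drift.\<close>

lemma pos_multiplier_shift: "pos_multiplier (\<lambda>u. iexp (u * a))"
proof -
  have "inv_fourier (\<lambda>u. h u * iexp (u * a)) x = inv_fourier h (x + a)" for h x
    unfolding inv_fourier_def by (simp add: distrib_left exp_add mult_ac)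
  then show ?thesis unfolding pos_multiplier_def by (auto intro!: exI[of _ 1])
qed

lemma pos_multiplier_power: "pos_multiplier L \<Longrightarrow> pos_multiplier (\<lambda>u. L u ^ k)"
proof (induction k)
  case 0 then show ?case using pos_multiplier_const[of 1] by simp
next
  case (Suc k) then show ?case using pos_multiplier_mult[of L "\<lambda>u. L u ^ k"] by simp
qed

lemma pos_multiplier_sum:
  "finite A \<Longrightarrow> (\<And>i. i \<in> A \<Longrightarrow> pos_multiplier (L i)) \<Longrightarrow> pos_multiplier (\<lambda>u. \<Sum>i\<in>A. L i u)"
proof (induction A rule: finite_induct)
  case empty then show ?case using pos_multiplier_const[of 0] by simp
next
  case (insert a A) then show ?case using pos_multiplier_add[of "L a" "\<lambda>u. \<Sum>i\<in>A. L i u"] by simp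
qed

lemma pos_multiplier_lim:
  assumes L: "\<And>n. pos_multiplier (L n)" and lim: "\<And>u. (\<lambda>n. L n u) \<longlonglongrightarrow> l u"
    and B: "\<And>n u. norm (L n u) \<le> B"
  shows "pos_multiplier l"
proof -
  have [measurable]: "L n \<in> borel_measurable borel" for n using L unfolding pos_multiplier_def by auto
  have [measurable]: "l \<in> borel_measurable borel"
    by (rule borel_measurable_LIMSEQ_metric[of L]) (use lim in auto)
  have "norm (l u) \<le> B" for u
    by (rule LIMSEQ_le_const2[OF tendsto_norm[OF lim]]) (use B in auto)
  moreover have "inv_fourier (\<lambda>u. h u * l u) x \<in> \<real>\<^sub>\<ge>\<^sub>0"
    if h: "integrable lborel h" "\<forall>x. inv_fourier h x \<in> \<real>\<^sub>\<ge>\<^sub>0" for h x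
  proof -
    note [measurable] = borel_measurable_integrable[OF h(1)]
    have "(\<lambda>n. \<integral>u. iexp (u * x) * (h u * L n u) \<partial>lborel) \<longlonglongrightarrow> (\<integral>u. iexp (u * x) * (h u * l u) \<partial>lborel)"
    proof (rule integral_dominated_convergence[where w="\<lambda>u. norm (h u) * B"])
      show "AE u in lborel. norm (iexp (u * x) * (h u * L n u)) \<le> norm (h u) * B" for n
        using B by (auto simp: norm_mult intro!: mult_left_mono)
    qed (use h lim in \<open>auto intro!: AE_I2 tendsto_intros\<close>)
    then have "(\<lambda>n. inv_fourier (\<lambda>u. h u * L n u) x) \<longlonglongrightarrow> inv_fourier (\<lambda>u. h u * l u) x"
      unfolding inv_fourier_def by (intro tendsto_intros) auto
    moreover have "inv_fourier (\<lambda>u. h u * L n u) x \<in> \<real>\<^sub>\<ge>\<^sub>0" for n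
      using L[of n] h unfolding pos_multiplier_def by blast
    ultimately show ?thesis
      by (rule closed_sequentially[OF closed_nonneg_Reals_complex, rotated])
  qed
  ultimately show ?thesis unfolding pos_multiplier_def by (auto intro!: exI[of _ B])
qed

text \<open>The partial sums of the exponential series are positive multipliers, bounded by
  \<open>exp B\<close> when \<open>B\<close> bounds \<open>L\<close>. For the transform of a finite
  measure this is the compound Poisson law.\<close>

lemma pos_multiplier_exp:
  assumes "pos_multiplier L" shows "pos_multiplier (\<lambda>u. exp (L u))"
proof -
  obtain B where B: "\<And>u. norm (L u) \<le> B" using assms unfolding pos_multiplier_def by blast
  have B0: "0 \<le> B" using norm_ge_zero[of "L 0"] B[of 0] by linarith
  show ?thesis
  proof (rule pos_multiplier_lim[where L="\<lambda>n u. \<Sum>k<n. L u ^ k /\<^sub>R fact k"])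
    show "pos_multiplier (\<lambda>u. \<Sum>k<n. L u ^ k /\<^sub>R fact k)" for n
    proof (rule pos_multiplier_sum)
      fix k
      have "pos_multiplier (\<lambda>u. complex_of_real (inverse (fact k)) * L u ^ k)"
        by (intro pos_multiplier_mult pos_multiplier_const pos_multiplier_power assms) auto
      then show "pos_multiplier (\<lambda>u. L u ^ k /\<^sub>R fact k)" by (simp add: scaleR_conv_of_real)
    qed auto
    show "(\<lambda>n. \<Sum>k<n. L u ^ k /\<^sub>R fact k) \<longlonglongrightarrow> exp (L u)" for u
      using exp_converges[of "L u"] by (simp add: sums_def)
    show "norm (\<Sum>k<n. L u ^ k /\<^sub>R fact k) \<le> exp B" for n u
    proof -
      have "norm (\<Sum>k<n. L u ^ k /\<^sub>R fact k) \<le> (\<Sum>k<n. norm (L u ^ k /\<^sub>R fact k))"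
        by (rule norm_sum)
      also have "\<dots> \<le> (\<Sum>k<n. B ^ k /\<^sub>R fact k)"
        by (intro sum_mono) (auto simp: norm_power intro!: mult_left_mono power_mono B)
      also have "\<dots> \<le> exp B"
        using exp_converges[of B] by (intro sum_le_suminf[THEN order_trans]) (auto simp: sums_iff B0)
      finally show ?thesis .
    qed
  qed
qed

lemma pos_multiplier_transform:
  fixes M :: "real measure" and q :: "real \<Rightarrow> real"
  assumes M: "sigma_finite_measure M" "sets M = sets borel"
    and q: "integrable M q" "\<And>y. 0 \<le> q y"
    and L: "(\<lambda>u. \<integral>y. of_real (q y) * iexp (- (u * y)) \<partial>M) \<in> borel_measurable borel"
  shows "pos_multiplier (\<lambda>u. \<integral>y. of_real (q y) * iexp (- (u * y)) \<partial>M)"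
proof -
  have "norm (\<integral>y. of_real (q y) * iexp (- (u * y)) \<partial>M) \<le> (\<integral>y. q y \<partial>M)" for u
    using integral_norm_bound[of M "\<lambda>y. of_real (q y) * iexp (- (u * y))"] q by (simp add: norm_mult)
  moreover have "inv_fourier (\<lambda>u. h u * (\<integral>y. of_real (q y) * iexp (- (u * y)) \<partial>M)) x \<in> \<real>\<^sub>\<ge>\<^sub>0"
    if h: "integrable lborel h" "\<forall>x. inv_fourier h x \<in> \<real>\<^sub>\<ge>\<^sub>0" for h x
  proof -
    have "(\<integral>y. of_real (q y) * inv_fourier h (x - y) \<partial>M) = (\<integral>y. of_real (q y * Re (inv_fourier h (x - y))) \<partial>M)"
      using h by (intro Bochner_Integration.integral_cong) (auto simp: complex_nonneg_Reals_iff complex_eq_iff)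
    also have "\<dots> = of_real (\<integral>y. q y * Re (inv_fourier h (x - y)) \<partial>M)" by (rule integral_complex_of_real)
    also have "\<dots> \<in> \<real>\<^sub>\<ge>\<^sub>0"
      unfolding nonneg_Reals_of_real_iff
      by (intro integral_nonneg_AE AE_I2 mult_nonneg_nonneg q) (use h in \<open>auto simp: complex_nonneg_Reals_iff\<close>)
    finally show ?thesis using inv_fourier_mult_transform[OF M q(1) h(1)] by simp
  qed
  ultimately show ?thesis unfolding pos_multiplier_def using L by blast
qed

section \<open>Gaussian regularisation\<close>

lemma gaussian_transform:
  fixes e s :: real assumes e: "0 < e"
  shows "(\<integral>x. iexp (x * s) * of_real (exp (- ((e * x)\<^sup>2) / 2)) \<partial>lborel) = of_real (sqrt (2 * pi) / e * exp (- ((s / e)\<^sup>2) / 2))"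
    and "integrable lborel (\<lambda>x. exp (- ((e * x)\<^sup>2) / 2))"
proof -
  have i: "integrable lborel (\<lambda>x. std_normal_density x)"
    using integrable_std_normal_moment[of 0] by simp
  then have "integrable lborel (\<lambda>x. std_normal_density x * sqrt (2 * pi))" by simp
  then have i2: "integrable lborel (\<lambda>x::real. exp (- x\<^sup>2 / 2))" by (simp add: std_normal_density_def)
  from lborel_integrable_real_affine[OF this, of e 0] e
  show "integrable lborel (\<lambda>x. exp (- ((e * x)\<^sup>2) / 2))" by simp
  have "(\<integral>x. iexp (x * s) * of_real (exp (- ((e * x)\<^sup>2) / 2)) \<partial>lborel)
     = \<bar>1/e\<bar> *\<^sub>R (\<integral>x. iexp ((0 + (1/e) * x) * s) * of_real (exp (- ((e * (0 + (1/e) * x))\<^sup>2) / 2)) \<partial>lborel)"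
    by (rule lborel_integral_real_affine) (use e in auto)
  also have "(\<integral>x. iexp ((0 + (1/e) * x) * s) * of_real (exp (- ((e * (0 + (1/e) * x))\<^sup>2) / 2)) \<partial>lborel)
     = (\<integral>x. sqrt (2 * pi) * (std_normal_density x *\<^sub>R iexp ((s / e) * x)) \<partial>lborel)"
    using e by (intro Bochner_Integration.integral_cong) (auto simp: std_normal_density_def scaleR_conv_of_real field_simps)
  also have "\<dots> = sqrt (2 * pi) * char std_normal_distribution (s / e)"
    unfolding char_def
    by (subst integral_mult_right_zero, subst integral_density) (auto simp: normal_density_nonneg)
  finally show "(\<integral>x. iexp (x * s) * of_real (exp (- ((e * x)\<^sup>2) / 2)) \<partial>lborel) = of_real (sqrt (2 * pi) / e * exp (- ((s / e)\<^sup>2) / 2))"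
    using e by (simp add: char_std_normal_distribution scaleR_conv_of_real)
qed

text \<open>The definition tests \<open>L\<close> against functions with nonnegative inverse
  transform. The constant \<open>1\<close> is not integrable, but it is the limit of Gaussians,
  whose inverse transforms are Gaussians.\<close>

lemma pos_multiplier_inv_fourier_nonneg:
  assumes L: "pos_multiplier L" "integrable lborel L"
  shows "inv_fourier L x \<in> \<real>\<^sub>\<ge>\<^sub>0"
proof -
  define g where "g n u = complex_of_real (exp (- ((inverse (real (Suc n)) * u)\<^sup>2) / 2))" for n u
  have gi: "integrable lborel (g n)" for n
    using gaussian_transform(2)[of "inverse (real (Suc n))"] unfolding g_def by (intro integrable_of_real) simp
  have "inv_fourier (g n) y \<in> \<real>\<^sub>\<ge>\<^sub>0" for n y
  proof -
    have "inv_fourier (g n) y = of_real (sqrt (2 * pi) / inverse (real (Suc n)) * exp (- ((y / inverse (real (Suc n)))\<^sup>2) / 2) / (2 * pi))"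
      unfolding inv_fourier_def g_def by (subst gaussian_transform) auto
    also have "\<dots> \<in> \<real>\<^sub>\<ge>\<^sub>0" unfolding nonneg_Reals_of_real_iff by simp
    finally show ?thesis .
  qed
  with L gi have nn: "inv_fourier (\<lambda>u. g n u * L u) x \<in> \<real>\<^sub>\<ge>\<^sub>0" for n
    unfolding pos_multiplier_def by blast
  have [measurable]: "L \<in> borel_measurable borel" "g n \<in> borel_measurable borel" for n
    using L borel_measurable_integrable[OF gi] unfolding pos_multiplier_def by auto
  have "(\<lambda>n. \<integral>u. iexp (u * x) * (g n u * L u) \<partial>lborel) \<longlonglongrightarrow> (\<integral>u. iexp (u * x) * L u \<partial>lborel)"
  proof (rule integral_dominated_convergence[where w="\<lambda>u. norm (L u)"])
    show "AE u in lborel. (\<lambda>n. iexp (u * x) * (g n u * L u)) \<longlonglongrightarrow> iexp (u * x) * L u"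
    proof (rule AE_I2)
      fix u
      have "(\<lambda>n. exp (- ((inverse (real (Suc n)) * u)\<^sup>2) / 2)) \<longlonglongrightarrow> exp (- ((0 * u)\<^sup>2) / 2)"
        by (intro tendsto_intros LIMSEQ_inverse_real_of_nat) simp
      then have "(\<lambda>n. g n u) \<longlonglongrightarrow> 1" unfolding g_def by (subst tendsto_of_real_iff[of _ 1, simplified]) simp
      then have "(\<lambda>n. iexp (u * x) * (g n u * L u)) \<longlonglongrightarrow> iexp (u * x) * (1 * L u)" by (intro tendsto_intros)
      then show "(\<lambda>n. iexp (u * x) * (g n u * L u)) \<longlonglongrightarrow> iexp (u * x) * L u" by simp
    qed
    show "AE u in lborel. norm (iexp (u * x) * (g n u * L u)) \<le> norm (L u)" for n
      by (rule AE_I2) (simp add: norm_mult g_def mult_left_le_one_le)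
  qed (use L in auto)
  then have "(\<lambda>n. inv_fourier (\<lambda>u. g n u * L u) x) \<longlonglongrightarrow> inv_fourier L x"
    unfolding inv_fourier_def by (intro tendsto_intros) auto
  then show ?thesis
    by (rule closed_sequentially[OF closed_nonneg_Reals_complex, rotated]) (rule nn)
qed

text \<open>Gaussian weights make every integral absolutely convergent and turn the weighted
  transform of \<open>inv_fourier h\<close> at \<open>v\<close> into an average of \<open>h\<close>
  around \<open>v\<close>. At \<open>v = 0\<close> the averages are bounded by \<open>B\<close>, so
  that Fatou's lemma together with positivity yields integrability; then dominated convergence
  removes the weights.\<close>

lemma fourier_inversion_nonneg:
  fixes h :: "real \<Rightarrow> complex"
  assumes h: "integrable lborel h" and cont: "\<And>u. isCont h u" and B: "\<And>u. norm (h u) \<le> B"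
    and nn: "\<And>x. inv_fourier h x \<in> \<real>\<^sub>\<ge>\<^sub>0"
  shows "integrable lborel (\<lambda>x. Re (inv_fourier h x))"
    and "(\<integral>x. iexp (- (v * x)) * inv_fourier h x \<partial>lborel) = h v"
proof -
  have B0: "0 \<le> B" using norm_ge_zero[of "h 0"] B[of 0] by linarith
  define e where "e n = inverse (real (Suc n))" for n
  have e: "0 < e n" for n by (simp add: e_def)
  define g where "g n x = exp (- ((e n * x)\<^sup>2) / 2)" for n x
  have gi: "integrable lborel (g n)" for n
    using gaussian_transform(2)[OF e] unfolding g_def by simp
  have g01: "0 \<le> g n x" "g n x \<le> 1" for n x by (auto simp: g_def)
  have glim: "(\<lambda>n. g n x) \<longlonglongrightarrow> 1" for x
  proof -
    have "(\<lambda>n. g n x) \<longlonglongrightarrow> exp (- ((0 * x)\<^sup>2) / 2)"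
      unfolding g_def e_def by (intro tendsto_intros LIMSEQ_inverse_real_of_nat) simp
    then show ?thesis by simp
  qed
  note [measurable] = borel_measurable_integrable[OF gi] borel_measurable_integrable[OF h] measurable_inv_fourier[OF h]
  have i0: "integrable lborel std_normal_density"
    using integrable_std_normal_moment[of 0] by simp
  have i1: "(\<integral>s. std_normal_density s \<partial>lborel) = 1"
    using integral_std_normal_moment_even[of 0] by simp
  have key: "(\<integral>x. iexp (- (v * x)) * inv_fourier h x * of_real (g n x) \<partial>lborel)
     = (\<integral>s. h (v + e n * s) * of_real (std_normal_density s) \<partial>lborel)" for n v
  proof -
    have int: "integrable (lborel \<Otimes>\<^sub>M lborel) (\<lambda>(u,x). iexp (x * (u - v)) * (h u * of_real (g n x)))"
    proof (rule lborel_pair.Fubini_integrable)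
      have "(\<lambda>u. \<integral>x. norm (case (u,x) of (u,x) \<Rightarrow> iexp (x * (u - v)) * (h u * of_real (g n x))) \<partial>lborel)
          = (\<lambda>u. norm (h u) * (\<integral>x. g n x \<partial>lborel))"
        using g01 by (simp add: norm_mult)
      then show "integrable lborel (\<lambda>u. \<integral>x. norm (case (u,x) of (u,x) \<Rightarrow> iexp (x * (u - v)) * (h u * of_real (g n x))) \<partial>lborel)"
        using h by simp
      show "AE u in lborel. integrable lborel (\<lambda>x. case (u,x) of (u,x) \<Rightarrow> iexp (x * (u - v)) * (h u * of_real (g n x)))"
      proof (rule AE_I2)
        fix u :: real
        have "integrable lborel (\<lambda>x. iexp (x * (u - v)) * (h u * of_real (g n x)))"
          by (rule integrable_iexp_mult) (use gi in auto)
        then show "integrable lborel (\<lambda>x. case (u,x) of (u,x) \<Rightarrow> iexp (x * (u - v)) * (h u * of_real (g n x)))" by simp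
      qed
    qed measurable
    have "(\<integral>x. iexp (- (v * x)) * inv_fourier h x * of_real (g n x) \<partial>lborel)
       = (\<integral>x. (\<integral>u. iexp (x * (u - v)) * (h u * of_real (g n x)) \<partial>lborel) / (2 * pi) \<partial>lborel)"
    proof (rule Bochner_Integration.integral_cong[OF refl])
      fix x :: real
      have "iexp (- (v * x)) * of_real (g n x) * (\<integral>u. iexp (u * x) * h u \<partial>lborel) 
         = (\<integral>u. iexp (- (v * x)) * of_real (g n x) * (iexp (u * x) * h u) \<partial>lborel)" by simp
      also have "\<dots> = (\<integral>u. iexp (x * (u - v)) * (h u * of_real (g n x)) \<partial>lborel)"
        by (intro Bochner_Integration.integral_cong) (auto simp: algebra_simps exp_diff exp_minus field_simps)
      finally show "iexp (- (v * x)) * inv_fourier h x * of_real (g n x) = (\<integral>u. iexp (x * (u - v)) * (h u * of_real (g n x)) \<partial>lborel) / (2 * pi)"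
        by (simp add: inv_fourier_def mult_ac)
    qed
    also have "\<dots> = (\<integral>x. (\<integral>u. iexp (x * (u - v)) * (h u * of_real (g n x)) \<partial>lborel) \<partial>lborel) / (2 * pi)"
      by simp
    also have "(\<integral>x. (\<integral>u. iexp (x * (u - v)) * (h u * of_real (g n x)) \<partial>lborel) \<partial>lborel)
        = (\<integral>u. (\<integral>x. iexp (x * (u - v)) * (h u * of_real (g n x)) \<partial>lborel) \<partial>lborel)"
      using lborel_pair.Fubini_integral[OF int] by simp
    also have "\<dots> = (\<integral>u. h u * of_real (sqrt (2 * pi) / e n * exp (- (((u - v) / e n)\<^sup>2) / 2)) \<partial>lborel)"
    proof (rule Bochner_Integration.integral_cong[OF refl])
      fix u :: real
      have "(\<integral>x. iexp (x * (u - v)) * (h u * of_real (g n x)) \<partial>lborel) = (\<integral>x. h u * (iexp (x * (u - v)) * of_real (g n x)) \<partial>lborel)"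
        by (simp add: mult_ac)
      then show "(\<integral>x. iexp (x * (u - v)) * (h u * of_real (g n x)) \<partial>lborel) = h u * of_real (sqrt (2 * pi) / e n * exp (- (((u - v) / e n)\<^sup>2) / 2))"
        using gaussian_transform(1)[OF e[of n], of "u - v"] by (simp add: g_def)
    qed
    also have "\<dots> = \<bar>e n\<bar> *\<^sub>R (\<integral>s. h (v + e n * s) * of_real (sqrt (2 * pi) / e n * exp (- (((v + e n * s - v) / e n)\<^sup>2) / 2)) \<partial>lborel)"
      by (rule lborel_integral_real_affine) (use e[of n] in auto)
    also have "\<dots> = (\<integral>s. of_real (e n) * (h (v + e n * s) * of_real (sqrt (2 * pi) / e n * exp (- (((v + e n * s - v) / e n)\<^sup>2) / 2))) \<partial>lborel)"
      using e[of n] by (simp add: scaleR_conv_of_real)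
    also have "\<dots> = (\<integral>s. (2 * pi) * (h (v + e n * s) * of_real (std_normal_density s)) \<partial>lborel)"
    proof (rule Bochner_Integration.integral_cong[OF refl])
      fix s :: real
      have r: "sqrt (2 * pi) * exp (- (s\<^sup>2) / 2) = 2 * pi * std_normal_density s"
        by (simp add: std_normal_density_def field_simps)
      have "of_real (e n) * (h (v + e n * s) * of_real (sqrt (2 * pi) / e n * exp (- (((v + e n * s - v) / e n)\<^sup>2) / 2))) 
          = h (v + e n * s) * of_real (sqrt (2 * pi) * exp (- (s\<^sup>2) / 2))"
        using e[of n] by (simp add: field_simps)
      then show "of_real (e n) * (h (v + e n * s) * of_real (sqrt (2 * pi) / e n * exp (- (((v + e n * s - v) / e n)\<^sup>2) / 2))) 
          = (2 * pi) * (h (v + e n * s) * of_real (std_normal_density s))"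
        unfolding r by simp
    qed
    finally show ?thesis by simp
  qed
  have re: "inv_fourier h x = of_real (Re (inv_fourier h x))" "0 \<le> Re (inv_fourier h x)" for x
    using nn[of x] by (auto simp: complex_nonneg_Reals_iff complex_eq_iff)
  show int: "integrable lborel (\<lambda>x. Re (inv_fourier h x))"
  proof (rule integrableI_nonneg)
    have "(\<integral>\<^sup>+x. ennreal (Re (inv_fourier h x)) \<partial>lborel) \<le> liminf (\<lambda>n. \<integral>\<^sup>+x. ennreal (Re (inv_fourier h x) * g n x) \<partial>lborel)"
    proof -
      have "(\<integral>\<^sup>+x. ennreal (Re (inv_fourier h x)) \<partial>lborel) = (\<integral>\<^sup>+x. liminf (\<lambda>n. ennreal (Re (inv_fourier h x) * g n x)) \<partial>lborel)"
      proof (rule nn_integral_cong)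
        fix x
        have "(\<lambda>n. ennreal (Re (inv_fourier h x) * g n x)) \<longlonglongrightarrow> ennreal (Re (inv_fourier h x) * 1)"
          by (intro tendsto_ennrealI tendsto_intros glim)
        from lim_imp_Liminf[OF _ this] show "ennreal (Re (inv_fourier h x)) = liminf (\<lambda>n. ennreal (Re (inv_fourier h x) * g n x))" by simp
      qed
      also have "\<dots> \<le> liminf (\<lambda>n. \<integral>\<^sup>+x. ennreal (Re (inv_fourier h x) * g n x) \<partial>lborel)"
        by (rule nn_integral_liminf) simp
      finally show ?thesis .
    qed
    also have "\<dots> \<le> ennreal B"
    proof (rule Liminf_le)
      show "\<forall>\<^sub>F n in sequentially. (\<integral>\<^sup>+x. ennreal (Re (inv_fourier h x) * g n x) \<partial>lborel) \<le> ennreal B"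
      proof (rule always_eventually, rule allI)
        fix n
        have ib: "integrable lborel (\<lambda>x. Re (inv_fourier h x) * g n x)"
        proof (rule Bochner_Integration.integrable_bound)
          let ?b = "(\<integral>u. norm (h u) \<partial>lborel) / (2 * pi)"
          show "integrable lborel (\<lambda>x. ?b * g n x)" using gi by simp
          show "AE x in lborel. norm (Re (inv_fourier h x) * g n x) \<le> norm (?b * g n x)"
          proof (rule AE_I2)
            fix x
            have "\<bar>Re (inv_fourier h x)\<bar> \<le> ?b" using abs_Re_le_cmod[of "inv_fourier h x"] norm_inv_fourier_le[OF h, of x] by linarith
            then show "norm (Re (inv_fourier h x) * g n x) \<le> norm (?b * g n x)"
              unfolding real_norm_def abs_mult by (intro mult_right_mono) auto
          qed
        qed measurable
        have "(\<integral>\<^sup>+x. ennreal (Re (inv_fourier h x) * g n x) \<partial>lborel) = ennreal (\<integral>x. Re (inv_fourier h x) * g n x \<partial>lborel)"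
          by (rule nn_integral_eq_integral[OF ib]) (use re g01 in auto)
        also have "(\<integral>x. Re (inv_fourier h x) * g n x \<partial>lborel) \<le> B"
        proof -
          have "of_real (\<integral>x. Re (inv_fourier h x) * g n x \<partial>lborel) = (\<integral>x. of_real (Re (inv_fourier h x) * g n x) \<partial>lborel :: complex)"
            by (rule integral_complex_of_real[symmetric])
          also have "\<dots> = (\<integral>x. iexp (- (0 * x)) * inv_fourier h x * of_real (g n x) \<partial>lborel)"
            by (intro Bochner_Integration.integral_cong refl) (subst re(1), simp)
          also have "\<dots> = (\<integral>s. h (0 + e n * s) * of_real (std_normal_density s) \<partial>lborel)" by (rule key)
          finally have *: "complex_of_real (\<integral>x. Re (inv_fourier h x) * g n x \<partial>lborel) = (\<integral>s. h (0 + e n * s) * of_real (std_normal_density s) \<partial>lborel)" .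
          have "norm (complex_of_real (\<integral>x. Re (inv_fourier h x) * g n x \<partial>lborel)) \<le> (\<integral>s. norm (h (0 + e n * s) * of_real (std_normal_density s)) \<partial>lborel)"
            unfolding * by (rule integral_norm_bound)
          also have "\<dots> \<le> (\<integral>s. B * std_normal_density s \<partial>lborel)"
          proof (rule integral_mono')
            show "integrable lborel (\<lambda>s. B * std_normal_density s)" using i0 by simp
            show "norm (h (0 + e n * s) * of_real (std_normal_density s)) \<le> B * std_normal_density s" for s
              by (auto simp: norm_mult intro!: mult_right_mono B)
            show "0 \<le> B * std_normal_density s" for s using B0 by simp
          qed
          also have "\<dots> = B" using i1 by simp
          finally show ?thesis by simp
        qed
        finally show "(\<integral>\<^sup>+x. ennreal (Re (inv_fourier h x) * g n x) \<partial>lborel) \<le> ennreal B" using B0 by (simp add: ennreal_leI)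
      qed
    qed simp
    also have "\<dots> < \<infinity>" by simp
    finally show "(\<integral>\<^sup>+x. ennreal (Re (inv_fourier h x)) \<partial>lborel) < \<infinity>" .
  qed (use re in auto)
  have "(\<lambda>n. \<integral>x. iexp (- (v * x)) * inv_fourier h x * of_real (g n x) \<partial>lborel) \<longlonglongrightarrow> (\<integral>x. iexp (- (v * x)) * inv_fourier h x \<partial>lborel)"
  proof (rule integral_dominated_convergence[where w="\<lambda>x. Re (inv_fourier h x)"])
    show "AE x in lborel. (\<lambda>n. iexp (- (v * x)) * inv_fourier h x * of_real (g n x)) \<longlonglongrightarrow> iexp (- (v * x)) * inv_fourier h x"
    proof (rule AE_I2)
      fix x
      have "(\<lambda>n. iexp (- (v * x)) * inv_fourier h x * of_real (g n x)) \<longlonglongrightarrow> iexp (- (v * x)) * inv_fourier h x * of_real 1"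
        by (intro tendsto_intros glim)
      then show "(\<lambda>n. iexp (- (v * x)) * inv_fourier h x * of_real (g n x)) \<longlonglongrightarrow> iexp (- (v * x)) * inv_fourier h x" by simp
    qed
    show "AE x in lborel. norm (iexp (- (v * x)) * inv_fourier h x * of_real (g n x)) \<le> Re (inv_fourier h x)" for n
    proof (rule AE_I2)
      fix x
      have "norm (iexp (- (v * x)) * inv_fourier h x * of_real (g n x)) = norm (complex_of_real (Re (inv_fourier h x))) * g n x"
        unfolding norm_mult using g01[of n x] re(1)[of x] by simp
      also have "\<dots> \<le> Re (inv_fourier h x)" using re(2)[of x] g01[of n x] by (simp add: mult_left_le)
      finally show "norm (iexp (- (v * x)) * inv_fourier h x * of_real (g n x)) \<le> Re (inv_fourier h x)" .
    qed
  qed (use int in auto)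
  moreover have "(\<lambda>n. \<integral>s. h (v + e n * s) * of_real (std_normal_density s) \<partial>lborel) \<longlonglongrightarrow> (\<integral>s. h v * of_real (std_normal_density s) \<partial>lborel)"
  proof (rule integral_dominated_convergence[where w="\<lambda>s. B * std_normal_density s"])
    show "AE s in lborel. (\<lambda>n. h (v + e n * s) * of_real (std_normal_density s)) \<longlonglongrightarrow> h v * of_real (std_normal_density s)"
    proof (rule AE_I2)
      fix s
      have "(\<lambda>n. v + e n * s) \<longlonglongrightarrow> v + 0 * s" unfolding e_def by (intro tendsto_intros LIMSEQ_inverse_real_of_nat)
      then have "(\<lambda>n. h (v + e n * s)) \<longlonglongrightarrow> h v" using isCont_tendsto_compose[OF cont] by simp
      then show "(\<lambda>n. h (v + e n * s) * of_real (std_normal_density s)) \<longlonglongrightarrow> h v * of_real (std_normal_density s)"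
        by (intro tendsto_intros)
    qed
    show "AE s in lborel. norm (h (v + e n * s) * of_real (std_normal_density s)) \<le> B * std_normal_density s" for n
      by (rule AE_I2) (auto simp: norm_mult intro!: mult_right_mono B)
  qed (use i0 in auto)
  moreover have "(\<integral>s. h v * of_real (std_normal_density s) \<partial>lborel) = h v"
  proof -
    have "(\<integral>s. h v * of_real (std_normal_density s) \<partial>lborel) = h v * of_real (\<integral>s. std_normal_density s \<partial>lborel)"
      by (subst integral_mult_right_zero, subst integral_complex_of_real) (rule refl)
    then show ?thesis using i1 by simp
  qed
  ultimately show "(\<integral>x. iexp (- (v * x)) * inv_fourier h x \<partial>lborel) = h v"
    unfolding key by (auto dest: LIMSEQ_unique)
qed

section \<open>Integrals along vertical lines\<close>

text \<open>The primitive \<open>F\<close> of \<open>H\<close> on the convex set replaces the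
  rectangle contour: the integrals over \<open>[-n,n]\<close> are differences of \<open>F\<close>,
  and the horizontal edges vanish by the exponential bound.\<close>

lemma vertical_integral_shift:
  fixes H :: "complex \<Rightarrow> complex"
  assumes S: "open S" "convex S" "H holomorphic_on S" "{z. w1 \<le> Re z \<and> Re z \<le> w2} \<subseteq> S"
    and bd: "\<And>z. w1 \<le> Re z \<Longrightarrow> Re z \<le> w2 \<Longrightarrow> norm (H z) \<le> C * exp (- (k * \<bar>Im z\<bar>))"
    and k: "0 < k" and w: "w1 \<le> w2"
    and i1: "integrable lborel (\<lambda>u. H (Complex w1 u))" and i2: "integrable lborel (\<lambda>u. H (Complex w2 u))"
  shows "(\<integral>u. H (Complex w1 u) \<partial>lborel) = (\<integral>u. H (Complex w2 u) \<partial>lborel)"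
proof -
  obtain F where F: "\<And>z. z \<in> S \<Longrightarrow> (F has_field_derivative H z) (at z within S)"
    using holomorphic_convex_primitive'[OF S(2,1,3)] by blast
  have F': "(F has_field_derivative H z) (at z)" if "w1 \<le> Re z" "Re z \<le> w2" for z
  proof -
    have "z \<in> S" using S(4) that by blast
    from F[OF this] show ?thesis unfolding at_within_open[OF \<open>z \<in> S\<close> S(1)] .
  qed
  have lim: "(\<lambda>n. (F (Complex w (real n)) - F (Complex w (- real n))) / \<i>) \<longlonglongrightarrow> (\<integral>u. H (Complex w u) \<partial>lborel)"
    if w: "w1 \<le> w" "w \<le> w2" and i: "integrable lborel (\<lambda>u. H (Complex w u))" for w
  proof -
    have ftc: "(\<integral>u. indicator {- real n..real n} u *\<^sub>R H (Complex w u) \<partial>lborel) = F (Complex w (real n)) / \<i> - F (Complex w (- real n)) / \<i>" for n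
    proof (rule integral_FTC_Icc)
      show "- real n \<le> real n" by simp
      show "((\<lambda>u. F (Complex w u) / \<i>) has_vector_derivative H (Complex w u)) (at u within {- real n..real n})" for u
      proof -
        have *: "((\<lambda>u. Complex w u) has_vector_derivative \<i>) (at u within {- real n..real n})"
          unfolding Complex_eq by (auto intro!: derivative_eq_intros simp: has_vector_derivative_def scaleR_conv_of_real mult.commute)
        have "((F \<circ> (\<lambda>u. Complex w u)) has_vector_derivative \<i> * H (Complex w u)) (at u within {- real n..real n})"
          by (rule field_vector_diff_chain_within[OF *]) (use F'[of "Complex w u"] w in \<open>auto intro: has_field_derivative_at_within\<close>)
        then have "((\<lambda>u. F (Complex w u) / \<i>) has_vector_derivative (\<i> * H (Complex w u)) / \<i>) (at u within {- real n..real n})"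
          unfolding o_def by (rule has_vector_derivative_divide)
        then show ?thesis by simp
      qed
      have "continuous_on {z. w1 \<le> Re z \<and> Re z \<le> w2} H"
        using holomorphic_on_imp_continuous_on[OF S(3)] S(4) continuous_on_subset by blast
      then show "continuous_on {- real n..real n} (\<lambda>u. H (Complex w u))"
        by (rule continuous_on_compose2) (use w in \<open>auto simp: Complex_eq intro!: continuous_intros\<close>)
    qed
    have "(\<lambda>n. \<integral>u. indicator {- real n..real n} u *\<^sub>R H (Complex w u) \<partial>lborel) \<longlonglongrightarrow> (\<integral>u. H (Complex w u) \<partial>lborel)"
    proof (rule integral_dominated_convergence[where w="\<lambda>u. norm (H (Complex w u))"])
      show "AE u in lborel. (\<lambda>n. indicator {- real n..real n} u *\<^sub>R H (Complex w u)) \<longlonglongrightarrow> H (Complex w u)"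
      proof (rule AE_I2)
        fix u :: real
        obtain N :: nat where N: "\<bar>u\<bar> \<le> real N" using real_arch_simple by blast
        show "(\<lambda>n. indicator {- real n..real n} u *\<^sub>R H (Complex w u)) \<longlonglongrightarrow> H (Complex w u)"
          by (rule tendsto_eventually, rule eventually_sequentiallyI[of N]) (use N in \<open>auto simp: indicator_def\<close>)
      qed
      show "AE u in lborel. norm (indicator {- real n..real n} u *\<^sub>R H (Complex w u)) \<le> norm (H (Complex w u))" for n
        by (auto simp: indicator_def)
    qed (use i borel_measurable_integrable[OF i] in \<open>auto intro!: integrable_norm\<close>)
    then show ?thesis unfolding ftc diff_divide_distrib .
  qed
  have edge: "(\<lambda>n. F (Complex w2 (s * real n)) - F (Complex w1 (s * real n))) \<longlonglongrightarrow> 0" if s: "\<bar>s\<bar> = 1" for s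
  proof (rule Lim_null_comparison)
    show "\<forall>\<^sub>F n in sequentially. norm (F (Complex w2 (s * real n)) - F (Complex w1 (s * real n))) \<le> (C * exp (- (k * real n))) * \<bar>w2 - w1\<bar>"
    proof (rule always_eventually, rule allI)
      fix n
      let ?L = "closed_segment (Complex w1 (s * real n)) (Complex w2 (s * real n))"
      have L: "w1 \<le> Re z \<and> Re z \<le> w2 \<and> Im z = s * real n" if "z \<in> ?L" for z
      proof -
        obtain v where v: "0 \<le> v" "v \<le> 1" "z = (1 - v) *\<^sub>R Complex w1 (s * real n) + v *\<^sub>R Complex w2 (s * real n)"
          using \<open>z \<in> ?L\<close> unfolding closed_segment_def by blast
        have "Re z = w1 + v * (w2 - w1)" "Im z = s * real n" unfolding v(3) by (auto simp: algebra_simps)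
        moreover have "v * (w2 - w1) \<le> w2 - w1" using v w by (intro mult_left_le_one_le) auto
        moreover have "0 \<le> v * (w2 - w1)" using v w by simp
        ultimately show ?thesis by (intro conjI) linarith+
      qed
      have "norm (F (Complex w2 (s * real n)) - F (Complex w1 (s * real n))) \<le> (C * exp (- (k * real n))) * norm (Complex w2 (s * real n) - Complex w1 (s * real n))"
      proof (rule field_differentiable_bound[where S="?L" and f'=H])
        fix z assume z: "z \<in> ?L"
        show "(F has_field_derivative H z) (at z within ?L)"
          using F' L[OF z] has_field_derivative_at_within by blast
        show "norm (H z) \<le> C * exp (- (k * real n))"
          using bd[of z] L[OF z] s by (simp add: abs_mult)
      qed auto
      also have "norm (Complex w2 (s * real n) - Complex w1 (s * real n)) = \<bar>w2 - w1\<bar>"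
        by (simp add: cmod_def)
      finally show "norm (F (Complex w2 (s * real n)) - F (Complex w1 (s * real n))) \<le> (C * exp (- (k * real n))) * \<bar>w2 - w1\<bar>" .
    qed
    have "(\<lambda>n. exp (- (k * real n))) \<longlonglongrightarrow> 0"
      using k by real_asymp
    then show "(\<lambda>n. (C * exp (- (k * real n))) * \<bar>w2 - w1\<bar>) \<longlonglongrightarrow> 0"
      by (intro tendsto_mult_left_zero tendsto_mult_right_zero)
  qed
  have "(\<lambda>n. (F (Complex w2 (real n)) - F (Complex w2 (- real n))) / \<i> - (F (Complex w1 (real n)) - F (Complex w1 (- real n))) / \<i>) \<longlonglongrightarrow> 0"
  proof -
    have "(\<lambda>n. ((F (Complex w2 (1 * real n)) - F (Complex w1 (1 * real n))) - (F (Complex w2 (- 1 * real n)) - F (Complex w1 (- 1 * real n)))) / \<i>) \<longlonglongrightarrow> (0 - 0) / \<i>"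
      by (intro tendsto_divide tendsto_diff edge tendsto_const) auto
    then show ?thesis by (simp add: diff_divide_distrib algebra_simps)
  qed
  moreover have "(\<lambda>n. (F (Complex w2 (real n)) - F (Complex w2 (- real n))) / \<i> - (F (Complex w1 (real n)) - F (Complex w1 (- real n))) / \<i>)
     \<longlonglongrightarrow> (\<integral>u. H (Complex w2 u) \<partial>lborel) - (\<integral>u. H (Complex w1 u) \<partial>lborel)"
    by (intro tendsto_diff lim i1 i2) (use w in auto)
  ultimately show ?thesis using LIMSEQ_unique by fastforce
qed

section \<open>Elementary inequalities\<close>

lemma exp_remainder_ge_quadratic:
  assumes "0 \<le> s" "s \<le> (1::real)" shows "s\<^sup>2 \<le> 4 * (exp (- s) - 1 + s)"
proof -
  have "(\<lambda>s. 4 * (exp (- s) - 1 + s) - s\<^sup>2) 0 \<le> (\<lambda>s. 4 * (exp (- s) - 1 + s) - s\<^sup>2) s"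
  proof (rule DERIV_nonneg_imp_nondecreasing[OF assms(1)], intro exI conjI)
    fix x assume x: "0 \<le> x" "x \<le> s"
    show "((\<lambda>s. 4 * (exp (- s) - 1 + s) - s\<^sup>2) has_real_derivative 4 * (1 - exp (- x)) - 2 * x) (at x)"
      by (auto intro!: derivative_eq_intros)
    have "exp (- x) * (1 + x) \<le> exp (- x) * exp x"
      by (intro mult_left_mono exp_ge_add_one_self) auto
    also have "\<dots> = 1" by (simp add: exp_minus)
    also have "1 \<le> (1 - x / 2) * (1 + x)"
      using x assms mult_nonneg_nonneg[of x "1 - x"] by (auto simp: field_simps power2_eq_square)
    finally have "exp (- x) \<le> 1 - x / 2" using x by (auto dest: mult_right_le_imp_le)
    then show "0 \<le> 4 * (1 - exp (- x)) - 2 * x" by simp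
  qed
  then show ?thesis by simp
qed

lemma exp_minus_ge_third: "s \<le> 1 \<Longrightarrow> 1 / 3 \<le> exp (- s :: real)"
proof -
  assume "s \<le> 1"
  then have "exp (-1) \<le> exp (- s)" by simp
  moreover have "exp (-1) = 1 / exp (1::real)" by (simp add: exp_minus divide_inverse)
  moreover have "1 / 3 \<le> 1 / exp (1::real)" using exp_le by (intro divide_left_mono) auto
  ultimately show ?thesis by linarith
qed

lemma exp_remainder_ge_linear:
  assumes "(1::real) \<le> s" shows "s \<le> 4 * (exp (- s) - 1 + s)"
proof -
  have "(\<lambda>s. 4 * (exp (- s) - 1 + s) - s) 1 \<le> (\<lambda>s. 4 * (exp (- s) - 1 + s) - s) s"
  proof (rule DERIV_nonneg_imp_nondecreasing[OF assms(1)], intro exI conjI)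
    fix x assume x: "1 \<le> x" "x \<le> s"
    show "((\<lambda>s. 4 * (exp (- s) - 1 + s) - s) has_real_derivative 4 * (1 - exp (- x)) - 1) (at x)"
      by (auto intro!: derivative_eq_intros)
    have "exp (- x) * 2 \<le> exp (- x) * exp x"
      using exp_ge_add_one_self[of x] x by (intro mult_left_mono) (linarith, simp)
    also have "\<dots> = 1" by (simp add: exp_minus)
    finally show "0 \<le> 4 * (1 - exp (- x)) - 1" by simp
  qed
  moreover have "1 / 3 \<le> exp (- 1 :: real)" by (rule exp_minus_ge_third) simp
  ultimately show ?thesis by simp
qed

lemma exp_remainder_ge: "0 \<le> s \<Longrightarrow> min s (s\<^sup>2) \<le> 4 * (exp (- s) - 1 + s)" for s :: real
  using exp_remainder_ge_quadratic[of s] exp_remainder_ge_linear[of s] by (cases "s \<le> 1") auto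

lemma exp_remainder_nonneg: "0 \<le> exp (- s) - 1 + (s::real)"
  using exp_ge_add_one_self[of "- s"] by simp

lemma exp_remainder_le_linear: "0 \<le> s \<Longrightarrow> exp (- s) - 1 + s \<le> (s::real)"
  by simp

lemma exp_remainder_le_quadratic:
  assumes "0 \<le> s" shows "exp (- s) - 1 + s \<le> (s::real)\<^sup>2 / 2"
proof -
  have "(\<lambda>s. s\<^sup>2 / 2 - (exp (- s) - 1 + s)) 0 \<le> (\<lambda>s. s\<^sup>2 / 2 - (exp (- s) - 1 + s)) s"
  proof (rule DERIV_nonneg_imp_nondecreasing[OF assms(1)], intro exI conjI)
    fix x :: real
    show "((\<lambda>s. s\<^sup>2 / 2 - (exp (- s) - 1 + s)) has_real_derivative x - (1 - exp (- x))) (at x)"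
      by (auto intro!: derivative_eq_intros)
    show "0 \<le> x - (1 - exp (- x))" using exp_remainder_nonneg[of x] by simp
  qed
  then show ?thesis by simp
qed

lemma min_linear_quadratic: "0 \<le> s \<Longrightarrow> min s (s\<^sup>2) = (if s \<le> 1 then s\<^sup>2 else s)" for s :: real
  by (auto simp: min_def power2_eq_square mult_le_cancel_left1 mult_le_cancel_left2)

lemma mult_exp_minus_le: "0 \<le> s \<Longrightarrow> s * exp (- s) \<le> (1::real)"
proof -
  assume "0 \<le> s"
  have "s * exp (- s) \<le> exp s * exp (- s)"
    using exp_ge_add_one_self[of s] by (intro mult_right_mono) (linarith, simp)
  then show ?thesis by (simp add: exp_minus)
qed

lemma square_exp_minus_le: "0 \<le> s \<Longrightarrow> s\<^sup>2 * exp (- s) \<le> (1::real)"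
proof -
  assume s: "0 \<le> s"
  have "0 \<le> (s - 4)\<^sup>2 / 16 + s\<^sup>2 / 16" by simp
  then have "s \<le> 1 + s / 2 + (s / 2)\<^sup>2 / 2" by (simp add: power2_eq_square field_simps)
  also have "\<dots> \<le> exp (s / 2)" using exp_lower_Taylor_quadratic[of "s / 2"] s by simp
  finally have "s\<^sup>2 \<le> (exp (s / 2))\<^sup>2" using s by (intro power_mono) auto
  also have "\<dots> = exp s" by (simp add: exp_double[symmetric])
  finally have "s\<^sup>2 * exp (- s) \<le> exp s * exp (- s)" by (intro mult_right_mono) auto
  then show ?thesis by (simp add: exp_minus)
qed

lemma one_minus_exp_bounds: "0 \<le> s \<Longrightarrow> exp (- s) - 1 + s \<le> s * (1 - exp (- s))" 
   "0 \<le> s \<Longrightarrow> s * (1 - exp (- s)) \<le> min s (s\<^sup>2)" for s :: real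
proof -
  assume s: "0 \<le> s"
  have "exp (- s) * (1 + s) \<le> exp (- s) * exp s"
    by (intro mult_left_mono exp_ge_add_one_self) auto
  also have "\<dots> = 1" by (simp add: exp_minus)
  finally show "exp (- s) - 1 + s \<le> s * (1 - exp (- s))" by (simp add: algebra_simps)
  have "s * (1 - exp (- s)) \<le> s * s" "s * (1 - exp (- s)) \<le> s * 1"
    using exp_remainder_nonneg[of s] s by (auto intro!: mult_left_mono simp del: mult_1_right)
  then show "s * (1 - exp (- s)) \<le> min s (s\<^sup>2)" by (simp add: power2_eq_square)
qed

lemma square_exp_le_min: "0 \<le> s \<Longrightarrow> s\<^sup>2 * exp (- s) \<le> min s (s\<^sup>2)" for s :: real
proof -
  assume s: "0 \<le> s"
  have "s * (s * exp (- s)) \<le> s * 1" by (intro mult_left_mono mult_exp_minus_le s)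
  moreover have "s\<^sup>2 * exp (- s) \<le> s\<^sup>2 * 1" using s by (intro mult_left_mono) auto
  ultimately show ?thesis by (simp add: power2_eq_square mult.assoc)
qed

lemma cube_exp_le_min: "0 \<le> s \<Longrightarrow> s^3 * exp (- s) \<le> min s (s\<^sup>2)" for s :: real
proof -
  assume s: "0 \<le> s"
  have "s * (s\<^sup>2 * exp (- s)) \<le> s * 1" by (intro mult_left_mono square_exp_minus_le s)
  moreover have "s\<^sup>2 * (s * exp (- s)) \<le> s\<^sup>2 * 1" by (intro mult_left_mono mult_exp_minus_le s) auto
  ultimately show ?thesis by (simp add: power2_eq_square power3_eq_cube mult_ac)
qed

lemma one_minus_cos_ge: "\<bar>x\<bar> \<le> 1 \<Longrightarrow> x\<^sup>2 / 4 \<le> 1 - cos (x::real)"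
proof -
  have sin: "x / 2 \<le> sin x" if x: "0 \<le> x" "x \<le> 1" for x :: real
  proof -
    have "(\<lambda>x. sin x - x / 2) 0 \<le> (\<lambda>x. sin x - x / 2) x"
    proof (rule DERIV_nonneg_imp_nondecreasing[OF x(1)], intro exI conjI)
      fix y assume y: "0 \<le> y" "y \<le> x"
      show "((\<lambda>x. sin x - x / 2) has_real_derivative cos y - 1 / 2) (at y)"
        by (auto intro!: derivative_eq_intros)
      have "cos (pi / 3) \<le> cos y"
        using y x pi_gt3 by (intro cos_monotone_0_pi_le) auto
      then show "0 \<le> cos y - 1 / 2" by (simp add: cos_60)
    qed
    then show ?thesis by simp
  qed
  have pos: "x\<^sup>2 / 4 \<le> 1 - cos x" if x: "0 \<le> x" "x \<le> 1" for x :: real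
  proof -
    have "(\<lambda>x. 1 - cos x - x\<^sup>2 / 4) 0 \<le> (\<lambda>x. 1 - cos x - x\<^sup>2 / 4) x"
    proof (rule DERIV_nonneg_imp_nondecreasing[OF x(1)], intro exI conjI)
      fix y assume y: "0 \<le> y" "y \<le> x"
      show "((\<lambda>x. 1 - cos x - x\<^sup>2 / 4) has_real_derivative sin y - y / 2) (at y)"
        by (auto intro!: derivative_eq_intros)
      show "0 \<le> sin y - y / 2" using sin[of y] x y by simp
    qed
    then show ?thesis by simp
  qed
  assume "\<bar>x\<bar> \<le> 1"
  then show ?thesis using pos[of "\<bar>x\<bar>"] by (auto simp: abs_if split: if_splits)
qed

lemma one_minus_cos_le: "1 - cos (x::real) \<le> x\<^sup>2 / 2"
proof -
  have "1 - cos x = 2 * (sin (x / 2))\<^sup>2" using cos_double_sin[of "x / 2"] by simp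
  also have "(sin (x / 2))\<^sup>2 \<le> (x / 2)\<^sup>2" using abs_sin_x_le_abs_x[of "x / 2"] by (simp only: abs_le_square_iff)
  finally show ?thesis by (simp add: power2_eq_square field_simps)
qed

lemma abs_minus_sin_le: "\<bar>x - sin (x::real)\<bar> \<le> \<bar>x\<bar>^3 / 6"
  using Maclaurin_sin_bound[of x 3] by (simp add: numeral_3_eq_3 sin_coeff_def abs_minus_commute fact_numeral)

lemma expm1_le: "0 \<le> s \<Longrightarrow> exp s - 1 - s \<le> s\<^sup>2 * exp s / 2" for s :: real
proof -
  assume s: "0 \<le> s"
  have "(\<lambda>s. s\<^sup>2 * exp s / 2 - (exp s - 1 - s)) 0 \<le> (\<lambda>s. s\<^sup>2 * exp s / 2 - (exp s - 1 - s)) s"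
  proof (rule DERIV_nonneg_imp_nondecreasing[OF s], intro exI conjI)
    fix x :: real assume x: "0 \<le> x"
    show "((\<lambda>s. s\<^sup>2 * exp s / 2 - (exp s - 1 - s)) has_real_derivative (x * exp x + x\<^sup>2 * exp x / 2 - (exp x - 1))) (at x)"
      by (auto intro!: derivative_eq_intros)
    have "exp x * (1 - x) \<le> exp x * exp (- x)" using exp_ge_add_one_self[of "- x"] by (intro mult_left_mono) auto
    also have "\<dots> = 1" by (simp add: exp_minus)
    finally have "exp x - 1 \<le> x * exp x" by (simp add: algebra_simps)
    then show "0 \<le> x * exp x + x\<^sup>2 * exp x / 2 - (exp x - 1)" by (simp add: add_increasing2)
  qed
  then show ?thesis by simp
qed

lemma norm_one_minus_exp_le:
  fixes z :: complex
  shows "0 \<le> Re z \<Longrightarrow> norm (1 - exp (- z)) \<le> norm z"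
    and "norm (1 - exp (- z)) \<le> norm z * exp (norm z)"
proof -
  assume "0 \<le> Re z"
  have "norm ((\<lambda>z. 1 - exp (- z)) z - (\<lambda>z. 1 - exp (- z)) 0) \<le> 1 * norm (z - 0)"
  proof (rule field_differentiable_bound[where S="{z. 0 \<le> Re z}" and f'="\<lambda>z. exp (- z)"])
    show "convex {z. 0 \<le> Re z}" by (rule convex_halfspace_Re_ge)
  qed (use \<open>0 \<le> Re z\<close> in \<open>auto intro!: derivative_eq_intros\<close>)
  then show "norm (1 - exp (- z)) \<le> norm z" by simp
next
  have "norm ((\<lambda>z. 1 - exp (- z)) z - (\<lambda>z. 1 - exp (- z)) 0) \<le> exp (norm z) * norm (z - 0)"
  proof (rule field_differentiable_bound[where S="cball 0 (norm z)" and f'="\<lambda>z. exp (- z)"])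
    fix x :: complex assume "x \<in> cball 0 (norm z)"
    then show "norm (exp (- x)) \<le> exp (norm z)"
      using abs_Re_le_cmod[of x] by simp
  qed (auto intro!: derivative_eq_intros)
  then show "norm (1 - exp (- z)) \<le> norm z * exp (norm z)" by (simp add: mult.commute)
qed

lemma norm_exp_remainder_le:
  fixes z :: complex
  assumes "\<And>s. 0 \<le> s \<Longrightarrow> s \<le> 1 \<Longrightarrow> norm (1 - exp (- (of_real s * z))) \<le> b"
  shows "norm (exp (- z) - 1 + z) \<le> b * norm z"
proof -
  have "norm ((\<lambda>z. exp (- z) - 1 + z) z - (\<lambda>z. exp (- z) - 1 + z) 0) \<le> b * norm (z - 0)"
  proof (rule field_differentiable_bound[where S="closed_segment 0 z" and f'="\<lambda>z. 1 - exp (- z)"])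
    fix x :: complex assume "x \<in> closed_segment 0 z"
    then obtain s where "0 \<le> s" "s \<le> 1" "x = of_real s * z"
      by (auto simp: closed_segment_def scaleR_conv_of_real)
    then show "norm (1 - exp (- x)) \<le> b" using assms by simp
  qed (auto intro!: derivative_eq_intros)
  then show ?thesis by simp
qed

section \<open>Laplace exponents of a Levy density\<close>

definition psi :: "(real \<Rightarrow> real) \<Rightarrow> real \<Rightarrow> real" where
  "psi n v = (\<integral>y. n y * (exp (- (v * y)) - 1 + v * y) \<partial>lborel)"
definition psi1 :: "(real \<Rightarrow> real) \<Rightarrow> real \<Rightarrow> real" where
  "psi1 n v = (\<integral>y. n y * (y * (1 - exp (- (v * y)))) \<partial>lborel)"
definition psi2 :: "(real \<Rightarrow> real) \<Rightarrow> real \<Rightarrow> real" where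
  "psi2 n v = (\<integral>y. n y * (y\<^sup>2 * exp (- (v * y))) \<partial>lborel)"
text \<open>The argument \<open>v\<close> of the exponent corresponds to the jump size
  \<open>1/v\<close>, at which the moments are split.\<close>

definition small_moment :: "(real \<Rightarrow> real) \<Rightarrow> real \<Rightarrow> real" where
  "small_moment n v = (\<integral>y. n y * (indicator {..1/v} y * y\<^sup>2) \<partial>lborel)"
definition large_moment :: "(real \<Rightarrow> real) \<Rightarrow> real \<Rightarrow> real" where
  "large_moment n v = (\<integral>y. n y * (indicator {1/v<..} y * y) \<partial>lborel)"
text \<open>\<open>cpsi\<close> extends \<open>psi\<close> to complex arguments. Along the line
  \<open>Re z = w\<close> its real part is \<open>psi n w - osc n w u\<close>, so \<open>osc\<close>
  measures the decay of \<open>\<bar>exp (cpsi n z)\<bar>\<close> away from the real axis. The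
  integrals converge for \<open>w > 0\<close>, and for all \<open>w\<close> if the jumps are
  bounded; \<open>expo_dom\<close> treats both cases at once.\<close>

definition cpsi :: "(real \<Rightarrow> real) \<Rightarrow> complex \<Rightarrow> complex" where
  "cpsi n z = (\<integral>y. n y *\<^sub>R (exp (- (z * of_real y)) - 1 + z * of_real y) \<partial>lborel)"
definition osc :: "(real \<Rightarrow> real) \<Rightarrow> real \<Rightarrow> real \<Rightarrow> real" where
  "osc n w u = (\<integral>y. n y * ((1 - cos (u * y)) * exp (- (w * y))) \<partial>lborel)"
definition expo_dom :: "(real \<Rightarrow> real) \<Rightarrow> real \<Rightarrow> bool" where
  "expo_dom n w \<longleftrightarrow> 0 < w \<or> (\<exists>d. \<forall>y>d. n y = 0)"

text \<open>The weight \<open>min y (y\<^sup>2)\<close> asks for a first moment of the large jumps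
  as well, so that the full linear compensator can be used.\<close>

locale levy_density =
  fixes n :: "real \<Rightarrow> real"
  assumes n_measurable [measurable]: "n \<in> borel_measurable borel"
    and n_nonneg: "\<And>y. 0 \<le> n y" and n_zero: "\<And>y. y \<le> 0 \<Longrightarrow> n y = 0"
    and n_integrable: "integrable lborel (\<lambda>y. n y * min y (y\<^sup>2))"
begin

lemma integrable_n:
  fixes f :: "real \<Rightarrow> 'b::{banach,second_countable_topology}"
  assumes [measurable]: "f \<in> borel_measurable borel" and B: "\<And>y. 0 < y \<Longrightarrow> n y \<noteq> 0 \<Longrightarrow> norm (f y) \<le> B * min y (y\<^sup>2)"
  shows "integrable lborel (\<lambda>y. n y *\<^sub>R f y)"
proof (rule Bochner_Integration.integrable_bound)
  show "integrable lborel (\<lambda>y. B * (n y * min y (y\<^sup>2)))" using n_integrable by simp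
  show "AE y in lborel. norm (n y *\<^sub>R f y) \<le> norm (B * (n y * min y (y\<^sup>2)))"
  proof (rule AE_I2)
    fix y
    show "norm (n y *\<^sub>R f y) \<le> norm (B * (n y * min y (y\<^sup>2)))"
    proof (cases "y \<le> 0 \<or> n y = 0")
      case False
      then have "norm (n y *\<^sub>R f y) \<le> n y * (B * min y (y\<^sup>2))"
        using B[of y] n_nonneg[of y] by (auto intro!: mult_left_mono)
      also have "\<dots> = B * (n y * min y (y\<^sup>2))" by simp
      also have "\<dots> \<le> norm (B * (n y * min y (y\<^sup>2)))" by simp
      finally show ?thesis .
    qed (use n_zero in auto)
  qed
qed measurable

lemma integrable_n_real:
  fixes f :: "real \<Rightarrow> real"
  assumes "f \<in> borel_measurable borel" and "\<And>y. 0 < y \<Longrightarrow> n y \<noteq> 0 \<Longrightarrow> \<bar>f y\<bar> \<le> B * min y (y\<^sup>2)"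
  shows "integrable lborel (\<lambda>y. n y * f y)"
  using integrable_n[of f B] assms by simp

lemma integral_n_mono:
  fixes f g :: "real \<Rightarrow> real"
  assumes "integrable lborel (\<lambda>y. n y * f y)" "integrable lborel (\<lambda>y. n y * g y)"
    and "\<And>y. 0 < y \<Longrightarrow> n y \<noteq> 0 \<Longrightarrow> f y \<le> g y"
  shows "(\<integral>y. n y * f y \<partial>lborel) \<le> (\<integral>y. n y * g y \<partial>lborel)"
proof (rule integral_mono[OF assms(1,2)])
  fix y show "n y * f y \<le> n y * g y"
  proof (cases "0 < y \<and> n y \<noteq> 0")
    case True then show ?thesis using assms(3)[of y] n_nonneg[of y] by (intro mult_left_mono) auto
  next
    case False then have "n y = 0" using n_zero[of y] by fastforce
    then show ?thesis by simp
  qed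
qed

lemma integral_n_cmult: "(\<integral>y. n y * (a * f y) \<partial>lborel) = a * (\<integral>y. n y * f y \<partial>lborel)" for f :: "real \<Rightarrow> real"
  by (subst integral_mult_right_zero[symmetric]) (simp only: mult.left_commute)

lemma scaled_min_le: 
  fixes v y :: real
  assumes "0 \<le> v" "0 \<le> y" shows "min (v * y) ((v * y)\<^sup>2) \<le> max v (v\<^sup>2) * min y (y\<^sup>2)"
proof (cases "y \<le> y\<^sup>2")
  case True
  have "min (v * y) ((v * y)\<^sup>2) \<le> v * y" by (rule min.cobounded1)
  also have "\<dots> \<le> max v (v\<^sup>2) * y" using assms by (intro mult_right_mono) auto
  finally show ?thesis using True by (simp add: min_def)
next
  case False
  have "min (v * y) ((v * y)\<^sup>2) \<le> v\<^sup>2 * y\<^sup>2" by (simp add: power_mult_distrib)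
  also have "\<dots> \<le> max v (v\<^sup>2) * y\<^sup>2" using assms by (intro mult_right_mono) auto
  finally show ?thesis using False by (simp add: min_def)
qed

lemma integrable_n_scaled:
  fixes f :: "real \<Rightarrow> real"
  assumes "f \<in> borel_measurable borel" "0 \<le> v" "0 \<le> B"
    and "\<And>y. 0 < y \<Longrightarrow> n y \<noteq> 0 \<Longrightarrow> \<bar>f y\<bar> \<le> B * min (v * y) ((v * y)\<^sup>2)"
  shows "integrable lborel (\<lambda>y. n y * f y)"
proof (rule integrable_n_real[OF assms(1)])
  fix y assume y: "0 < y" "n y \<noteq> 0"
  have "\<bar>f y\<bar> \<le> B * min (v * y) ((v * y)\<^sup>2)" using assms(4) y .
  also have "\<dots> \<le> B * (max v (v\<^sup>2) * min y (y\<^sup>2))" using scaled_min_le[of v y] assms y by (intro mult_left_mono) auto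
  finally show "\<bar>f y\<bar> \<le> (B * max v (v\<^sup>2)) * min y (y\<^sup>2)" by simp
qed

lemma integrable_psi: "0 \<le> v \<Longrightarrow> integrable lborel (\<lambda>y. n y * (exp (- (v * y)) - 1 + v * y))"
proof (rule integrable_n_scaled[where v=v and B=1])
  fix y :: real assume "0 \<le> v" "0 < y"
  then have s: "0 \<le> v * y" by simp
  have "exp (- (v * y)) - 1 + v * y \<le> min (v * y) ((v * y)\<^sup>2)"
    using exp_remainder_le_linear[OF s] exp_remainder_le_quadratic[OF s] zero_le_power2[of "v * y"] by (intro min.boundedI) linarith+
  then show "\<bar>exp (- (v * y)) - 1 + v * y\<bar> \<le> 1 * min (v * y) ((v * y)\<^sup>2)"
    using exp_remainder_nonneg[of "v * y"] by simp
qed auto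

lemma integrable_psi1: "0 \<le> v \<Longrightarrow> integrable lborel (\<lambda>y. n y * (y * (1 - exp (- (v * y)))))"
proof (rule integrable_n_real[where B="max 1 v"])
  fix y :: real assume v: "0 \<le> v" and y: "0 < y"
  have "0 \<le> 1 - exp (- (v * y))" using v y by simp
  moreover have "1 - exp (- (v * y)) \<le> v * y" using exp_remainder_nonneg[of "v * y"] by simp
  moreover have "v * y \<le> max 1 v * y" using y by (intro mult_right_mono) auto
  moreover have "1 - exp (- (v * y)) \<le> max 1 v" by (rule order_trans[of _ 1]) auto
  ultimately have "1 - exp (- (v * y)) \<le> max 1 v * min 1 y" by (auto simp: min_def)
  then have "y * (1 - exp (- (v * y))) \<le> y * (max 1 v * min 1 y)" using y by (intro mult_left_mono) auto
  also have "\<dots> = max 1 v * min y (y\<^sup>2)" using y by (auto simp: min_def power2_eq_square)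
  finally show "\<bar>y * (1 - exp (- (v * y)))\<bar> \<le> max 1 v * min y (y\<^sup>2)"
    using \<open>0 \<le> 1 - exp (- (v * y))\<close> y by simp
qed auto

lemma integrable_power_exp:
  assumes v: "0 < v" and k: "k \<in> {2, 3}" shows "integrable lborel (\<lambda>y. n y * (y ^ k * exp (- (v * y))))"
proof (rule integrable_n_scaled[where v=v and B="1 / v^k"])
  fix y :: real assume y: "0 < y"
  have "(v * y) ^ k * exp (- (v * y)) \<le> min (v * y) ((v * y)\<^sup>2)"
    using square_exp_le_min[of "v * y"] cube_exp_le_min[of "v * y"] v y k by auto
  then have "v^k * (y ^ k * exp (- (v * y))) \<le> min (v * y) ((v * y)\<^sup>2)" by (simp add: power_mult_distrib mult.assoc)
  then have "y ^ k * exp (- (v * y)) \<le> min (v * y) ((v * y)\<^sup>2) / v^k"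
    using v by (simp add: pos_le_divide_eq mult.commute)
  then show "\<bar>y ^ k * exp (- (v * y))\<bar> \<le> 1 / v^k * min (v * y) ((v * y)\<^sup>2)" using y by (simp add: abs_mult)
qed (use v in auto)

lemma integrable_psi2: "0 < v \<Longrightarrow> integrable lborel (\<lambda>y. n y * (y\<^sup>2 * exp (- (v * y))))"
  using integrable_power_exp[of v 2] by simp

lemma integrable_small_moment: assumes v: "0 < v" shows "integrable lborel (\<lambda>y. n y * (indicator {..1/v} y * y\<^sup>2))"
proof (rule integrable_n_scaled[where v=v and B="1 / v\<^sup>2"])
  fix y :: real assume y: "0 < y"
  show "\<bar>indicator {..1/v} y * y\<^sup>2\<bar> \<le> 1 / v\<^sup>2 * min (v * y) ((v * y)\<^sup>2)"
    using v y min_linear_quadratic[of "v * y"] by (auto simp: indicator_def field_simps)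
qed (use v in auto)

lemma integrable_large_moment: assumes v: "0 < v" shows "integrable lborel (\<lambda>y. n y * (indicator {1/v<..} y * y))"
proof (rule integrable_n_scaled[where v=v and B="1 / v"])
  fix y :: real assume y: "0 < y"
  show "\<bar>indicator {1/v<..} y * y\<bar> \<le> 1 / v * min (v * y) ((v * y)\<^sup>2)"
    using v y min_linear_quadratic[of "v * y"] by (auto simp: indicator_def field_simps)
qed (use v in auto)

lemma integrable_large_mass: assumes v: "0 < v" shows "integrable lborel (\<lambda>y. n y * indicator {1/v<..} y)"
proof (rule integrable_n_scaled[where v=v and B="1"])
  fix y :: real assume y: "0 < y"
  show "\<bar>indicator {1/v<..} y\<bar> \<le> 1 * min (v * y) ((v * y)\<^sup>2)"
    using v y min_linear_quadratic[of "v * y"] by (auto simp: indicator_def field_simps)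
qed (use v in auto)

lemma psi_nonneg: "0 \<le> psi n v"
  unfolding psi_def by (intro integral_nonneg_AE AE_I2 mult_nonneg_nonneg n_nonneg exp_remainder_nonneg)

lemma psi_0 [simp]: "psi n 0 = 0" by (simp add: psi_def)
lemma psi1_0 [simp]: "psi1 n 0 = 0" by (simp add: psi1_def)

lemma small_moment_nonneg: "0 \<le> small_moment n v"
  unfolding small_moment_def by (intro integral_nonneg_AE AE_I2 mult_nonneg_nonneg n_nonneg) auto

lemma large_moment_nonneg: "0 \<le> large_moment n v"
  unfolding large_moment_def
proof (intro integral_nonneg_AE AE_I2)
  show "0 \<le> n y * (indicator {1/v<..} y * y)" for y
    using n_zero[of y] n_nonneg[of y] by (cases "y \<le> 0") auto
qed

text \<open>\<open>exp (-s) - 1 + s\<close> is comparable with \<open>min s (s\<^sup>2)\<close>,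
  which is what the two moments add up to.\<close>

lemma split_le_psi: assumes v: "0 < v" shows "v\<^sup>2 * small_moment n v + v * large_moment n v \<le> 4 * psi n v"
proof -
  have "v\<^sup>2 * small_moment n v + v * large_moment n v 
      = (\<integral>y. v\<^sup>2 * (n y * (indicator {..1/v} y * y\<^sup>2)) + v * (n y * (indicator {1/v<..} y * y)) \<partial>lborel)"
    unfolding small_moment_def large_moment_def using integrable_small_moment[OF v] integrable_large_moment[OF v]
    by (subst Bochner_Integration.integral_add) auto
  also have "\<dots> = (\<integral>y. n y * (v\<^sup>2 * (indicator {..1/v} y * y\<^sup>2) + v * (indicator {1/v<..} y * y)) \<partial>lborel)"
    by (intro Bochner_Integration.integral_cong) (auto simp: algebra_simps)
  also have "\<dots> \<le> (\<integral>y. n y * (4 * (exp (- (v * y)) - 1 + v * y)) \<partial>lborel)"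
  proof (rule integral_n_mono)
    have "integrable lborel (\<lambda>y. v\<^sup>2 * (n y * (indicator {..1/v} y * y\<^sup>2)) + v * (n y * (indicator {1/v<..} y * y)))"
      using integrable_small_moment[OF v] integrable_large_moment[OF v] by auto
    then show "integrable lborel (\<lambda>y. n y * (v\<^sup>2 * (indicator {..1/v} y * y\<^sup>2) + v * (indicator {1/v<..} y * y)))"
      by (simp add: algebra_simps)
    have "integrable lborel (\<lambda>y. 4 * (n y * (exp (- (v * y)) - 1 + v * y)))"
      using integrable_psi[of v] v by (intro integrable_mult_right) auto
    then show "integrable lborel (\<lambda>y. n y * (4 * (exp (- (v * y)) - 1 + v * y)))" by (simp only: mult.left_commute)
    fix y :: real assume y: "0 < y"
    have "v\<^sup>2 * (indicator {..1/v} y * y\<^sup>2) + v * (indicator {1/v<..} y * y) = min (v * y) ((v * y)\<^sup>2)"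
      using v y min_linear_quadratic[of "v * y"] by (auto simp: indicator_def field_simps)
    also have "\<dots> \<le> 4 * (exp (- (v * y)) - 1 + v * y)" using exp_remainder_ge[of "v * y"] v y by simp
    finally show "v\<^sup>2 * (indicator {..1/v} y * y\<^sup>2) + v * (indicator {1/v<..} y * y) \<le> 4 * (exp (- (v * y)) - 1 + v * y)" .
  qed
  also have "\<dots> = 4 * psi n v" unfolding psi_def by (rule integral_n_cmult)
  finally show ?thesis .
qed

lemma small_moment_le_psi: "0 < v \<Longrightarrow> v\<^sup>2 * small_moment n v \<le> 4 * psi n v"
  and large_moment_le_psi: "0 < v \<Longrightarrow> v * large_moment n v \<le> 4 * psi n v"
  using split_le_psi[of v] large_moment_nonneg[of v] small_moment_nonneg[of v] by (auto intro: order_trans[rotated])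

lemma large_mass_le_psi: assumes v: "0 < v" shows "(\<integral>y. n y * indicator {1/v<..} y \<partial>lborel) \<le> 4 * psi n v"
proof -
  have "(\<integral>y. n y * indicator {1/v<..} y \<partial>lborel) \<le> (\<integral>y. n y * (v * (indicator {1/v<..} y * y)) \<partial>lborel)"
  proof (rule integral_n_mono[OF integrable_large_mass[OF v]])
    show "integrable lborel (\<lambda>y. n y * (v * (indicator {1/v<..} y * y)))"
      using integrable_mult_right[OF integrable_large_moment[OF v], of v] by (simp add: mult_ac)
  qed (use v in \<open>auto simp: indicator_def field_simps\<close>)
  also have "\<dots> = v * large_moment n v" unfolding large_moment_def by (rule integral_n_cmult)
  finally show ?thesis using large_moment_le_psi[OF v] by simp
qed

lemma psi_le_split: assumes v: "0 < v" shows "psi n v \<le> v\<^sup>2 * small_moment n v / 2 + v * large_moment n v"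
proof -
  have i: "integrable lborel (\<lambda>y. n y * (v\<^sup>2 * (indicator {..1/v} y * y\<^sup>2) / 2 + v * (indicator {1/v<..} y * y)))"
  proof -
    have "integrable lborel (\<lambda>y. (v\<^sup>2 / 2) * (n y * (indicator {..1/v} y * y\<^sup>2)) + v * (n y * (indicator {1/v<..} y * y)))"
      using integrable_small_moment[OF v] integrable_large_moment[OF v] by auto
    then show ?thesis by (simp add: algebra_simps)
  qed
  have "psi n v \<le> (\<integral>y. n y * (v\<^sup>2 * (indicator {..1/v} y * y\<^sup>2) / 2 + v * (indicator {1/v<..} y * y)) \<partial>lborel)"
    unfolding psi_def
  proof (rule integral_n_mono[OF _ i])
    show "integrable lborel (\<lambda>y. n y * (exp (- (v * y)) - 1 + v * y))" using integrable_psi v by simp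
    fix y :: real assume y: "0 < y"
    then have s: "0 \<le> v * y" using v by simp
    show "exp (- (v * y)) - 1 + v * y \<le> v\<^sup>2 * (indicator {..1/v} y * y\<^sup>2) / 2 + v * (indicator {1/v<..} y * y)"
    proof (cases "y \<le> 1 / v")
      case True then show ?thesis using exp_remainder_le_quadratic[OF s] by (simp add: power_mult_distrib)
    next
      case False then show ?thesis using exp_remainder_le_linear[OF s] by simp
    qed
  qed
  also have "\<dots> = (\<integral>y. (v\<^sup>2 / 2) * (n y * (indicator {..1/v} y * y\<^sup>2)) + v * (n y * (indicator {1/v<..} y * y)) \<partial>lborel)"
    by (intro Bochner_Integration.integral_cong) (auto simp: algebra_simps)
  also have "\<dots> = v\<^sup>2 * small_moment n v / 2 + v * large_moment n v"
    unfolding small_moment_def large_moment_def using integrable_small_moment[OF v] integrable_large_moment[OF v]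
    by (subst Bochner_Integration.integral_add) auto
  finally show ?thesis .
qed

lemma psi1_nonneg: "0 \<le> v \<Longrightarrow> 0 \<le> psi1 n v"
  unfolding psi1_def
proof (intro integral_nonneg_AE AE_I2)
  fix y assume "0 \<le> v" then show "0 \<le> n y * (y * (1 - exp (- (v * y))))"
    using n_zero[of y] n_nonneg[of y] by (cases "y \<le> 0") auto
qed

lemma psi_le_psi1: assumes v: "0 < v" shows "psi n v \<le> v * psi1 n v"
proof -
  have "psi n v \<le> (\<integral>y. n y * (v * (y * (1 - exp (- (v * y))))) \<partial>lborel)"
    unfolding psi_def
  proof (rule integral_n_mono)
    show "integrable lborel (\<lambda>y. n y * (v * (y * (1 - exp (- (v * y))))))"
      using integrable_mult_right[OF integrable_psi1[of v], of v] v by (simp add: mult.left_commute)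
    fix y :: real assume y: "0 < y"
    then show "exp (- (v * y)) - 1 + v * y \<le> v * (y * (1 - exp (- (v * y))))"
      using one_minus_exp_bounds(1)[of "v * y"] v by (simp add: mult.assoc)
  qed (use integrable_psi v in auto)
  also have "\<dots> = v * psi1 n v" unfolding psi1_def by (rule integral_n_cmult)
  finally show ?thesis .
qed

text \<open>The common source of the bounds by \<open>4 \<psi>(v)\<close> for \<open>v^k\<close>
  times the absolute value of the \<open>k\<close>-th derivative at \<open>v\<close>, where \<open>k
  \<le> 3\<close>: each integrand is dominated by \<open>min (v y) ((v y)\<^sup>2)\<close>.\<close>

lemma integral_le_4psi:
  assumes v: "0 < v" and i: "integrable lborel (\<lambda>y. n y * f y)" and le: "\<And>y. 0 < y \<Longrightarrow> a * f y \<le> min (v * y) ((v * y)\<^sup>2)"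
  shows "a * (\<integral>y. n y * f y \<partial>lborel) \<le> 4 * psi n v"
proof -
  have "a * (\<integral>y. n y * f y \<partial>lborel) = (\<integral>y. n y * (a * f y) \<partial>lborel)" by (rule integral_n_cmult[symmetric])
  also have "\<dots> \<le> (\<integral>y. n y * (4 * (exp (- (v * y)) - 1 + v * y)) \<partial>lborel)"
  proof (rule integral_n_mono)
    show "integrable lborel (\<lambda>y. n y * (a * f y))" 
      using integrable_mult_right[OF i, of a] by (simp only: mult.left_commute)
    have "integrable lborel (\<lambda>y. 4 * (n y * (exp (- (v * y)) - 1 + v * y)))"
      using integrable_psi[of v] v by (intro integrable_mult_right) auto
    then show "integrable lborel (\<lambda>y. n y * (4 * (exp (- (v * y)) - 1 + v * y)))" by (simp only: mult.left_commute)
    fix y :: real assume y: "0 < y"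
    have "0 \<le> v * y" using v y by simp
    from le[OF y] exp_remainder_ge[OF this] show "a * f y \<le> 4 * (exp (- (v * y)) - 1 + v * y)"
      by (rule order_trans)
  qed
  also have "\<dots> = 4 * psi n v" unfolding psi_def by (rule integral_n_cmult)
  finally show ?thesis .
qed

lemma psi1_le_psi: "0 < v \<Longrightarrow> v * psi1 n v \<le> 4 * psi n v"
  unfolding psi1_def using integrable_psi1 one_minus_exp_bounds(2)
  by (intro integral_le_4psi) (auto simp: mult.assoc[symmetric])

lemma psi2_le_psi: "0 < v \<Longrightarrow> v\<^sup>2 * psi2 n v \<le> 4 * psi n v"
  unfolding psi2_def using integrable_psi2 square_exp_le_min
  by (intro integral_le_4psi) (auto simp: mult.assoc[symmetric] power_mult_distrib[symmetric])

lemma psi3_le_psi: "0 < v \<Longrightarrow> v^3 * (\<integral>y. n y * (y^3 * exp (- (v * y))) \<partial>lborel) \<le> 4 * psi n v"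
  using integrable_power_exp[of v 3] cube_exp_le_min
  by (intro integral_le_4psi) (auto simp: mult.assoc[symmetric] power_mult_distrib[symmetric])

lemma psi2_nonneg: "0 \<le> psi2 n v"
  unfolding psi2_def by (intro integral_nonneg_AE AE_I2 mult_nonneg_nonneg n_nonneg) auto

lemma small_moment_le_psi2: assumes v: "0 < v" shows "small_moment n v \<le> 3 * psi2 n v"
proof -
  have "small_moment n v \<le> (\<integral>y. n y * (3 * (y\<^sup>2 * exp (- (v * y)))) \<partial>lborel)"
    unfolding small_moment_def
  proof (rule integral_n_mono[OF integrable_small_moment[OF v]])
    show "integrable lborel (\<lambda>y. n y * (3 * (y\<^sup>2 * exp (- (v * y)))))"
      using integrable_mult_right[OF integrable_psi2[OF v], of 3] by (simp add: mult.left_commute)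
    fix y :: real assume y: "0 < y"
    show "indicator {..1/v} y * y\<^sup>2 \<le> 3 * (y\<^sup>2 * exp (- (v * y)))"
    proof (cases "y \<le> 1 / v")
      case True
      then have "1 / 3 \<le> exp (- (v * y))" using v by (intro exp_minus_ge_third) (simp add: field_simps)
      then have "y\<^sup>2 * (1/3) \<le> y\<^sup>2 * exp (- (v * y))" by (intro mult_left_mono) auto
      then show ?thesis using True by simp
    qed (use y in auto)
  qed
  also have "\<dots> = 3 * psi2 n v" unfolding psi2_def by (rule integral_n_cmult)
  finally show ?thesis .
qed

lemma small_moment_antimono: assumes "0 < v" "v \<le> v'" shows "small_moment n v' \<le> small_moment n v"
  unfolding small_moment_def
proof (rule integral_n_mono)
  fix y :: real assume "0 < y"
  have "1 / v' \<le> 1 / v" using assms by (intro divide_left_mono) auto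
  then show "indicator {..1/v'} y * y\<^sup>2 \<le> indicator {..1/v} y * y\<^sup>2" by (auto simp: indicator_def)
qed (use integrable_small_moment assms in auto)

lemma psi_deriv: assumes v: "0 < v" shows "(psi n has_field_derivative psi1 n v) (at v)"
  unfolding psi_def[abs_def] psi1_def
proof (rule has_field_derivative_integral[where S="{0<..<2 * v}" and D="\<lambda>y. n y * (y * (1 - exp (- (2 * v * y))))"])
  show "integrable lborel (\<lambda>y. n y * (y * (1 - exp (- (2 * v * y)))))" using integrable_psi1[of "2 * v"] v by simp
  fix x y :: real assume x: "x \<in> {0<..<2 * v}"
  show "((\<lambda>x. n y * (exp (- (x * y)) - 1 + x * y)) has_field_derivative n y * (y * (1 - exp (- (x * y))))) (at x)"
    by (auto intro!: derivative_eq_intros simp: algebra_simps)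
  show "norm (n y * (y * (1 - exp (- (x * y))))) \<le> n y * (y * (1 - exp (- (2 * v * y))))"
  proof (cases "y \<le> 0")
    case False
    then show ?thesis using x v n_nonneg[of y] by (auto simp: abs_mult intro!: mult_left_mono)
  qed (use n_zero in simp)
qed (use v integrable_psi in auto)

lemma psi1_deriv: assumes v: "0 < v" shows "(psi1 n has_field_derivative psi2 n v) (at v)"
  unfolding psi1_def[abs_def] psi2_def
proof (rule has_field_derivative_integral[where S="{v/2<..<2 * v}" and D="\<lambda>y. n y * (y\<^sup>2 * exp (- (v / 2 * y)))"])
  show "integrable lborel (\<lambda>y. n y * (y\<^sup>2 * exp (- (v / 2 * y))))" using integrable_psi2[of "v/2"] v by simp
  fix x y :: real assume x: "x \<in> {v/2<..<2 * v}"
  show "((\<lambda>x. n y * (y * (1 - exp (- (x * y))))) has_field_derivative n y * (y\<^sup>2 * exp (- (x * y)))) (at x)"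
    by (auto intro!: derivative_eq_intros simp: algebra_simps power2_eq_square)
  show "norm (n y * (y\<^sup>2 * exp (- (x * y)))) \<le> n y * (y\<^sup>2 * exp (- (v / 2 * y)))"
  proof (cases "y \<le> 0")
    case False
    then show ?thesis using x v n_nonneg[of y] by (auto simp: abs_mult intro!: mult_left_mono)
  qed (use n_zero in simp)
next
  fix x assume "x \<in> {v/2<..<2 * v}"
  then show "integrable lborel (\<lambda>y. n y * (y * (1 - exp (- (x * y)))))" using integrable_psi1[of x] v by simp
qed (use v in auto)

lemma psi_mono: assumes "0 < v" "v \<le> v'" shows "psi n v \<le> psi n v'"
proof (rule DERIV_nonneg_imp_nondecreasing[OF assms(2)], intro exI conjI)
  fix x assume "v \<le> x" "x \<le> v'"
  then show "(psi n has_real_derivative psi1 n x) (at x)" "0 \<le> psi1 n x"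
    using assms psi_deriv[of x] psi1_nonneg[of x] by auto
qed

lemma psi1_mono: assumes "0 < v" "v \<le> v'" shows "psi1 n v \<le> psi1 n v'"
proof (rule DERIV_nonneg_imp_nondecreasing[OF assms(2)], intro exI conjI)
  fix x assume "v \<le> x" "x \<le> v'"
  then show "(psi1 n has_real_derivative psi2 n x) (at x)" "0 \<le> psi2 n x"
    using assms psi1_deriv[of x] psi2_nonneg[of x] by auto
qed

lemma psi2_antimono: assumes "0 < v" "v \<le> v'" shows "psi2 n v' \<le> psi2 n v"
  unfolding psi2_def
proof (rule integral_n_mono)
  fix y :: real assume "0 < y"
  then show "y\<^sup>2 * exp (- (v' * y)) \<le> y\<^sup>2 * exp (- (v * y))"
    using assms by (intro mult_left_mono) auto
qed (use integrable_psi2 assms in auto)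

text \<open>If the second derivative vanished, there would be no jumps at all.\<close>

lemma psi2_pos: assumes v: "0 < v" and pos: "0 < psi n v" shows "0 < psi2 n v"
proof (rule ccontr)
  assume "\<not> 0 < psi2 n v"
  then have "psi2 n v = 0" using psi2_nonneg[of v] by simp
  then have "AE y in lborel. n y * (y\<^sup>2 * exp (- (v * y))) = 0"
    unfolding psi2_def by (subst (asm) integral_nonneg_eq_0_iff_AE[OF integrable_psi2[OF v]]) (auto intro!: mult_nonneg_nonneg n_nonneg)
  then have "AE y in lborel. n y * (exp (- (v * y)) - 1 + v * y) = 0"
    by eventually_elim (auto simp: n_zero)
  then have "psi n v = 0" unfolding psi_def by (rule integral_eq_zero_AE)
  then show False using pos by simp
qed

lemma levy_density_le:
  assumes "levy_density n1" "\<And>y. n1 y \<le> n y" "0 < w"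
  shows "psi n1 w \<le> psi n w" "psi1 n1 w \<le> psi1 n w"
proof -
  interpret n1: levy_density n1 by fact
  have le: "n1 y * f \<le> n y * f" if "0 < y \<Longrightarrow> 0 \<le> f" for y f
    using that assms(2)[of y] n_zero[of y] n1.n_zero[of y] by (cases "y \<le> 0") (auto intro!: mult_right_mono)
  show "psi n1 w \<le> psi n w" unfolding psi_def
    by (rule integral_mono[OF n1.integrable_psi integrable_psi le]) (use assms exp_remainder_nonneg in auto)
  show "psi1 n1 w \<le> psi1 n w" unfolding psi1_def
    by (rule integral_mono[OF n1.integrable_psi1 integrable_psi1 le]) (use assms in auto)
qed

lemma psi1_tendsto_0: "(psi1 n \<longlongrightarrow> 0) (at_right 0)"
  unfolding tendsto_at_iff_sequentially
proof (intro allI impI)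
  fix X :: "nat \<Rightarrow> real" assume X: "\<forall>i. X i \<in> {0<..} - {0}" "X \<longlonglongrightarrow> 0"
  obtain N where N: "\<And>i. N \<le> i \<Longrightarrow> X i < 1" 
    using order_tendstoD(2)[OF X(2), of 1] by (auto simp: eventually_sequentially)
  have "(\<lambda>i. psi1 n (X (i + N))) \<longlonglongrightarrow> (\<integral>y. (0::real) \<partial>(lborel :: real measure))"
    unfolding psi1_def
  proof (rule integral_dominated_convergence[where s="\<lambda>i y. n y * (y * (1 - exp (- (X (i + N) * y))))" and f="\<lambda>_. 0" and w="\<lambda>y. n y * (y * (1 - exp (- (1 * y))))"])
    show "integrable lborel (\<lambda>y. n y * (y * (1 - exp (- (1 * y)))))" by (rule integrable_psi1) simp
    show "AE y in lborel. (\<lambda>i. n y * (y * (1 - exp (- (X (i + N) * y))))) \<longlonglongrightarrow> 0"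
    proof (rule AE_I2)
      fix y
      have "(\<lambda>i. n y * (y * (1 - exp (- (X (i + N) * y))))) \<longlonglongrightarrow> n y * (y * (1 - exp (- (0 * y))))"
        by (intro tendsto_intros LIMSEQ_ignore_initial_segment X)
      then show "(\<lambda>i. n y * (y * (1 - exp (- (X (i + N) * y))))) \<longlonglongrightarrow> 0" by simp
    qed
    show "AE y in lborel. norm (n y * (y * (1 - exp (- (X (i + N) * y))))) \<le> n y * (y * (1 - exp (- (1 * y))))" for i
    proof (rule AE_I2)
      fix y
      show "norm (n y * (y * (1 - exp (- (X (i + N) * y))))) \<le> n y * (y * (1 - exp (- (1 * y))))"
      proof (cases "y \<le> 0")
        case False
        have "X (i + N) * y \<le> 1 * y" using N[of "i + N"] False by (intro mult_right_mono) auto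
        moreover have "0 \<le> X (i + N) * y" using X(1) False by (simp add: less_imp_le)
        ultimately show ?thesis using False n_nonneg[of y] by (auto simp: abs_mult intro!: mult_left_mono)
      qed (simp add: n_zero)
    qed
  qed measurable
  then have "(\<lambda>i. psi1 n (X i)) \<longlonglongrightarrow> 0" by (simp add: LIMSEQ_offset)
  then show "(psi1 n \<circ> X) \<longlonglongrightarrow> 0" by (simp add: o_def)
qed

subsection \<open>The complex exponent\<close>

text \<open>Locally uniform domination, in the form needed both for integrability and for
  differentiation under the integral. The parameter \<open>s\<close> is there because \<open>exp
  (-x) - 1 + x\<close> is bounded by integrating \<open>1 - exp (- s x)\<close> along the segment
  from \<open>0\<close> to \<open>x\<close>.\<close>

lemma expo_dom_bound:
  assumes "expo_dom n (Re z0)"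
  obtains S B where "open S" "convex S" "z0 \<in> S" "\<And>z. z \<in> S \<Longrightarrow> expo_dom n (Re z)"
    "\<And>z y s. z \<in> S \<Longrightarrow> 0 \<le> s \<Longrightarrow> s \<le> 1 \<Longrightarrow> 0 < y \<Longrightarrow> n y \<noteq> 0 \<Longrightarrow> norm (1 - exp (- (of_real s * (z * of_real y)))) \<le> B * min 1 y"
    "0 \<le> B" "\<And>z. z \<in> S \<Longrightarrow> norm z \<le> B"
proof (cases "0 < Re z0")
  case True
  show ?thesis
  proof (rule that[of "{z. 0 < Re z} \<inter> ball z0 1" "max 2 (norm z0 + 1)"])
    show "open ({z. 0 < Re z} \<inter> ball z0 1)" by (intro open_Int open_halfspace_Re_gt open_ball)
    show "convex ({z. 0 < Re z} \<inter> ball z0 1)" by (intro convex_Int convex_halfspace_Re_gt convex_ball)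
    have nz: "norm z \<le> norm z0 + 1" if "z \<in> {z. 0 < Re z} \<inter> ball z0 1" for z
      using that norm_triangle_ineq4[of z0 "z0 - z"] by (auto simp: dist_norm)
    then show "norm z \<le> max 2 (norm z0 + 1)" if "z \<in> {z. 0 < Re z} \<inter> ball z0 1" for z
      using that by fastforce
    fix z :: complex and y s :: real assume z: "z \<in> {z. 0 < Re z} \<inter> ball z0 1" and y: "0 < y" and s: "0 \<le> s" "s \<le> 1"
    let ?x = "of_real s * (z * of_real y)"
    have re: "0 \<le> Re ?x" using z y s by simp
    have "norm (1 - exp (- ?x)) \<le> norm (1::complex) + norm (exp (- ?x))" by (rule norm_triangle_ineq4)
    also have "\<dots> \<le> 2" using re by simp
    finally have 1: "norm (1 - exp (- ?x)) \<le> 2" .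
    have "norm ?x = s * (norm z * y)" using y s by (simp add: norm_mult)
    also have "\<dots> \<le> 1 * (norm z * y)" using s y by (intro mult_right_mono) auto
    also have "\<dots> \<le> max 2 (norm z0 + 1) * y" using nz[OF z] y by (auto intro!: mult_right_mono)
    finally have 2: "norm (1 - exp (- ?x)) \<le> max 2 (norm z0 + 1) * y"
      using norm_one_minus_exp_le(1)[OF re] by linarith
    show "norm (1 - exp (- ?x)) \<le> max 2 (norm z0 + 1) * min 1 y" using 1 2 by (auto simp: min_def)
  qed (use True in \<open>auto simp: expo_dom_def\<close>)
next
  case False
  then obtain d' where d': "\<And>y. d' < y \<Longrightarrow> n y = 0" using assms by (auto simp: expo_dom_def)
  define d where "d = max 1 d'"
  have d: "y \<le> d" if "n y \<noteq> 0" for y using d'[of y] that unfolding d_def by (cases "y \<le> d'") auto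
  define R where "R = norm z0 + 1"
  have R: "1 \<le> R" by (simp add: R_def)
  have d1: "1 \<le> d" by (simp add: d_def)
  show ?thesis
  proof (rule that[of "ball z0 1" "R * d * exp (R * d)"])
    have nz: "norm z \<le> R" if "z \<in> ball z0 1" for z
      using that norm_triangle_ineq4[of z0 "z0 - z"] by (auto simp: dist_norm R_def)
    have RB: "R \<le> R * d * exp (R * d)"
    proof -
      have "R * (1 * 1) \<le> R * (d * exp (R * d))" using R d1 by (intro mult_left_mono mult_mono) auto
      then show ?thesis by (simp add: mult.assoc)
    qed
    then show "norm z \<le> R * d * exp (R * d)" if "z \<in> ball z0 1" for z
      using nz[OF that] by simp
    show "0 \<le> R * d * exp (R * d)" using R d1 by simp
    show "expo_dom n (Re z)" for z using d' by (auto simp: expo_dom_def)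
    fix z :: complex and y s :: real assume z: "z \<in> ball z0 1" and y: "0 < y" "n y \<noteq> 0" and s: "0 \<le> s" "s \<le> 1"
    let ?x = "of_real s * (z * of_real y)"
    have "norm ?x = s * (norm z * y)" using y s by (simp add: norm_mult)
    also have "\<dots> \<le> 1 * (norm z * y)" using s y by (intro mult_right_mono) auto
    also have "\<dots> \<le> R * y" using nz[OF z] y by (auto intro!: mult_right_mono)
    finally have x1: "norm ?x \<le> R * y" .
    also have "R * y \<le> R * d" using d[OF y(2)] R by (intro mult_left_mono) auto
    finally have x2: "norm ?x \<le> R * d" .
    have "norm (1 - exp (- ?x)) \<le> norm ?x * exp (norm ?x)" by (rule norm_one_minus_exp_le(2))
    also have "\<dots> \<le> (R * y) * exp (R * d)" using x1 x2 R y by (intro mult_mono) auto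
    also have "\<dots> \<le> (R * (d * min 1 y)) * exp (R * d)"
    proof -
      have "y \<le> d * min 1 y" using d[OF y(2)] d1 y mult_right_mono[of 1 d y] by (auto simp: min_def)
      then show ?thesis using R by (intro mult_right_mono mult_left_mono) auto
    qed
    finally show "norm (1 - exp (- ?x)) \<le> R * d * exp (R * d) * min 1 y" by (simp add: mult_ac)
  qed auto
qed

lemma min_one_mult: "0 < y \<Longrightarrow> y * min 1 y = min y (y\<^sup>2)" for y :: real
  by (auto simp: min_def power2_eq_square)

lemma integrable_cpsi:
  assumes "expo_dom n (Re z)"
  shows "integrable lborel (\<lambda>y. n y *\<^sub>R (exp (- (z * of_real y)) - 1 + z * of_real y))"
proof -
  obtain S B where S: "z \<in> S" and
    bd: "\<And>z y s. z \<in> S \<Longrightarrow> 0 \<le> s \<Longrightarrow> s \<le> 1 \<Longrightarrow> 0 < y \<Longrightarrow> n y \<noteq> 0 \<Longrightarrow> norm (1 - exp (- (of_real s * (z * of_real y)))) \<le> B * min 1 y"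
    using expo_dom_bound[OF assms] by metis
  show ?thesis
  proof (rule integrable_n[where B="B * norm z"])
    fix y :: real assume y: "0 < y" "n y \<noteq> 0"
    have "norm (exp (- (z * of_real y)) - 1 + z * of_real y) \<le> (B * min 1 y) * norm (z * of_real y)"
      by (rule norm_exp_remainder_le) (use bd[OF S] y in auto)
    also have "\<dots> = B * norm z * (y * min 1 y)" using y by (simp add: norm_mult)
    finally show "norm (exp (- (z * of_real y)) - 1 + z * of_real y) \<le> B * norm z * min y (y\<^sup>2)"
      unfolding min_one_mult[OF y(1)] .
  qed measurable
qed

lemma cpsi_deriv:
  assumes "expo_dom n (Re z)"
  shows "(cpsi n has_field_derivative (\<integral>y. n y *\<^sub>R (of_real y * (1 - exp (- (z * of_real y)))) \<partial>lborel)) (at z)"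
proof -
  obtain S B where S: "open S" "convex S" "z \<in> S" "\<And>z. z \<in> S \<Longrightarrow> expo_dom n (Re z)" and
    bd: "\<And>z y s. z \<in> S \<Longrightarrow> 0 \<le> s \<Longrightarrow> s \<le> 1 \<Longrightarrow> 0 < y \<Longrightarrow> n y \<noteq> 0 \<Longrightarrow> norm (1 - exp (- (of_real s * (z * of_real y)))) \<le> B * min 1 y"
    using expo_dom_bound[OF assms] by metis
  show ?thesis
    unfolding cpsi_def[abs_def]
  proof (rule has_field_derivative_integral[OF S(1-3), where D="\<lambda>y. B * (n y * min y (y\<^sup>2))"])
    fix x y assume x: "x \<in> S"
    show "integrable lborel (\<lambda>y. n y *\<^sub>R (exp (- (x * of_real y)) - 1 + x * of_real y))"
      by (rule integrable_cpsi[OF S(4)[OF x]])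
    show "((\<lambda>x. n y *\<^sub>R (exp (- (x * of_real y)) - 1 + x * of_real y)) has_field_derivative n y *\<^sub>R (of_real y * (1 - exp (- (x * of_real y))))) (at x)"
      by (auto intro!: derivative_eq_intros simp: algebra_simps)
    show "norm (n y *\<^sub>R (complex_of_real y * (1 - exp (- (x * of_real y))))) \<le> B * (n y * min y (y\<^sup>2))"
    proof (cases "y \<le> 0 \<or> n y = 0")
      case True then show ?thesis using n_zero by auto
    next
      case False
      then have "norm (1 - exp (- (x * of_real y))) \<le> B * min 1 y" using bd[OF x, of 1 y] by simp
      then have "n y * (y * norm (1 - exp (- (x * of_real y)))) \<le> n y * (y * (B * min 1 y))"
        using False n_nonneg[of y] by (intro mult_left_mono) auto
      also have "\<dots> = B * (n y * (y * min 1 y))" by simp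
      finally show ?thesis using False n_nonneg[of y] min_one_mult[of y] by (simp add: norm_mult)
    qed
  qed (use n_integrable in auto)
qed

lemma holomorphic_cpsi: "(\<And>z. z \<in> S \<Longrightarrow> expo_dom n (Re z)) \<Longrightarrow> cpsi n holomorphic_on S"
  using cpsi_deriv by (meson field_differentiable_at_within field_differentiable_def holomorphic_on_def)

lemma cpsi_of_real: "expo_dom n w \<Longrightarrow> cpsi n (of_real w) = of_real (psi n w)"
  unfolding cpsi_def psi_def integral_complex_of_real[symmetric]
  by (intro Bochner_Integration.integral_cong) (auto simp: scaleR_conv_of_real exp_of_real[symmetric])

lemma expo_dom_psi_integrable:
  assumes "expo_dom n w" shows "integrable lborel (\<lambda>y. n y * (exp (- (w * y)) - 1 + w * y))"
proof -
  have "integrable lborel (\<lambda>y. Re (n y *\<^sub>R (exp (- (of_real w * complex_of_real y)) - 1 + of_real w * of_real y)))"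
    by (intro integrable_Re integrable_cpsi) (use assms in simp)
  then show ?thesis by (simp add: exp_of_real flip: of_real_mult of_real_minus)
qed

lemma expo_dom_exp_bound:
  assumes "expo_dom n w" 
  obtains B where "\<And>y. 0 < y \<Longrightarrow> n y \<noteq> 0 \<Longrightarrow> exp (- (w * y)) * min y (y\<^sup>2) \<le> B * min y (y\<^sup>2)"
proof (cases "0 < w")
  case True
  show ?thesis by (rule that[of 1], rule mult_right_mono) (use True in auto)
next
  case False
  then obtain d where d: "\<And>y. d < y \<Longrightarrow> n y = 0" using assms by (auto simp: expo_dom_def)
  show ?thesis
  proof (rule that[of "exp (- (w * d))"], rule mult_right_mono)
    fix y assume "0 < y" "n y \<noteq> 0"
    then have "y \<le> d" using d[of y] by (cases "y \<le> d") auto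
    then have "(- w) * y \<le> (- w) * d" using False by (intro mult_left_mono) auto
    then show "exp (- (w * y)) \<le> exp (- (w * d))" by simp
  qed auto
qed

lemma integrable_osc:
  assumes "expo_dom n w" shows "integrable lborel (\<lambda>y. n y * ((1 - cos (u * y)) * exp (- (w * y))))"
proof -
  obtain B where B: "\<And>y. 0 < y \<Longrightarrow> n y \<noteq> 0 \<Longrightarrow> exp (- (w * y)) * min y (y\<^sup>2) \<le> B * min y (y\<^sup>2)"
    using expo_dom_exp_bound[OF assms] by metis
  show ?thesis
  proof (cases "0 < w")
    case True
    show ?thesis
    proof (rule Bochner_Integration.integrable_bound)
      show "integrable lborel (\<lambda>y. (u\<^sup>2 / 2) * (n y * (y\<^sup>2 * exp (- (w * y)))))"
        using integrable_psi2[OF True] by simp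
      show "AE y in lborel. norm (n y * ((1 - cos (u * y)) * exp (- (w * y)))) \<le> norm ((u\<^sup>2 / 2) * (n y * (y\<^sup>2 * exp (- (w * y)))))"
      proof (rule AE_I2)
        fix y
        have "n y * ((1 - cos (u * y)) * exp (- (w * y))) \<le> n y * (((u * y)\<^sup>2 / 2) * exp (- (w * y)))"
          using n_nonneg[of y] one_minus_cos_le[of "u * y"] by (intro mult_left_mono mult_right_mono) auto
        moreover have "0 \<le> n y * ((1 - cos (u * y)) * exp (- (w * y)))" using n_nonneg[of y] by simp
        ultimately show "norm (n y * ((1 - cos (u * y)) * exp (- (w * y)))) \<le> norm ((u\<^sup>2 / 2) * (n y * (y\<^sup>2 * exp (- (w * y)))))"
          using n_nonneg[of y] by (simp add: power_mult_distrib mult_ac)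
      qed
    qed measurable
  next
    case False
    then obtain d' where d': "\<And>y. d' < y \<Longrightarrow> n y = 0" using assms by (auto simp: expo_dom_def)
    define d where "d = max 1 d'"
    have d: "y \<le> d" if "n y \<noteq> 0" for y using d'[of y] that unfolding d_def by (cases "y \<le> d'") auto
    have d1: "1 \<le> d" by (simp add: d_def)
    show ?thesis
    proof (rule integrable_n_real[where B="u\<^sup>2 * d * exp (- (w * d))"])
      fix y assume y: "0 < y" "n y \<noteq> 0"
      have e: "exp (- (w * y)) \<le> exp (- (w * d))"
        using d[OF y(2)] False mult_left_mono[of y d "- w"] by simp
      have yy: "y\<^sup>2 \<le> d * min y (y\<^sup>2)"
        using d[OF y(2)] d1 y mult_right_mono[of y d y] mult_right_mono[of 1 d "y * y"] by (auto simp: min_def power2_eq_square)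
      have "(1 - cos (u * y)) * exp (- (w * y)) \<le> (u * y)\<^sup>2 / 2 * exp (- (w * d))"
        using one_minus_cos_le[of "u * y"] e by (intro mult_mono) auto
      also have "\<dots> \<le> (u\<^sup>2 * y\<^sup>2) * exp (- (w * d))" by (intro mult_right_mono) (auto simp: power_mult_distrib)
      also have "\<dots> \<le> (u\<^sup>2 * (d * min y (y\<^sup>2))) * exp (- (w * d))" using yy by (intro mult_right_mono mult_left_mono) auto
      finally show "\<bar>(1 - cos (u * y)) * exp (- (w * y))\<bar> \<le> u\<^sup>2 * d * exp (- (w * d)) * min y (y\<^sup>2)"
        by (simp add: abs_mult mult_ac)
    qed auto
  qed
qed

lemma Re_cpsi: 
  assumes "expo_dom n w" shows "Re (cpsi n (Complex w u)) = psi n w - osc n w u"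
proof -
  have i: "integrable lborel (\<lambda>y. n y *\<^sub>R (exp (- (Complex w u * of_real y)) - 1 + Complex w u * of_real y))"
    by (rule integrable_cpsi) (use assms in simp)
  have "Re (cpsi n (Complex w u)) = (\<integral>y. Re (n y *\<^sub>R (exp (- (Complex w u * of_real y)) - 1 + Complex w u * of_real y)) \<partial>lborel)"
    unfolding cpsi_def by (rule integral_Re[OF i, symmetric])
  also have "\<dots> = (\<integral>y. n y * (exp (- (w * y)) - 1 + w * y) - n y * ((1 - cos (u * y)) * exp (- (w * y))) \<partial>lborel)"
    by (intro Bochner_Integration.integral_cong) (auto simp: Re_exp algebra_simps)
  also have "\<dots> = psi n w - osc n w u"
    unfolding psi_def osc_def
    by (rule Bochner_Integration.integral_diff[OF expo_dom_psi_integrable[OF assms] integrable_osc[OF assms]])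
  finally show ?thesis .
qed

text \<open>The linear part \<open>u \<psi>'(w)\<close> is what the saddle point cancels; the
  remainder is of third order.\<close>

lemma Im_cpsi: 
  assumes w: "0 < w" 
  shows "Im (cpsi n (Complex w u)) = u * psi1 n w + (\<integral>y. n y * ((u * y - sin (u * y)) * exp (- (w * y))) \<partial>lborel)"
proof -
  have i: "integrable lborel (\<lambda>y. n y *\<^sub>R (exp (- (Complex w u * of_real y)) - 1 + Complex w u * of_real y))"
    by (rule integrable_cpsi) (use w in \<open>simp add: expo_dom_def\<close>)
  have i1: "integrable lborel (\<lambda>y. u * (n y * (y * (1 - exp (- (w * y))))))" using integrable_psi1[of w] w by simp
  have eq: "Im (n y *\<^sub>R (exp (- (Complex w u * of_real y)) - 1 + Complex w u * of_real y)) 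
     = u * (n y * (y * (1 - exp (- (w * y))))) + n y * ((u * y - sin (u * y)) * exp (- (w * y)))" for y
    by (simp add: Im_exp algebra_simps)
  have i2: "integrable lborel (\<lambda>y. n y * ((u * y - sin (u * y)) * exp (- (w * y))))"
  proof -
    have "integrable lborel (\<lambda>y. Im (n y *\<^sub>R (exp (- (Complex w u * of_real y)) - 1 + Complex w u * of_real y)) - u * (n y * (y * (1 - exp (- (w * y))))))"
      by (intro Bochner_Integration.integrable_diff i1 integrable_Im i)
    then show ?thesis unfolding eq by simp
  qed
  have "Im (cpsi n (Complex w u)) = (\<integral>y. Im (n y *\<^sub>R (exp (- (Complex w u * of_real y)) - 1 + Complex w u * of_real y)) \<partial>lborel)"
    unfolding cpsi_def by (rule integral_Im[OF i, symmetric])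
  also have "\<dots> = u * psi1 n w + (\<integral>y. n y * ((u * y - sin (u * y)) * exp (- (w * y))) \<partial>lborel)"
    unfolding eq using Bochner_Integration.integral_add[OF i1 i2] by (simp add: psi1_def)
  finally show ?thesis .
qed

lemma Im_remainder_le:
  assumes w: "0 < w"
  shows "\<bar>\<integral>y. n y * ((u * y - sin (u * y)) * exp (- (w * y))) \<partial>lborel\<bar> \<le> (\<bar>u\<bar> / w)^3 * psi n w"
proof -
  have le: "\<bar>n y * ((u * y - sin (u * y)) * exp (- (w * y)))\<bar> \<le> (\<bar>u\<bar>^3 / 6) * (n y * (y^3 * exp (- (w * y))))" for y
  proof (cases "y \<le> 0")
    case False
    have "\<bar>n y * ((u * y - sin (u * y)) * exp (- (w * y)))\<bar> = n y * (\<bar>u * y - sin (u * y)\<bar> * exp (- (w * y)))"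
      using n_nonneg[of y] by (simp add: abs_mult)
    also have "\<dots> \<le> n y * ((\<bar>u * y\<bar>^3 / 6) * exp (- (w * y)))"
      using n_nonneg[of y] abs_minus_sin_le[of "u * y"] by (intro mult_left_mono mult_right_mono) auto
    finally show ?thesis using False by (simp add: abs_mult power_mult_distrib mult_ac)
  qed (simp add: n_zero)
  have "\<bar>\<integral>y. n y * ((u * y - sin (u * y)) * exp (- (w * y))) \<partial>lborel\<bar> \<le> (\<integral>y. (\<bar>u\<bar>^3 / 6) * (n y * (y^3 * exp (- (w * y)))) \<partial>lborel)"
    using integral_abs_bound_integral[of lborel] integrable_power_exp[OF w, of 3]
  proof (intro order_trans[OF integral_abs_bound] integral_mono')
    show "integrable lborel (\<lambda>y. (\<bar>u\<bar>^3 / 6) * (n y * (y^3 * exp (- (w * y)))))"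
      using integrable_power_exp[OF w, of 3] by simp
    show "0 \<le> (\<bar>u\<bar>^3 / 6) * (n y * (y^3 * exp (- (w * y))))" for y using le[of y] by linarith
  qed (rule le)
  also have "\<dots> = (\<bar>u\<bar> / w)^3 / 6 * (w^3 * (\<integral>y. n y * (y^3 * exp (- (w * y))) \<partial>lborel))"
    using w by (simp add: power_divide)
  also have "\<dots> \<le> (\<bar>u\<bar> / w)^3 / 6 * (4 * psi n w)"
    using psi3_le_psi[OF w] w by (intro mult_left_mono) auto
  also have "\<dots> \<le> (\<bar>u\<bar> / w)^3 * psi n w" using psi_nonneg[of w] w by simp
  finally show ?thesis .
qed

lemma osc_nonneg: "0 \<le> osc n w u"
  unfolding osc_def by (intro integral_nonneg_AE AE_I2 mult_nonneg_nonneg n_nonneg) auto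

lemma osc_le: assumes w: "0 < w" shows "osc n w u \<le> 2 * (u / w)\<^sup>2 * psi n w"
proof -
  have "osc n w u \<le> (\<integral>y. n y * ((u\<^sup>2 / 2) * (y\<^sup>2 * exp (- (w * y)))) \<partial>lborel)"
    unfolding osc_def
  proof (rule integral_n_mono[OF integrable_osc])
    show "integrable lborel (\<lambda>y. n y * ((u\<^sup>2 / 2) * (y\<^sup>2 * exp (- (w * y)))))"
      using integrable_mult_right[OF integrable_psi2[OF w], of "u\<^sup>2 / 2"] by (simp add: mult.left_commute)
    fix y :: real
    have "(1 - cos (u * y)) * exp (- (w * y)) \<le> ((u * y)\<^sup>2 / 2) * exp (- (w * y))"
      using one_minus_cos_le[of "u * y"] by (intro mult_right_mono) auto
    then show "(1 - cos (u * y)) * exp (- (w * y)) \<le> (u\<^sup>2 / 2) * (y\<^sup>2 * exp (- (w * y)))"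
      by (simp add: power_mult_distrib)
  qed (use w in \<open>simp add: expo_dom_def\<close>)
  also have "\<dots> = (u\<^sup>2 / 2) * psi2 n w" unfolding psi2_def by (rule integral_n_cmult)
  also have "\<dots> = ((u / w)\<^sup>2 / 2) * (w\<^sup>2 * psi2 n w)" using w by (simp add: power_divide)
  also have "\<dots> \<le> ((u / w)\<^sup>2 / 2) * (4 * psi n w)" using psi2_le_psi[OF w] by (intro mult_left_mono) auto
  finally show ?thesis by (simp add: mult_ac)
qed

end

text \<open>For \<open>y \<le> 1/v\<close> and \<open>\<bar>u\<bar> \<le> v\<close> the argument
  \<open>u y\<close> stays in \<open>[-1,1]\<close>, where \<open>1 - cos\<close> is quadratic, and
  \<open>exp (-w y)\<close> is at least \<open>1/3\<close>. Only jumps below \<open>1/v\<close> are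
  used, so that truncated densities \<open>n1\<close> satisfy the bound with the constants of
  \<open>n\<close>.\<close>

lemma osc_ge:
  assumes "levy_density n" "levy_density n1" and dom: "expo_dom n1 w"
    and eq: "\<And>y. y \<le> 1 / v \<Longrightarrow> n1 y = n y" and v: "0 < v" "\<bar>u\<bar> \<le> v" "w \<le> v"
  shows "u\<^sup>2 * small_moment n v / 12 \<le> osc n1 w u"
proof -
  interpret n: levy_density n by fact
  interpret n1: levy_density n1 by fact
  have "u\<^sup>2 * small_moment n v / 12 = (\<integral>y. (u\<^sup>2 / 12) * (n y * (indicator {..1/v} y * y\<^sup>2)) \<partial>lborel)"
    unfolding small_moment_def by simp
  also have "\<dots> = (\<integral>y. n1 y * ((u\<^sup>2 / 12) * (indicator {..1/v} y * y\<^sup>2)) \<partial>lborel)"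
    using eq by (intro Bochner_Integration.integral_cong) (auto simp: indicator_def)
  also have "\<dots> \<le> osc n1 w u"
    unfolding osc_def
  proof (rule n1.integral_n_mono[OF _ n1.integrable_osc[OF dom]])
    show "integrable lborel (\<lambda>y. n1 y * ((u\<^sup>2 / 12) * (indicator {..1/v} y * y\<^sup>2)))"
      using integrable_mult_right[OF n1.integrable_small_moment[OF v(1)], of "u\<^sup>2 / 12"] by (simp add: mult.left_commute)
    fix y :: real assume y: "0 < y"
    show "(u\<^sup>2 / 12) * (indicator {..1/v} y * y\<^sup>2) \<le> (1 - cos (u * y)) * exp (- (w * y))"
    proof (cases "y \<le> 1 / v")
      case True
      then have vy: "v * y \<le> 1" using v by (simp add: field_simps)
      have "\<bar>u * y\<bar> \<le> v * y" using v y by (simp add: abs_mult mult_right_mono)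
      then have 1: "(u * y)\<^sup>2 / 4 \<le> 1 - cos (u * y)" using vy by (intro one_minus_cos_ge) auto
      have "w * y \<le> v * y" using v y by (intro mult_right_mono) auto
      then have 2: "1 / 3 \<le> exp (- (w * y))" using vy by (intro exp_minus_ge_third) auto
      have "((u * y)\<^sup>2 / 4) * (1 / 3) \<le> (1 - cos (u * y)) * exp (- (w * y))" using 1 2 by (intro mult_mono) auto
      then show ?thesis using True by (simp add: power_mult_distrib)
    qed (use y in auto)
  qed
  finally show ?thesis .
qed

section \<open>Vertical integrals of exponentials of the exponent\<close>

lemma nn_integral_exp_abs:
  assumes b: "0 < b"
  shows "(\<integral>\<^sup>+u. ennreal (exp (- (b * \<bar>u\<bar>))) \<partial>lborel) \<le> ennreal (2 / b)"
proof -
  have half: "(\<integral>\<^sup>+u. ennreal (exp (- (b * u))) * indicator {0..} u \<partial>lborel) = ennreal (1 / b)"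
  proof -
    have "(\<integral>\<^sup>+u. ennreal (exp (- (b * u))) * indicator {0..} u \<partial>lborel) = ennreal (0 - (- exp (- (b * 0)) / b))"
    proof (rule nn_integral_FTC_atLeast)
      show "((\<lambda>u. - exp (- (b * u)) / b) has_real_derivative exp (- (b * x))) (at x)" for x
        using b by (auto intro!: derivative_eq_intros)
      show "((\<lambda>u. - exp (- (b * u)) / b) \<longlongrightarrow> 0) at_top"
        using b by real_asymp
    qed auto
    then show ?thesis by simp
  qed
  have "(\<integral>\<^sup>+u. ennreal (exp (- (b * \<bar>u\<bar>))) \<partial>lborel) 
     \<le> (\<integral>\<^sup>+u. (ennreal (exp (- (b * u))) * indicator {0..} u + ennreal (exp (- (b * (- u)))) * indicator {0..} (- u)) \<partial>lborel)"
    by (intro nn_integral_mono) (auto simp: indicator_def abs_if)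
  also have "\<dots> = (\<integral>\<^sup>+u. ennreal (exp (- (b * u))) * indicator {0..} u \<partial>lborel)
      + (\<integral>\<^sup>+u. ennreal (exp (- (b * (- u)))) * indicator {0..} (- u) \<partial>lborel)"
    by (rule nn_integral_add) measurable
  also have "(\<integral>\<^sup>+u. ennreal (exp (- (b * (- u)))) * indicator {0..} (- u) \<partial>lborel) 
      = (\<integral>\<^sup>+u. ennreal (exp (- (b * u))) * indicator {0..} u \<partial>lborel)"
    using nn_integral_real_affine[of "\<lambda>u. ennreal (exp (- (b * u))) * indicator {0..} u" "-1" 0] by simp
  finally show ?thesis using b by (simp add: half flip: ennreal_plus)
qed

lemma integrable_exp_abs: 
  assumes b: "(0::real) < b" shows "integrable lborel (\<lambda>u. exp (- (b * \<bar>u\<bar>)))"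
    and "(\<integral>u. exp (- (b * \<bar>u\<bar>)) \<partial>lborel) \<le> 2 / b"
proof -
  show i: "integrable lborel (\<lambda>u. exp (- (b * \<bar>u\<bar>)))"
    by (rule integrableI_nonneg) (use nn_integral_exp_abs[OF b] in \<open>auto intro: le_less_trans\<close>)
  show "(\<integral>u. exp (- (b * \<bar>u\<bar>)) \<partial>lborel) \<le> 2 / b"
    using nn_integral_exp_abs[OF b] b by (subst (asm) nn_integral_eq_integral[OF i]) (auto simp: ennreal_le_iff)
qed

text \<open>The parameter \<open>m\<close> is a drift; it appears when large jumps are removed but
  their compensator is kept.\<close>

definition line_exp :: "(real \<Rightarrow> real) \<Rightarrow> real \<Rightarrow> real \<Rightarrow> real \<Rightarrow> real \<Rightarrow> complex" where
  "line_exp n m t w u = exp (of_real t * (of_real m * Complex w u + cpsi n (Complex w u)))"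

definition inv_laplace :: "(real \<Rightarrow> real) \<Rightarrow> real \<Rightarrow> real \<Rightarrow> real \<Rightarrow> real \<Rightarrow> complex" where
  "inv_laplace n m t w x = of_real (exp (w * x)) * inv_fourier (line_exp n m t w) x"

text \<open>Linear growth of \<open>osc\<close>, uniformly in a strip, makes the integrand
  exponentially small far from the real axis for every \<open>t > 0\<close>, which is all that
  moving the line of integration requires.\<close>

definition osc_grows :: "(real \<Rightarrow> real) \<Rightarrow> real \<Rightarrow> real \<Rightarrow> bool" where
  "osc_grows n w1 w2 \<longleftrightarrow> (\<exists>k>0. \<exists>U. \<forall>w u. w1 \<le> w \<longrightarrow> w \<le> w2 \<longrightarrow> k * (\<bar>u\<bar> - U) \<le> osc n w u)"

lemma osc_growsI: "0 < k \<Longrightarrow> (\<And>w u. w1 \<le> w \<Longrightarrow> w \<le> w2 \<Longrightarrow> k * (\<bar>u\<bar> - U) \<le> osc n w u) \<Longrightarrow> osc_grows n w1 w2"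
  unfolding osc_grows_def by blast

context levy_density
begin

lemma norm_line_exp: "expo_dom n w \<Longrightarrow> norm (line_exp n m t w u) = exp (t * (m * w + psi n w - osc n w u))"
  unfolding line_exp_def by (simp add: Re_cpsi algebra_simps)

lemma isCont_line_exp: assumes "expo_dom n w" shows "isCont (line_exp n m t w) u"
proof -
  have "isCont (cpsi n) (Complex w u)"
    using DERIV_isCont[OF cpsi_deriv[of "Complex w u"]] assms by simp
  then have "isCont (\<lambda>u. cpsi n (Complex w u)) u"
    by (rule isCont_o2[rotated]) (simp add: Complex_eq)
  then show ?thesis unfolding line_exp_def Complex_eq by (intro continuous_intros) (simp add: Complex_eq)
qed

lemma line_exp_measurable: "expo_dom n w \<Longrightarrow> line_exp n m t w \<in> borel_measurable borel"
  by (intro borel_measurable_continuous_onI continuous_at_imp_continuous_on ballI isCont_line_exp)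

lemma line_exp_integrable:
  assumes dom: "expo_dom n w" and t: "0 < t" and g: "osc_grows n w w"
  shows "integrable lborel (line_exp n m t w)"
proof -
  obtain k U where k: "0 < k" "\<And>u. k * (\<bar>u\<bar> - U) \<le> osc n w u" using g unfolding osc_grows_def by blast
  show ?thesis
  proof (rule Bochner_Integration.integrable_bound)
    show "integrable lborel (\<lambda>u. exp (t * (m * w + psi n w + k * U)) * exp (- ((t * k) * \<bar>u\<bar>)))"
      using integrable_exp_abs[of "t * k"] k t by simp
    show "AE u in lborel. norm (line_exp n m t w u) \<le> norm (exp (t * (m * w + psi n w + k * U)) * exp (- ((t * k) * \<bar>u\<bar>)))"
    proof (rule AE_I2)
      fix u
      have "t * (m * w + psi n w - osc n w u) \<le> t * (m * w + psi n w - k * (\<bar>u\<bar> - U))"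
        using k(2)[of u] t by (intro mult_left_mono) auto
      also have "\<dots> = t * (m * w + psi n w + k * U) + - ((t * k) * \<bar>u\<bar>)" by (simp add: algebra_simps)
      finally show "norm (line_exp n m t w u) \<le> norm (exp (t * (m * w + psi n w + k * U)) * exp (- ((t * k) * \<bar>u\<bar>)))"
        by (simp add: norm_line_exp[OF dom] exp_add[symmetric])
    qed
    show "line_exp n m t w \<in> borel_measurable lborel" using line_exp_measurable[OF dom] by simp
  qed
qed

lemma inv_laplace_eq: "inv_laplace n m t w x 
   = (\<integral>u. exp (Complex w u * of_real x + of_real t * (of_real m * Complex w u + cpsi n (Complex w u))) \<partial>lborel) / (2 * pi)"
proof -
  have "of_real (exp (w * x)) * (\<integral>u. iexp (u * x) * line_exp n m t w u \<partial>lborel)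
     = (\<integral>u. of_real (exp (w * x)) * (iexp (u * x) * line_exp n m t w u) \<partial>lborel)" by simp
  also have "\<dots> = (\<integral>u. exp (Complex w u * of_real x + of_real t * (of_real m * Complex w u + cpsi n (Complex w u))) \<partial>lborel)"
    unfolding line_exp_def
    by (intro Bochner_Integration.integral_cong) (auto simp: exp_add[symmetric] exp_of_real[symmetric] Complex_eq algebra_simps)
  finally show ?thesis by (simp add: inv_laplace_def inv_fourier_def)
qed

lemma osc_grows_mono: "osc_grows n w1 w2 \<Longrightarrow> w1 \<le> w1' \<Longrightarrow> w2' \<le> w2 \<Longrightarrow> osc_grows n w1' w2'"
  unfolding osc_grows_def by (meson order_trans)

text \<open>The norm of the integrand is its value on the real axis, bounded on a compact interval,
  times \<open>exp (- t osc)\<close>.\<close>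

lemma inv_laplace_shift:
  assumes dom: "expo_dom n w1" "expo_dom n w2" and t: "0 < t" and w: "w1 \<le> w2" and g: "osc_grows n w1 w2"
  shows "inv_laplace n m t w1 x = inv_laplace n m t w2 x"
proof -
  define S where "S = (if \<exists>d. \<forall>y>d. n y = 0 then UNIV else {z. 0 < Re z})"
  have S: "open S" "convex S" by (auto simp: S_def open_halfspace_Re_gt convex_halfspace_Re_gt)
  have domS: "expo_dom n (Re z)" if "z \<in> S" for z using that by (auto simp: S_def expo_dom_def split: if_splits)
  have sub: "{z. w1 \<le> Re z \<and> Re z \<le> w2} \<subseteq> S" using dom by (auto simp: S_def expo_dom_def)
  let ?H = "\<lambda>z. exp (z * of_real x + of_real t * (of_real m * z + cpsi n z))"
  have hol: "?H holomorphic_on S"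
    by (intro holomorphic_intros holomorphic_cpsi domS)
  obtain k U where k: "0 < k" "\<And>w u. w1 \<le> w \<Longrightarrow> w \<le> w2 \<Longrightarrow> k * (\<bar>u\<bar> - U) \<le> osc n w u" 
    using g unfolding osc_grows_def by blast
  have "compact (?H ` of_real ` {w1..w2})"
  proof (intro compact_continuous_image continuous_intros)
    show "continuous_on (complex_of_real ` {w1..w2}) (cpsi n)"
      by (rule continuous_on_subset[OF holomorphic_on_imp_continuous_on[OF holomorphic_cpsi[of S]]]) (use domS sub in auto)
  qed simp
  from compact_imp_bounded[OF this] obtain P where "\<forall>z\<in>?H ` of_real ` {w1..w2}. norm z \<le> P"
    unfolding bounded_iff ..
  then have P: "\<And>w. w \<in> {w1..w2} \<Longrightarrow> norm (?H (of_real w)) \<le> P" by blast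
  have bd: "norm (?H z) \<le> (P * exp (t * k * U)) * exp (- (t * k * \<bar>Im z\<bar>))" if z: "w1 \<le> Re z" "Re z \<le> w2" for z
  proof -
    have d: "expo_dom n (Re z)" using domS sub z by blast
    have "norm (?H z) = exp (Re z * x + t * (m * Re z + psi n (Re z) - osc n (Re z) (Im z)))"
      unfolding norm_exp_eq_Re using Re_cpsi[OF d, of "Im z"] by (simp add: add_diff_eq[symmetric] distrib_left)
    also have "\<dots> = norm (?H (of_real (Re z))) * exp (- (t * osc n (Re z) (Im z)))"
      by (simp add: cpsi_of_real[OF d] exp_add[symmetric] algebra_simps)
    also have "\<dots> \<le> P * exp (- (t * (k * (\<bar>Im z\<bar> - U))))"
    proof (rule mult_mono)
      show "norm (?H (of_real (Re z))) \<le> P" using P z by auto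
      show "exp (- (t * osc n (Re z) (Im z))) \<le> exp (- (t * (k * (\<bar>Im z\<bar> - U))))"
        using k(2)[OF z, of "Im z"] t by simp
      show "0 \<le> P" by (rule order_trans[OF norm_ge_zero P[of w1]]) (use w in auto)
    qed auto
    also have "\<dots> = (P * exp (t * k * U)) * exp (- (t * k * \<bar>Im z\<bar>))"
      by (simp add: exp_add[symmetric] algebra_simps mult_exp_exp)
    finally show ?thesis .
  qed
  have int: "integrable lborel (\<lambda>u. ?H (Complex w u))" if "expo_dom n w" "w1 \<le> w" "w \<le> w2" for w
  proof -
    have "integrable lborel (\<lambda>u. of_real (exp (w * x)) * (iexp (u * x) * line_exp n m t w u))"
      by (intro integrable_mult_right integrable_iexp_mult line_exp_integrable that t osc_grows_mono[OF g]) (use that in auto)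
    then show ?thesis unfolding line_exp_def
      by (simp add: exp_add[symmetric] exp_of_real[symmetric] Complex_eq algebra_simps)
  qed
  have "(\<integral>u. ?H (Complex w1 u) \<partial>lborel) = (\<integral>u. ?H (Complex w2 u) \<partial>lborel)"
    by (rule vertical_integral_shift[OF S hol sub bd]) (use k t w int dom in auto)
  then show ?thesis unfolding inv_laplace_eq by simp
qed

end

section \<open>The saddle point estimate\<close>

text \<open>The number \<open>a\<close> plays the role of \<open>t \<psi>(w)\<close>; the peak of
  the integrand has width of order \<open>w / sqrt a\<close>. It is kept separate from \<open>t *
  psi n w\<close> because for a truncated density the lower bound on \<open>osc\<close> comes with
  the exponent of the original one.\<close>

locale saddle = levy_density n for n +
  fixes m t w a \<kappa> :: real
  assumes t: "0 < t" and w: "0 < w" and a: "1 \<le> a" and kappa: "0 < \<kappa>" "\<kappa> \<le> 1"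
    and psi_le: "t * psi n w \<le> a"
    and osc_lower: "\<And>u. \<kappa> * a * min ((u / w)\<^sup>2) (\<bar>u\<bar> / w) \<le> t * osc n w u"
begin

lemma dom: "expo_dom n w" using w by (simp add: expo_dom_def)

lemma min_ge: assumes "0 < v" "v \<le> 1" "v * w \<le> \<bar>u\<bar>" shows "v * \<bar>u\<bar> / w \<le> min ((u / w)\<^sup>2) (\<bar>u\<bar> / w)"
proof (rule min.boundedI)
  have "v * (\<bar>u\<bar> / w) \<le> (\<bar>u\<bar> / w) * (\<bar>u\<bar> / w)"
    using assms w by (intro mult_right_mono) (auto simp: field_simps)
  then show "v * \<bar>u\<bar> / w \<le> (u / w)\<^sup>2" by (simp add: power2_eq_square)
  have "v * (\<bar>u\<bar> / w) \<le> 1 * (\<bar>u\<bar> / w)" using assms w by (intro mult_right_mono) auto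
  then show "v * \<bar>u\<bar> / w \<le> \<bar>u\<bar> / w" by simp
qed

lemma osc_lower': "0 < v \<Longrightarrow> v \<le> 1 \<Longrightarrow> v * w \<le> \<bar>u\<bar> \<Longrightarrow> (\<kappa> * a * v / w) * \<bar>u\<bar> \<le> t * osc n w u"
  using order_trans[OF mult_left_mono[OF min_ge, of v u "\<kappa> * a"] osc_lower[of u]] kappa a by (simp add: mult_ac)

lemma grows: "osc_grows n w w"
proof (rule osc_growsI[where k="\<kappa> * a / w / t" and U=w])
  show "0 < \<kappa> * a / w / t" using kappa a w t by simp
  fix w' u assume "w \<le> w'" "w' \<le> w"
  then have [simp]: "w' = w" by simp
  show "\<kappa> * a / w / t * (\<bar>u\<bar> - w) \<le> osc n w' u"
  proof (cases "w \<le> \<bar>u\<bar>")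
    case True
    have "\<kappa> * a / w / t * (\<bar>u\<bar> - w) \<le> \<kappa> * a / w / t * \<bar>u\<bar>" using kappa a w t by (intro mult_left_mono) auto
    also have "\<dots> \<le> osc n w u" using osc_lower'[of 1 u] True t w by (simp add: field_simps)
    finally show ?thesis by simp
  next
    case False
    then have "\<kappa> * a / w / t * (\<bar>u\<bar> - w) \<le> 0" using kappa a w t by (intro mult_nonneg_nonpos) auto
    then show ?thesis using osc_nonneg[of w u] by simp
  qed
qed

lemma transform_integrable: "integrable lborel (line_exp n m t w)"
  by (rule line_exp_integrable[OF dom t grows])

definition "peak = exp (t * (m * w + psi n w))"

lemma norm_line_exp_peak: "norm (line_exp n m t w u) = peak * exp (- (t * osc n w u))"
  by (simp add: norm_line_exp[OF dom] peak_def exp_add[symmetric] algebra_simps)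

lemma peak_pos: "0 < peak" by (simp add: peak_def)

text \<open>Within \<open>\<bar>u\<bar> \<le> w / sqrt a\<close> the integrand is bounded by its
  peak; beyond, \<open>osc_lower\<close> gives exponential decay of rate \<open>\<kappa> sqrt a /
  w\<close>.\<close>

lemma norm_inv_laplace_le: "norm (inv_laplace n m t w x) \<le> exp (w * x) * peak * w / (\<kappa> * sqrt a)"
proof -
  define v where "v = 1 / sqrt a"
  have v: "0 < v" "v \<le> 1" using a by (auto simp: v_def)
  define b where "b = \<kappa> * a * v / w"
  have b: "0 < b" using kappa a v w by (simp add: b_def)
  have "(\<integral>u. norm (line_exp n m t w u) \<partial>lborel) \<le> (\<integral>u. peak * (indicator {- (v * w)..v * w} u + exp (- (b * \<bar>u\<bar>))) \<partial>lborel)"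
  proof (rule integral_mono)
    show "integrable lborel (\<lambda>u. norm (line_exp n m t w u))" using transform_integrable by simp
    show "integrable lborel (\<lambda>u. peak * (indicator {- (v * w)..v * w} u + exp (- (b * \<bar>u\<bar>))))"
      using integrable_exp_abs(1)[OF b]
      by (intro integrable_mult_right Bochner_Integration.integrable_add integrable_real_indicator) (auto simp: emeasure_lborel_Icc_eq)
    fix u
    have "exp (- (t * osc n w u)) \<le> indicator {- (v * w)..v * w} u + exp (- (b * \<bar>u\<bar>))"
    proof (cases "\<bar>u\<bar> \<le> v * w")
      case True
      have "exp (- (t * osc n w u)) \<le> 1" using t osc_nonneg[of w u] by simp
      also have "1 \<le> indicator {- (v * w)..v * w} u + exp (- (b * \<bar>u\<bar>))" using True by (auto simp: indicator_def)
      finally show ?thesis .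
    next
      case False
      then show ?thesis using osc_lower'[OF v, of u] by (auto simp: b_def indicator_def)
    qed
    then show "norm (line_exp n m t w u) \<le> peak * (indicator {- (v * w)..v * w} u + exp (- (b * \<bar>u\<bar>)))"
      unfolding norm_line_exp_peak using peak_pos by (intro mult_left_mono) auto
  qed
  also have "\<dots> = peak * (2 * (v * w) + (\<integral>u. exp (- (b * \<bar>u\<bar>)) \<partial>lborel))"
    using integrable_exp_abs(1)[OF b] v w by (subst integral_mult_right_zero, subst Bochner_Integration.integral_add) auto
  also have "\<dots> \<le> peak * (2 * (v * w) + 2 / b)"
    using integrable_exp_abs(2)[OF b] peak_pos by (intro mult_left_mono) auto
  also have "2 / b = 2 * w / (\<kappa> * sqrt a)"
  proof -
    have "b = \<kappa> * (a / sqrt a) / w" by (simp add: b_def v_def)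
    then show ?thesis using a w kappa by (simp add: real_div_sqrt)
  qed
  also have "2 * (v * w) \<le> 2 * w / (\<kappa> * sqrt a)"
  proof -
    have "\<kappa> * sqrt a \<le> 1 * sqrt a" using kappa a by (intro mult_right_mono) auto
    then have "1 / (1 * sqrt a) \<le> 1 / (\<kappa> * sqrt a)" using kappa a by (intro divide_left_mono) auto
    then have "2 * w * (1 / sqrt a) \<le> 2 * w * (1 / (\<kappa> * sqrt a))" using w by (intro mult_left_mono) auto
    then show ?thesis by (simp add: v_def)
  qed
  finally have *: "(\<integral>u. norm (line_exp n m t w u) \<partial>lborel) \<le> peak * (4 * (w / (\<kappa> * sqrt a)))"
    using peak_pos by simp
  have "norm (inv_laplace n m t w x) \<le> exp (w * x) * ((\<integral>u. norm (line_exp n m t w u) \<partial>lborel) / (2 * pi))"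
    unfolding inv_laplace_def norm_mult using norm_inv_fourier_le[OF transform_integrable, of x] by (simp del: times_divide_eq_right)
  also have "\<dots> \<le> exp (w * x) * (peak * (4 * (w / (\<kappa> * sqrt a))) / (2 * pi))"
    using * by (intro mult_left_mono divide_right_mono) auto
  also have "\<dots> = exp (w * x) * peak * (w / (\<kappa> * sqrt a)) * (2 / pi)" by (simp add: mult_ac)
  also have "\<dots> \<le> exp (w * x) * peak * (w / (\<kappa> * sqrt a)) * 1"
    using pi_gt3 peak_pos w kappa a by (intro mult_left_mono) auto
  finally show ?thesis by simp
qed

text \<open>The integrand is \<open>exp (- t osc) cos \<theta>\<close>. At the saddle point the
  phase \<open>\<theta>\<close> is of third order in \<open>u/w\<close>, so that there is an
  intermediate radius \<open>v w\<close>, with \<open>v\<close> of order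
  \<open>a\<^sup>-\<^sup>1\<^sup>/\<^sup>3\<close>, up to which \<open>cos \<theta> \<ge>
  1/2\<close> and beyond which the integrand is negligible against the peak, provided that
  \<open>a\<close> is large compared with \<open>1/\<kappa>\<close>. Missing the saddle point by
  \<open>1/(2 w)\<close> changes the phase by at most \<open>1/2\<close> there; this tolerance is
  needed for a convolution with the big jump.\<close>

lemma Re_inv_laplace_ge:
  assumes big: "(64 / \<kappa>) ^ 6 \<le> a" and x: "\<bar>x + t * (m + psi1 n w)\<bar> \<le> 1 / (2 * w)"
  shows "exp (w * x) * peak * w / (128 * sqrt a) \<le> Re (inv_laplace n m t w x)"
proof -
  (* The sixth root avoids fractional powers: sqrt a = q^3 and a powr (-1/3) = 1 / q^2. *)
  define q where "q = root 6 a"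
  have q6: "q ^ 6 = a" using a by (simp add: q_def real_root_pow_pos2)
  have q: "64 / \<kappa> \<le> q"
  proof -
    have "root 6 ((64 / \<kappa>) ^ 6) \<le> root 6 a" using big by simp
    then show ?thesis unfolding q_def using kappa by (subst (asm) real_root_power_cancel) auto
  qed
  have q64: "64 \<le> q"
  proof -
    have "64 \<le> 64 / \<kappa>" using kappa by (simp add: field_simps)
    then show ?thesis using q by linarith
  qed
  have sq: "sqrt a = q ^ 3"
  proof -
    have "sqrt (q ^ 6) = q ^ 3" using q64 by (intro real_sqrt_unique) (auto simp: power_mult[symmetric])
    then show ?thesis by (simp add: q6)
  qed
  define v where "v = 1 / (2 * q\<^sup>2)"
  have v: "0 < v" "v \<le> 1" using q64 mult_mono[of 1 q 1 q] by (auto simp: v_def power2_eq_square)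
  have av: "a * v ^ 3 \<le> 1 / 2"
    unfolding q6[symmetric] v_def using q64 by (simp add: power_divide power_mult_distrib flip: power_mult)
  have vs: "1 / sqrt a \<le> v" 
    unfolding sq v_def
  proof (intro divide_left_mono)
    show "2 * q\<^sup>2 \<le> q ^ 3" using q64 by (simp add: power2_eq_square power3_eq_cube)
  qed (use q64 in auto)
  define b where "b = \<kappa> * a * v / w"
  have b: "0 < b" using kappa a v w by (simp add: b_def)
  (* The mass 2 / b of the tails must be at most half of the contribution w / (8 * sqrt a) of the
     peak; this fixes the threshold for a. *)
  have bb: "2 / b \<le> w / (16 * sqrt a)"
  proof -
    have "2 / b = w * 4 / (\<kappa> * q ^ 4)"
    proof -
      have "b = \<kappa> * q ^ 4 / (2 * w)" unfolding b_def v_def q6[symmetric] using q64 by (simp add: eval_nat_numeral)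
      then show ?thesis using w kappa by simp
    qed
    also have "\<dots> \<le> w * 4 / (64 * q ^ 3)"
    proof (intro divide_left_mono)
      have "64 \<le> \<kappa> * q" using q kappa by (simp add: field_simps)
      then have "64 * q ^ 3 \<le> \<kappa> * q * q ^ 3" using q64 by (intro mult_right_mono) auto
      then show "64 * q ^ 3 \<le> \<kappa> * q ^ 4" by (simp add: eval_nat_numeral)
    qed (use w kappa q64 in auto)
    finally show ?thesis by (simp add: sq)
  qed
  let ?R = "\<lambda>u. \<integral>y. n y * ((u * y - sin (u * y)) * exp (- (w * y))) \<partial>lborel"
  let ?ph = "\<lambda>u. u * (x + t * (m + psi1 n w)) + t * ?R u"
  (* The phase splits into the linear term, which vanishes at the saddle point, and the remainder. *)
  have form: "Re (iexp (u * x) * line_exp n m t w u) = peak * (exp (- (t * osc n w u)) * cos (?ph u))" for u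
  proof -
    have "iexp (u * x) * line_exp n m t w u = exp (Complex (t * (m * w + psi n w - osc n w u)) (?ph u))"
      unfolding line_exp_def exp_add[symmetric]
      by (rule arg_cong[where f=exp]) (auto simp: complex_eq_iff Re_cpsi[OF dom] Im_cpsi[OF w] algebra_simps)
    then have "Re (iexp (u * x) * line_exp n m t w u) = exp (t * (m * w + psi n w - osc n w u)) * cos (?ph u)"
      by (simp add: Re_exp)
    then show ?thesis by (simp add: peak_def exp_add[symmetric] algebra_simps mult_exp_exp)
  qed
  have lower: "indicator {- (w / sqrt a)..w / sqrt a} u / 16 - exp (- (b * \<bar>u\<bar>)) \<le> exp (- (t * osc n w u)) * cos (?ph u)" for u
  proof (cases "\<bar>u\<bar> \<le> v * w")
    case True
    then have uw: "\<bar>u\<bar> / w \<le> v" using w by (simp add: field_simps)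
    have "\<bar>u * (x + t * (m + psi1 n w))\<bar> \<le> \<bar>u\<bar> * (1 / (2 * w))"
      unfolding abs_mult using x by (intro mult_left_mono) auto
    also have "\<dots> \<le> 1 / 2" using uw v by simp
    finally have 1: "\<bar>u * (x + t * (m + psi1 n w))\<bar> \<le> 1 / 2" .
    have "\<bar>t * ?R u\<bar> \<le> t * ((\<bar>u\<bar> / w)^3 * psi n w)"
      unfolding abs_mult using Im_remainder_le[OF w, of u] t by (simp add: mult_left_mono)
    also have "\<dots> = (\<bar>u\<bar> / w)^3 * (t * psi n w)" by simp
    also have "\<dots> \<le> v^3 * a" using psi_le uw w v a t psi_nonneg[of w] by (intro mult_mono power_mono) auto
    finally have 2: "\<bar>t * ?R u\<bar> \<le> 1 / 2" using av by (simp add: mult.commute)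
    have "\<bar>?ph u\<bar> \<le> 1" using 1 2 by linarith
    then have "\<bar>?ph u\<bar> \<le> pi / 3" using pi_gt3 by linarith
    then have "cos (pi / 3) \<le> cos \<bar>?ph u\<bar>" by (intro cos_monotone_0_pi_le) auto
    then have cos: "1 / 2 \<le> cos (?ph u)" by (simp add: cos_60)
    show ?thesis
    proof (cases "\<bar>u\<bar> \<le> w / sqrt a")
      case True
      have "t * osc n w u \<le> t * (2 * (u / w)\<^sup>2 * psi n w)" using osc_le[OF w, of u] t by (intro mult_left_mono) auto
      also have "\<dots> = 2 * (u / w)\<^sup>2 * (t * psi n w)" by simp
      also have "\<dots> \<le> 2 * (1 / a) * a"
      proof (intro mult_mono)
        have "\<bar>u / w\<bar> \<le> 1 / sqrt a" using True w a by (simp add: field_simps)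
        then have "(u / w)\<^sup>2 \<le> (1 / sqrt a)\<^sup>2" by (metis abs_ge_zero power2_abs power_mono)
        then show "(u / w)\<^sup>2 \<le> 1 / a" using a by (simp add: power_divide)
      qed (use psi_le a t psi_nonneg[of w] in auto)
      also have "\<dots> = 2" using a by simp
      finally have e2: "exp (- 2) \<le> exp (- (t * osc n w u))" by simp
      have "1 / 8 \<le> exp (- 2 :: real)"
      proof -
        have "exp (2::real) \<le> 8"
        proof -
          have "exp (1::real) \<le> 28/10" using e_less_272 by simp
          then have "exp (1::real) * exp 1 \<le> 28/10 * (28/10)" by (intro mult_mono) auto
          then show ?thesis by (simp add: mult_exp_exp)
        qed
        then have "1 / 8 \<le> 1 / exp (2::real)" by (intro divide_left_mono) auto
        also have "1 / exp (2::real) = exp (- 2)" by (simp only: exp_minus divide_inverse mult_1_left)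
        finally show ?thesis .
      qed
      then have e8: "1 / 8 \<le> exp (- (t * osc n w u))" using e2 by (rule order_trans)
      have "(1 / 8) * (1 / 2) \<le> exp (- (t * osc n w u)) * cos (?ph u)" by (rule mult_mono[OF e8 cos]) auto
      moreover have "indicator {- (w / sqrt a)..w / sqrt a} u = (1::real)" using True by (auto simp: indicator_def)
      moreover have "0 \<le> exp (- (b * \<bar>u\<bar>))" by simp
      ultimately show ?thesis by linarith
    next
      case False
      then have "indicator {- (w / sqrt a)..w / sqrt a} u = (0::real)" by (auto simp: indicator_def)
      moreover have "0 \<le> exp (- (t * osc n w u)) * cos (?ph u)" using cos by simp
      moreover have "0 \<le> exp (- (b * \<bar>u\<bar>))" by simp
      ultimately show ?thesis by linarith
    qed
  next
    case False
    then have u: "v * w \<le> \<bar>u\<bar>" "v * w < \<bar>u\<bar>" by auto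
    have "w / sqrt a \<le> v * w" using mult_right_mono[OF vs, of w] w by simp
    then have "indicator {- (w / sqrt a)..w / sqrt a} u = (0::real)" using u by (auto simp: indicator_def)
    moreover have "- exp (- (b * \<bar>u\<bar>)) \<le> exp (- (t * osc n w u)) * cos (?ph u)"
    proof -
      have "exp (- (t * osc n w u)) \<le> exp (- (b * \<bar>u\<bar>))" using osc_lower'[OF v u(1)] by (simp add: b_def)
      moreover have "exp (- (t * osc n w u)) * (- 1) \<le> exp (- (t * osc n w u)) * cos (?ph u)" by (intro mult_left_mono) auto
      ultimately show ?thesis by linarith
    qed
    ultimately show ?thesis by simp
  qed
  have ind: "integrable lborel (\<lambda>u. indicator {- (w / sqrt a)..w / sqrt a} u / 16 :: real)"
    by (intro integrable_divide_zero integrable_real_indicator) (auto simp: emeasure_lborel_Icc_eq)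
  have "w / (16 * sqrt a) \<le> w / (8 * sqrt a) - 2 / b" using bb by simp
  also have "\<dots> \<le> (\<integral>u. indicator {- (w / sqrt a)..w / sqrt a} u / 16 - exp (- (b * \<bar>u\<bar>)) \<partial>lborel)"
  proof -
    have "(\<integral>u. indicator {- (w / sqrt a)..w / sqrt a} u / 16 - exp (- (b * \<bar>u\<bar>)) \<partial>lborel) = w / (8 * sqrt a) - (\<integral>u. exp (- (b * \<bar>u\<bar>)) \<partial>lborel)"
      using integrable_exp_abs(1)[OF b] w a by (subst Bochner_Integration.integral_diff[OF ind]) auto
    then show ?thesis using integrable_exp_abs(2)[OF b] by simp
  qed
  also have "\<dots> \<le> (\<integral>u. exp (- (t * osc n w u)) * cos (?ph u) \<partial>lborel)"
  proof (rule integral_mono[OF _ _ lower])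
    show "integrable lborel (\<lambda>u. indicator {- (w / sqrt a)..w / sqrt a} u / 16 - exp (- (b * \<bar>u\<bar>)))"
      by (rule Bochner_Integration.integrable_diff[OF ind integrable_exp_abs(1)[OF b]])
    have "integrable lborel (\<lambda>u. Re (iexp (u * x) * line_exp n m t w u) / peak)"
      by (intro integrable_divide_zero integrable_Re integrable_iexp_mult transform_integrable) auto
    then show "integrable lborel (\<lambda>u. exp (- (t * osc n w u)) * cos (?ph u))"
      unfolding form using peak_pos by simp
  qed
  finally have main: "w / (16 * sqrt a) \<le> (\<integral>u. exp (- (t * osc n w u)) * cos (?ph u) \<partial>lborel)" .
  have "Re (inv_laplace n m t w x) = exp (w * x) * (Re (\<integral>u. iexp (u * x) * line_exp n m t w u \<partial>lborel) / (2 * pi))"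
    unfolding inv_laplace_def inv_fourier_def by (simp add: Re_divide_of_real flip: of_real_mult)
  also have "Re (\<integral>u. iexp (u * x) * line_exp n m t w u \<partial>lborel) = (\<integral>u. Re (iexp (u * x) * line_exp n m t w u) \<partial>lborel)"
    by (rule integral_Re[symmetric], rule integrable_iexp_mult[OF transform_integrable]) auto
  also have "\<dots> = peak * (\<integral>u. exp (- (t * osc n w u)) * cos (?ph u) \<partial>lborel)"
    unfolding form by (rule integral_mult_right_zero)
  finally have eq: "Re (inv_laplace n m t w x) = exp (w * x) * peak * ((\<integral>u. exp (- (t * osc n w u)) * cos (?ph u) \<partial>lborel) / (2 * pi))"
    by simp
  have "w / (128 * sqrt a) \<le> w / (16 * sqrt a) / (2 * pi)"
  proof -
    have "16 * sqrt a * (2 * pi) \<le> 128 * sqrt a" using pi_less_4 a by simp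
    then have "w / (128 * sqrt a) \<le> w / (16 * sqrt a * (2 * pi))" using w a by (intro divide_left_mono) auto
    then show ?thesis by simp
  qed
  also have "\<dots> \<le> (\<integral>u. exp (- (t * osc n w u)) * cos (?ph u) \<partial>lborel) / (2 * pi)"
    using main by (intro divide_right_mono) auto
  finally have "exp (w * x) * peak * (w / (128 * sqrt a)) \<le> Re (inv_laplace n m t w x)"
    unfolding eq using peak_pos by (intro mult_left_mono) auto
  then show ?thesis by simp
qed

end

section \<open>Removing the large jumps\<close>

definition trunc :: "(real \<Rightarrow> real) \<Rightarrow> real \<Rightarrow> real \<Rightarrow> real" where
  "trunc n d y = n y * indicator {..d} y"
definition tail :: "(real \<Rightarrow> real) \<Rightarrow> real \<Rightarrow> real \<Rightarrow> real" where
  "tail n d y = n y * indicator {d<..} y"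
definition tail_mass :: "(real \<Rightarrow> real) \<Rightarrow> real \<Rightarrow> real" where
  "tail_mass n d = (\<integral>y. tail n d y \<partial>lborel)"

context levy_density
begin

lemma trunc_measurable [measurable]: "trunc n d \<in> borel_measurable borel"
  and tail_measurable [measurable]: "tail n d \<in> borel_measurable borel"
  unfolding trunc_def[abs_def] tail_def[abs_def] by measurable

lemma levy_density_trunc: "levy_density (trunc n d)"
proof
  show "integrable lborel (\<lambda>y. trunc n d y * min y (y\<^sup>2))"
  proof (rule Bochner_Integration.integrable_bound[OF n_integrable])
    show "AE y in lborel. norm (trunc n d y * min y (y\<^sup>2)) \<le> norm (n y * min y (y\<^sup>2))"
      by (auto simp: trunc_def abs_mult indicator_def)
  qed measurable
qed (auto simp: trunc_def n_nonneg n_zero)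

lemma levy_density_tail: "levy_density (tail n d)"
proof
  show "integrable lborel (\<lambda>y. tail n d y * min y (y\<^sup>2))"
  proof (rule Bochner_Integration.integrable_bound[OF n_integrable])
    show "AE y in lborel. norm (tail n d y * min y (y\<^sup>2)) \<le> norm (n y * min y (y\<^sup>2))"
      by (auto simp: tail_def abs_mult indicator_def)
  qed measurable
qed (auto simp: tail_def n_nonneg n_zero)

lemma expo_dom_trunc: "expo_dom (trunc n d) w"
  unfolding expo_dom_def trunc_def by (auto intro!: exI[of _ d])

lemma tail_nonneg: "0 \<le> tail n d y"
  by (simp add: tail_def n_nonneg)

lemma integrable_tail: "0 < d \<Longrightarrow> integrable lborel (tail n d)"
  using integrable_large_mass[of "1 / d"] unfolding tail_def[abs_def] by simp

lemma integrable_tail1: "0 < d \<Longrightarrow> integrable lborel (\<lambda>y. tail n d y * y)"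
  using integrable_large_moment[of "1 / d"] unfolding tail_def[abs_def] by (simp add: mult_ac)

lemma tail_mass_nonneg: "0 \<le> tail_mass n d"
  unfolding tail_mass_def by (intro integral_nonneg_AE AE_I2 tail_nonneg)

lemma tail_mass_le: "0 < d \<Longrightarrow> tail_mass n d \<le> 4 * psi n (1 / d)"
  using large_mass_le_psi[of "1 / d"] unfolding tail_mass_def tail_def by simp

lemma integrable_tail_exp: 
  assumes d: "0 < d" and z: "0 \<le> Re z"
  shows "integrable lborel (\<lambda>y. tail n d y *\<^sub>R exp (- (z * of_real y)))"
proof (rule Bochner_Integration.integrable_bound[OF integrable_tail[OF d]])
  show "AE y in lborel. norm (tail n d y *\<^sub>R exp (- (z * of_real y))) \<le> norm (tail n d y)"
  proof (rule AE_I2)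
    fix y
    show "norm (tail n d y *\<^sub>R exp (- (z * of_real y))) \<le> norm (tail n d y)"
    proof (cases "y \<le> d")
      case False
      then have "norm (exp (- (z * of_real y))) \<le> 1" using z d by simp
      then have "\<bar>tail n d y\<bar> * norm (exp (- (z * of_real y))) \<le> \<bar>tail n d y\<bar> * 1" by (intro mult_left_mono) auto
      then show ?thesis by simp
    qed (simp add: tail_def)
  qed
qed measurable

lemma cpsi_trunc_tail:
  assumes z: "expo_dom n (Re z)" and d: "0 < d" "0 \<le> Re z"
  shows "cpsi n z = cpsi (trunc n d) z + cpsi (tail n d) z"
proof -
  interpret T: levy_density "trunc n d" by (rule levy_density_trunc)
  interpret L: levy_density "tail n d" by (rule levy_density_tail)
  let ?f = "\<lambda>y. exp (- (z * of_real y)) - 1 + z * of_real y"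
  have eq: "n y *\<^sub>R ?f y = trunc n d y *\<^sub>R ?f y + tail n d y *\<^sub>R ?f y" for y
    by (auto simp: trunc_def tail_def indicator_def)
  have i1: "integrable lborel (\<lambda>y. trunc n d y *\<^sub>R ?f y)" by (rule T.integrable_cpsi[OF expo_dom_trunc])
  have "integrable lborel (\<lambda>y. n y *\<^sub>R ?f y - trunc n d y *\<^sub>R ?f y)"
    by (intro Bochner_Integration.integrable_diff integrable_cpsi i1 z)
  then have i2: "integrable lborel (\<lambda>y. tail n d y *\<^sub>R ?f y)" unfolding eq by simp
  show ?thesis unfolding cpsi_def eq by (rule Bochner_Integration.integral_add[OF i1 i2])
qed

text \<open>A finite jump measure may be uncompensated: the exponent is that of a compound Poisson
  process with a drift.\<close>

lemma cpsi_tail: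
  assumes d: "0 < d" and z: "0 \<le> Re z"
  shows "cpsi (tail n d) z = (\<integral>y. tail n d y *\<^sub>R exp (- (z * of_real y)) \<partial>lborel) - of_real (tail_mass n d) + z * of_real (large_moment n (1 / d))"
proof -
  have i1: "integrable lborel (\<lambda>y. tail n d y *\<^sub>R exp (- (z * of_real y)))" by (rule integrable_tail_exp[OF d z])
  have i2: "integrable lborel (\<lambda>y. complex_of_real (tail n d y))" using integrable_tail[OF d] by simp
  have i3: "integrable lborel (\<lambda>y. z * complex_of_real (tail n d y * y))"
    by (rule integrable_mult_right[OF integrable_of_real[OF integrable_tail1[OF d]]])
  have "cpsi (tail n d) z = (\<integral>y. (tail n d y *\<^sub>R exp (- (z * of_real y)) - of_real (tail n d y)) + z * of_real (tail n d y * y) \<partial>lborel)"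
    unfolding cpsi_def by (intro Bochner_Integration.integral_cong) (auto simp: scaleR_conv_of_real algebra_simps)
  also have "\<dots> = (\<integral>y. tail n d y *\<^sub>R exp (- (z * of_real y)) \<partial>lborel) - (\<integral>y. of_real (tail n d y) \<partial>lborel) + (\<integral>y. z * of_real (tail n d y * y) \<partial>lborel)"
    using i1 i2 i3 by (subst Bochner_Integration.integral_add, auto simp del: integral_complex_of_real integral_mult_right_zero of_real_mult intro!: Bochner_Integration.integral_diff)
  also have "(\<integral>y. z * of_real (tail n d y * y) \<partial>lborel) = z * of_real (\<integral>y. tail n d y * y \<partial>lborel)"
    unfolding integral_mult_right_zero integral_complex_of_real ..
  also have "(\<integral>y. tail n d y * y \<partial>lborel) = large_moment n (1 / d)"
    unfolding large_moment_def tail_def by (simp add: mult.assoc)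
  finally show ?thesis by (simp add: tail_mass_def)
qed

text \<open>On the imaginary axis the exponent is the limit of the exponents of the jumps beyond
  \<open>1/(j+1)\<close>, each of which is a drift plus a compound Poisson exponent.\<close>

lemma pos_multiplier_line_exp_0:
  assumes dom: "expo_dom n 0" and t: "0 < t"
  shows "pos_multiplier (line_exp n m t 0)"
proof -
  define e where "e j = inverse (real (Suc j))" for j
  have e: "0 < e j" for j by (simp add: e_def)
  define A where "A j u = cpsi (tail n (e j)) (Complex 0 u)" for j u
  define N where "N j u = (\<integral>y. of_real (tail n (e j) y) * iexp (- (u * y)) \<partial>lborel)" for j u
  have AN: "A j u = N j u - of_real (tail_mass n (e j)) + of_real (large_moment n (1 / e j)) * (\<i> * of_real u)" for j u
    unfolding A_def cpsi_tail[OF e, of "Complex 0 u", simplified] N_def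
    by (simp add: scaleR_conv_of_real Complex_eq mult_ac)
  have posN: "pos_multiplier (N j)" for j
    unfolding N_def[abs_def]
    by (rule pos_multiplier_transform) (auto intro!: lborel.sigma_finite_measure_axioms integrable_tail e tail_nonneg)
  show ?thesis
  proof (rule pos_multiplier_lim)
    let ?L = "\<lambda>j u. exp (of_real t * (of_real m * Complex 0 u + A j u))"
    show "pos_multiplier (?L j)" for j
    proof -
      have "pos_multiplier (\<lambda>u. of_real (exp (- t * tail_mass n (e j))) * (iexp (u * (t * (m + large_moment n (1 / e j)))) * exp (of_real t * N j u)))"
        by (intro pos_multiplier_mult pos_multiplier_const pos_multiplier_shift pos_multiplier_exp posN) (use t in auto)
      also have "(\<lambda>u. of_real (exp (- t * tail_mass n (e j))) * (iexp (u * (t * (m + large_moment n (1 / e j)))) * exp (of_real t * N j u))) = ?L j"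
        unfolding AN by (auto simp: exp_of_real[symmetric] exp_add[symmetric] Complex_eq algebra_simps)
      finally show ?thesis .
    qed
    show "norm (?L j u) \<le> 1" for j u
    proof -
      interpret L: levy_density "tail n (e j)" by (rule levy_density_tail)
      have i: "integrable lborel (\<lambda>y. complex_of_real (tail n (e j) y) * iexp (- (u * y)))"
        using integrable_tail_exp[OF e, of "Complex 0 u" j] by (simp add: scaleR_conv_of_real Complex_eq mult_ac)
      have "Re (N j u) \<le> norm (N j u)" by (rule complex_Re_le_cmod)
      also have "\<dots> \<le> (\<integral>y. norm (complex_of_real (tail n (e j) y) * iexp (- (u * y))) \<partial>lborel)"
        unfolding N_def by (rule integral_norm_bound)
      also have "\<dots> = tail_mass n (e j)" unfolding tail_mass_def using tail_nonneg by (simp add: norm_mult)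
      finally have "Re (A j u) \<le> 0" unfolding AN by simp
      then have "t * Re (A j u) \<le> 0" using t by (simp add: mult_le_0_iff)
      then show ?thesis by simp
    qed
    show "(\<lambda>j. ?L j u) \<longlonglongrightarrow> line_exp n m t 0 u" for u
    proof -
      let ?f = "\<lambda>y. exp (- (Complex 0 u * of_real y)) - 1 + Complex 0 u * of_real y"
      have "(\<lambda>j. A j u) \<longlonglongrightarrow> cpsi n (Complex 0 u)"
        unfolding A_def cpsi_def
      proof (rule integral_dominated_convergence[where w="\<lambda>y. norm (n y *\<^sub>R ?f y)"])
        have i: "integrable lborel (\<lambda>y. n y *\<^sub>R ?f y)" by (rule integrable_cpsi) (use dom in simp)
        show "integrable lborel (\<lambda>y. norm (n y *\<^sub>R ?f y))" by (rule integrable_norm[OF i])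
        show "AE y in lborel. norm (tail n (e j) y *\<^sub>R ?f y) \<le> norm (n y *\<^sub>R ?f y)" for j
          by (auto simp: tail_def indicator_def)
        show "AE y in lborel. (\<lambda>j. tail n (e j) y *\<^sub>R ?f y) \<longlonglongrightarrow> n y *\<^sub>R ?f y"
        proof (rule AE_I2)
          fix y
          show "(\<lambda>j. tail n (e j) y *\<^sub>R ?f y) \<longlonglongrightarrow> n y *\<^sub>R ?f y"
          proof (cases "y \<le> 0")
            case True then show ?thesis by (simp add: tail_def n_zero)
          next
            case False
            have "\<forall>\<^sub>F j in sequentially. e j < y"
              using order_tendstoD(2)[OF LIMSEQ_inverse_real_of_nat, of y] False by (simp add: e_def)
            then have "\<forall>\<^sub>F j in sequentially. tail n (e j) y *\<^sub>R ?f y = n y *\<^sub>R ?f y"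
              by eventually_elim (simp add: tail_def)
            then show ?thesis by (rule tendsto_eventually)
          qed
        qed
      qed measurable
      then show ?thesis unfolding line_exp_def by (intro tendsto_intros)
    qed
  qed
qed

end

text \<open>The jumps of size at most \<open>d\<close>, with exponent \<open>cpsi n1\<close>, are
  separated from the larger ones. The compensator of the latter acts on the former as the drift
  \<open>m1\<close>.\<close>

locale big_jumps = levy_density n for n +
  fixes d t :: real
  assumes d: "0 < d" and t: "0 < t"
    and grow: "\<And>w1 w2. osc_grows (trunc n d) w1 w2"
    and grow': "osc_grows n 1 1"
begin

abbreviation "n1 \<equiv> trunc n d"
abbreviation "m1 \<equiv> large_moment n (1 / d)"

sublocale T: levy_density n1 by (rule levy_density_trunc)

text \<open>The density at time \<open>t\<close> of the process without the big jumps. Since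
  \<open>n1\<close> has bounded support, the line of integration may have any abscissa, also a
  negative one.\<close>

definition f0 :: "real \<Rightarrow> real" where "f0 x = Re (inv_laplace n1 m1 t 0 x)"

lemma transform_integrable: "integrable lborel (line_exp n1 m1 t w)"
  by (rule T.line_exp_integrable[OF expo_dom_trunc t grow])

lemma inv_laplace0_nonneg: "inv_fourier (line_exp n1 m1 t 0) x \<in> \<real>\<^sub>\<ge>\<^sub>0"
  by (rule pos_multiplier_inv_fourier_nonneg[OF T.pos_multiplier_line_exp_0[OF expo_dom_trunc t] transform_integrable])

lemma inv_laplace_f0: "inv_laplace n1 m1 t w x = of_real (f0 x)"
proof -
  have "inv_laplace n1 m1 t w x = inv_laplace n1 m1 t 0 x"
    using T.inv_laplace_shift[OF expo_dom_trunc expo_dom_trunc t _ grow] by (cases "w \<le> 0") (auto intro: sym)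
  also have "\<dots> = of_real (f0 x)"
    using inv_laplace0_nonneg[of x] by (auto simp: inv_laplace_def f0_def complex_nonneg_Reals_iff complex_eq_iff)
  finally show ?thesis .
qed

lemma f0_eq: "f0 x = Re (inv_fourier (line_exp n1 m1 t 0) x)"
  by (simp add: f0_def inv_laplace_def)

lemma f0_nonneg: "0 \<le> f0 x"
  using inv_laplace0_nonneg[of x] by (simp add: f0_eq complex_nonneg_Reals_iff)

lemma norm_line_exp0: "norm (line_exp n1 m1 t 0 u) \<le> 1"
  using T.osc_nonneg[of 0 u] t by (simp add: T.norm_line_exp[OF expo_dom_trunc])

lemma f0_integrable: "integrable lborel f0" and f0_integral: "(\<integral>x. f0 x \<partial>lborel) = 1"
proof -
  have h: "integrable lborel (\<lambda>x. Re (inv_fourier (line_exp n1 m1 t 0) x))"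
    and eq: "(\<integral>x. iexp (- (0 * x)) * inv_fourier (line_exp n1 m1 t 0) x \<partial>lborel) = line_exp n1 m1 t 0 0"
    by (rule fourier_inversion_nonneg[OF transform_integrable T.isCont_line_exp[OF expo_dom_trunc] norm_line_exp0 inv_laplace0_nonneg])+
  show "integrable lborel f0" using h by (simp add: f0_eq[abs_def])
  have inv: "inv_fourier (line_exp n1 m1 t 0) x = of_real (f0 x)" for x
    using inv_laplace_f0[of 0 x] by (simp add: inv_laplace_def)
  have "complex_of_real (\<integral>x. f0 x \<partial>lborel) = line_exp n1 m1 t 0 0"
    using eq unfolding inv by simp
  also have "\<dots> = 1"
    using T.cpsi_of_real[OF expo_dom_trunc, of 0] by (simp add: line_exp_def Complex_eq)
  finally show "(\<integral>x. f0 x \<partial>lborel) = 1" by simp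
qed

lemma f0_continuous: "continuous_on UNIV f0"
  unfolding f0_eq[abs_def] by (intro continuous_intros continuous_inv_fourier transform_integrable)

lemma f0_measurable [measurable]: "f0 \<in> borel_measurable borel"
  by (rule borel_measurable_continuous_onI[OF f0_continuous])

text \<open>\<open>g k\<close> is the convolution of \<open>f0\<close> with the \<open>k\<close>-th
  convolution power of the big jumps.\<close>

primrec g :: "nat \<Rightarrow> real \<Rightarrow> real" where
  "g 0 = f0"
| "g (Suc k) = (\<lambda>x. \<integral>y. tail n d y * g k (x - y) \<partial>lborel)"

text \<open>The transform of the big jumps along \<open>Re z = 1\<close>, a line on which the
  transforms of both \<open>n\<close> and \<open>n1\<close> are available.\<close>

definition N :: "real \<Rightarrow> complex" where
  "N u = (\<integral>y. of_real (tail n d y * exp (- y)) * iexp (- (u * y)) \<partial>lborel)"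

lemma tail_exp_integrable: "integrable lborel (\<lambda>y. tail n d y * exp (- y))"
proof (rule Bochner_Integration.integrable_bound[OF integrable_tail[OF d]])
  show "AE y in lborel. norm (tail n d y * exp (- y)) \<le> norm (tail n d y)"
    using d by (auto simp: tail_def indicator_def abs_mult mult_left_le)
qed measurable

lemma N_measurable [measurable]: "N \<in> borel_measurable borel"
  unfolding N_def[abs_def] by measurable

lemma norm_N: "norm (N u) \<le> tail_mass n d"
proof -
  have "norm (N u) \<le> (\<integral>y. norm (complex_of_real (tail n d y * exp (- y)) * iexp (- (u * y))) \<partial>lborel)"
    unfolding N_def by (rule integral_norm_bound)
  also have "\<dots> = (\<integral>y. tail n d y * exp (- y) \<partial>lborel)" using tail_nonneg by (simp add: norm_mult)
  also have "\<dots> \<le> tail_mass n d" unfolding tail_mass_def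
  proof (rule integral_mono[OF tail_exp_integrable integrable_tail[OF d]])
    show "tail n d y * exp (- y) \<le> tail n d y" for y
      using d n_nonneg[of y] by (auto simp: tail_def indicator_def mult_left_le)
  qed
  finally show ?thesis .
qed

lemma norm_N_power: "norm (N u ^ k) \<le> tail_mass n d ^ k"
  unfolding norm_power by (intro power_mono norm_N) auto

lemma transform_N_integrable: "integrable lborel (\<lambda>u. line_exp n1 m1 t 1 u * N u ^ k)"
  by (rule integrable_mult_bounded[OF transform_integrable _ norm_N_power]) measurable

lemma g_transform: "of_real (g k x) = of_real (exp x) * inv_fourier (\<lambda>u. line_exp n1 m1 t 1 u * N u ^ k) x"
proof (induction k arbitrary: x)
  case 0
  then show ?case using inv_laplace_f0[of 1 x] by (simp add: inv_laplace_def)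
next
  case (Suc k)
  have "of_real (exp x) * inv_fourier (\<lambda>u. line_exp n1 m1 t 1 u * N u ^ Suc k) x
      = of_real (exp x) * inv_fourier (\<lambda>u. (line_exp n1 m1 t 1 u * N u ^ k) * N u) x"
    by (simp add: mult_ac)
  also have "\<dots> = of_real (exp x) * (\<integral>y. of_real (tail n d y * exp (- y)) * inv_fourier (\<lambda>u. line_exp n1 m1 t 1 u * N u ^ k) (x - y) \<partial>lborel)"
    unfolding N_def
    by (subst inv_fourier_mult_transform[OF lborel.sigma_finite_measure_axioms _ tail_exp_integrable transform_N_integrable[unfolded N_def]]) simp_all
  also have "\<dots> = (\<integral>y. of_real (exp x) * (of_real (tail n d y * exp (- y)) * inv_fourier (\<lambda>u. line_exp n1 m1 t 1 u * N u ^ k) (x - y)) \<partial>lborel)"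
    by simp
  also have "\<dots> = (\<integral>y. of_real (tail n d y * g k (x - y)) \<partial>lborel)"
    by (intro Bochner_Integration.integral_cong) (auto simp: Suc.IH exp_diff exp_minus field_simps)
  also have "\<dots> = of_real (g (Suc k) x)" by (simp only: integral_complex_of_real g.simps)
  finally show ?case by simp
qed

lemma g_measurable [measurable]: "g k \<in> borel_measurable borel"
proof -
  have "g k = (\<lambda>x. Re (of_real (exp x) * inv_fourier (\<lambda>u. line_exp n1 m1 t 1 u * N u ^ k) x))"
    unfolding g_transform[symmetric] by simp
  also have "\<dots> \<in> borel_measurable borel"
    using measurable_inv_fourier[OF transform_N_integrable] by measurable
  finally show ?thesis .
qed

lemma g_nonneg: "0 \<le> g k x"
proof (induction k arbitrary: x)
  case (Suc k)
  then show ?case by (auto intro!: integral_nonneg_AE AE_I2 mult_nonneg_nonneg tail_nonneg)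
qed (simp add: f0_nonneg)

lemma g_integral: "(\<integral>\<^sup>+x. ennreal (g k x) \<partial>lborel) \<le> ennreal (tail_mass n d ^ k)"
proof (induction k)
  case 0
  then show ?case using nn_integral_eq_integral[OF f0_integrable] f0_nonneg f0_integral by simp
next
  case (Suc k)
  have "(\<integral>\<^sup>+x. ennreal (g (Suc k) x) \<partial>lborel) \<le> (\<integral>\<^sup>+x. (\<integral>\<^sup>+y. ennreal (tail n d y * g k (x - y)) \<partial>lborel) \<partial>lborel)"
  proof (rule nn_integral_mono)
    fix x
    show "ennreal (g (Suc k) x) \<le> (\<integral>\<^sup>+y. ennreal (tail n d y * g k (x - y)) \<partial>lborel)"
    proof (cases "integrable lborel (\<lambda>y. tail n d y * g k (x - y))")
      case True
      then show ?thesis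
        by (subst nn_integral_eq_integral[OF True]) (auto intro!: mult_nonneg_nonneg tail_nonneg g_nonneg)
    qed (simp add: not_integrable_integral_eq)
  qed
  also have "\<dots> = (\<integral>\<^sup>+y. (\<integral>\<^sup>+x. ennreal (tail n d y * g k (x - y)) \<partial>lborel) \<partial>lborel)"
    by (rule lborel_pair.Fubini') measurable
  also have "\<dots> = (\<integral>\<^sup>+y. ennreal (tail n d y) * (\<integral>\<^sup>+x. ennreal (g k x) \<partial>lborel) \<partial>lborel)"
  proof (rule nn_integral_cong)
    fix y
    have "(\<integral>\<^sup>+x. ennreal (tail n d y * g k (x - y)) \<partial>lborel) = ennreal (tail n d y) * (\<integral>\<^sup>+x. ennreal (g k (x - y)) \<partial>lborel)"
      by (subst nn_integral_cmult[symmetric]) (auto simp: ennreal_mult tail_nonneg g_nonneg)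
    also have "(\<integral>\<^sup>+x. ennreal (g k (x - y)) \<partial>lborel) = (\<integral>\<^sup>+x. ennreal (g k x) \<partial>lborel)"
      using nn_integral_real_affine[of "\<lambda>x. ennreal (g k x)" 1 "- y"] by simp
    finally show "(\<integral>\<^sup>+x. ennreal (tail n d y * g k (x - y)) \<partial>lborel) = ennreal (tail n d y) * (\<integral>\<^sup>+x. ennreal (g k x) \<partial>lborel)" .
  qed
  also have "\<dots> = (\<integral>\<^sup>+y. ennreal (tail n d y) \<partial>lborel) * (\<integral>\<^sup>+x. ennreal (g k x) \<partial>lborel)"
    by (rule nn_integral_multc) measurable
  also have "(\<integral>\<^sup>+y. ennreal (tail n d y) \<partial>lborel) = ennreal (tail_mass n d)"
    unfolding tail_mass_def by (rule nn_integral_eq_integral[OF integrable_tail[OF d]]) (simp add: tail_nonneg)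
  also have "ennreal (tail_mass n d) * (\<integral>\<^sup>+x. ennreal (g k x) \<partial>lborel) \<le> ennreal (tail_mass n d) * ennreal (tail_mass n d ^ k)"
    by (intro mult_left_mono Suc) auto
  finally show ?case by (simp add: ennreal_mult'[symmetric] tail_mass_nonneg)
qed

lemma g_integrable: "integrable lborel (g k)"
  by (rule integrableI_nonneg) (use g_integral[of k] g_nonneg in \<open>auto intro: le_less_trans\<close>)

lemma g_Suc_le:
  assumes S: "\<And>y. tail n d y \<le> S"
  shows "g (Suc k) x \<le> S * tail_mass n d ^ k"
proof -
  have i: "integrable lborel (\<lambda>y. g k (x - y))"
    using lborel_integrable_real_affine[OF g_integrable, of "-1" k x] by simp
  have S0: "0 \<le> S" using tail_nonneg[of d 0] S[of 0] by linarith
  have "g (Suc k) x \<le> (\<integral>y. S * g k (x - y) \<partial>lborel)"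
    unfolding g.simps
    by (rule integral_mono') (use i S g_nonneg S0 in \<open>auto intro!: mult_right_mono\<close>)
  also have "\<dots> = S * (\<integral>y. g k (x - y) \<partial>lborel)" by simp
  also have "(\<integral>y. g k (x - y) \<partial>lborel) = (\<integral>y. g k y \<partial>lborel)"
    using lborel_integral_real_affine[of "-1" "g k" x] by simp
  also have "\<dots> \<le> tail_mass n d ^ k"
    using g_integral[of k] tail_mass_nonneg[of d] by (subst (asm) nn_integral_eq_integral[OF g_integrable]) (auto simp: g_nonneg ennreal_le_iff)
  finally show ?thesis using S0 by (simp add: mult_left_mono)
qed

lemma line_exp_decomp: "line_exp n 0 t 1 u = of_real (exp (- t * tail_mass n d)) * (line_exp n1 m1 t 1 u * exp (of_real t * N u))"
proof -
  have "cpsi n (Complex 1 u) = cpsi n1 (Complex 1 u) + cpsi (tail n d) (Complex 1 u)"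
    by (rule cpsi_trunc_tail) (auto simp: expo_dom_def d)
  also have "cpsi (tail n d) (Complex 1 u) = (\<integral>y. tail n d y *\<^sub>R exp (- (Complex 1 u * of_real y)) \<partial>lborel) - of_real (tail_mass n d) + Complex 1 u * of_real m1"
    by (rule cpsi_tail) (auto simp: d)
  also have "(\<integral>y. tail n d y *\<^sub>R exp (- (Complex 1 u * of_real y)) \<partial>lborel) = N u"
    unfolding N_def
    by (intro Bochner_Integration.integral_cong) (auto simp: scaleR_conv_of_real Complex_eq exp_of_real[symmetric] exp_add[symmetric] algebra_simps)
  finally have *: "cpsi n (Complex 1 u) = cpsi n1 (Complex 1 u) + (N u - of_real (tail_mass n d) + Complex 1 u * of_real m1)" .
  show ?thesis unfolding line_exp_def * 
    by (simp add: exp_of_real[symmetric] exp_add[symmetric] algebra_simps)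
qed

text \<open>The density of the full process, for which the line \<open>Re z = 1\<close> is a
  convenient choice.\<close>

definition P :: "real \<Rightarrow> real" where "P x = Re (inv_laplace n 0 t 1 x)"

text \<open>Expand \<open>exp (t N)\<close> in the factorisation \<open>line_exp_decomp\<close> and
  integrate term by term: the \<open>k\<close>-th term corresponds to \<open>k\<close> big jumps. As
  all terms are real, so is the integral.\<close>

lemma series: "(\<lambda>k. t ^ k / fact k * g k x) sums (exp (t * tail_mass n d) * P x)"
  and inv_laplace_real: "inv_laplace n 0 t 1 x = of_real (P x)"
proof -
  let ?T = "\<lambda>k u. of_real (t ^ k / fact k) * (iexp (u * x) * (line_exp n1 m1 t 1 u * N u ^ k))"
  let ?L = "tail_mass n d"
  have i: "integrable lborel (?T k)" for k
    by (intro integrable_mult_right integrable_iexp_mult transform_N_integrable) auto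
  have nT: "norm (?T k u) \<le> (norm (line_exp n1 m1 t 1 u)) * ((t * ?L) ^ k / fact k)" for k u
  proof -
    have "norm (?T k u) = norm (line_exp n1 m1 t 1 u) * (t ^ k / fact k * norm (N u ^ k))"
      using t by (simp add: norm_mult norm_divide norm_power)
    also have "\<dots> \<le> norm (line_exp n1 m1 t 1 u) * (t ^ k / fact k * ?L ^ k)"
      using norm_N_power t by (intro mult_left_mono) auto
    finally show ?thesis by (simp add: power_mult_distrib)
  qed
  have sexp: "summable (\<lambda>k. (t * ?L) ^ k / fact k)"
    using summable_exp[of "t * ?L"] by (simp add: divide_inverse mult.commute)
  have "(\<lambda>k. \<integral>u. ?T k u \<partial>lborel) sums (\<integral>u. (\<Sum>k. ?T k u) \<partial>lborel)"
  proof (rule sums_integral[OF i])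
    show "AE u in lborel. summable (\<lambda>k. norm (?T k u))"
      by (rule AE_I2, rule summable_comparison_test'[OF summable_mult[OF sexp]]) (use nT in auto)
    show "summable (\<lambda>k. \<integral>u. norm (?T k u) \<partial>lborel)"
    proof (rule summable_comparison_test'[OF summable_mult[OF sexp, of "\<integral>u. norm (line_exp n1 m1 t 1 u) \<partial>lborel"]])
      fix k
      have "(\<integral>u. norm (?T k u) \<partial>lborel) \<le> (\<integral>u. norm (line_exp n1 m1 t 1 u) * ((t * ?L) ^ k / fact k) \<partial>lborel)"
        by (rule integral_mono[OF integrable_norm[OF i] _ nT]) (use transform_integrable[of 1] in auto)
      then show "norm (\<integral>u. norm (?T k u) \<partial>lborel) \<le> (\<integral>u. norm (line_exp n1 m1 t 1 u) \<partial>lborel) * ((t * ?L) ^ k / fact k)"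
        by simp
    qed
  qed
  moreover have "(\<Sum>k. ?T k u) = of_real (exp (t * ?L)) * (iexp (u * x) * line_exp n 0 t 1 u)" for u
  proof -
    have "(\<lambda>k. (of_real t * N u) ^ k /\<^sub>R fact k) sums exp (of_real t * N u)" by (rule exp_converges)
    then have "(\<lambda>k. (iexp (u * x) * line_exp n1 m1 t 1 u) * ((of_real t * N u) ^ k /\<^sub>R fact k)) sums ((iexp (u * x) * line_exp n1 m1 t 1 u) * exp (of_real t * N u))"
      by (rule sums_mult)
    also have "(\<lambda>k. (iexp (u * x) * line_exp n1 m1 t 1 u) * ((of_real t * N u) ^ k /\<^sub>R fact k)) = (\<lambda>k. ?T k u)"
      by (auto simp: scaleR_conv_of_real power_mult_distrib field_simps)
    finally have "(\<Sum>k. ?T k u) = (iexp (u * x) * line_exp n1 m1 t 1 u) * exp (of_real t * N u)" by (rule sums_unique[symmetric])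
    also have "\<dots> = of_real (exp (t * ?L)) * (iexp (u * x) * line_exp n 0 t 1 u)"
      unfolding line_exp_decomp by (simp add: exp_minus)
    finally show ?thesis .
  qed
  ultimately have "(\<lambda>k. \<integral>u. ?T k u \<partial>lborel) sums (\<integral>u. of_real (exp (t * ?L)) * (iexp (u * x) * line_exp n 0 t 1 u) \<partial>lborel)"
    by simp
  then have "(\<lambda>k. of_real (exp x) / (2 * pi) * (\<integral>u. ?T k u \<partial>lborel)) sums (of_real (exp x) / (2 * pi) * (\<integral>u. of_real (exp (t * ?L)) * (iexp (u * x) * line_exp n 0 t 1 u) \<partial>lborel))"
    by (rule sums_mult)
  also have "(\<lambda>k. of_real (exp x) / (2 * pi) * (\<integral>u. ?T k u \<partial>lborel)) = (\<lambda>k. of_real (t ^ k / fact k * g k x))"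
  proof
    fix k
    show "of_real (exp x) / (2 * pi) * (\<integral>u. ?T k u \<partial>lborel) = complex_of_real (t ^ k / fact k * g k x)"
      unfolding of_real_mult[of "t ^ k / fact k"] g_transform inv_fourier_def integral_mult_right_zero by (simp add: mult_ac)
  qed
  also have "of_real (exp x) / (2 * pi) * (\<integral>u. of_real (exp (t * ?L)) * (iexp (u * x) * line_exp n 0 t 1 u) \<partial>lborel) = of_real (exp (t * ?L)) * inv_laplace n 0 t 1 x"
    unfolding inv_laplace_def inv_fourier_def integral_mult_right_zero by simp
  finally have S: "(\<lambda>k. complex_of_real (t ^ k / fact k * g k x)) sums (of_real (exp (t * ?L)) * inv_laplace n 0 t 1 x)" .
  have "Re (of_real (exp (t * ?L)) * inv_laplace n 0 t 1 x) = exp (t * ?L) * P x"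
    "Im (of_real (exp (t * ?L)) * inv_laplace n 0 t 1 x) = exp (t * ?L) * Im (inv_laplace n 0 t 1 x)" by (simp_all add: P_def)
  note ReIm = this
  from sums_Re[OF S] show 1: "(\<lambda>k. t ^ k / fact k * g k x) sums (exp (t * ?L) * P x)"
    unfolding Re_complex_of_real ReIm .
  from sums_Im[OF S] have "(\<lambda>k::nat. 0::real) sums (exp (t * ?L) * Im (inv_laplace n 0 t 1 x))"
    unfolding Im_complex_of_real ReIm .
  then have "Im (inv_laplace n 0 t 1 x) = 0" using sums_unique2[OF _ sums_zero] by fastforce
  then show "inv_laplace n 0 t 1 x = of_real (P x)" by (simp add: P_def complex_eq_iff)
qed

lemma P_nonneg: "0 \<le> P x"
proof -
  have "0 \<le> exp (t * tail_mass n d) * P x"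
    using sums_le[OF _ sums_zero series] g_nonneg t by (auto intro!: mult_nonneg_nonneg)
  then show ?thesis by (simp add: zero_le_mult_iff)
qed

lemma one_big_jump_lower:
  "exp (- (t * tail_mass n d)) * (t * (\<integral>y. tail n d y * f0 (x - y) \<partial>lborel)) \<le> P x"
proof -
  have "(\<Sum>k\<in>{1}. t ^ k / fact k * g k x) \<le> exp (t * tail_mass n d) * P x"
    using series[of x] g_nonneg t by (intro sum_le_suminf[THEN order_trans]) (auto simp: sums_iff)
  then have "exp (- (t * tail_mass n d)) * (t * g 1 x) \<le> exp (- (t * tail_mass n d)) * (exp (t * tail_mass n d) * P x)"
    by (intro mult_left_mono) auto
  also have "\<dots> = P x" by (simp add: exp_minus)
  finally show ?thesis by simp
qed

text \<open>Among one or more big jumps, one is bounded by the supremum of its density and the rest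
  only by their total mass; the sum over their number is absorbed by the Poisson weight.\<close>

lemma one_big_jump_upper:
  assumes S: "\<And>y. tail n d y \<le> S"
  shows "P x \<le> f0 x + t * S"
proof -
  let ?L = "tail_mass n d"
  have S0: "0 \<le> S" using tail_nonneg[of d 0] S[of 0] by linarith
  have s1: "(\<lambda>k. t ^ Suc k / fact (Suc k) * g (Suc k) x) sums (exp (t * ?L) * P x - f0 x)"
    using series[of x] by (subst sums_Suc_iff) simp
  have "(\<lambda>k. (t * ?L) ^ k /\<^sub>R fact k) sums exp (t * ?L)" by (rule exp_converges)
  then have s2: "(\<lambda>k. (t * S) * ((t * ?L) ^ k /\<^sub>R fact k)) sums ((t * S) * exp (t * ?L))" by (rule sums_mult)
  have "exp (t * ?L) * P x - f0 x \<le> (t * S) * exp (t * ?L)"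
  proof (rule sums_le[OF _ s1 s2])
    fix k
    have "t ^ Suc k / fact (Suc k) * g (Suc k) x \<le> t ^ Suc k / fact k * (S * ?L ^ k)"
    proof (rule mult_mono)
      show "t ^ Suc k / fact (Suc k) \<le> t ^ Suc k / fact k"
        using t by (intro divide_left_mono fact_mono) auto
      show "g (Suc k) x \<le> S * ?L ^ k" by (rule g_Suc_le[OF S])
      show "0 \<le> g (Suc k) x" by (rule g_nonneg)
    qed (use t in auto)
    then show "t ^ Suc k / fact (Suc k) * g (Suc k) x \<le> (t * S) * ((t * ?L) ^ k /\<^sub>R fact k)"
      by (simp add: power_mult_distrib field_simps)
  qed
  moreover have "exp (t * ?L) * (f0 x * exp (- (t * ?L)) + t * S) = f0 x + (t * S) * exp (t * ?L)"
    by (simp add: exp_minus distrib_left mult_ac)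
  ultimately have "exp (t * ?L) * P x \<le> exp (t * ?L) * (f0 x * exp (- (t * ?L)) + t * S)" by linarith
  then have "P x \<le> f0 x * exp (- (t * ?L)) + t * S" by simp
  also have "f0 x * exp (- (t * ?L)) \<le> f0 x * 1"
    using f0_nonneg t tail_mass_nonneg[of d] by (intro mult_left_mono) auto
  finally show ?thesis by simp
qed

lemma f0_bounded: "\<exists>B. \<forall>x. f0 x \<le> B"
  using norm_inv_fourier_le[OF transform_integrable[of 0]] complex_Re_le_cmod order_trans unfolding f0_eq by blast

lemma integrable_tail_f0: "integrable lborel (\<lambda>y. tail n d y * f0 (x - y))"
proof -
  obtain B where B: "\<And>x. f0 x \<le> B" using f0_bounded by blast
  show ?thesis
  proof (rule Bochner_Integration.integrable_bound)
    show "integrable lborel (\<lambda>y. tail n d y * B)" using integrable_tail[OF d] by simp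
    show "AE y in lborel. norm (tail n d y * f0 (x - y)) \<le> norm (tail n d y * B)"
    proof (rule AE_I2)
      fix y
      have "0 \<le> f0 (x - y)" "f0 (x - y) \<le> B" by (rule f0_nonneg, rule B)
      then show "norm (tail n d y * f0 (x - y)) \<le> norm (tail n d y * B)"
        unfolding real_norm_def abs_mult by (intro mult_left_mono) auto
    qed
  qed measurable
qed

end

section \<open>Consequences of the scaling conditions\<close>

locale scaling_density = levy_density n for n +
  fixes \<alpha> c \<beta> C x0 C0 :: real
  assumes lower: "\<And>u x. 1 \<le> u \<Longrightarrow> x0 < x \<Longrightarrow> c * u powr \<alpha> * psi n x \<le> psi n (u * x)"
    and upper: "\<And>u x. 1 \<le> u \<Longrightarrow> x0 < x \<Longrightarrow> psi n (u * x) \<le> C * u powr \<beta> * psi n x"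
    and params: "0 < c" "c \<le> 1" "1 \<le> C" "0 \<le> x0" "1 < \<alpha>" "\<beta> < 2" "1 \<le> C0"
    and amono: "\<And>x y. 0 < x \<Longrightarrow> x \<le> y \<Longrightarrow> n y \<le> C0 * n x"
    and psi_pos: "\<And>v. 0 < v \<Longrightarrow> 0 < psi n v"
begin

lemma scale_lower: "x0 < v \<Longrightarrow> v \<le> v' \<Longrightarrow> c * (v' / v) powr \<alpha> * psi n v \<le> psi n v'"
  using lower[of "v' / v" v] params by simp

lemma scale_linear: assumes "x0 < v" "v \<le> v'" shows "c * (v' / v) * psi n v \<le> psi n v'"
proof -
  have "(v' / v) powr 1 \<le> (v' / v) powr \<alpha>" using assms params by (intro powr_mono) auto
  then have "c * (v' / v) * psi n v \<le> c * (v' / v) powr \<alpha> * psi n v"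
    using assms params psi_nonneg[of v] by (intro mult_right_mono mult_left_mono) auto
  then show ?thesis using scale_lower[OF assms] by linarith
qed

lemma scale_quadratic: assumes "x0 < v" "v \<le> v'" shows "psi n v' \<le> C * (v' / v)\<^sup>2 * psi n v"
proof -
  have "(v' / v) powr \<beta> \<le> (v' / v) powr 2" using assms params by (intro powr_mono) auto
  also have "(v' / v) powr 2 = (v' / v)\<^sup>2" using assms params by (subst powr_numeral) auto
  finally have "C * (v' / v) powr \<beta> * psi n v \<le> C * (v' / v)\<^sup>2 * psi n v"
    using assms params psi_nonneg[of v] by (intro mult_right_mono mult_left_mono) auto
  moreover have "psi n v' \<le> C * (v' / v) powr \<beta> * psi n v" using upper[of "v' / v" v] assms params by simp
  ultimately show ?thesis by linarith
qed

lemma exists_big_power: "\<exists>A\<ge>B. D \<le> A powr (\<alpha> - 1)" for B D :: real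
proof (intro exI conjI)
  let ?A = "max B ((max D 1) powr (1 / (\<alpha> - 1)))"
  show "B \<le> ?A" by simp
  have "D \<le> (max D 1 powr (1 / (\<alpha> - 1))) powr (\<alpha> - 1)" using params by (simp add: powr_powr)
  also have "\<dots> \<le> ?A powr (\<alpha> - 1)" using params by (intro powr_mono2) auto
  finally show "D \<le> ?A powr (\<alpha> - 1)" .
qed

lemma large_moment_scale: assumes "0 < v" "1 \<le> l" shows "large_moment n (l * v) \<le> large_moment n v + l * v * small_moment n v"
proof -
  have i: "integrable lborel (\<lambda>y. n y * (indicator {1/v<..} y * y + l * v * (indicator {..1/v} y * y\<^sup>2)))"
  proof -
    have "integrable lborel (\<lambda>y. n y * (indicator {1/v<..} y * y) + l * v * (n y * (indicator {..1/v} y * y\<^sup>2)))"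
      using integrable_small_moment[OF assms(1)] integrable_large_moment[OF assms(1)] by auto
    then show ?thesis by (simp add: algebra_simps)
  qed
  have "large_moment n (l * v) \<le> (\<integral>y. n y * (indicator {1/v<..} y * y + l * v * (indicator {..1/v} y * y\<^sup>2)) \<partial>lborel)"
    unfolding large_moment_def
  proof (rule integral_n_mono[OF integrable_large_moment i])
    fix y :: real assume y: "0 < y"
    have "1 / (l * v) < y \<Longrightarrow> 1 * y \<le> (l * v * y) * y" using assms y by (intro mult_right_mono) (auto simp: field_simps)
    then show "indicator {1/(l * v)<..} y * y \<le> indicator {1/v<..} y * y + l * v * (indicator {..1/v} y * y\<^sup>2)"
      using y assms by (auto simp: indicator_def power2_eq_square mult.assoc)
  qed (use assms in simp)
  also have "\<dots> = (\<integral>y. n y * (indicator {1/v<..} y * y) + l * v * (n y * (indicator {..1/v} y * y\<^sup>2)) \<partial>lborel)"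
    by (intro Bochner_Integration.integral_cong) (auto simp: algebra_simps)
  also have "\<dots> = large_moment n v + l * v * small_moment n v"
    unfolding large_moment_def small_moment_def using integrable_small_moment[OF assms(1)] integrable_large_moment[OF assms(1)]
    by (subst Bochner_Integration.integral_add) auto
  finally show ?thesis .
qed

text \<open>Compare \<open>v\<close> with \<open>l v\<close> for a large factor \<open>l\<close>. If
  the small jumps contributed little to \<open>\<psi>(v)\<close>, then \<open>\<psi>\<close> would
  grow only linearly from \<open>v\<close> to \<open>l v\<close>, contradicting the lower scaling
  with \<open>\<alpha> > 1\<close>.\<close>

lemma small_moment_ge: obtains c1 where "0 < c1" "c1 \<le> 1" "\<And>v. x0 < v \<Longrightarrow> c1 * psi n v \<le> v\<^sup>2 * small_moment n v"
proof -
  obtain l where l: "1 \<le> l" "8 / c \<le> l powr (\<alpha> - 1)" using exists_big_power[of 1 "8 / c"] by auto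
  show ?thesis
  proof (rule that[of "1 / l"])
    fix v assume v: "x0 < v"
    then have v0: "0 < v" using params by simp
    have "8 * l \<le> c * l powr \<alpha>"
    proof -
      have "8 \<le> c * l powr (\<alpha> - 1)" using l params by (simp add: field_simps)
      then have "8 * l \<le> c * l powr (\<alpha> - 1) * l" using l by (intro mult_right_mono) auto
      also have "\<dots> = c * (l powr (\<alpha> - 1) * l powr 1)" using l by simp
      also have "\<dots> = c * l powr \<alpha>" by (subst powr_add[symmetric]) simp
      finally show ?thesis .
    qed
    then have "8 * l * psi n v \<le> c * l powr \<alpha> * psi n v" using psi_nonneg[of v] by (intro mult_right_mono)
    also have "\<dots> \<le> psi n (l * v)" by (rule lower[OF l(1) v])
    also have "\<dots> \<le> (l * v)\<^sup>2 * small_moment n (l * v) / 2 + l * v * large_moment n (l * v)"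
      using psi_le_split[of "l * v"] l v0 by simp
    also have "\<dots> \<le> (l * v)\<^sup>2 * small_moment n v / 2 + l * v * (large_moment n v + l * v * small_moment n v)"
    proof (intro add_mono divide_right_mono mult_left_mono)
      have "1 * v \<le> l * v" using l v0 by (intro mult_right_mono) auto
      then show "small_moment n (l * v) \<le> small_moment n v" by (intro small_moment_antimono v0) simp
    qed (use large_moment_scale[OF v0 l(1)] l v0 in auto)
    also have "l * v * (large_moment n v + l * v * small_moment n v) = l * (v * large_moment n v) + (l * v)\<^sup>2 * small_moment n v"
      by (simp add: algebra_simps power2_eq_square)
    also have "\<dots> \<le> l * (4 * psi n v) + (l * v)\<^sup>2 * small_moment n v"
      using large_moment_le_psi[OF v0] l by (intro add_right_mono mult_left_mono) auto
    finally have "4 * l * psi n v \<le> 3 / 2 * (l * v)\<^sup>2 * small_moment n v" by (simp add: mult_ac)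
    then have "l * (4 * psi n v) \<le> l * (3 / 2 * l * v\<^sup>2 * small_moment n v)" by (simp add: power2_eq_square mult_ac)
    then have "4 * psi n v \<le> 3 / 2 * l * v\<^sup>2 * small_moment n v" using l by (subst (asm) mult_le_cancel_left_pos) auto
    moreover have "0 \<le> l * (v\<^sup>2 * small_moment n v)" using l small_moment_nonneg[of v] by simp
    ultimately have "psi n v \<le> l * (v\<^sup>2 * small_moment n v)" by simp
    then show "1 / l * psi n v \<le> v\<^sup>2 * small_moment n v" using l by (simp add: field_simps)
  qed (use l in auto)
qed

text \<open>On \<open>[y/2, y]\<close> the density is at least \<open>n(y) / C0\<close>, and the
  second moment over this interval is bounded by \<open>4 \<psi>(1/y) y\<^sup>2\<close>.\<close>

lemma density_le: assumes y: "0 < y" shows "y * n y \<le> 32 * C0 * psi n (1 / y)"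
proof -
  define v where "v = 1 / y"
  have v: "0 < v" "y = 1 / v" using y by (auto simp: v_def)
  have e: "emeasure lborel {1 / (2 * v)..1 / v} = ennreal (1 / (2 * v))"
    using v by (subst emeasure_lborel_Icc) (auto simp: field_simps)
  have m: "measure lborel {1 / (2 * v)..1 / v} = 1 / (2 * v)" using e v by (simp add: measure_def)
  have "n y / (8 * C0 * v ^ 3) = (\<integral>s. indicator {1 / (2 * v)..1 / v} s * (n y / C0 / (4 * v\<^sup>2)) \<partial>lborel)"
    using m by (simp add: power3_eq_cube power2_eq_square)
  also have "\<dots> \<le> small_moment n v"
    unfolding small_moment_def
  proof (rule integral_mono[OF _ integrable_small_moment[OF v(1)]])
    show "integrable lborel (\<lambda>s. indicator {1 / (2 * v)..1 / v} s * (n y / C0 / (4 * v\<^sup>2)))"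
      using e by (intro integrable_mult_left integrable_real_indicator) auto
    fix s
    show "indicator {1 / (2 * v)..1 / v} s * (n y / C0 / (4 * v\<^sup>2)) \<le> n s * (indicator {..1/v} s * s\<^sup>2)"
    proof (cases "s \<in> {1 / (2 * v)..1 / v}")
      case True
      have "0 < 1 / (2 * v)" using v by simp
      then have s0: "0 < s" using True by (meson atLeastAtMost_iff less_le_trans)
      have "n y \<le> C0 * n s" by (rule amono) (use True s0 v in auto)
      then have 1: "n y / C0 \<le> n s" using params by (simp add: field_simps)
      have "(1 / (2 * v))\<^sup>2 \<le> s\<^sup>2" using True v by (intro power_mono) auto
      then have "1 / (4 * v\<^sup>2) \<le> s\<^sup>2" by (simp add: power_divide power_mult_distrib)
      then have "(n y / C0) * (1 / (4 * v\<^sup>2)) \<le> n s * s\<^sup>2" using 1 n_nonneg by (intro mult_mono) auto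
      then show ?thesis using True by simp
    qed (simp add: n_nonneg)
  qed
  also have "\<dots> \<le> 4 * psi n v / v\<^sup>2" using small_moment_le_psi[OF v(1)] v by (simp add: field_simps)
  finally have "n y / (8 * C0 * v ^ 3) \<le> 4 * psi n v / v\<^sup>2" .
  then have "n y / (8 * C0 * v ^ 3) * (8 * C0 * v^2) \<le> 4 * psi n v / v\<^sup>2 * (8 * C0 * v^2)"
    using params by (intro mult_right_mono) auto
  then show ?thesis using v params by (simp add: power3_eq_cube power2_eq_square mult_ac)
qed

text \<open>With \<open>v = 1 / (l y)\<close>, the jumps below \<open>y\<close> contribute at most a
  factor of order \<open>l powr (\<beta> - 2)\<close> of \<open>\<psi>(v)\<close> to
  \<open>v\<^sup>2 * small_moment n v\<close>. For large \<open>l\<close> this is half of the lower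
  bound in \<open>small_moment_ge\<close>, and the other half must come from \<open>[y, l
  y]\<close>, where the density is at most \<open>C0 n(y)\<close>.\<close>

lemma density_ge: 
  obtains l k where "1 \<le> l" "0 < k" "\<And>y. 0 < y \<Longrightarrow> l * y * x0 < 1 \<Longrightarrow> k * psi n (1 / y) \<le> y * n y"
proof -
  obtain c1 where c1: "0 < c1" "c1 \<le> 1" "\<And>v. x0 < v \<Longrightarrow> c1 * psi n v \<le> v\<^sup>2 * small_moment n v" using small_moment_ge by metis
  define l where "l = (8 * C / c1) powr (1 / (2 - \<beta>))"
  have b1: "1 \<le> 8 * C / c1" using c1 params by (simp add: field_simps)
  have l1: "1 \<le> l" unfolding l_def using b1 params by (intro ge_one_powr_ge_zero) auto
  have lb: "4 * C * l powr \<beta> = c1 / 2 * l\<^sup>2"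
  proof -
    have "l powr (2 - \<beta>) = 8 * C / c1" unfolding l_def using b1 params c1(1) by (simp add: powr_powr)
    moreover have "l\<^sup>2 = l powr \<beta> * l powr (2 - \<beta>)" using l1 by (simp add: powr_add[symmetric] powr_numeral)
    ultimately show ?thesis using c1 by (simp add: field_simps)
  qed
  show ?thesis
  proof (rule that[OF l1, of "c1 / (2 * C0 * C * l\<^sup>2 * l)"])
    show "0 < c1 / (2 * C0 * C * l\<^sup>2 * l)" using c1 params l1 by simp
    fix y assume y: "0 < y" "l * y * x0 < 1"
    define v where "v = 1 / (l * y)"
    have ly: "0 < l * y" using y l1 by simp
    have v: "0 < v" "y = 1 / (l * v)" "l * v = 1 / y" using ly l1 y by (simp_all add: v_def)
    have "x0 * (l * y) < 1" using y(2) by (simp only: mult.commute)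
    then have v2: "x0 < v" unfolding v_def pos_less_divide_eq[OF ly] .
    have lv: "v \<le> l * v" using mult_right_mono[OF l1, of v] v(1) by simp
    have lvp: "0 < l * v" using v(1) l1 by simp
    then have vl: "1 / (l * v) \<le> 1 / v" using lv v(1) by (intro divide_left_mono mult_pos_pos) auto
    have "(l * v)\<^sup>2 * small_moment n (l * v) \<le> 4 * psi n (l * v)" by (rule small_moment_le_psi[OF lvp])
    also have "\<dots> \<le> 4 * (C * l powr \<beta> * psi n v)" using upper[OF l1 v2] by simp
    also have "\<dots> = (c1 / 2 * l\<^sup>2) * psi n v" using lb by (simp add: mult.assoc[symmetric])
    finally have "l\<^sup>2 * (v\<^sup>2 * small_moment n (l * v)) \<le> l\<^sup>2 * (c1 / 2 * psi n v)" by (simp add: power_mult_distrib mult_ac)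
    then have 1: "v\<^sup>2 * small_moment n (l * v) \<le> c1 / 2 * psi n v" using l1 by (subst (asm) mult_le_cancel_left_pos) auto
    have e: "emeasure lborel {1 / (l * v)..1 / v} = ennreal (1 / v - 1 / (l * v))"
      using vl by (rule emeasure_lborel_Icc)
    have m: "measure lborel {1 / (l * v)..1 / v} = 1 / v - 1 / (l * v)" using e vl by (simp add: measure_def)
    have "small_moment n v - small_moment n (l * v) = (\<integral>s. n s * (indicator {..1/v} s * s\<^sup>2) - n s * (indicator {..1/(l * v)} s * s\<^sup>2) \<partial>lborel)"
      unfolding small_moment_def
      by (subst Bochner_Integration.integral_diff[OF integrable_small_moment[OF v(1)] integrable_small_moment[OF lvp]]) (rule refl)
    also have "\<dots> \<le> (\<integral>s. indicator {1 / (l * v)..1 / v} s * (C0 * n y / v\<^sup>2) \<partial>lborel)"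
    proof (rule integral_mono)
      show "integrable lborel (\<lambda>s. n s * (indicator {..1/v} s * s\<^sup>2) - n s * (indicator {..1/(l * v)} s * s\<^sup>2))"
        by (rule Bochner_Integration.integrable_diff[OF integrable_small_moment[OF v(1)] integrable_small_moment[OF lvp]])
      show "integrable lborel (\<lambda>s. indicator {1 / (l * v)..1 / v} s * (C0 * n y / v\<^sup>2))"
        using e by (intro integrable_mult_left integrable_real_indicator) auto
      fix s
      consider "s \<le> 1 / (l * v)" | "1 / v < s" | "1 / (l * v) < s" "s \<le> 1 / v" by linarith
      then show "n s * (indicator {..1/v} s * s\<^sup>2) - n s * (indicator {..1/(l * v)} s * s\<^sup>2) \<le> indicator {1 / (l * v)..1 / v} s * (C0 * n y / v\<^sup>2)"
      proof cases
        case 3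
        have "0 < 1 / (l * v)" using lvp by simp
        then have s0: "0 < s" using 3 by linarith
        have "n s \<le> C0 * n y" by (rule amono[OF y(1)]) (use 3(1) v(2) in linarith)
        moreover have "s\<^sup>2 \<le> (1 / v)\<^sup>2" using 3 s0 by (intro power_mono) auto
        ultimately have "n s * s\<^sup>2 \<le> C0 * n y * (1 / v)\<^sup>2" using n_nonneg[of s] n_nonneg[of y] params by (intro mult_mono) auto
        then show ?thesis using 3 by (simp add: power_divide)
      qed (use vl n_nonneg[of y] params in \<open>auto simp: indicator_def\<close>)
    qed
    also have "\<dots> = (1 / v - 1 / (l * v)) * (C0 * n y / v\<^sup>2)" using m by simp
    also have "\<dots> \<le> (1 / v) * (C0 * n y / v\<^sup>2)" using lvp params n_nonneg[of y] by (intro mult_right_mono) auto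
    finally have "v\<^sup>2 * (small_moment n v - small_moment n (l * v)) \<le> v\<^sup>2 * ((1 / v) * (C0 * n y / v\<^sup>2))" by (intro mult_left_mono) auto
    also have "\<dots> = C0 * n y / v" using v(1) by simp
    finally have 2: "v\<^sup>2 * small_moment n v - v\<^sup>2 * small_moment n (l * v) \<le> C0 * n y / v" by (simp add: right_diff_distrib)
    have "c1 / 2 * psi n v \<le> C0 * n y / v" using 1 2 c1(3)[OF v2] by linarith
    also have "C0 * n y / v = C0 * l * (y * n y)" by (simp add: v_def)
    finally have 3: "c1 / 2 * psi n v \<le> C0 * l * (y * n y)" .
    have "psi n (1 / y) \<le> C * l\<^sup>2 * psi n v"
      using scale_quadratic[OF v2 lv] y(1) unfolding v(3) by (simp add: v_def)
    then have "c1 / (2 * C0 * C * l\<^sup>2 * l) * psi n (1 / y) \<le> c1 / (2 * C0 * C * l\<^sup>2 * l) * (C * l\<^sup>2 * psi n v)"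
      using c1 params l1 by (intro mult_left_mono) auto
    also have "\<dots> = (c1 / 2 * psi n v) / (C0 * l)" using params l1 by (simp add: field_simps)
    also have "\<dots> \<le> (C0 * l * (y * n y)) / (C0 * l)" using 3 params l1 by (intro divide_right_mono) auto
    also have "\<dots> = y * n y" using params l1 by simp
    finally show "c1 / (2 * C0 * C * l\<^sup>2 * l) * psi n (1 / y) \<le> y * n y" .
  qed
qed

text \<open>Two lower bounds for \<open>osc\<close> with one constant. The first is for lines
  \<open>Re z = w > x0\<close>; the second allows any abscissa, also a negative one, at heights
  \<open>\<bar>u\<bar>\<close> above a reference level \<open>r\<close>. Both hold for all densities
  that agree with \<open>n\<close> on the relevant small jumps.\<close>

definition osc_const :: "real \<Rightarrow> bool" where
  "osc_const \<kappa> \<longleftrightarrow> 0 < \<kappa> \<and> \<kappa> \<le> 1 \<and>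
    (\<forall>n1 w u. levy_density n1 \<longrightarrow> (\<forall>y\<le>1 / w. n1 y = n y) \<longrightarrow> x0 < w \<longrightarrow>
       \<kappa> * psi n w * min ((u / w)\<^sup>2) (\<bar>u\<bar> / w) \<le> osc n1 w u) \<and>
    (\<forall>n1 w u r. levy_density n1 \<longrightarrow> expo_dom n1 w \<longrightarrow> (\<forall>y\<le>1 / \<bar>u\<bar>. n1 y = n y) \<longrightarrow> w \<le> \<bar>u\<bar> \<longrightarrow> x0 < r \<longrightarrow> r \<le> \<bar>u\<bar> \<longrightarrow>
       \<kappa> * psi n r * (\<bar>u\<bar> / r) \<le> osc n1 w u)"

lemma osc_const_exists: "\<exists>\<kappa>. osc_const \<kappa>"
proof -
  obtain c1 where c1: "0 < c1" "c1 \<le> 1" "\<And>v. x0 < v \<Longrightarrow> c1 * psi n v \<le> v\<^sup>2 * small_moment n v" using small_moment_ge by metis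
  have k: "c1 * c / 12 \<le> 1" using mult_mono[OF c1(2) params(2)] c1 params by simp
  have far: "c1 * c / 12 * psi n r * (\<bar>u\<bar> / r) \<le> osc n1 w u"
    if n1: "levy_density n1" "expo_dom n1 w" "\<And>y. y \<le> 1 / \<bar>u\<bar> \<Longrightarrow> n1 y = n y" "w \<le> \<bar>u\<bar>" "x0 < r" "r \<le> \<bar>u\<bar>" for n1 w u r
  proof -
    have u: "0 < \<bar>u\<bar>" "x0 < \<bar>u\<bar>" using that params by auto
    have "c1 * c / 12 * psi n r * (\<bar>u\<bar> / r) = c1 / 12 * (c * (\<bar>u\<bar> / r) * psi n r)" by simp
    also have "\<dots> \<le> c1 / 12 * psi n \<bar>u\<bar>" using scale_linear[OF n1(5,6)] c1 by (intro mult_left_mono) auto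
    also have "\<dots> \<le> \<bar>u\<bar>\<^sup>2 * small_moment n \<bar>u\<bar> / 12" using c1(3)[OF u(2)] by simp
    also have "\<dots> \<le> osc n1 w u"
      using osc_ge[OF levy_density_axioms n1(1,2,3) u(1) _ n1(4)] by simp
    finally show ?thesis .
  qed
  have near: "c1 * c / 12 * psi n w * min ((u / w)\<^sup>2) (\<bar>u\<bar> / w) \<le> osc n1 w u"
    if n1: "levy_density n1" "\<And>y. y \<le> 1 / w \<Longrightarrow> n1 y = n y" "x0 < w" for n1 w u
  proof -
    have w: "0 < w" using n1 params by simp
    have dom: "expo_dom n1 w" using w by (simp add: expo_dom_def)
    show "c1 * c / 12 * psi n w * min ((u / w)\<^sup>2) (\<bar>u\<bar> / w) \<le> osc n1 w u"
    proof (cases "\<bar>u\<bar> \<le> w")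
      case True
      have "c1 * c / 12 * psi n w * min ((u / w)\<^sup>2) (\<bar>u\<bar> / w) \<le> c1 * 1 / 12 * psi n w * (u / w)\<^sup>2"
        using c1 params psi_nonneg[of w] w by (intro mult_mono divide_right_mono) auto
      also have "\<dots> = (u / w)\<^sup>2 / 12 * (c1 * psi n w)" by simp
      also have "\<dots> \<le> (u / w)\<^sup>2 / 12 * (w\<^sup>2 * small_moment n w)" using c1(3)[OF n1(3)] by (intro mult_left_mono) auto
      also have "\<dots> = u\<^sup>2 * small_moment n w / 12" using w by (simp add: power_divide)
      also have "\<dots> \<le> osc n1 w u" by (rule osc_ge[OF levy_density_axioms n1(1) dom n1(2) w True]) auto
      finally show ?thesis .
    next
      case False
      have le: "1 / \<bar>u\<bar> \<le> 1 / w" using False w by (intro divide_left_mono) auto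
      have "c1 * c / 12 * psi n w * min ((u / w)\<^sup>2) (\<bar>u\<bar> / w) \<le> c1 * c / 12 * psi n w * (\<bar>u\<bar> / w)"
        using c1 params psi_nonneg[of w] by (intro mult_left_mono) auto
      also have "\<dots> \<le> osc n1 w u"
        by (rule far[OF n1(1) dom]) (use n1 False le in auto)
      finally show ?thesis .
    qed
  qed
  show ?thesis
  proof (intro exI[of _ "c1 * c / 12"], unfold osc_const_def, intro conjI allI impI)
    fix n1 w u r
    assume "levy_density n1" "expo_dom n1 w" "\<forall>y\<le>1 / \<bar>u\<bar>. n1 y = n y" "w \<le> \<bar>u\<bar>" "x0 < r" "r \<le> \<bar>u\<bar>"
    then show "c1 * c / 12 * psi n r * (\<bar>u\<bar> / r) \<le> osc n1 w u" by (intro far) auto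
  next
    fix n1 w u
    assume "levy_density n1" "\<forall>y\<le>1 / w. n1 y = n y" "x0 < w"
    then show "c1 * c / 12 * psi n w * min ((u / w)\<^sup>2) (\<bar>u\<bar> / w) \<le> osc n1 w u" by (intro near) auto
  qed (use k c1 params in auto)
qed

definition "kappa = (SOME \<kappa>. osc_const \<kappa>)"

lemma kappa: "osc_const kappa"
  unfolding kappa_def by (rule someI_ex[OF osc_const_exists])

lemma kappa_pos: "0 < kappa" "kappa \<le> 1"
  using kappa by (auto simp: osc_const_def)

lemma kappa_near: "levy_density n1 \<Longrightarrow> (\<And>y. y \<le> 1 / w \<Longrightarrow> n1 y = n y) \<Longrightarrow> x0 < w \<Longrightarrow>
       kappa * psi n w * min ((u / w)\<^sup>2) (\<bar>u\<bar> / w) \<le> osc n1 w u"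
  using kappa unfolding osc_const_def by blast

lemma kappa_far: "levy_density n1 \<Longrightarrow> expo_dom n1 w \<Longrightarrow> (\<And>y. y \<le> 1 / \<bar>u\<bar> \<Longrightarrow> n1 y = n y) \<Longrightarrow> w \<le> \<bar>u\<bar> \<Longrightarrow> x0 < r \<Longrightarrow> r \<le> \<bar>u\<bar> \<Longrightarrow>
       kappa * psi n r * (\<bar>u\<bar> / r) \<le> osc n1 w u"
  using kappa unfolding osc_const_def by blast

lemma osc_grows:
  assumes n1: "levy_density n1" "0 < d" "\<And>y. y \<le> d \<Longrightarrow> n1 y = n y" and dom: "\<And>w. w1 \<le> w \<Longrightarrow> w \<le> w2 \<Longrightarrow> expo_dom n1 w"
  shows "osc_grows n1 w1 w2"
proof -
  interpret N1: levy_density n1 by fact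
  define r where "r = x0 + 1"
  have r: "x0 < r" "0 < r" using params by (auto simp: r_def)
  define U where "U = max r (max (1 / d) w2)"
  let ?k = "kappa * psi n r / r"
  show ?thesis
  proof (rule osc_growsI[where k="?k" and U=U])
    show "0 < ?k" using kappa_pos psi_pos r by simp
    fix w u assume w: "w1 \<le> w" "w \<le> w2"
    show "?k * (\<bar>u\<bar> - U) \<le> osc n1 w u"
    proof (cases "U \<le> \<bar>u\<bar>")
      case True
      then have u: "r \<le> \<bar>u\<bar>" "1 / d \<le> \<bar>u\<bar>" "w2 \<le> \<bar>u\<bar>" by (auto simp: U_def)
      have "0 < \<bar>u\<bar>" using u r by linarith
      then have "1 / \<bar>u\<bar> \<le> d" using u(2) n1(2) by (simp add: field_simps)
      then have eq: "n1 y = n y" if "y \<le> 1 / \<bar>u\<bar>" for y using n1(3)[of y] that by linarith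
      have "0 \<le> U" using r by (simp add: U_def)
      have "?k * (\<bar>u\<bar> - U) \<le> ?k * \<bar>u\<bar>" using kappa_pos psi_nonneg[of r] r \<open>0 \<le> U\<close> by (intro mult_left_mono) auto
      also have "\<dots> = kappa * psi n r * (\<bar>u\<bar> / r)" by simp
      also have "\<dots> \<le> osc n1 w u"
        by (rule kappa_far[OF n1(1) dom[OF w] eq _ r(1) u(1)]) (use u w in auto)
      finally show ?thesis .
    next
      case False
      then have "?k * (\<bar>u\<bar> - U) \<le> 0" using kappa_pos psi_nonneg[of r] r by (intro mult_nonneg_nonpos) auto
      then show ?thesis using N1.osc_nonneg[of w u] by linarith
    qed
  qed
qed

lemma big_jumps: "0 < d \<Longrightarrow> 0 < t \<Longrightarrow> big_jumps n d t"
proof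
  assume d: "0 < d" and t: "0 < t"
  show "osc_grows (trunc n d) w1 w2" for w1 w2
    by (rule osc_grows[OF levy_density_trunc d]) (auto simp: trunc_def expo_dom_trunc)
  show "osc_grows n 1 1"
    by (rule osc_grows[OF levy_density_axioms d]) (auto simp: expo_dom_def)
qed

text \<open>Any other positive abscissa gives the same function, by
  \<open>inv_laplace_p\<close>.\<close>

definition p :: "real \<Rightarrow> real \<Rightarrow> real" where "p t x = Re (inv_laplace n 0 t 1 x)"

lemma inv_laplace_p: assumes "0 < w" "0 < t" shows "inv_laplace n 0 t w x = of_real (p t x)"
proof -
  interpret B: big_jumps n 1 t using big_jumps[of 1 t] assms by simp
  have g: "osc_grows n w1 w2" if "0 < w1" for w1 w2
    by (rule osc_grows[OF levy_density_axioms zero_less_one]) (use that in \<open>auto simp: expo_dom_def\<close>)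
  have dom: "expo_dom n w" "expo_dom n 1" using assms by (auto simp: expo_dom_def)
  have "inv_laplace n 0 t w x = inv_laplace n 0 t 1 x"
  proof (cases "w \<le> 1")
    case True then show ?thesis by (rule inv_laplace_shift[OF dom assms(2) _ g[OF assms(1)]])
  next
    case False
    then have "1 \<le> w" by simp
    from inv_laplace_shift[OF dom(2,1) assms(2) this g[OF zero_less_one]] show ?thesis by (rule sym)
  qed
  also have "inv_laplace n 0 t 1 x = of_real (B.P x)" by (rule B.inv_laplace_real)
  also have "B.P x = p t x" unfolding B.P_def p_def ..
  finally show ?thesis .
qed

lemma p_nonneg: "0 < t \<Longrightarrow> 0 \<le> p t x"
  using big_jumps.P_nonneg[OF big_jumps[of 1 t], of x] by (simp add: p_def big_jumps.P_def[OF big_jumps[of 1 t]])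

section \<open>Bounds near and left of the origin\<close>

lemma x0_pos: "x0 < v \<Longrightarrow> 0 < v" using params by linarith

lemma saddle:
  assumes w: "x0 < w" and t: "0 < t" and a: "1 \<le> t * psi n w"
  shows "saddle n t w (t * psi n w) kappa"
proof unfold_locales
  show "0 < w" by (rule x0_pos[OF w])
  fix u
  have "t * (kappa * psi n w * min ((u / w)\<^sup>2) (\<bar>u\<bar> / w)) \<le> t * osc n w u"
    using kappa_near[OF levy_density_axioms _ w] t by (intro mult_left_mono) auto
  then show "kappa * (t * psi n w) * min ((u / w)\<^sup>2) (\<bar>u\<bar> / w) \<le> t * osc n w u" by (simp add: mult_ac)
qed (use t a kappa_pos in auto)

lemma p_upper_saddle:
  assumes w: "x0 < w" and t: "0 < t" and a: "1 \<le> t * psi n w"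
  shows "p t x \<le> exp (w * x + t * psi n w) * w / (kappa * sqrt (t * psi n w))"
proof -
  have w0: "0 < w" using x0_pos[OF w] .
  interpret S: saddle n 0 t w "t * psi n w" kappa
    by (rule saddle[OF w t a])
  have "p t x \<le> norm (inv_laplace n 0 t w x)"
    unfolding inv_laplace_p[OF w0 t] by simp
  also have "\<dots> \<le> exp (w * x) * S.peak * w / (kappa * sqrt (t * psi n w))" by (rule S.norm_inv_laplace_le)
  also have "exp (w * x) * S.peak = exp (w * x + t * psi n w)" by (simp add: S.peak_def exp_add)
  finally show ?thesis .
qed

lemma p_lower_saddle:
  assumes w: "x0 < w" and t: "0 < t" and a: "(64 / kappa) ^ 6 \<le> t * psi n w"
  shows "exp (- t * (w * psi1 n w - psi n w)) * w / (128 * sqrt (t * psi n w)) \<le> p t (- (t * psi1 n w))"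
proof -
  have w0: "0 < w" using x0_pos[OF w] .
  have "1 \<le> 64 / kappa" using kappa_pos by (simp add: field_simps)
  then have "1 \<le> (64 / kappa) ^ 6" by (rule one_le_power)
  then have a1: "1 \<le> t * psi n w" using a by linarith
  interpret S: saddle n 0 t w "t * psi n w" kappa
    by (rule saddle[OF w t a1])
  have "exp (w * (- (t * psi1 n w))) * S.peak * w / (128 * sqrt (t * psi n w)) \<le> Re (inv_laplace n 0 t w (- (t * psi1 n w)))"
    by (rule S.Re_inv_laplace_ge[OF a]) (use w0 in simp)
  also have "\<dots> = p t (- (t * psi1 n w))" unfolding inv_laplace_p[OF w0 t] by simp
  also have "exp (w * (- (t * psi1 n w))) * S.peak = exp (- t * (w * psi1 n w - psi n w))"
    unfolding S.peak_def exp_add[symmetric] by (rule arg_cong[where f=exp]) (simp add: algebra_simps)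
  finally show ?thesis .
qed

lemma p_upper_mid:
  assumes r: "x0 < r" and t: "0 < t" and tr: "t * psi n r = 1" and x: "x \<le> 1 / r"
  shows "p t x \<le> (exp 2 / kappa) * r"
proof -
  have r0: "0 < r" using x0_pos[OF r] .
  have "p t x \<le> exp (r * x + 1) * r / kappa" using p_upper_saddle[OF r t, of x] tr by simp
  also have "r * x \<le> 1" using x r0 by (simp add: field_simps)
  then have "exp (r * x + 1) * r / kappa \<le> exp 2 * r / kappa"
    using r0 kappa_pos by (intro divide_right_mono mult_right_mono) auto
  finally show ?thesis by simp
qed

section \<open>One big jump\<close>

text \<open>The big jumps are those beyond \<open>d = 1/r\<close>; their mean number up to time
  \<open>t\<close> is at most \<open>4\<close>. The small-jump density \<open>f0\<close> is at least
  of order \<open>r\<close> on an interval of length of order \<open>1/r\<close> around a point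
  \<open>z0\<close> between \<open>-K3/r\<close> and \<open>-(K+2)/r\<close>, by the saddle point
  estimate at \<open>w = A r\<close>. One jump of size close to \<open>x - z0\<close>, which lies
  between \<open>d\<close> and \<open>x + \<Theta>/r\<close>, then leads to
  \<open>x\<close>.\<close>

lemma one_jump_lower:
  assumes K: "0 \<le> K"
  shows "\<exists>\<Theta>\<ge>K + 1. \<exists>k>0. \<forall>t r x. 0 < t \<longrightarrow> x0 < r \<longrightarrow> t * psi n r = 1 \<longrightarrow> - K / r \<le> x \<longrightarrow> k * t * n (x + \<Theta> / r) \<le> p t x"
proof -
  obtain c1 where c1: "0 < c1" "c1 \<le> 1" "\<And>v. x0 < v \<Longrightarrow> c1 * psi n v \<le> v\<^sup>2 * small_moment n v" using small_moment_ge by metis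
  define M where "M = (64 / kappa) ^ 6"
  have "1 \<le> 64 / kappa" using kappa_pos by (simp add: field_simps)
  then have M1: "1 \<le> M" unfolding M_def by (rule one_le_power)
  (* The first bound makes the saddle point estimate applicable at w = A r; the second, where
     alpha > 1 is essential, pushes z0 to the left of - (K + 2) / r. *)
  obtain A where A: "max 1 (M / c) \<le> A" "4 * (K + 2) / (c1 * c) \<le> A powr (\<alpha> - 1)"
    using exists_big_power[of "max 1 (M / c)" "4 * (K + 2) / (c1 * c)"] by auto
  have A1: "1 \<le> A" and AM: "M \<le> c * A" using A params by (auto simp: field_simps)
  define K3 where "K3 = 4 + 4 * C * A"
  define \<Theta> where "\<Theta> = K3 + K + 1"
  define k0 where "k0 = exp (- (A * K3 + 1)) * A / (128 * sqrt (C * A\<^sup>2))"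
  have k0: "0 < k0" using A1 params by (simp add: k0_def)
  have K3: "0 \<le> K3" using A1 params by (simp add: K3_def)
  show ?thesis
  proof (rule exI[of _ \<Theta>], intro exI[of _ "exp (-4) * k0 / (A * C0)"] conjI allI impI)
    show "K + 1 \<le> \<Theta>" using K3 by (simp add: \<Theta>_def)
    show "0 < exp (-4) * k0 / (A * C0)" using k0 A1 params by simp
    fix t r x
    assume t: "0 < t" and r: "x0 < r" and tr: "t * psi n r = 1" and x: "- K / r \<le> x"
    have r0: "0 < r" using x0_pos[OF r] .
    define d where "d = 1 / r"
    have d: "0 < d" "1 / d = r" using r0 by (auto simp: d_def)
    define w where "w = A * r"
    have rw: "r \<le> w" using mult_right_mono[OF A1, of r] r0 by (simp add: w_def)
    have w: "r \<le> w" "0 < w" "x0 < w" "w / r = A" "1 / w \<le> d"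
    proof -
      show w2: "0 < w" and "x0 < w" using rw r r0 by linarith+
      show "w / r = A" using r0 by (simp add: w_def)
      show "1 / w \<le> d" unfolding d_def using rw r0 w2 by (intro divide_left_mono) auto
    qed (rule rw)
    define a where "a = t * psi n w"
    have aM: "M \<le> a"
    proof -
      have "t * (c * A * psi n r) \<le> t * psi n w"
        using scale_linear[OF r w(1)] t unfolding w(4) by (intro mult_left_mono) auto
      then have "c * A * (t * psi n r) \<le> a" by (simp add: a_def mult_ac)
      then show ?thesis using AM tr by simp
    qed
    have aU: "a \<le> C * A\<^sup>2"
    proof -
      have "t * psi n w \<le> t * (C * A\<^sup>2 * psi n r)"
        using scale_quadratic[OF r w(1)] t unfolding w(4) by (intro mult_left_mono) auto
      also have "\<dots> = C * A\<^sup>2 * (t * psi n r)" by simp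
      finally show ?thesis using tr by (simp add: a_def)
    qed
    have aA: "c * A powr \<alpha> \<le> a"
    proof -
      have "t * (c * A powr \<alpha> * psi n r) \<le> t * psi n w"
        using scale_lower[OF r w(1)] t unfolding w(4) by (intro mult_left_mono) auto
      then have "c * A powr \<alpha> * (t * psi n r) \<le> a" by (simp add: a_def mult_ac)
      then show ?thesis using tr by simp
    qed
    have a1: "1 \<le> a" using aM M1 by linarith
    let ?n1 = "trunc n d"
    let ?m = "large_moment n (1 / d)"
    interpret B: big_jumps n d t by (rule big_jumps[OF d(1) t])
    have n1_le: "?n1 y \<le> n y" for y using n_nonneg[of y] by (auto simp: trunc_def indicator_def)
    note le = levy_density_le[OF levy_density_trunc n1_le w(2)]
    interpret S: saddle ?n1 ?m t w a kappa
    proof unfold_locales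
      show "t * psi ?n1 w \<le> a" unfolding a_def using le(1) t by (intro mult_left_mono) auto
      fix u
      have "t * (kappa * psi n w * min ((u / w)\<^sup>2) (\<bar>u\<bar> / w)) \<le> t * osc ?n1 w u"
        using kappa_near[OF levy_density_trunc[of d] _ w(3), of u] w(5) t by (intro mult_left_mono) (auto simp: trunc_def)
      then show "kappa * a * min ((u / w)\<^sup>2) (\<bar>u\<bar> / w) \<le> t * osc ?n1 w u" by (simp add: mult_ac a_def)
    qed (use w a1 t kappa_pos in auto)
    have m0: "0 \<le> ?m" by (rule large_moment_nonneg)
    have tm: "t * ?m \<le> 4 / r"
    proof -
      have "t * (r * large_moment n r) \<le> t * (4 * psi n r)" using large_moment_le_psi[OF r0] t by (intro mult_left_mono) auto
      then have "r * (t * large_moment n r) \<le> 4 * (t * psi n r)" by (simp add: mult_ac)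
      then show ?thesis unfolding d(2) using r0 tr by (simp add: field_simps)
    qed
    have tp_up: "t * psi1 ?n1 w \<le> 4 * C * A / r"
    proof -
      have "w * (t * psi1 ?n1 w) \<le> t * (w * psi1 n w)" using le(2) w t by (simp add: mult_left_mono)
      also have "\<dots> \<le> t * (4 * psi n w)" using psi1_le_psi[OF w(2)] t by (intro mult_left_mono) auto
      also have "\<dots> \<le> 4 * (C * A\<^sup>2)" using aU by (simp add: a_def)
      finally have "A * (r * (t * psi1 ?n1 w)) \<le> A * (4 * C * A)" by (simp add: w_def power2_eq_square mult_ac)
      then have "r * (t * psi1 ?n1 w) \<le> 4 * C * A" using A1 by (subst (asm) mult_le_cancel_left_pos) auto
      then show ?thesis using r0 by (simp add: field_simps)
    qed
    have tp_lo: "(K + 2) / r \<le> t * psi1 ?n1 w"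
    proof -
      have sm: "small_moment ?n1 w = small_moment n w"
        unfolding small_moment_def trunc_def using w(5) by (intro Bochner_Integration.integral_cong) (auto simp: indicator_def)
      have "c1 * psi n w \<le> w\<^sup>2 * small_moment ?n1 w" using c1(3)[OF w(3)] by (simp add: sm)
      also have "\<dots> \<le> 4 * psi ?n1 w" by (rule B.T.small_moment_le_psi[OF w(2)])
      also have "\<dots> \<le> 4 * (w * psi1 ?n1 w)" using B.T.psi_le_psi1[OF w(2)] by simp
      finally have "t * (c1 * psi n w) \<le> t * (4 * (w * psi1 ?n1 w))" using t by (intro mult_left_mono) auto
      then have "c1 * a \<le> 4 * A * (r * (t * psi1 ?n1 w))" by (simp add: a_def w_def mult_ac)
      moreover have "c1 * (c * A powr \<alpha>) \<le> c1 * a" using aA c1 by (intro mult_left_mono) auto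
      moreover have "A powr \<alpha> = A powr (\<alpha> - 1) * A" using A1 powr_add[of A "\<alpha> - 1" 1] by simp
      moreover have "4 * (K + 2) \<le> c1 * c * A powr (\<alpha> - 1)" using A(2) c1 params by (simp add: field_simps)
      then have "4 * (K + 2) * A \<le> c1 * c * A powr (\<alpha> - 1) * A" using A1 by (intro mult_right_mono) auto
      ultimately have "(4 * A) * (K + 2) \<le> (4 * A) * (r * (t * psi1 ?n1 w))" by (simp add: mult_ac)
      then have "K + 2 \<le> r * (t * psi1 ?n1 w)" using A1 by (subst (asm) mult_le_cancel_left_pos) auto
      then show ?thesis using r0 by (simp add: field_simps)
    qed
    (* The point whose saddle point is w. *)
    define z0 where "z0 = - (t * (?m + psi1 ?n1 w))"
    have z0: "- (K3 / r) \<le> z0" "z0 \<le> - ((K + 2) / r)"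
    proof -
      have "t * ?m + t * psi1 ?n1 w \<le> 4 / r + 4 * C * A / r" using tm tp_up by linarith
      also have "\<dots> = K3 / r" by (simp add: K3_def add_divide_distrib)
      finally show "- (K3 / r) \<le> z0" by (simp add: z0_def distrib_left)
      show "z0 \<le> - ((K + 2) / r)" using tp_lo mult_nonneg_nonneg[OF less_imp_le[OF t] m0] unfolding z0_def distrib_left by linarith
    qed
    define h where "h = 1 / (2 * w)"
    have h: "0 < h" "h < 1 / r" 
    proof -
      show "0 < h" using w by (simp add: h_def)
      have "h < 1 / w" using w(2) by (simp add: h_def field_simps)
      then show "h < 1 / r" using w(5) by (simp add: d_def)
    qed
    have f0: "k0 * r \<le> B.f0 z" if z: "\<bar>z - z0\<bar> \<le> h" for z
    proof -
      have zz: "\<bar>z + t * (?m + psi1 ?n1 w)\<bar> \<le> 1 / (2 * w)" using z by (simp add: z0_def h_def)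
      have "exp (w * z) * S.peak * w / (128 * sqrt a) \<le> Re (inv_laplace ?n1 ?m t w z)"
        by (rule S.Re_inv_laplace_ge[OF _ zz]) (use aM in \<open>simp add: M_def\<close>)
      also have "\<dots> = B.f0 z" unfolding B.inv_laplace_f0 by simp
      finally have 1: "exp (w * z) * S.peak * w / (128 * sqrt a) \<le> B.f0 z" .
      have peak: "1 \<le> S.peak" unfolding S.peak_def using t m0 w B.T.psi_nonneg[of w] by simp
      have "- (K3 / r) - h \<le> z" using z z0(1) by linarith
      then have "w * (- (K3 / r) - h) \<le> w * z" using w by (intro mult_left_mono) auto
      moreover have "w * (- (K3 / r) - h) = - (A * K3 + 1 / 2)" using w r0 by (simp add: h_def w_def field_simps)
      ultimately have "- (A * K3 + 1) \<le> w * z" by linarith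
      then have ez: "exp (- (A * K3 + 1)) \<le> exp (w * z)" by simp
      have "k0 * r = exp (- (A * K3 + 1)) * 1 * w / (128 * sqrt (C * A\<^sup>2))" by (simp add: k0_def w_def)
      also have "\<dots> \<le> exp (w * z) * S.peak * w / (128 * sqrt a)"
        using ez peak w aU a1 by (intro frac_le mult_mono mult_right_mono) auto
      finally show ?thesis using 1 by linarith
    qed
    let ?I = "{x - z0 - h..x - z0 + h}"
    have e: "emeasure lborel ?I = ennreal (2 * h)" using h by (subst emeasure_lborel_Icc) auto
    have ms: "measure lborel ?I = 2 * h" using e h by (simp add: measure_def)
    have Kx: "- (K / r) \<le> x" using x by simp
    have "n (x + \<Theta> / r) / C0 * (k0 * r) * (2 * h) = (\<integral>y. indicator ?I y * (n (x + \<Theta> / r) / C0 * (k0 * r)) \<partial>lborel)"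
      using ms by simp
    also have "\<dots> \<le> (\<integral>y. tail n d y * B.f0 (x - y) \<partial>lborel)"
    proof (rule integral_mono[OF _ B.integrable_tail_f0])
      show "integrable lborel (\<lambda>y. indicator ?I y * (n (x + \<Theta> / r) / C0 * (k0 * r)))"
        using e by (intro integrable_mult_left integrable_real_indicator) auto
      fix y
      show "indicator ?I y * (n (x + \<Theta> / r) / C0 * (k0 * r)) \<le> tail n d y * B.f0 (x - y)"
      proof (cases "y \<in> ?I")
        case True
        have "(K + 2) / r = K / r + 1 / r + 1 / r" by (simp add: add_divide_distrib)
        moreover have "x - z0 - h \<le> y" using True by simp
        ultimately have yd: "d < y" using z0(2) h(2) Kx unfolding d_def by linarith
        have "\<Theta> / r = K3 / r + K / r + 1 / r" by (simp add: \<Theta>_def add_divide_distrib)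
        moreover have "0 \<le> K / r" using K r0 by simp
        ultimately have yu: "y \<le> x + \<Theta> / r" using True z0(1) h by auto
        have "n (x + \<Theta> / r) \<le> C0 * n y" using amono[OF _ yu] yd d by auto
        then have 1: "n (x + \<Theta> / r) / C0 \<le> tail n d y" using params yd by (simp add: tail_def field_simps)
        have "\<bar>(x - y) - z0\<bar> \<le> h" using True by auto
        then have 2: "k0 * r \<le> B.f0 (x - y)" by (rule f0)
        have "n (x + \<Theta> / r) / C0 * (k0 * r) \<le> tail n d y * B.f0 (x - y)"
          by (rule mult_mono[OF 1 2 tail_nonneg]) (use k0 r0 in simp)
        then show ?thesis using True by simp
      next
        case False
        then have "indicator ?I y = (0::real)" by (simp add: indicator_def)
        then show ?thesis using mult_nonneg_nonneg[OF tail_nonneg[of d y] B.f0_nonneg[of "x - y"]] by (simp only: mult_zero_left)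
      qed
    qed
    finally have I: "n (x + \<Theta> / r) / C0 * (k0 * r) * (2 * h) \<le> (\<integral>y. tail n d y * B.f0 (x - y) \<partial>lborel)" .
    have rh: "r * (2 * h) = 1 / A" using r0 A1 by (simp add: h_def w_def)
    have "t * tail_mass n d \<le> t * (4 * psi n r)" using tail_mass_le[OF d(1)] d t by (intro mult_left_mono) auto
    also have "\<dots> = 4" using tr by (simp add: mult.left_commute)
    finally have e4: "exp (-4) \<le> exp (- (t * tail_mass n d))" by simp
    have "t * (n (x + \<Theta> / r) / C0 * (k0 * r) * (2 * h)) \<le> t * (\<integral>y. tail n d y * B.f0 (x - y) \<partial>lborel)"
      using I t by (intro mult_left_mono) auto
    from mult_mono[OF e4 this] have "exp (-4) * (t * (n (x + \<Theta> / r) / C0 * (k0 * r) * (2 * h))) \<le> 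
       exp (- (t * tail_mass n d)) * (t * (\<integral>y. tail n d y * B.f0 (x - y) \<partial>lborel))"
      using t n_nonneg[of "x + \<Theta> / r"] params k0 r0 h by simp
    also have "\<dots> \<le> B.P x" by (rule B.one_big_jump_lower)
    also have "B.P x = p t x" unfolding B.P_def p_def ..
    also have "exp (-4) * (t * (n (x + \<Theta> / r) / C0 * (k0 * r) * (2 * h))) = exp (-4) * k0 / C0 * t * n (x + \<Theta> / r) * (r * (2 * h))" by simp
    also have "\<dots> = exp (-4) * k0 / (A * C0) * t * n (x + \<Theta> / r)" unfolding rh by simp
    finally show "exp (-4) * k0 / (A * C0) * t * n (x + \<Theta> / r) \<le> p t x" .
  qed
qed

text \<open>Since \<open>x + \<Theta>/r\<close> is at most a multiple of \<open>y\<close>, the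
  density of the big jump there is at least of order \<open>n(y)\<close>, hence of order
  \<open>\<psi>(1/y) / y\<close>. For \<open>x \<le> 1/r\<close> one has \<open>y = 1/r\<close> and
  the bound is of order \<open>r\<close>, so that the lemma also covers the middle region.\<close>

lemma p_lower_right:
  assumes K: "0 \<le> K"
  shows "\<exists>\<Theta>\<ge>1. \<exists>k>0. \<forall>t r x y. 0 < t \<longrightarrow> 0 < r \<longrightarrow> t * psi n r = 1 \<longrightarrow> - K / r \<le> x \<longrightarrow> y = max x (1 / r) \<longrightarrow> \<Theta> * y * x0 < 1
      \<longrightarrow> k * (t * psi n (1 / y) / y) \<le> p t x"
proof -
  obtain \<Theta> k where Th: "K + 1 \<le> \<Theta>" "0 < k" 
    and low: "\<And>t r x. 0 < t \<Longrightarrow> x0 < r \<Longrightarrow> t * psi n r = 1 \<Longrightarrow> - K / r \<le> x \<Longrightarrow> k * t * n (x + \<Theta> / r) \<le> p t x"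
    using one_jump_lower[OF K] by blast
  obtain l k5 where l: "1 \<le> l" "0 < k5" "\<And>y. 0 < y \<Longrightarrow> l * y * x0 < 1 \<Longrightarrow> k5 * psi n (1 / y) \<le> y * n y"
    using density_ge by metis
  define D where "D = 1 + \<Theta>"
  have D: "1 \<le> D" "0 < \<Theta>" using Th K by (auto simp: D_def)
  have lD: "1 \<le> l * D" using mult_mono[OF l(1) D(1)] l D by simp
  show ?thesis
  proof (rule exI[of _ "l * D"], intro exI[of _ "k * k5 / (C0 * (C * D\<^sup>2) * D)"] conjI allI impI lD)
    show "0 < k * k5 / (C0 * (C * D\<^sup>2) * D)" using Th l params D by simp
    fix t r x y
    assume t: "0 < t" and r: "0 < r" and tr: "t * psi n r = 1" and x: "- K / r \<le> x" 
      and y: "y = max x (1 / r)" and small: "l * D * y * x0 < 1"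
    have y0: "0 < y" "1 / r \<le> y" "x \<le> y" using r by (auto simp: y less_max_iff_disj)
    have yx: "l * (D * y) * x0 < 1" using small by (simp add: mult_ac)
    have "1 * (y * x0) \<le> (l * D) * (y * x0)" using lD y0 params by (intro mult_right_mono) auto
    then have "y * x0 < 1" using small by (simp add: mult_ac)
    moreover have "1 / r * x0 \<le> y * x0" using y0 params by (intro mult_right_mono) auto
    ultimately have "x0 / r < 1" by simp
    then have rx: "x0 < r" using r by (simp add: field_simps)
    have pos: "0 < x + \<Theta> / r"
    proof -
      have "(K + 1) / r \<le> \<Theta> / r" using Th r by (intro divide_right_mono) auto
      moreover have "(K + 1) / r = K / r + 1 / r" by (simp add: add_divide_distrib)
      moreover have "0 < 1 / r" using r by simp
      moreover have "- (K / r) \<le> x" using x by simp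
      ultimately show ?thesis by linarith
    qed
    have "\<Theta> * (1 / r) \<le> \<Theta> * y" using y0 D by (intro mult_left_mono) auto
    then have "x + \<Theta> / r \<le> D * y" using y0 by (simp add: D_def algebra_simps)
    from amono[OF pos this] have n1: "n (D * y) / C0 \<le> n (x + \<Theta> / r)" using params by (simp add: field_simps)
    have Dy: "0 < D * y" using D y0 by simp
    have n2: "k5 * psi n (1 / (D * y)) \<le> (D * y) * n (D * y)" by (rule l(3)[OF Dy yx])
    have "1 * (D * y * x0) \<le> l * (D * y * x0)" using l Dy params by (intro mult_right_mono) auto
    then have "x0 * (D * y) < 1" using yx by (simp add: mult_ac)
    then have "x0 < 1 / (D * y)" using Dy by (simp add: pos_less_divide_eq)
    moreover have "1 / (D * y) \<le> 1 / y" using D y0 mult_right_mono[OF D(1), of y] by (intro divide_left_mono) auto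
    ultimately have "psi n (1 / y) \<le> C * ((1 / y) / (1 / (D * y)))\<^sup>2 * psi n (1 / (D * y))" by (rule scale_quadratic)
    also have "(1 / y) / (1 / (D * y)) = D" using y0 by simp
    finally have n3: "psi n (1 / y) \<le> C * D\<^sup>2 * psi n (1 / (D * y))" .
    have CD: "0 < C * D\<^sup>2" using params D by simp
    have "k * k5 / (C0 * (C * D\<^sup>2) * D) * (t * psi n (1 / y) / y) = k * t / C0 * (k5 * psi n (1 / y) / (C * D\<^sup>2)) / (D * y)" by (simp add: mult_ac)
    also have "\<dots> \<le> k * t / C0 * (k5 * psi n (1 / (D * y))) / (D * y)"
    proof (intro divide_right_mono mult_left_mono)
      have "k5 * psi n (1 / y) \<le> k5 * (C * D\<^sup>2 * psi n (1 / (D * y)))" using n3 l by (intro mult_left_mono) auto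
      then show "k5 * psi n (1 / y) / (C * D\<^sup>2) \<le> k5 * psi n (1 / (D * y))" using CD by (simp add: pos_divide_le_eq mult_ac)
    qed (use Th t params Dy in auto)
    also have "\<dots> \<le> k * t / C0 * ((D * y) * n (D * y)) / (D * y)"
      using n2 Th t params Dy by (intro divide_right_mono mult_left_mono) auto
    also have "\<dots> = k * t * (n (D * y) / C0)" using D(1) y0(1) by simp
    also have "\<dots> \<le> k * t * n (x + \<Theta> / r)" using n1 Th t by (intro mult_left_mono) auto
    also have "\<dots> \<le> p t x" by (rule low[OF t rx tr x])
    finally show "k * k5 / (C0 * (C * D\<^sup>2) * D) * (t * psi n (1 / y) / y) \<le> p t x" .
  qed
qed

text \<open>Let \<open>\<tau> = t \<psi>(1/x)\<close>, which is at most \<open>1\<close>; the target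
  is \<open>\<tau>/x\<close>. With jumps cut at \<open>d = x/4\<close>, moving the line to \<open>Re
  z = -s\<close> costs \<open>t \<psi>(-s)\<close>, at most of order \<open>(s d)\<^sup>2 exp (s d)
  \<tau>\<close>, and gains \<open>exp (- s x) = exp (- 4 s d)\<close>. The choice \<open>exp (s d)
  = q\<^sup>2\<close> with \<open>q = \<tau> powr (- 1 / 4)\<close> keeps the cost bounded and gains
  \<open>q\<^sup>-\<^sup>8 = \<tau>\<^sup>2\<close>. One factor \<open>\<tau>\<close> pays for the
  height \<open>r\<close> of the integral, as \<open>r \<le> 1 / (c x \<tau>)\<close>, and the other
  remains.\<close>

lemma p_upper_right:
  shows "\<exists>k>0. \<forall>t r x. 0 < t \<longrightarrow> x0 < r \<longrightarrow> t * psi n r = 1 \<longrightarrow> 1 / r < x \<longrightarrow> x * x0 < 1 \<longrightarrow> p t x \<le> k * (t * psi n (1 / x) / x)"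
proof -
  define D where "D = exp (128 * C + 4) * (2 / kappa)"
  have D0: "0 < D" using kappa_pos by (simp add: D_def)
  show ?thesis
  proof (intro exI[of _ "D / c + 2048 * C0\<^sup>2 * C"] conjI allI impI)
    show "0 < D / c + 2048 * C0\<^sup>2 * C" using D0 params by (intro add_pos_nonneg) auto
    fix t r x
    assume t: "0 < t" and r: "x0 < r" and tr: "t * psi n r = 1" and x: "1 / r < x" and xx: "x * x0 < 1"
    have r0: "0 < r" using x0_pos[OF r] .
    have "0 < 1 / r" using r0 by simp
    then have x0': "0 < x" using x by linarith
    have ix: "x0 < 1 / x" using xx x0' by (simp add: pos_less_divide_eq mult.commute)
    have ixr: "1 / x \<le> r" using x x0' r0 by (simp add: field_simps)
    have ixp: "0 < 1 / x" using x0' by simp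
    define d where "d = x / 4"
    have d: "0 < d" "1 / d = 4 / x" using x0' by (auto simp: d_def)
    define \<tau> where "\<tau> = t * psi n (1 / x)"
    have \<tau>: "0 < \<tau>" "\<tau> \<le> 1"
    proof -
      show "0 < \<tau>" using t psi_pos[OF ixp] by (simp add: \<tau>_def)
      have "t * psi n (1 / x) \<le> t * psi n r" using psi_mono[OF ixp ixr] t by (intro mult_left_mono) auto
      then show "\<tau> \<le> 1" using tr by (simp add: \<tau>_def)
    qed
    define q where "q = \<tau> powr (- (1 / 4))"
    have q4: "q ^ 4 * \<tau> = 1"
    proof -
      have "q ^ 4 = \<tau> powr (- 1)" using \<tau> by (simp add: q_def powr_power)
      then show ?thesis using \<tau> by (simp add: powr_minus)
    qed
    have q0: "0 < q" using \<tau> by (simp add: q_def)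
    have q1: "1 \<le> q"
    proof (rule ccontr)
      assume "\<not> 1 \<le> q"
      then have "q ^ 4 < 1" using q0 by (intro power_less_one_iff[THEN iffD2]) auto
      then have "q ^ 4 * \<tau> < 1 * \<tau>" using \<tau> by (intro mult_strict_right_mono) auto
      then show False using q4 \<tau> by simp
    qed
    have lnq: "0 \<le> ln q" "ln q \<le> q" using q1 ln_le_minus_one[OF q0] by auto
    define s where "s = 2 * ln q / d"
    have s: "0 \<le> s" "s * d = 2 * ln q" "s * x = 8 * ln q" using lnq d x0' by (auto simp: s_def d_def)
    let ?n1 = "trunc n d"
    let ?m = "large_moment n (1 / d)"
    interpret B: big_jumps n d t by (rule big_jumps[OF d(1) t])
    have psi4: "psi n (4 / x) \<le> 16 * C * psi n (1 / x)"
      using scale_quadratic[OF ix, of "4 / x"] x0' by (simp add: divide_right_mono)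
    have esd: "exp (s * d) = q\<^sup>2"
      unfolding s(2) using q0 by (simp add: exp_double)
    have psi_s: "psi ?n1 (- s) \<le> s\<^sup>2 * exp (s * d) / 2 * small_moment n (1 / d)"
    proof -
      have i: "integrable lborel (\<lambda>y. (s\<^sup>2 * exp (s * d) / 2) * (n y * (indicator {..1 / (1 / d)} y * y\<^sup>2)))"
        by (intro integrable_mult_right integrable_small_moment) (simp add: d(1))
      have "psi ?n1 (- s) \<le> (\<integral>y. (s\<^sup>2 * exp (s * d) / 2) * (n y * (indicator {..1 / (1 / d)} y * y\<^sup>2)) \<partial>lborel)"
        unfolding psi_def
      proof (rule integral_mono[OF B.T.expo_dom_psi_integrable[OF expo_dom_trunc] i])
        fix y
        show "?n1 y * (exp (- (- s * y)) - 1 + - s * y) \<le> (s\<^sup>2 * exp (s * d) / 2) * (n y * (indicator {..1 / (1 / d)} y * y\<^sup>2))"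
        proof (cases "0 < y \<and> y \<le> d")
          case True
          then have sy: "0 \<le> s * y" using s by simp
          have "exp (s * y) - 1 - s * y \<le> (s * y)\<^sup>2 * exp (s * y) / 2" by (rule expm1_le[OF sy])
          also have "\<dots> \<le> (s * y)\<^sup>2 * exp (s * d) / 2"
            using mult_left_mono[of y d s] True s(1) by (intro divide_right_mono mult_left_mono) auto
          finally have "n y * (exp (s * y) - 1 - s * y) \<le> n y * ((s * y)\<^sup>2 * exp (s * d) / 2)"
            using n_nonneg by (intro mult_left_mono) auto
          also have "\<dots> = (s\<^sup>2 * exp (s * d) / 2) * (n y * y\<^sup>2)" by (simp add: power_mult_distrib)
          finally show ?thesis using True by (simp add: trunc_def)
        next
          case False
          then have "?n1 y = 0" using n_zero[of y] by (auto simp: trunc_def indicator_def)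
          then show ?thesis using n_nonneg[of y] by simp
        qed
      qed
      then show ?thesis unfolding small_moment_def by simp
    qed
    have tpsi: "t * psi ?n1 (- s) \<le> 128 * C"
    proof -
      have "(1 / d)\<^sup>2 * small_moment n (1 / d) \<le> 4 * psi n (4 / x)" using small_moment_le_psi[of "4 / x"] x0' unfolding d(2) by simp
      then have "small_moment n (1 / d) \<le> d\<^sup>2 * (4 * psi n (4 / x))" using d by (simp add: power_divide field_simps)
      also have "\<dots> \<le> d\<^sup>2 * (4 * (16 * C * psi n (1 / x)))" using psi4 by (intro mult_left_mono) auto
      finally have sm: "small_moment n (1 / d) \<le> d\<^sup>2 * (64 * C * psi n (1 / x))" by simp
      have "psi ?n1 (- s) \<le> s\<^sup>2 * exp (s * d) / 2 * (d\<^sup>2 * (64 * C * psi n (1 / x)))"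
        by (rule order_trans[OF psi_s]) (use sm in \<open>intro mult_left_mono, auto\<close>)
      also have "\<dots> = (s * d)\<^sup>2 * exp (s * d) * (32 * C * psi n (1 / x))" by (simp add: power_mult_distrib)
      also have "\<dots> = (2 * ln q)\<^sup>2 * q\<^sup>2 * (32 * C * psi n (1 / x))" unfolding esd unfolding s(2) ..
      finally have "t * psi ?n1 (- s) \<le> t * ((2 * ln q)\<^sup>2 * q\<^sup>2 * (32 * C * psi n (1 / x)))" using t by (intro mult_left_mono) auto
      also have "\<dots> = 128 * C * ((ln q)\<^sup>2 * q\<^sup>2 * \<tau>)" by (simp add: \<tau>_def power_mult_distrib)
      also have "\<dots> \<le> 128 * C * (q\<^sup>2 * q\<^sup>2 * \<tau>)"
        using lnq \<tau> params by (intro mult_left_mono mult_right_mono power_mono) auto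
      also have "q\<^sup>2 * q\<^sup>2 * \<tau> = 1" using q4 by (simp add: power2_eq_square eval_nat_numeral mult_ac)
      finally show ?thesis by simp
    qed
    define b where "b = kappa / r"
    have b: "0 < b" using kappa_pos r0 by (simp add: b_def)
    have hle: "norm (line_exp ?n1 ?m t (- s) u) \<le> exp (128 * C + 4) * exp (- (b * \<bar>u\<bar>))" for u
    proof -
      (* Above the height 4 r the truncation at d is not felt, as 1 / (4 r) < x / 4; below it the claim is
         trivial. *)
      have osc: "b * \<bar>u\<bar> - 4 \<le> t * osc ?n1 (- s) u"
      proof (cases "4 * r \<le> \<bar>u\<bar>")
        case True
        have u: "0 < \<bar>u\<bar>" using True r0 by linarith
        have "1 / \<bar>u\<bar> \<le> 1 / (4 * r)" using True r0 by (intro divide_left_mono) auto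
        also have "\<dots> \<le> d" using x unfolding d_def by simp
        finally have ud: "1 / \<bar>u\<bar> \<le> d" .
        have "kappa * psi n r * (\<bar>u\<bar> / r) \<le> osc ?n1 (- s) u"
          by (rule kappa_far[OF levy_density_trunc expo_dom_trunc _ _ r]) (use ud s True r0 in \<open>auto simp: trunc_def\<close>)
        then have "t * (kappa * psi n r * (\<bar>u\<bar> / r)) \<le> t * osc ?n1 (- s) u" using t by (intro mult_left_mono) auto
        moreover have "t * (kappa * psi n r * (\<bar>u\<bar> / r)) = (t * psi n r) * (b * \<bar>u\<bar>)" by (simp add: b_def)
        ultimately show ?thesis using tr by simp
      next
        case False
        have "b * \<bar>u\<bar> \<le> b * (4 * r)" using False b by (intro mult_left_mono) auto
        also have "\<dots> \<le> 4" using kappa_pos r0 by (simp add: b_def)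
        finally show ?thesis using B.T.osc_nonneg[of "- s" u] t mult_nonneg_nonneg[of t "osc ?n1 (- s) u"] by linarith
      qed
      have "t * (?m * (- s) + psi ?n1 (- s) - osc ?n1 (- s) u) = - (t * ?m * s) + t * psi ?n1 (- s) - t * osc ?n1 (- s) u"
        by (simp add: algebra_simps)
      also have "\<dots> \<le> 0 + 128 * C - (b * \<bar>u\<bar> - 4)"
        using tpsi osc t s large_moment_nonneg[of "1 / d"] by (intro diff_mono add_mono) auto
      finally have "t * (?m * (- s) + psi ?n1 (- s) - osc ?n1 (- s) u) \<le> (128 * C + 4) + - (b * \<bar>u\<bar>)" by simp
      then show ?thesis unfolding B.T.norm_line_exp[OF expo_dom_trunc] exp_add[symmetric] by simp
    qed
    have f0: "B.f0 x \<le> D / c * (\<tau> / x)"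
    proof -
      have "(\<integral>u. norm (line_exp ?n1 ?m t (- s) u) \<partial>lborel) \<le> (\<integral>u. exp (128 * C + 4) * exp (- (b * \<bar>u\<bar>)) \<partial>lborel)"
        by (rule integral_mono[OF integrable_norm[OF B.transform_integrable] integrable_mult_right[OF integrable_exp_abs(1)[OF b]] hle])
      also have "\<dots> = exp (128 * C + 4) * (\<integral>u. exp (- (b * \<bar>u\<bar>)) \<partial>lborel)" by (rule integral_mult_right_zero)
      also have "\<dots> \<le> exp (128 * C + 4) * (2 / b)" using integrable_exp_abs(2)[OF b] by (intro mult_left_mono) auto
      also have "\<dots> = D * r" by (simp add: D_def b_def)
      finally have I: "(\<integral>u. norm (line_exp ?n1 ?m t (- s) u) \<partial>lborel) \<le> D * r" .
      have "B.f0 x \<le> norm (inv_laplace ?n1 ?m t (- s) x)" unfolding B.inv_laplace_f0 by simp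
      also have "\<dots> \<le> exp (- s * x) * ((\<integral>u. norm (line_exp ?n1 ?m t (- s) u) \<partial>lborel) / (2 * pi))"
        unfolding inv_laplace_def norm_mult using norm_inv_fourier_le[OF B.transform_integrable[of "- s"], of x] by (simp del: times_divide_eq_right)
      also have "\<dots> \<le> exp (- s * x) * (D * r)"
      proof (intro mult_left_mono)
        have "(\<integral>u. norm (line_exp ?n1 ?m t (- s) u) \<partial>lborel) / (2 * pi) \<le> D * r / (2 * pi)" using I by (intro divide_right_mono) auto
        also have "\<dots> \<le> D * r / 1" using D0 r0 pi_gt3 by (intro divide_left_mono) auto
        finally show "(\<integral>u. norm (line_exp ?n1 ?m t (- s) u) \<partial>lborel) / (2 * pi) \<le> D * r" by simp
      qed simp
      also have "exp (- s * x) = 1 / q ^ 8"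
      proof -
        have "exp (8 * ln q) = exp (ln q) ^ 8" using exp_of_nat_mult[of 8 "ln q"] by simp
        then have "exp (8 * ln q) = q ^ 8" using q0 by simp
        moreover have "- s * x = - (8 * ln q)" using s(3) by simp
        ultimately show ?thesis by (simp only: exp_minus divide_inverse mult_1_left)
      qed
      also have "r \<le> q ^ 4 / (c * x)"
      proof -
        have "t * (c * (r / (1 / x)) * psi n (1 / x)) \<le> t * psi n r"
          using scale_linear[OF ix ixr] t by (intro mult_left_mono) auto
        then have "r * (c * x * \<tau>) \<le> 1" using tr by (simp add: \<tau>_def mult_ac)
        then have "r * (c * x * \<tau>) * q ^ 4 \<le> 1 * q ^ 4" using q0 by (intro mult_right_mono) auto
        then have "r * (c * x) * (q ^ 4 * \<tau>) \<le> q ^ 4" by (simp add: mult_ac)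
        then show ?thesis unfolding q4 using params x0' by (simp add: pos_le_divide_eq)
      qed
      then have "1 / q ^ 8 * (D * r) \<le> 1 / q ^ 8 * (D * (q ^ 4 / (c * x)))"
        using D0 q0 by (intro mult_left_mono) auto
      also have "\<dots> = D / c * (1 / q ^ 4 / x)"
      proof -
        have q8: "q ^ 8 = q ^ 4 * q ^ 4" by (simp flip: power_add)
        have gen: "1 / (Q * Q) * (D * (Q / (c * x))) = D / c * (1 / Q / x)" if "0 < Q" for Q :: real
          using that by simp
        show ?thesis unfolding q8 by (rule gen) (use q0 in simp)
      qed
      also have "1 / q ^ 4 = \<tau>" using q4 q0 by (simp add: field_simps)
      finally show ?thesis .
    qed
    have tl: "tail n d y \<le> C0 * n d" for y
    proof (cases "d < y")
      case True then show ?thesis using amono[OF d(1), of y] by (simp add: tail_def)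
    next
      case False then show ?thesis using n_nonneg[of d] params by (simp add: tail_def)
    qed
    have S: "t * (C0 * n d) \<le> 2048 * C0\<^sup>2 * C * (\<tau> / x)"
    proof -
      have "d * n d \<le> 32 * C0 * (16 * C * psi n (1 / x))"
      proof -
        have "d * n d \<le> 32 * C0 * psi n (4 / x)" using density_le[OF d(1)] unfolding d(2) .
        also have "\<dots> \<le> 32 * C0 * (16 * C * psi n (1 / x))" using psi4 params by (intro mult_left_mono) auto
        finally show ?thesis .
      qed
      then have "x * n d \<le> 2048 * C0 * C * psi n (1 / x)" by (simp add: d_def)
      then have "(t * C0) * (x * n d) \<le> (t * C0) * (2048 * C0 * C * psi n (1 / x))" using t params by (intro mult_left_mono) auto
      then have "t * (C0 * n d) * x \<le> 2048 * C0\<^sup>2 * C * \<tau>" by (simp add: \<tau>_def power2_eq_square mult_ac)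
      then show ?thesis using x0' by (simp add: pos_le_divide_eq)
    qed
    have "p t x = B.P x" unfolding B.P_def p_def ..
    also have "\<dots> \<le> B.f0 x + t * (C0 * n d)" by (rule B.one_big_jump_upper[OF tl])
    also have "\<dots> \<le> D / c * (\<tau> / x) + 2048 * C0\<^sup>2 * C * (\<tau> / x)" using f0 S by (rule add_mono)
    finally show "p t x \<le> (D / c + 2048 * C0\<^sup>2 * C) * (t * psi n (1 / x) / x)"
      unfolding \<tau>_def distrib_right .
  qed
qed

section \<open>The estimate within the range of the scaling conditions\<close>

lemma psi_strict_mono: assumes "0 < v" "v < v'" shows "psi n v < psi n v'"
proof (rule DERIV_pos_imp_increasing[OF assms(2)], intro exI conjI)
  fix x assume "v \<le> x" "x \<le> v'"
  then have x: "0 < x" using assms by linarith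
  show "(psi n has_real_derivative psi1 n x) (at x)" by (rule psi_deriv[OF x])
  have "0 < x * psi1 n x" using psi_le_psi1[OF x] psi_pos[OF x] by linarith
  then show "0 < psi1 n x" using x by (simp add: zero_less_mult_iff)
qed

lemma psi1_strict_mono: assumes "0 < v" "v < v'" shows "psi1 n v < psi1 n v'"
proof (rule DERIV_pos_imp_increasing[OF assms(2)], intro exI conjI)
  fix x assume "v \<le> x" "x \<le> v'"
  then have x: "0 < x" using assms by linarith
  show "(psi1 n has_real_derivative psi2 n x) (at x)" by (rule psi1_deriv[OF x])
  show "0 < psi2 n x" by (rule psi2_pos[OF x psi_pos[OF x]])
qed

text \<open>Lower scaling from the base point \<open>x0 + 1\<close>, with \<open>\<alpha> >
  1\<close>.\<close>

lemma psi_superlinear: "\<exists>R\<ge>R0. B * R \<le> psi n R"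
proof -
  define v where "v = x0 + 1"
  have v: "x0 < v" "1 \<le> v" using params by (auto simp: v_def)
  have pv: "0 < psi n v" using psi_pos v by simp
  obtain A where A: "max 1 (R0 / v) \<le> A" "\<bar>B\<bar> * v / (c * psi n v) \<le> A powr (\<alpha> - 1)"
    using exists_big_power[of "max 1 (R0 / v)" "\<bar>B\<bar> * v / (c * psi n v)"] by auto
  have A1: "1 \<le> A" using A by simp
  show ?thesis
  proof (intro exI conjI)
    show "R0 \<le> A * v" using A v by (simp add: field_simps)
    have "A powr \<alpha> = A powr (\<alpha> - 1) * A" using A1 powr_add[of A "\<alpha> - 1" 1] by simp
    moreover have "\<bar>B\<bar> * v \<le> c * psi n v * A powr (\<alpha> - 1)" using A(2) pv params by (simp add: pos_divide_le_eq mult_ac)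
    then have "\<bar>B\<bar> * v * A \<le> c * psi n v * A powr (\<alpha> - 1) * A" using A1 by (intro mult_right_mono) auto
    moreover have "c * A powr \<alpha> * psi n v \<le> psi n (A * v)" by (rule lower[OF A1 v(1)])
    ultimately have "\<bar>B\<bar> * (A * v) \<le> psi n (A * v)" by (simp add: mult_ac)
    moreover have "B * (A * v) \<le> \<bar>B\<bar> * (A * v)" using A1 v by (intro mult_right_mono) auto
    ultimately show "B * (A * v) \<le> psi n (A * v)" by linarith
  qed
qed

lemma exists_psi_eq: assumes b: "0 < b" shows "\<exists>r>0. psi n r = b"
proof -
  define v where "v = min 1 (b / (psi1 n 1 + 1))"
  have p1: "0 \<le> psi1 n 1" by (rule psi1_nonneg) simp
  have v: "0 < v" "v \<le> 1" using b p1 by (auto simp: v_def)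
  have "psi n v \<le> v * psi1 n v" by (rule psi_le_psi1[OF v(1)])
  also have "\<dots> \<le> (b / (psi1 n 1 + 1)) * psi1 n 1"
    using v b p1 psi1_mono[OF v] psi1_nonneg[of v] by (intro mult_mono) (auto simp: v_def)
  also have "\<dots> \<le> b" using b p1 by (simp add: field_simps)
  finally have lo: "psi n v \<le> b" .
  obtain R where R: "1 \<le> R" "b * R \<le> psi n R" using psi_superlinear[of 1 b] by auto
  have "b * 1 \<le> b * R" using R b by (intro mult_left_mono) auto
  then have hi: "b \<le> psi n R" using R by linarith
  have cont: "continuous_on {v..R} (psi n)"
    using v by (intro continuous_at_imp_continuous_on ballI DERIV_isCont[OF psi_deriv]) auto
  obtain r where "v \<le> r" "psi n r = b" using IVT'[OF lo hi _ cont] v R by auto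
  then show ?thesis using v by (intro exI[of _ r]) auto
qed

text \<open>\<open>target\<close> is the right-hand side of the estimate in terms of the exponent;
  \<open>r\<close> stands for the value of its inverse at \<open>1/t\<close> and \<open>w\<close>
  for the saddle point.\<close>

definition left_target :: "real \<Rightarrow> real \<Rightarrow> real" where
  "left_target t w = (t * psi2 n w) powr (- 1 / 2) * exp (- t * (w * psi1 n w - psi n w))"

definition target :: "real \<Rightarrow> real \<Rightarrow> real \<Rightarrow> real \<Rightarrow> real" where
  "target t r w x = (if x * r \<le> -1 then left_target t w else if x * r \<le> 1 then r else t * inverse x * psi n (1 / x))"

lemma powr_minus_half: "0 < b \<Longrightarrow> b powr (- 1 / 2) = 1 / sqrt b"
  using powr_minus_divide[of b "1/2"] by (simp add: powr_half_sqrt)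

text \<open>\<open>w\<^sup>2 \<psi>''(w)\<close> is comparable with \<open>\<psi>(w)\<close>: the
  upper bound is general, and the lower one holds because the second derivative dominates the second
  moment of the jumps below \<open>1/w\<close>.\<close>

lemma psi2_compare:
  obtains E where "1 \<le> E" "\<And>t w. 0 < t \<Longrightarrow> x0 < w \<Longrightarrow> 
    w / (2 * sqrt (t * psi n w)) \<le> (t * psi2 n w) powr (- 1 / 2) \<and> (t * psi2 n w) powr (- 1 / 2) \<le> E * (w / sqrt (t * psi n w))"
proof -
  obtain c1 where c1: "0 < c1" "c1 \<le> 1" "\<And>v. x0 < v \<Longrightarrow> c1 * psi n v \<le> v\<^sup>2 * small_moment n v" using small_moment_ge by metis
  show ?thesis
  proof (rule that[of "1 / sqrt (c1 / 3)"])
    show "1 \<le> 1 / sqrt (c1 / 3)" using c1 by simp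
    fix t w :: real assume t: "0 < t" and w: "x0 < w"
    have w0: "0 < w" using x0_pos[OF w] .
    have a: "0 < t * psi n w" "0 < t * psi2 n w" using psi_pos[OF w0] psi2_pos[OF w0] t by auto
    have "w\<^sup>2 * (t * psi2 n w) \<le> 4 * (t * psi n w)" using mult_left_mono[OF psi2_le_psi[OF w0], of t] t by (simp add: mult_ac)
    then have "sqrt (w\<^sup>2 * (t * psi2 n w)) \<le> sqrt (2\<^sup>2 * (t * psi n w))" by (intro real_sqrt_le_mono) simp
    then have 1: "w * sqrt (t * psi2 n w) \<le> 2 * sqrt (t * psi n w)" using w0 by (simp add: real_sqrt_mult)
    have "c1 * psi n w \<le> 3 * (w\<^sup>2 * psi2 n w)"
      using c1(3)[OF w] mult_left_mono[OF small_moment_le_psi2[OF w0], of "w\<^sup>2"] by simp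
    then have "t * (c1 * psi n w) \<le> t * (3 * (w\<^sup>2 * psi2 n w))" using t by (intro mult_left_mono) auto
    then have "(c1 / 3) * (t * psi n w) \<le> w\<^sup>2 * (t * psi2 n w)" by (simp add: mult_ac)
    then have "sqrt ((c1 / 3) * (t * psi n w)) \<le> sqrt (w\<^sup>2 * (t * psi2 n w))" by (intro real_sqrt_le_mono)
    moreover have "sqrt (w\<^sup>2 * (t * psi2 n w)) = w * sqrt (t * psi2 n w)" using w0 by (simp add: real_sqrt_mult)
    ultimately have 2: "sqrt (c1 / 3) * sqrt (t * psi n w) \<le> w * sqrt (t * psi2 n w)" by (simp only: real_sqrt_mult[of "c1 / 3"])
    have s: "0 < sqrt (t * psi n w)" "0 < sqrt (t * psi2 n w)" "0 < sqrt (c1 / 3)" using a c1 by auto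
    show "w / (2 * sqrt (t * psi n w)) \<le> (t * psi2 n w) powr (- 1 / 2) \<and> (t * psi2 n w) powr (- 1 / 2) \<le> 1 / sqrt (c1 / 3) * (w / sqrt (t * psi n w))"
    proof
      show "w / (2 * sqrt (t * psi n w)) \<le> (t * psi2 n w) powr (- 1 / 2)"
        unfolding powr_minus_half[OF a(2)] using 1 s by (simp add: pos_divide_le_eq pos_le_divide_eq)
      have "1 / sqrt (c1 / 3) * (w / sqrt (t * psi n w)) = w / (sqrt (c1 / 3) * sqrt (t * psi n w))" by simp
      moreover have "1 / sqrt (t * psi2 n w) \<le> w / (sqrt (c1 / 3) * sqrt (t * psi n w))"
        using 2 s mult_pos_pos[OF s(3,1)] by (simp only: pos_divide_le_eq pos_le_divide_eq times_divide_eq_left mult_1_left)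
      ultimately show "(t * psi2 n w) powr (- 1 / 2) \<le> 1 / sqrt (c1 / 3) * (w / sqrt (t * psi n w))"
        unfolding powr_minus_half[OF a(2)] by simp
    qed
  qed
qed

lemma left_saddle:
  "\<exists>M\<ge>1. \<exists>k1>0. \<exists>k2>0. \<forall>t w. 0 < t \<longrightarrow> x0 < w \<longrightarrow> M \<le> t * psi n w \<longrightarrow>
     k1 * left_target t w \<le> p t (- (t * psi1 n w)) \<and> p t (- (t * psi1 n w)) \<le> k2 * left_target t w"
proof -
  obtain E where E: "1 \<le> E" "\<And>t w. 0 < t \<Longrightarrow> x0 < w \<Longrightarrow> 
    w / (2 * sqrt (t * psi n w)) \<le> (t * psi2 n w) powr (- 1 / 2) \<and> (t * psi2 n w) powr (- 1 / 2) \<le> E * (w / sqrt (t * psi n w))"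
    using psi2_compare by metis
  have "1 \<le> 64 / kappa" using kappa_pos by (simp add: field_simps)
  then have M1: "1 \<le> (64 / kappa) ^ 6" by (rule one_le_power)
  have E0: "0 < 1 / (128 * E)" using E(1) by simp
  show ?thesis
  proof (rule exI[of _ "(64 / kappa) ^ 6"], rule conjI[OF M1], rule exI[of _ "1 / (128 * E)"], rule conjI[OF E0], 
      rule exI[of _ "2 / kappa"], intro conjI allI impI)
    show "0 < 2 / kappa" using kappa_pos by simp
    fix t w assume t: "0 < t" and w: "x0 < w" and a: "(64 / kappa) ^ 6 \<le> t * psi n w"
    have w0: "0 < w" using x0_pos[OF w] .
    let ?e = "exp (- t * (w * psi1 n w - psi n w))"
    let ?s = "sqrt (t * psi n w)"
    have s: "0 < ?s" using psi_pos[OF w0] t by simp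
    note cmp = E(2)[OF t w]
    have "1 / (128 * E) * left_target t w = ?e * ((t * psi2 n w) powr (- 1 / 2)) / (128 * E)" by (simp add: left_target_def)
    also have "\<dots> \<le> ?e * (E * (w / ?s)) / (128 * E)" using cmp E(1) by (intro divide_right_mono mult_left_mono) auto
    also have "\<dots> = ?e * w / (128 * ?s)" using E(1) by simp
    also have "\<dots> \<le> p t (- (t * psi1 n w))" by (rule p_lower_saddle[OF w t a])
    finally show "1 / (128 * E) * left_target t w \<le> p t (- (t * psi1 n w))" .
    have "p t (- (t * psi1 n w)) \<le> exp (w * (- (t * psi1 n w)) + t * psi n w) * w / (kappa * ?s)"
      by (rule p_upper_saddle[OF w t]) (use a M1 in linarith)
    also have "w * (- (t * psi1 n w)) + t * psi n w = - t * (w * psi1 n w - psi n w)" by (simp add: algebra_simps)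
    also have "?e * w / (kappa * ?s) = 2 / kappa * ((w / (2 * ?s)) * ?e)" by simp
    also have "\<dots> \<le> 2 / kappa * left_target t w"
      unfolding left_target_def using cmp kappa_pos by (intro mult_left_mono mult_right_mono) auto
    finally show "p t (- (t * psi1 n w)) \<le> 2 / kappa * left_target t w" .
  qed
qed

text \<open>The premise says that the saddle point belongs to some \<open>x \<le> -1/r\<close>. Then
  \<open>w\<close> cannot be much smaller than \<open>r\<close>, as \<open>\<psi>'(w)\<close> is of
  order at most \<open>\<psi>(w)/w\<close>, which tends to zero relative to
  \<open>\<psi>(r)/r\<close> as \<open>w/r\<close> decreases.\<close>

lemma saddle_location:
  obtains \<theta> where "0 < \<theta>" "\<theta> \<le> 1" "\<And>r w. 0 < r \<Longrightarrow> x0 < \<theta> * r \<Longrightarrow> 0 < w \<Longrightarrow> psi n r \<le> r * psi1 n w \<Longrightarrow> \<theta> * r \<le> w"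
proof -
  define \<theta> where "\<theta> = (c / 8) powr (1 / (\<alpha> - 1))"
  have th: "0 < \<theta>" "\<theta> \<le> 1" "\<theta> powr (\<alpha> - 1) = c / 8"
    using params powr_mono2[of "1 / (\<alpha> - 1)" "c / 8" 1] by (auto simp: \<theta>_def powr_powr)
  show ?thesis
  proof (rule that[OF th(1,2)], rule ccontr)
    fix r w assume r: "0 < r" and x: "x0 < \<theta> * r" and w: "0 < w" and le: "psi n r \<le> r * psi1 n w" and "\<not> \<theta> * r \<le> w"
    then have "psi1 n w \<le> psi1 n (\<theta> * r)" using w by (intro psi1_mono) auto
    then have "\<theta> * (r * psi1 n w) \<le> \<theta> * (r * psi1 n (\<theta> * r))" using r th by (intro mult_left_mono) auto
    also have "\<dots> \<le> 4 * psi n (\<theta> * r)" using psi1_le_psi[of "\<theta> * r"] r th by (simp add: mult.assoc)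
    finally have 1: "\<theta> * psi n r \<le> 4 * psi n (\<theta> * r)" using le th by (meson less_imp_le mult_left_mono order_trans)
    have "c * (r / (\<theta> * r)) powr \<alpha> * psi n (\<theta> * r) \<le> psi n r"
      by (rule scale_lower[OF x]) (use th r mult_right_mono[of \<theta> 1 r] in auto)
    then have A: "\<theta> powr \<alpha> * (c * (1 / \<theta>) powr \<alpha> * psi n (\<theta> * r)) \<le> \<theta> powr \<alpha> * psi n r" using r by (intro mult_left_mono) auto
    have one: "\<theta> powr \<alpha> * (1 / \<theta>) powr \<alpha> = 1" using th by (subst powr_mult[symmetric]) auto
    have "\<theta> powr \<alpha> * (c * (1 / \<theta>) powr \<alpha> * psi n (\<theta> * r)) = c * (\<theta> powr \<alpha> * (1 / \<theta>) powr \<alpha>) * psi n (\<theta> * r)" by (simp only: mult_ac)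
    then have B: "\<theta> powr \<alpha> * (c * (1 / \<theta>) powr \<alpha> * psi n (\<theta> * r)) = c * psi n (\<theta> * r)" unfolding one by simp
    have D: "\<theta> powr \<alpha> = c / 8 * \<theta>" using th powr_add[of \<theta> "\<alpha> - 1" 1] by simp
    have "c * psi n (\<theta> * r) \<le> \<theta> powr \<alpha> * psi n r" using A unfolding B .
    then have "c * psi n (\<theta> * r) \<le> c / 8 * \<theta> * psi n r" unfolding D .
    then have "c * (8 * psi n (\<theta> * r)) \<le> c * (\<theta> * psi n r)" by simp
    then have "8 * psi n (\<theta> * r) \<le> \<theta> * psi n r" using params by (subst (asm) mult_le_cancel_left_pos) auto
    then have "psi n (\<theta> * r) \<le> 0" using 1 by linarith
    then show False using psi_pos[of "\<theta> * r"] r th by simp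
  qed
qed

text \<open>If \<open>t \<psi>(w) \<ge> M\<close>, this is \<open>left_saddle\<close>. Otherwise
  \<open>t \<psi>(w)\<close> and \<open>w/r\<close> both lie between two constants, and
  \<open>x\<close> is at least \<open>- K/r\<close> for a constant \<open>K\<close>; both the
  density and the target are then of order \<open>r\<close>.\<close>

lemma core_left:
  "\<exists>\<Theta>\<ge>1. \<exists>k1>0. \<exists>k2>0. \<forall>t r w. 0 < t \<longrightarrow> 0 < r \<longrightarrow> t * psi n r = 1 \<longrightarrow> \<Theta> * x0 < r \<longrightarrow> 0 < w \<longrightarrow> 1 / r \<le> t * psi1 n w \<longrightarrow>
     k1 * left_target t w \<le> p t (- (t * psi1 n w)) \<and> p t (- (t * psi1 n w)) \<le> k2 * left_target t w"
proof -
  obtain M k1 k2 where M: "1 \<le> M" "0 < k1" "0 < k2" and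
    sad: "\<And>t w. 0 < t \<Longrightarrow> x0 < w \<Longrightarrow> M \<le> t * psi n w \<Longrightarrow>
     k1 * left_target t w \<le> p t (- (t * psi1 n w)) \<and> p t (- (t * psi1 n w)) \<le> k2 * left_target t w" using left_saddle by blast
  obtain E where E: "1 \<le> E" "\<And>t w. 0 < t \<Longrightarrow> x0 < w \<Longrightarrow> 
    w / (2 * sqrt (t * psi n w)) \<le> (t * psi2 n w) powr (- 1 / 2) \<and> (t * psi2 n w) powr (- 1 / 2) \<le> E * (w / sqrt (t * psi n w))"
    using psi2_compare by metis
  obtain \<theta> where th: "0 < \<theta>" "\<theta> \<le> 1" and
    loc: "\<And>r w. 0 < r \<Longrightarrow> x0 < \<theta> * r \<Longrightarrow> 0 < w \<Longrightarrow> psi n r \<le> r * psi1 n w \<Longrightarrow> \<theta> * r \<le> w"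
    using saddle_location by metis
  have K: "0 \<le> 4 * M / \<theta>" using M th by simp
  obtain \<Theta>' k4 where Th': "1 \<le> \<Theta>'" "0 < k4" and
    low: "\<And>t r x y. 0 < t \<Longrightarrow> 0 < r \<Longrightarrow> t * psi n r = 1 \<Longrightarrow> - (4 * M / \<theta>) / r \<le> x \<Longrightarrow> y = max x (1 / r) \<Longrightarrow> \<Theta>' * y * x0 < 1
      \<Longrightarrow> k4 * (t * psi n (1 / y) / y) \<le> p t x"
    using p_lower_right[OF K] by blast
  (* Constants with ql * r <= left_target t w <= qh * r in the second case. *)
  define qh where "qh = E * ((M / c) * (sqrt C / \<theta>))"
  define ql where "ql = exp (- (4 * M)) * \<theta> / (2 * sqrt M)"
  have q0: "0 < qh" "0 < ql" using E M th params by (auto simp: qh_def ql_def)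
  define \<Theta> where "\<Theta> = max \<Theta>' (1 / \<theta>)"
  have Th1: "1 \<le> \<Theta>" and kk: "0 < min k1 (k4 / qh)" "0 < max k2 (exp 2 / kappa / ql)"
    using Th' M q0 by (auto simp: \<Theta>_def less_max_iff_disj)
  show ?thesis
  proof (rule exI[of _ \<Theta>], rule conjI[OF Th1], rule exI[of _ "min k1 (k4 / qh)"], rule conjI[OF kk(1)],
     rule exI[of _ "max k2 (exp 2 / kappa / ql)"], rule conjI[OF kk(2)], intro allI impI)
    fix t r w
    assume t: "0 < t" and r: "0 < r" and tr: "t * psi n r = 1" and rx: "\<Theta> * x0 < r" and w0: "0 < w" and xr: "1 / r \<le> t * psi1 n w"
    have "\<Theta>' * x0 \<le> \<Theta> * x0" unfolding \<Theta>_def using params by (intro mult_right_mono) auto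
    moreover have "1 / \<theta> * x0 \<le> \<Theta> * x0" unfolding \<Theta>_def using params by (intro mult_right_mono) auto
    ultimately have rx': "\<Theta>' * x0 < r" "1 / \<theta> * x0 < r" using rx by linarith+
    then have rth: "x0 < \<theta> * r" using th by (simp add: field_simps)
    have rx0: "x0 < r"
    proof -
      have "1 * x0 \<le> \<Theta>' * x0" using Th' params by (intro mult_right_mono) auto
      then show ?thesis using rx' by linarith
    qed
    have "psi n r * (1 / r) \<le> psi n r * (t * psi1 n w)" using xr psi_nonneg[of r] by (intro mult_left_mono) auto
    also have "\<dots> = (t * psi n r) * psi1 n w" by simp
    finally have "psi n r \<le> r * psi1 n w" using tr r by (simp add: field_simps)
    then have wr: "\<theta> * r \<le> w" by (rule loc[OF r rth w0])
    have w: "x0 < w" using wr rth by linarith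
    define a where "a = t * psi n w"
    have q_pos: "0 \<le> left_target t w" by (simp add: left_target_def)
    let ?P = "p t (- (t * psi1 n w))"
    show "min k1 (k4 / qh) * left_target t w \<le> ?P \<and> ?P \<le> max k2 (exp 2 / kappa / ql) * left_target t w"
    proof (cases "M \<le> a")
      case True
      have "min k1 (k4 / qh) * left_target t w \<le> k1 * left_target t w" "k2 * left_target t w \<le> max k2 (exp 2 / kappa / ql) * left_target t w"
        using q_pos by (auto intro!: mult_right_mono)
      then show ?thesis using sad[OF t w] True unfolding a_def by fastforce
    next
      case False
      have a0: "0 < a" using psi_pos[OF w0] t by (simp add: a_def)
      have tp: "w * (t * psi1 n w) \<le> 4 * a" using mult_left_mono[OF psi1_le_psi[OF w0], of t] t by (simp add: a_def mult_ac)
      have x: "- (4 * M / \<theta>) / r \<le> - (t * psi1 n w)"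
      proof -
        have "(\<theta> * r) * (t * psi1 n w) \<le> w * (t * psi1 n w)" using wr t psi1_nonneg[of w] w0 by (intro mult_right_mono) auto
        also have "\<dots> \<le> 4 * M" using tp False by linarith
        finally show ?thesis using th r by (simp add: field_simps)
      qed
      have y: "1 / r = max (- (t * psi1 n w)) (1 / r)"
      proof -
        have "0 < 1 / r" using r by simp
        then show ?thesis using xr by linarith
      qed
      have "k4 * (t * psi n (1 / (1 / r)) / (1 / r)) \<le> ?P"
        by (rule low[OF t r tr x y]) (use rx' r in \<open>simp add: field_simps\<close>)
      then have lo: "k4 * r \<le> ?P" using tr by simp
      have hi: "?P \<le> (exp 2 / kappa) * r"
        by (rule p_upper_mid[OF rx0 t tr]) (use y in linarith)
      have Mc: "1 \<le> M / c" using M params by (simp add: field_simps)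
      have w_up: "w \<le> (M / c) * r"
      proof (cases "r \<le> w")
        case True
        have "t * (c * (w / r) * psi n r) \<le> t * psi n w" using scale_linear[OF rx0 True] t by (intro mult_left_mono) auto
        then have "c * (w / r) * (t * psi n r) \<le> a" by (simp add: a_def mult_ac)
        then have "c * (w / r) \<le> M" using tr False by simp
        then show ?thesis using r params by (simp add: field_simps)
      next
        case False
        have "1 * r \<le> (M / c) * r" using Mc r by (intro mult_right_mono) auto
        then show ?thesis using False by simp
      qed
      have a_lo: "\<theta>\<^sup>2 / C \<le> a"
      proof -
        have tw: "0 < \<theta> * r" "\<theta> * r \<le> r" using th r mult_right_mono[of \<theta> 1 r] by auto
        have "psi n r \<le> C * (r / (\<theta> * r))\<^sup>2 * psi n (\<theta> * r)" by (rule scale_quadratic[OF rth tw(2)])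
        also have "\<dots> \<le> C * (r / (\<theta> * r))\<^sup>2 * psi n w" using psi_mono[OF tw(1) wr] params by (intro mult_left_mono) auto
        also have "r / (\<theta> * r) = 1 / \<theta>" using r by simp
        finally have "t * psi n r \<le> t * (C * (1 / \<theta>)\<^sup>2 * psi n w)" using t by (intro mult_left_mono) auto
        then have "1 \<le> C * (1 / \<theta>)\<^sup>2 * a" using tr by (simp add: a_def mult_ac)
        then show ?thesis using th params by (simp add: power_divide field_simps)
      qed
      have sa: "\<theta> / sqrt C \<le> sqrt a"
      proof -
        have "sqrt (\<theta>\<^sup>2 / C) \<le> sqrt a" using a_lo by (rule real_sqrt_le_mono)
        then show ?thesis using th by (simp add: real_sqrt_divide)
      qed
      have sM: "sqrt a \<le> sqrt M" using False by (intro real_sqrt_le_mono) simp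
      have sa0: "0 < sqrt a" using a0 by simp
      note cmp = E(2)[OF t w, folded a_def]
      have e1: "exp (- t * (w * psi1 n w - psi n w)) \<le> 1"
        using psi_le_psi1[OF w0] t by (simp add: mult_nonneg_nonneg)
      have e2: "exp (- (4 * M)) \<le> exp (- t * (w * psi1 n w - psi n w))"
      proof -
        have "t * (w * psi1 n w - psi n w) \<le> w * (t * psi1 n w)" using t psi_nonneg[of w] by (simp add: algebra_simps)
        then show ?thesis using tp False by simp
      qed
      have "left_target t w \<le> E * (w / sqrt a) * 1"
        unfolding left_target_def using cmp e1 E w0 sa0 by (intro mult_mono) auto
      also have "w / sqrt a \<le> ((M / c) * r) / (\<theta> / sqrt C)"
        using w_up sa th params w0 M r by (intro frac_le) auto
      then have "E * (w / sqrt a) * 1 \<le> E * (((M / c) * r) / (\<theta> / sqrt C)) * 1" using E by (intro mult_left_mono mult_right_mono) auto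
      also have "\<dots> = qh * r" using th params by (simp add: qh_def)
      finally have qu: "left_target t w \<le> qh * r" .
      have "ql * r = (\<theta> * r / (2 * sqrt M)) * exp (- (4 * M))" by (simp add: ql_def)
      also have "\<dots> \<le> (w / (2 * sqrt a)) * exp (- (4 * M))"
        using wr sM sa0 th r w0 by (intro mult_right_mono frac_le) auto
      also have "\<dots> \<le> left_target t w"
        unfolding left_target_def using cmp e2 w0 sa0 by (intro mult_mono) auto
      finally have qd: "ql * r \<le> left_target t w" .
      have "min k1 (k4 / qh) * left_target t w \<le> k4 / qh * left_target t w" using q_pos by (intro mult_right_mono) auto
      also have "\<dots> \<le> k4 / qh * (qh * r)" using qu Th' q0 by (intro mult_left_mono) auto
      also have "\<dots> = k4 * r" using q0 by simp
      finally have A: "min k1 (k4 / qh) * left_target t w \<le> ?P" using lo by linarith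
      have "(exp 2 / kappa) * r = (exp 2 / kappa / ql) * (ql * r)" using q0 by simp
      also have "\<dots> \<le> (exp 2 / kappa / ql) * left_target t w" using qd q0 kappa_pos by (intro mult_left_mono) auto
      also have "\<dots> \<le> max k2 (exp 2 / kappa / ql) * left_target t w" using q_pos by (intro mult_right_mono) auto
      finally have "?P \<le> max k2 (exp 2 / kappa / ql) * left_target t w" using hi by linarith
      with A show ?thesis by blast
    qed
  qed
qed

text \<open>The multiple \<open>\<Theta>\<close> keeps all auxiliary points, such as
  \<open>1/y\<close> and \<open>\<theta> r\<close>, in the range of the scaling conditions.\<close>

lemma core_estimate:
  "\<exists>\<Theta>\<ge>1. \<exists>k1>0. \<exists>k2>0. \<forall>t r w x. 0 < t \<longrightarrow> 0 < r \<longrightarrow> t * psi n r = 1 \<longrightarrow> \<Theta> * x0 < r \<longrightarrow>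
     (x * r \<le> -1 \<longrightarrow> 0 < w \<and> t * psi1 n w = - x) \<longrightarrow> (1 < x * r \<longrightarrow> \<Theta> * x * x0 < 1) \<longrightarrow>
     k1 * target t r w x \<le> p t x \<and> p t x \<le> k2 * target t r w x"
proof -
  obtain \<Theta>1 k1 k2 where L: "1 \<le> \<Theta>1" "0 < k1" "0 < k2" and
    left: "\<And>t r w. 0 < t \<Longrightarrow> 0 < r \<Longrightarrow> t * psi n r = 1 \<Longrightarrow> \<Theta>1 * x0 < r \<Longrightarrow> 0 < w \<Longrightarrow> 1 / r \<le> t * psi1 n w \<Longrightarrow>
     k1 * left_target t w \<le> p t (- (t * psi1 n w)) \<and> p t (- (t * psi1 n w)) \<le> k2 * left_target t w"
    using core_left by blast
  obtain \<Theta>2 k3 where R: "1 \<le> \<Theta>2" "0 < k3" and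
    low: "\<And>t r x y. 0 < t \<Longrightarrow> 0 < r \<Longrightarrow> t * psi n r = 1 \<Longrightarrow> - 1 / r \<le> x \<Longrightarrow> y = max x (1 / r) \<Longrightarrow> \<Theta>2 * y * x0 < 1
      \<Longrightarrow> k3 * (t * psi n (1 / y) / y) \<le> p t x"
    using p_lower_right[of 1] by auto
  obtain k4 where k4: "0 < k4" and
    up: "\<And>t r x. 0 < t \<Longrightarrow> x0 < r \<Longrightarrow> t * psi n r = 1 \<Longrightarrow> 1 / r < x \<Longrightarrow> x * x0 < 1 \<Longrightarrow> p t x \<le> k4 * (t * psi n (1 / x) / x)"
    using p_upper_right by blast
  define \<Theta> where "\<Theta> = max \<Theta>1 \<Theta>2"
  define l where "l = min k1 k3"
  define u where "u = max k2 (max (exp 2 / kappa) k4)"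
  have l: "0 < l" "l \<le> k1" "l \<le> k3" using L R by (auto simp: l_def)
  have u: "0 < u" "k2 \<le> u" "exp 2 / kappa \<le> u" "k4 \<le> u" using L by (auto simp: u_def less_max_iff_disj)
  have Th: "1 \<le> \<Theta>" "\<Theta>1 \<le> \<Theta>" "\<Theta>2 \<le> \<Theta>" using L by (auto simp: \<Theta>_def)
  show ?thesis
  proof (rule exI[of _ \<Theta>], rule conjI[OF Th(1)], rule exI[of _ l], rule conjI[OF l(1)], rule exI[of _ u], rule conjI[OF u(1)], intro allI impI)
    fix t r w x
    assume t: "0 < t" and r: "0 < r" and tr: "t * psi n r = 1" and rx: "\<Theta> * x0 < r" 
      and lft: "x * r \<le> -1 \<longrightarrow> 0 < w \<and> t * psi1 n w = - x" and rgt: "1 < x * r \<longrightarrow> \<Theta> * x * x0 < 1"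
    have "1 * x0 \<le> \<Theta> * x0" "\<Theta>1 * x0 \<le> \<Theta> * x0" "\<Theta>2 * x0 \<le> \<Theta> * x0"
      by (intro mult_right_mono Th params)+
    then have rr: "x0 < r" "\<Theta>1 * x0 < r" "\<Theta>2 * x0 < r" using rx by linarith+
    have key: "l * q \<le> P \<and> P \<le> u * q" if "a * q \<le> P" "P \<le> b * q" "l \<le> a" "b \<le> u" "0 \<le> q" for a b q P :: real
      using that mult_right_mono[of l a q] mult_right_mono[of b u q] by linarith
    consider "x * r \<le> -1" | "-1 < x * r" "x * r \<le> 1" | "1 < x * r" by linarith
    then show "l * target t r w x \<le> p t x \<and> p t x \<le> u * target t r w x"
    proof cases
      case 1
      then have w: "0 < w" "t * psi1 n w = - x" using lft by auto
      have "1 / r \<le> t * psi1 n w" using 1 r by (simp add: w field_simps)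
      from left[OF t r tr rr(2) w(1) this] have "k1 * left_target t w \<le> p t x" "p t x \<le> k2 * left_target t w" by (simp_all add: w)
      then have "l * left_target t w \<le> p t x \<and> p t x \<le> u * left_target t w"
        by (rule key[OF _ _ l(2) u(2)]) (simp add: left_target_def)
      then show ?thesis using 1 by (simp add: target_def)
    next
      case 2
      have x: "- 1 / r \<le> x" "x \<le> 1 / r" using 2 r by (auto simp: field_simps)
      have "\<Theta>2 * (1 / r) * x0 < 1" using rr r by (simp add: field_simps)
      then have "k3 * (t * psi n (1 / (1 / r)) / (1 / r)) \<le> p t x"
        using low[OF t r tr x(1), of "1 / r"] x(2) by simp
      then have "k3 * r \<le> p t x" using tr by simp
      moreover have "p t x \<le> (exp 2 / kappa) * r" by (rule p_upper_mid[OF rr(1) t tr x(2)])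
      ultimately have "l * r \<le> p t x \<and> p t x \<le> u * r"
        by (rule key[OF _ _ l(3) u(3)]) (use r in simp)
      then show ?thesis using 2 by (simp add: target_def)
    next
      case 3
      have x: "1 / r < x" using 3 r by (simp add: field_simps)
      have "0 < 1 / r" using r by simp
      then have x0': "0 < x" using x by linarith
      have "\<Theta> * (x * x0) < 1" using rgt 3 by (simp add: mult.assoc)
      moreover have xx0: "0 \<le> x * x0" using x0' params by simp
      moreover have "1 * (x * x0) \<le> \<Theta> * (x * x0)" by (rule mult_right_mono[OF Th(1) xx0])
      moreover have "\<Theta>2 * (x * x0) \<le> \<Theta> * (x * x0)" by (rule mult_right_mono[OF Th(3) xx0])
      ultimately have xx: "x * x0 < 1" "\<Theta>2 * x * x0 < 1" by (auto simp: mult.assoc)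
      have "- (1 / r) \<le> x" using x0' \<open>0 < 1 / r\<close> by linarith
      then have "- 1 / r \<le> x" by simp
      then have "k3 * (t * psi n (1 / x) / x) \<le> p t x"
        by (rule low[OF t r tr]) (use x xx in auto)
      moreover have "p t x \<le> k4 * (t * psi n (1 / x) / x)" by (rule up[OF t rr(1) tr x xx(1)])
      ultimately have "l * (t * psi n (1 / x) / x) \<le> p t x \<and> p t x \<le> u * (t * psi n (1 / x) / x)"
        by (rule key[OF _ _ l(3) u(4)]) (use x0' t psi_nonneg in simp)
      then show ?thesis using 3 by (simp add: target_def divide_inverse mult_ac)
    qed
  qed
qed

section \<open>The semigroup property\<close>

lemma line_exp1_integrable: "0 < t \<Longrightarrow> integrable lborel (line_exp n 0 t 1)"
  by (rule line_exp_integrable) (auto simp: expo_dom_def intro: osc_grows[OF levy_density_axioms zero_less_one])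

lemma inv_fourier_p: assumes t: "0 < t" shows "inv_fourier (line_exp n 0 t 1) x = of_real (exp (- x) * p t x)"
proof -
  have e: "complex_of_real (exp (- x)) * of_real (exp x) = 1"
    unfolding of_real_mult[symmetric] mult_exp_exp by simp
  have "inv_fourier (line_exp n 0 t 1) x = (of_real (exp (- x)) * of_real (exp x)) * inv_fourier (line_exp n 0 t 1) x" unfolding e by simp
  also have "\<dots> = of_real (exp (- x)) * of_real (p t x)"
    using inv_laplace_p[OF zero_less_one t, of x] by (simp add: inv_laplace_def mult.assoc)
  finally show ?thesis by simp
qed

lemma p_continuous: assumes t: "0 < t" shows "continuous_on UNIV (p t)"
proof -
  have eq: "p t = (\<lambda>x. exp x * Re (inv_fourier (line_exp n 0 t 1) x))"
    by (rule ext) (simp add: inv_fourier_p[OF t] mult.assoc[symmetric] mult_exp_exp)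
  show ?thesis
    by (subst eq) (intro continuous_intros continuous_inv_fourier line_exp1_integrable t)
qed

lemma p_measurable [measurable]: "0 < t \<Longrightarrow> p t \<in> borel_measurable borel"
  by (rule borel_measurable_continuous_onI[OF p_continuous])

text \<open>The tilt by \<open>exp (-x)\<close> corresponds to the line \<open>Re z =
  1\<close>.\<close>

lemma p_fourier: 
  assumes t: "0 < t" 
  shows "integrable lborel (\<lambda>x. exp (- x) * p t x)"
    and "(\<integral>x. of_real (exp (- x) * p t x) * iexp (- (v * x)) \<partial>lborel) = line_exp n 0 t 1 v"
proof -
  have B: "norm (line_exp n 0 t 1 u) \<le> exp (t * psi n 1)" for u
    using osc_nonneg[of 1 u] t by (simp add: norm_line_exp expo_dom_def)
  have nn: "inv_fourier (line_exp n 0 t 1) x \<in> \<real>\<^sub>\<ge>\<^sub>0" for x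
    unfolding inv_fourier_p[OF t] nonneg_Reals_of_real_iff using p_nonneg[OF t] by simp
  have dom: "expo_dom n 1" by (simp add: expo_dom_def)
  note inv = fourier_inversion_nonneg[OF line_exp1_integrable[OF t] isCont_line_exp[OF dom] B nn]
  show "integrable lborel (\<lambda>x. exp (- x) * p t x)" using inv(1) by (simp add: inv_fourier_p[OF t])
  show "(\<integral>x. of_real (exp (- x) * p t x) * iexp (- (v * x)) \<partial>lborel) = line_exp n 0 t 1 v"
    using inv(2)[of v] by (simp only: inv_fourier_p[OF t] mult.commute)
qed

lemma chapman_kolmogorov:
  assumes s: "0 < s" and t: "0 < t"
  shows "integrable lborel (\<lambda>y. p s y * p t (x - y))" and "p (s + t) x = (\<integral>y. p s y * p t (x - y) \<partial>lborel)"
proof -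
  let ?q = "\<lambda>y. exp (- y) * p s y"
  have st: "0 < s + t" using s t by simp
  have split: "p s y * p t (x - y) = exp x * (?q y * (exp (- (x - y)) * p t (x - y)))" for y
    by (simp add: exp_diff exp_minus)
  have bd: "\<bar>exp (- z) * p t z\<bar> \<le> (\<integral>u. norm (line_exp n 0 t 1 u) \<partial>lborel) / (2 * pi)" for z
  proof -
    have "\<bar>exp (- z) * p t z\<bar> = norm (inv_fourier (line_exp n 0 t 1) z)" unfolding inv_fourier_p[OF t] by (simp add: norm_mult abs_mult)
    then show ?thesis using norm_inv_fourier_le[OF line_exp1_integrable[OF t], of z] by simp
  qed
  have "integrable lborel (\<lambda>y. ?q y * (exp (- (x - y)) * p t (x - y)))"
  proof (rule Bochner_Integration.integrable_bound)
    show "integrable lborel (\<lambda>y. ?q y * ((\<integral>u. norm (line_exp n 0 t 1 u) \<partial>lborel) / (2 * pi)))"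
      using p_fourier(1)[OF s] by (rule integrable_mult_left)
    show "AE y in lborel. norm (?q y * (exp (- (x - y)) * p t (x - y))) \<le> norm (?q y * ((\<integral>u. norm (line_exp n 0 t 1 u) \<partial>lborel) / (2 * pi)))"
    proof (rule AE_I2)
      fix y
      have "\<bar>?q y\<bar> * \<bar>exp (- (x - y)) * p t (x - y)\<bar> \<le> \<bar>?q y\<bar> * \<bar>(\<integral>u. norm (line_exp n 0 t 1 u) \<partial>lborel) / (2 * pi)\<bar>"
        using bd[of "x - y"] by (intro mult_left_mono) (auto intro: order_trans)
      then show "norm (?q y * (exp (- (x - y)) * p t (x - y))) \<le> norm (?q y * ((\<integral>u. norm (line_exp n 0 t 1 u) \<partial>lborel) / (2 * pi)))"
        by (simp only: real_norm_def abs_mult)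
    qed
    show "(\<lambda>y. ?q y * (exp (- (x - y)) * p t (x - y))) \<in> borel_measurable lborel"
      using p_measurable[OF s] p_measurable[OF t] by measurable
  qed
  then show "integrable lborel (\<lambda>y. p s y * p t (x - y))" unfolding split by (rule integrable_mult_right)
  have h: "line_exp n 0 t 1 u * line_exp n 0 s 1 u = line_exp n 0 (s + t) 1 u" for u
    by (simp add: line_exp_def exp_add[symmetric] algebra_simps)
  have "inv_fourier (\<lambda>u. line_exp n 0 t 1 u * (\<integral>y. of_real (?q y) * iexp (- (u * y)) \<partial>lborel)) x = (\<integral>y. of_real (?q y) * inv_fourier (line_exp n 0 t 1) (x - y) \<partial>lborel)"
    by (rule inv_fourier_mult_transform) (auto intro: lborel.sigma_finite_measure_axioms p_fourier s line_exp1_integrable t)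
  then have "inv_fourier (line_exp n 0 (s + t) 1) x = (\<integral>y. of_real (?q y) * inv_fourier (line_exp n 0 t 1) (x - y) \<partial>lborel)"
    by (simp only: p_fourier(2)[OF s] h)
  then have "of_real (exp (- x) * p (s + t) x) = (\<integral>y. complex_of_real (?q y * (exp (- (x - y)) * p t (x - y))) \<partial>lborel)"
    by (simp only: inv_fourier_p[OF st] inv_fourier_p[OF t] of_real_mult)
  then have "exp (- x) * p (s + t) x = (\<integral>y. ?q y * (exp (- (x - y)) * p t (x - y)) \<partial>lborel)"
    by (simp only: integral_complex_of_real of_real_eq_iff)
  then have "exp x * (exp (- x) * p (s + t) x) = (\<integral>y. p s y * p t (x - y) \<partial>lborel)"
    unfolding split by (subst integral_mult_right_zero) simp
  then show "p (s + t) x = (\<integral>y. p s y * p t (x - y) \<partial>lborel)"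
    by (simp add: mult.assoc[symmetric] mult_exp_exp)
qed

lemma convolution_lower:
  assumes s: "0 < s" and t: "0 < t" and h: "0 \<le> h" and a: "0 \<le> a" and b: "0 \<le> b"
    and lo: "\<And>y. l \<le> y \<Longrightarrow> y \<le> l + h \<Longrightarrow> a \<le> p s y \<and> b \<le> p t (x - y)"
  shows "a * b * h \<le> p (s + t) x"
proof -
  have e: "emeasure lborel {l..l + h} = ennreal h" using h by simp
  have "a * b * h = (\<integral>y. indicator {l..l + h} y * (a * b) \<partial>lborel)" using h by simp
  also have "\<dots> \<le> (\<integral>y. p s y * p t (x - y) \<partial>lborel)"
  proof (rule integral_mono[OF _ chapman_kolmogorov(1)[OF s t]])
    show "integrable lborel (\<lambda>y. indicator {l..l + h} y * (a * b))"
      using e by (intro integrable_mult_left integrable_real_indicator) auto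
    fix y
    show "indicator {l..l + h} y * (a * b) \<le> p s y * p t (x - y)"
    proof (cases "y \<in> {l..l + h}")
      case True
      then have "a * b \<le> p s y * p t (x - y)" using lo[of y] a b by (intro mult_mono) auto
      then show ?thesis using True by simp
    next
      case False
      then have "indicator {l..l + h} y = (0::real)" by (simp add: indicator_def)
      then show ?thesis using p_nonneg[OF s, of y] p_nonneg[OF t, of "x - y"] by simp
    qed
  qed
  also have "\<dots> = p (s + t) x" by (rule chapman_kolmogorov(2)[OF s t, symmetric])
  finally show ?thesis .
qed

text \<open>Each convolution with \<open>p s\<close> widens the interval on which a lower bound is
  known by \<open>\<rho>/2\<close> on both sides.\<close>

lemma iterated_lower:
  assumes s: "0 < s" and \<rho>: "0 < \<rho>" and a: "0 \<le> a" and lo: "\<And>y. \<bar>y\<bar> \<le> \<rho> \<Longrightarrow> a \<le> p s y"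
  shows "\<bar>x\<bar> \<le> (real k + 2) * \<rho> / 2 \<Longrightarrow> a ^ Suc k * (\<rho> / 2) ^ k \<le> p (real (Suc k) * s) x"
proof (induction k arbitrary: x)
  case 0
  then show ?case using lo[of x] by simp
next
  case (Suc k)
  (* The first step y runs through [rho / 2, rho] if x >= 0 and through [-rho, -rho / 2] otherwise: it
     shifts x towards the origin by at least rho / 2. *)
  define l where "l = (if 0 \<le> x then \<rho> / 2 else - \<rho>)"
  define A where "A = (real k + 2) * \<rho> / 2"
  have k0: "\<rho> \<le> A" using \<rho> by (simp add: A_def field_simps)
  have eq: "(real (Suc k) + 2) * \<rho> / 2 = A + \<rho> / 2" by (simp add: A_def field_simps)
  have xA: "\<bar>x\<bar> \<le> A + \<rho> / 2" using Suc.prems unfolding eq .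
  have "a * (a ^ Suc k * (\<rho> / 2) ^ k) * (\<rho> / 2) \<le> p (s + real (Suc k) * s) x"
  proof (rule convolution_lower)
    fix y assume y: "l \<le> y" "y \<le> l + \<rho> / 2"
    have "\<bar>y\<bar> \<le> \<rho>" using y \<rho> by (auto simp: l_def split: if_splits)
    moreover have "\<bar>x - y\<bar> \<le> (real k + 2) * \<rho> / 2"
      unfolding A_def[symmetric] using y xA \<rho> k0 by (cases "0 \<le> x") (simp_all add: l_def abs_le_iff)
    ultimately show "a \<le> p s y \<and> a ^ Suc k * (\<rho> / 2) ^ k \<le> p (real (Suc k) * s) (x - y)"
      using lo Suc.IH by blast
  qed (use s a \<rho> in auto)
  then show ?case by (simp add: algebra_simps)
qed

section \<open>Times bounded away from zero\<close>

text \<open>Split \<open>t\<close> into \<open>N\<close> steps of length \<open>s\<close>, so short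
  that \<open>\<psi>\<^sup>-\<^sup>1(1/s)\<close> lies between \<open>\<Theta> x0\<close> and
  \<open>R\<close>; then \<open>p s\<close> is bounded below on \<open>[-1/R, 1/R]\<close>. With
  \<open>N\<close> of order \<open>e \<psi>(R)\<close>, the steps cover a distance of order \<open>e
  \<psi>(R) / R\<close>, which exceeds \<open>K\<close> for large \<open>R\<close> as
  \<open>\<psi>\<close> grows faster than linearly.\<close>

lemma p_pos_compact:
  assumes x0: "0 < x0" and e: "0 < e" "e \<le> T"
  shows "\<exists>k>0. \<forall>t x. e \<le> t \<longrightarrow> t \<le> T \<longrightarrow> \<bar>x\<bar> \<le> K \<longrightarrow> k \<le> p t x"
proof -
  obtain \<Theta> k1 where Th: "1 \<le> \<Theta>" "0 < k1" and
    low: "\<And>t r x y. 0 < t \<Longrightarrow> 0 < r \<Longrightarrow> t * psi n r = 1 \<Longrightarrow> - 1 / r \<le> x \<Longrightarrow> y = max x (1 / r) \<Longrightarrow> \<Theta> * y * x0 < 1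
      \<Longrightarrow> k1 * (t * psi n (1 / y) / y) \<le> p t x"
    using p_lower_right[of 1] by auto
  define R1 where "R1 = \<Theta> * x0"
  have R1: "0 < R1" using Th x0 by (simp add: R1_def)
  have T: "0 < T" using e by simp
  define B where "B = 4 * \<bar>K\<bar> / e + 2 / e + 2 * T * psi n R1 / e + 2"
  have pR1: "0 < psi n R1" by (rule psi_pos[OF R1])
  have B: "4 * \<bar>K\<bar> / e \<le> B" "2 / e \<le> B" "2 * T * psi n R1 / e < B" "0 < B"
    using e T pR1 by (auto simp: B_def add_nonneg_pos add_pos_nonneg)
  obtain R where R: "1 \<le> R" "B * R \<le> psi n R" using psi_superlinear[of 1 B] by auto
  have BR: "B \<le> psi n R" using R B mult_left_mono[of 1 R B] by linarith
  have ePsi: "2 \<le> e * psi n R" "2 * T * psi n R1 < e * psi n R" "4 * \<bar>K\<bar> * R \<le> e * psi n R"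
  proof -
    have "2 / e \<le> psi n R" "2 * T * psi n R1 / e < psi n R" using B BR by linarith+
    then show "2 \<le> e * psi n R" "2 * T * psi n R1 < e * psi n R" using e by (auto simp: field_simps)
    have "4 * \<bar>K\<bar> / e * R \<le> B * R" using B R by (intro mult_right_mono) auto
    then have "4 * \<bar>K\<bar> / e * R \<le> psi n R" using R by linarith
    then show "4 * \<bar>K\<bar> * R \<le> e * psi n R" using e by (simp add: field_simps)
  qed
  define N where "N = nat \<lfloor>e * psi n R\<rfloor>"
  have N: "real N \<le> e * psi n R" "e * psi n R < real N + 1" using ePsi by (auto simp: N_def)
  have "0 < real N" using N ePsi(1) by linarith
  then have N2: "e * psi n R / 2 \<le> real N" "0 < N" using N ePsi(1) by (linarith, simp)
  obtain k where k: "N = Suc k" using N2 by (cases N) auto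
  define a where "a = k1 * R1"
  have a: "0 < a" using Th R1 by (simp add: a_def)
  have \<rho>: "0 < 1 / R" using R by simp
  show ?thesis
  proof (rule exI[of _ "a ^ Suc k * (1 / R / 2) ^ k"], intro conjI allI impI)
    show "0 < a ^ Suc k * (1 / R / 2) ^ k" using a R by simp
    fix t x assume t: "e \<le> t" "t \<le> T" and x: "\<bar>x\<bar> \<le> K"
    have t0: "0 < t" using t e by linarith
    define s where "s = t / real N"
    have s: "0 < s" "real (Suc k) * s = t" using t0 N2 k by (auto simp: s_def)
    obtain r where r: "0 < r" "psi n r = 1 / s" using exists_psi_eq[of "1 / s"] s by auto
    have sr: "s * psi n r = 1" using r s by simp
    have Ns: "1 / s = real N / t" by (simp add: s_def)
    have rR: "r \<le> R"
    proof (rule ccontr)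
      assume "\<not> r \<le> R"
      then have "psi n R < psi n r" using R by (intro psi_strict_mono) auto
      also have "\<dots> = real N / t" using r Ns by simp
      also have "\<dots> \<le> real N / e" using t e by (intro divide_left_mono) auto
      also have "\<dots> \<le> psi n R" using N(1) e by (simp add: field_simps)
      finally show False by simp
    qed
    have rR1: "R1 < r"
    proof (rule ccontr)
      assume "\<not> R1 < r"
      then have "psi n r \<le> psi n R1" using r by (intro psi_mono) auto
      then have "real N / t \<le> psi n R1" using r Ns by simp
      moreover have "real N / T \<le> real N / t" using t t0 by (intro divide_left_mono) auto
      ultimately have "real N / T \<le> psi n R1" by linarith
      then have "real N \<le> T * psi n R1" using T by (simp add: pos_divide_le_eq mult.commute)
      then show False using N2 ePsi(2) by linarith
    qed
    have lo: "a \<le> p s y" if y: "\<bar>y\<bar> \<le> 1 / R" for y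
    proof -
      have "1 / R \<le> 1 / r" using rR r R by (intro divide_left_mono) auto
      then have y': "- (1 / r) \<le> y" "y \<le> 1 / r" using y by auto
      have "k1 * (s * psi n (1 / (1 / r)) / (1 / r)) \<le> p s y"
        by (rule low[OF s(1) r(1) sr]) (use y' rR1 r in \<open>auto simp: R1_def field_simps\<close>)
      then have "k1 * r \<le> p s y" using sr by simp
      moreover have "k1 * R1 \<le> k1 * r" using Th rR1 by simp
      ultimately show ?thesis by (simp add: a_def)
    qed
    have "4 * \<bar>K\<bar> * R \<le> 2 * real N" using ePsi(3) N2 by linarith
    then have "\<bar>K\<bar> \<le> real N / (2 * R)" using R by (simp add: field_simps)
    also have "\<dots> \<le> (real k + 2) / (2 * R)" using R k by (intro divide_right_mono) auto
    also have "\<dots> = (real k + 2) * (1 / R) / 2" by simp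
    finally have xk: "\<bar>x\<bar> \<le> (real k + 2) * (1 / R) / 2" using x by linarith
    have "a ^ Suc k * (1 / R / 2) ^ k \<le> p (real (Suc k) * s) x"
      by (rule iterated_lower[OF s(1) \<rho> _ lo xk]) (use a in auto)
    then show "a ^ Suc k * (1 / R / 2) ^ k \<le> p t x" using s by simp
  qed
qed

text \<open>A fixed line \<open>Re z = W\<close> with \<open>e \<psi>(W) \<ge> 1\<close> serves all
  times in \<open>[e,T]\<close>.\<close>

lemma p_bounded_compact:
  assumes e: "0 < e" "e \<le> T"
  shows "\<exists>k>0. \<forall>t x. e \<le> t \<longrightarrow> t \<le> T \<longrightarrow> x \<le> K \<longrightarrow> p t x \<le> k"
proof -
  obtain W where W: "x0 + 1 \<le> W" "1 / e * W \<le> psi n W" using psi_superlinear[of "x0 + 1" "1 / e"] by auto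
  have W0: "x0 < W" "1 \<le> W" using W params by auto
  have eW: "1 \<le> e * psi n W"
  proof -
    have "1 * W \<le> e * psi n W" using W(2) e by (simp add: field_simps)
    then show ?thesis using W0 by linarith
  qed
  have T: "0 < T" using e by simp
  show ?thesis
  proof (rule exI[of _ "exp (W * K + T * psi n W) * W / kappa"], intro conjI allI impI)
    show "0 < exp (W * K + T * psi n W) * W / kappa" using W0 kappa_pos by simp
    fix t x assume t: "e \<le> t" "t \<le> T" and x: "x \<le> K"
    have t0: "0 < t" using t e by linarith
    have "e * psi n W \<le> t * psi n W" using t psi_nonneg[of W] by (intro mult_right_mono) auto
    then have a: "1 \<le> t * psi n W" using eW by linarith
    have s1: "1 \<le> sqrt (t * psi n W)" using a by simp
    have "p t x \<le> exp (W * x + t * psi n W) * W / (kappa * sqrt (t * psi n W))" by (rule p_upper_saddle[OF W0(1) t0 a])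
    also have "\<dots> \<le> exp (W * K + T * psi n W) * W / (kappa * 1)"
    proof (rule frac_le)
      have "W * x + t * psi n W \<le> W * K + T * psi n W"
        using x t W0 psi_nonneg[of W] by (intro add_mono mult_left_mono mult_right_mono) auto
      then show "exp (W * x + t * psi n W) * W \<le> exp (W * K + T * psi n W) * W" using W0 by (intro mult_right_mono) auto
      show "kappa * 1 \<le> kappa * sqrt (t * psi n W)" using s1 kappa_pos by (intro mult_left_mono) auto
    qed (use W0 kappa_pos in auto)
    finally show "p t x \<le> exp (W * K + T * psi n W) * W / kappa" by simp
  qed
qed

text \<open>The bound on \<open>r\<close> keeps \<open>t\<close> away from zero. Saddle points above
  \<open>W\<close> satisfy \<open>t \<psi>(w) \<ge> M\<close>, so that \<open>left_saddle\<close>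
  applies. For the others \<open>x\<close> stays in a compact interval, \<open>w\<close> in
  \<open>[w1,W]\<close> and \<open>r\<close> in \<open>[r0, \<Theta> x0]\<close>, and both sides of
  the estimate are bounded above and below.\<close>

lemma local_estimate:
  assumes x0: "0 < x0" and Th: "1 \<le> \<Theta>" and T: "0 < T"
  shows "\<exists>k1>0. \<exists>k2>0. \<forall>t r w x. 0 < t \<longrightarrow> t \<le> T \<longrightarrow> 0 < r \<longrightarrow> t * psi n r = 1 \<longrightarrow> r \<le> \<Theta> * x0 \<longrightarrow>
     (x * r \<le> -1 \<longrightarrow> 0 < w \<and> t * psi1 n w = - x) \<longrightarrow> x * r \<le> 1 \<longrightarrow>
     k1 * target t r w x \<le> p t x \<and> p t x \<le> k2 * target t r w x"
proof -
  define R1 where "R1 = \<Theta> * x0"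
  have R1: "0 < R1" using Th x0 by (simp add: R1_def)
  define e where "e = min T (1 / psi n R1)"
  have e: "0 < e" "e \<le> T" using T psi_pos[OF R1] by (auto simp: e_def)
  obtain M k1 k2 where M: "1 \<le> M" "0 < k1" "0 < k2" and
    sad: "\<And>t w. 0 < t \<Longrightarrow> x0 < w \<Longrightarrow> M \<le> t * psi n w \<Longrightarrow>
     k1 * left_target t w \<le> p t (- (t * psi1 n w)) \<and> p t (- (t * psi1 n w)) \<le> k2 * left_target t w" using left_saddle by blast
  obtain W where W: "x0 + 1 \<le> W" "M / e * W \<le> psi n W" using psi_superlinear[of "x0 + 1" "M / e"] by auto
  have W0: "x0 < W" "1 \<le> W" "0 < W" using W params by auto
  have eW: "M \<le> e * psi n W"
  proof -
    have "M * W \<le> e * psi n W" using W(2) e by (simp add: field_simps)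
    moreover have "M * 1 \<le> M * W" using W0 M by (intro mult_left_mono) auto
    ultimately show ?thesis by linarith
  qed
  obtain r0 where r0: "0 < r0" "psi n r0 = 1 / T" using exists_psi_eq[of "1 / T"] T by auto
  (* A saddle point with x r <= -1 has t * psi1 n w >= 1 / r, hence psi1 n w >= eta; this bounds w from
     below by w1. *)
  define \<eta> where "\<eta> = 1 / (R1 * T)"
  have \<eta>: "0 < \<eta>" using R1 T by (simp add: \<eta>_def)
  obtain w1 where w1: "0 < w1" "psi1 n w1 < \<eta>"
  proof -
    have "\<forall>\<^sub>F v in at_right 0. psi1 n v < \<eta>" using order_tendstoD(2)[OF psi1_tendsto_0 \<eta>] .
    then obtain b where "0 < b" "\<And>v. 0 < v \<Longrightarrow> v < b \<Longrightarrow> psi1 n v < \<eta>" by (auto simp: eventually_at_right_field)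
    then have "psi1 n (b / 2) < \<eta>" "0 < b / 2" by auto
    then show ?thesis using that by blast
  qed
  define K where "K = T * psi1 n W + 1 / r0"
  have pW: "0 \<le> psi1 n W" using W0 by (intro psi1_nonneg) auto
  obtain lo where lo: "0 < lo" "\<And>t x. e \<le> t \<Longrightarrow> t \<le> T \<Longrightarrow> \<bar>x\<bar> \<le> K \<Longrightarrow> lo \<le> p t x"
    using p_pos_compact[OF x0 e, of K] by blast
  obtain hi where hi: "0 < hi" "\<And>t x. e \<le> t \<Longrightarrow> t \<le> T \<Longrightarrow> x \<le> K \<Longrightarrow> p t x \<le> hi"
    using p_bounded_compact[OF e, of K] by blast
  define qh where "qh = max R1 ((e * psi2 n W) powr (- 1 / 2))"
  define ql where "ql = min r0 ((T * psi2 n w1) powr (- 1 / 2) * exp (- (4 * T * psi n W)))"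
  have pp: "0 < psi2 n W" "0 < psi2 n w1" by (intro psi2_pos psi_pos W0 w1)+
  have q0: "0 < qh" "0 < ql" using R1 r0 pp T by (auto simp: qh_def ql_def less_max_iff_disj)
  define l where "l = min k1 (lo / qh)"
  define u where "u = max k2 (hi / ql)"
  have l0: "0 < l" and u0: "0 < u" using M lo q0 by (auto simp: l_def u_def less_max_iff_disj)
  have key: "l * q \<le> P \<and> P \<le> u * q" if "lo \<le> P" "P \<le> hi" "ql \<le> q" "q \<le> qh" for q P
  proof
    have q: "0 \<le> q" using that q0 by linarith
    have "l * q \<le> lo / qh * qh" using that q q0 lo l0 by (intro mult_mono) (auto simp: l_def)
    then show "l * q \<le> P" using that q0 by simp
    have "hi / ql * ql \<le> u * q" using that q0 hi u0 by (intro mult_mono) (auto simp: u_def)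
    then show "P \<le> u * q" using that q0 by simp
  qed
  show ?thesis
  proof (rule exI[of _ l], rule conjI[OF l0], rule exI[of _ u], rule conjI[OF u0], intro allI impI)
    fix t r w x
    assume t: "0 < t" "t \<le> T" and r: "0 < r" and tr: "t * psi n r = 1" and rR: "r \<le> \<Theta> * x0" 
      and lft: "x * r \<le> -1 \<longrightarrow> 0 < w \<and> t * psi1 n w = - x" and xr: "x * r \<le> 1"
    have psir: "psi n r = 1 / t" using tr t by (simp add: field_simps)
    have te: "e \<le> t"
    proof -
      have "1 / t \<le> psi n R1" using psi_mono[OF r, of R1] rR psir by (simp add: R1_def)
      then have "1 / psi n R1 \<le> t" using t psi_pos[OF R1] by (simp add: field_simps)
      then show ?thesis by (simp add: e_def)
    qed
    have rr0: "r0 \<le> r"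
    proof (rule ccontr)
      assume "\<not> r0 \<le> r"
      then have "psi n r < psi n r0" using r by (intro psi_strict_mono) auto
      moreover have "1 / T \<le> 1 / t" using t by (intro divide_left_mono) auto
      ultimately show False using psir r0 by simp
    qed
    have ir: "1 / r \<le> 1 / r0" using rr0 r0 r by (intro divide_left_mono) auto
    have TW: "0 \<le> T * psi1 n W" using T pW by simp
    show "l * target t r w x \<le> p t x \<and> p t x \<le> u * target t r w x"
    proof (cases "x * r \<le> -1")
      case True
      then have w: "0 < w" "t * psi1 n w = - x" using lft by auto
      have x_neg: "x \<le> K" 
      proof -
        have "x \<le> 0" using psi1_nonneg[of w] w t mult_nonneg_nonneg[of t "psi1 n w"] by linarith
        then show ?thesis using TW r0 by (simp add: K_def add_nonneg_nonneg order_trans)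
      qed
      have q: "target t r w x = left_target t w" using True by (simp add: target_def)
      show ?thesis
      proof (cases "w \<le> W")
        case False
        have "e * psi n W \<le> t * psi n w"
          using te e t psi_mono[of W w] False W0 psi_nonneg[of W] by (intro mult_mono) auto
        then have "M \<le> t * psi n w" using eW by linarith
        then have "k1 * left_target t w \<le> p t x" "p t x \<le> k2 * left_target t w"
          using sad[OF t(1), of w] False W0 w(2) by auto
        moreover have "l * left_target t w \<le> k1 * left_target t w" "k2 * left_target t w \<le> u * left_target t w"
          by (auto simp: l_def u_def left_target_def intro!: mult_right_mono)
        ultimately show ?thesis unfolding q by linarith
      next
        case True
        have "t * psi1 n w \<le> T * psi1 n W"
          using t psi1_mono[OF w(1) True] psi1_nonneg[of w] w(1) by (intro mult_mono) auto
        then have "- x \<le> T * psi1 n W" using w by simp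
        moreover have "0 \<le> 1 / r0" using r0 by simp
        ultimately have "\<bar>x\<bar> \<le> K" using x_neg unfolding K_def by linarith
        then have P: "lo \<le> p t x" "p t x \<le> hi" using lo(2)[OF te t(2)] hi(2)[OF te t(2) x_neg] by auto
        have ww1: "w1 \<le> w"
        proof (rule ccontr)
          assume "\<not> w1 \<le> w"
          then have "psi1 n w \<le> psi1 n w1" using w by (intro psi1_mono) auto
          then have "psi1 n w < \<eta>" using w1 by linarith
          then have "psi1 n w * (R1 * T) < 1" using R1 T by (simp add: \<eta>_def field_simps)
          moreover have "r * (t * psi1 n w) \<le> R1 * (T * psi1 n w)"
            using r rR t psi1_nonneg[of w] w(1) R1 T by (intro mult_mono mult_right_mono) (auto simp: R1_def)
          moreover have "1 \<le> r * (t * psi1 n w)" using \<open>x * r \<le> -1\<close> unfolding w(2) by (simp add: mult.commute)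
          ultimately show False by (simp add: mult_ac)
        qed
        have p2: "psi2 n W \<le> psi2 n w" "psi2 n w \<le> psi2 n w1" 
          using psi2_antimono[OF w(1) True] psi2_antimono[OF w1(1) ww1] by auto
        have t2: "e * psi2 n W \<le> t * psi2 n w" "t * psi2 n w \<le> T * psi2 n w1"
          using p2 te t e pp psi2_nonneg[of w] by (auto intro!: mult_mono)
        have pos2: "0 < e * psi2 n W" "0 < t * psi2 n w" using e pp t psi2_pos[OF w(1) psi_pos[OF w(1)]] by auto
        have pw: "(t * psi2 n w) powr (- 1 / 2) \<le> (e * psi2 n W) powr (- 1 / 2)"
          "(T * psi2 n w1) powr (- 1 / 2) \<le> (t * psi2 n w) powr (- 1 / 2)"
          using t2 pos2 by (auto intro!: powr_mono2')
        have e1: "exp (- t * (w * psi1 n w - psi n w)) \<le> 1"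
          using psi_le_psi1[OF w(1)] t by (simp add: mult_nonneg_nonneg)
        have e2: "exp (- (4 * T * psi n W)) \<le> exp (- t * (w * psi1 n w - psi n w))"
        proof -
          have "t * (w * psi1 n w - psi n w) \<le> t * (4 * psi n w)"
            using psi1_le_psi[OF w(1)] psi_nonneg[of w] t by (intro mult_left_mono) auto
          also have "\<dots> \<le> T * (4 * psi n W)" using t psi_mono[OF w(1) True] psi_nonneg[of w] T by (intro mult_mono) auto
          finally show ?thesis by simp
        qed
        have "left_target t w \<le> (e * psi2 n W) powr (- 1 / 2) * 1"
          unfolding left_target_def using pw(1) e1 by (intro mult_mono) auto
        then have qu: "left_target t w \<le> qh" by (simp add: qh_def)
        have "(T * psi2 n w1) powr (- 1 / 2) * exp (- (4 * T * psi n W)) \<le> left_target t w"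
          unfolding left_target_def using pw(2) e2 by (intro mult_mono) auto
        then have "ql \<le> left_target t w" by (simp add: ql_def)
        then show ?thesis unfolding q by (intro key P qu)
      qed
    next
      case False
      have q: "target t r w x = r" using False xr by (simp add: target_def)
      have "- (1 / r) \<le> x" "x \<le> 1 / r" using False xr r by (auto simp: field_simps)
      then have "\<bar>x\<bar> \<le> K" "x \<le> K" using ir TW unfolding K_def by linarith+
      then have "lo \<le> p t x" "p t x \<le> hi" using lo(2)[OF te t(2)] hi(2)[OF te t(2)] by auto
      moreover have "ql \<le> r" "r \<le> qh" using rr0 rR by (auto simp: ql_def qh_def R1_def)
      ultimately show ?thesis unfolding q by (intro key)
    qed
  qed
qed

end

section \<open>Identification of the law\<close>

text \<open>For positive \<open>x\<close> the exponential absorbs the factor \<open>x\<close>; for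
  negative \<open>x\<close> the factor is absorbed by a slightly larger exponential moment.\<close>

lemma mult_exp_bound: 
  fixes x :: real
  assumes "0 < a" "a \<le> s" "s \<le> b" 
  shows "\<bar>x\<bar> * exp (- (s * x)) \<le> 1 / a + exp (- ((b + 1) * x))"
proof (cases "0 \<le> x")
  case True
  have "(a * x) * exp (- (a * x)) \<le> 1" using assms True by (intro mult_exp_minus_le) auto
  then have "x * exp (- (a * x)) \<le> 1 / a" using assms by (simp add: field_simps)
  moreover have "x * exp (- (s * x)) \<le> x * exp (- (a * x))" using assms True by (intro mult_left_mono) (auto intro: mult_right_mono)
  ultimately show ?thesis using True by (simp add: add_increasing2)
next
  case False
  have "\<bar>x\<bar> * exp (- (s * x)) \<le> exp \<bar>x\<bar> * exp (b * \<bar>x\<bar>)"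
  proof (intro mult_mono)
    show "\<bar>x\<bar> \<le> exp \<bar>x\<bar>" using exp_ge_add_one_self[of "\<bar>x\<bar>"] by linarith
    have "s * \<bar>x\<bar> \<le> b * \<bar>x\<bar>" using assms by (intro mult_right_mono) auto
    then show "exp (- (s * x)) \<le> exp (b * \<bar>x\<bar>)" using False by simp
  qed auto
  also have "\<dots> = exp (- ((b + 1) * x))" using False by (simp add: mult_exp_exp algebra_simps)
  finally show ?thesis using assms by (simp add: add_increasing)
qed

lemma (in prob_space) complex_laplace_holomorphic:
  assumes Y[measurable]: "Y \<in> borel_measurable M" and int: "\<And>u. 0 \<le> u \<Longrightarrow> integrable M (\<lambda>\<omega>. exp (- u * Y \<omega>))"
  shows "(\<lambda>z. \<integral>\<omega>. exp (- (z * of_real (Y \<omega>))) \<partial>M) holomorphic_on {z. 0 < Re z}"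
    and "0 \<le> Re z \<Longrightarrow> integrable M (\<lambda>\<omega>. exp (- (z * of_real (Y \<omega>))))"
proof -
  show i: "integrable M (\<lambda>\<omega>. exp (- (z * of_real (Y \<omega>))))" if "0 \<le> Re z" for z
    by (rule Bochner_Integration.integrable_bound[OF int[OF that]]) auto
  show "(\<lambda>z. \<integral>\<omega>. exp (- (z * of_real (Y \<omega>))) \<partial>M) holomorphic_on {z. 0 < Re z}"
    unfolding holomorphic_on_def
  proof
    fix z :: complex assume "z \<in> {z. 0 < Re z}"
    then have z: "0 < Re z" by simp
    let ?S = "{w. Re z / 2 < Re w} \<inter> {w. Re w < Re z + 1}"
    have "((\<lambda>w. \<integral>\<omega>. exp (- (w * of_real (Y \<omega>))) \<partial>M) has_field_derivative (\<integral>\<omega>. - (of_real (Y \<omega>) * exp (- (z * of_real (Y \<omega>)))) \<partial>M)) (at z)"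
    proof (rule has_field_derivative_integral[where S="?S" and D="\<lambda>\<omega>. 1 / (Re z / 2) + exp (- ((Re z + 1 + 1) * Y \<omega>))"])
      show "open ?S" by (intro open_Int open_halfspace_Re_gt open_halfspace_Re_lt)
      show "convex ?S" by (intro convex_Int convex_halfspace_Re_gt convex_halfspace_Re_lt)
      show "z \<in> ?S" using z by simp
      show "integrable M (\<lambda>\<omega>. 1 / (Re z / 2) + exp (- ((Re z + 1 + 1) * Y \<omega>)))"
      proof (rule Bochner_Integration.integrable_add)
        have "0 \<le> Re z + 1 + 1" using z by simp
        from int[OF this] show "integrable M (\<lambda>\<omega>. exp (- ((Re z + 1 + 1) * Y \<omega>)))" by (simp only: mult_minus_left)
      qed simp
      fix x \<omega> assume x: "x \<in> ?S"
      show "integrable M (\<lambda>\<omega>. exp (- (x * of_real (Y \<omega>))))" by (rule i) (use x z in auto)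
      show "((\<lambda>x. exp (- (x * of_real (Y \<omega>)))) has_field_derivative - (of_real (Y \<omega>) * exp (- (x * of_real (Y \<omega>))))) (at x)"
        by (auto intro!: derivative_eq_intros)
      show "norm (- (complex_of_real (Y \<omega>) * exp (- (x * of_real (Y \<omega>))))) \<le> 1 / (Re z / 2) + exp (- ((Re z + 1 + 1) * Y \<omega>))"
        using mult_exp_bound[of "Re z / 2" "Re x" "Re z + 1" "Y \<omega>"] x z unfolding norm_minus_cancel norm_mult by simp
    qed measurable
    then show "(\<lambda>z. \<integral>\<omega>. exp (- (z * of_real (Y \<omega>))) \<partial>M) field_differentiable at z within {z. 0 < Re z}"
      using field_differentiable_at_within field_differentiable_def by blast
  qed
qed

text \<open>Both sides are holomorphic in the right half-plane and agree on the positive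
  reals.\<close>

lemma (in levy_density) complex_laplace:
  assumes M: "prob_space M" and Y: "Y \<in> borel_measurable M"
    and int: "\<And>u. 0 \<le> u \<Longrightarrow> integrable M (\<lambda>\<omega>. exp (- u * Y \<omega>))"
    and eq: "\<And>u. 0 \<le> u \<Longrightarrow> (\<integral>\<omega>. exp (- u * Y \<omega>) \<partial>M) = exp (t * psi n u)"
    and z: "0 < Re z"
  shows "(\<integral>\<omega>. exp (- (z * of_real (Y \<omega>))) \<partial>M) = exp (of_real t * cpsi n z)"
proof -
  interpret prob_space M by fact
  let ?H = "{z. 0 < Re z}"
  let ?f = "\<lambda>z. (\<integral>\<omega>. exp (- (z * of_real (Y \<omega>))) \<partial>M) - exp (of_real t * cpsi n z)"
  have "?f z = 0"
  proof (rule analytic_continuation[where f="?f" and w=z and S="?H" and U="complex_of_real ` {0<..}" and \<xi>=1])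
    show "?f holomorphic_on ?H"
      by (intro holomorphic_intros complex_laplace_holomorphic Y int holomorphic_cpsi) (auto simp: expo_dom_def)
    show "open ?H" by (rule open_halfspace_Re_gt)
    show "connected ?H" by (intro convex_connected convex_halfspace_Re_gt)
    show "1 islimpt complex_of_real ` {0<..}"
    proof (rule islimpt_sequential[THEN iffD2], rule exI[of _ "\<lambda>k. complex_of_real (1 + inverse (real (Suc k)))"], intro conjI allI)
      let ?x = "\<lambda>k. complex_of_real (1 + inverse (real (Suc k)))"
      show "?x k \<in> complex_of_real ` {0<..} - {1}" for k
      proof -
        have "0 < inverse (real (Suc k))" by simp
        then have "0 < 1 + inverse (real (Suc k))" "1 + inverse (real (Suc k)) \<noteq> 1" by linarith+
        then show ?thesis by (metis DiffI greaterThan_iff image_eqI of_real_1 of_real_eq_iff singletonD)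
      qed
      have "(\<lambda>k. 1 + inverse (real (Suc k))) \<longlonglongrightarrow> 1 + 0" by (intro tendsto_intros LIMSEQ_inverse_real_of_nat)
      then have "?x \<longlonglongrightarrow> complex_of_real (1 + 0)" by (rule tendsto_of_real)
      then show "?x \<longlonglongrightarrow> 1" by simp
    qed
    fix w assume "w \<in> complex_of_real ` {0<..}"
    then obtain u where u: "0 < u" "w = of_real u" by auto
    have "(\<integral>\<omega>. exp (- (w * of_real (Y \<omega>))) \<partial>M) = (\<integral>\<omega>. complex_of_real (exp (- u * Y \<omega>)) \<partial>M)"
      unfolding u by (simp add: exp_of_real[symmetric])
    also have "\<dots> = of_real (exp (t * psi n u))" unfolding integral_complex_of_real using eq[of u] u by simp
    finally show "?f w = 0" using u cpsi_of_real[of u] by (simp add: expo_dom_def exp_of_real[symmetric])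
  qed (use z in auto)
  then show ?thesis by simp
qed

text \<open>The transforms are known for \<open>Re z > 0\<close>, not on the imaginary axis. Hence
  the uniqueness theorem for characteristic functions is applied to the law of \<open>Y\<close> and
  to \<open>p t\<close> after tilting both by \<open>exp (-x) / Z\<close>, where \<open>Z\<close>
  normalises them to probability measures; the tilt is undone afterwards.\<close>

lemma (in scaling_density) distributed_p:
  assumes M: "prob_space M" and Y[measurable]: "Y \<in> borel_measurable M" and t: "0 < t"
    and int: "\<And>u. 0 \<le> u \<Longrightarrow> integrable M (\<lambda>\<omega>. exp (- u * Y \<omega>))"
    and eq: "\<And>u. 0 \<le> u \<Longrightarrow> (\<integral>\<omega>. exp (- u * Y \<omega>) \<partial>M) = exp (t * psi n u)"
  shows "distributed M lborel Y (\<lambda>x. ennreal (p t x))"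
proof -
  interpret prob_space M by fact
  define L where "L = distr M borel Y"
  have [measurable_cong]: "sets L = sets borel" by (simp add: L_def)
  have [measurable]: "p t \<in> borel_measurable borel" by (rule p_measurable[OF t])
  define Z where "Z = exp (t * psi n 1)"
  have Z: "0 < Z" by (simp add: Z_def)
  have cZ: "cpsi n 1 = of_real (psi n 1)" using cpsi_of_real[of 1] by (simp add: expo_dom_def)
  define M1 where "M1 = density L (\<lambda>x. ennreal (exp (- x) / Z))"
  define M2 where "M2 = density lborel (\<lambda>x. ennreal (exp (- x) * p t x / Z))"
  have four: "(\<integral>x. of_real (exp (- x) / Z) * iexp (v * x) \<partial>L) = line_exp n 0 t 1 (- v) / Z" for v
  proof -
    have "(\<integral>x. of_real (exp (- x) / Z) * iexp (v * x) \<partial>L) = (\<integral>\<omega>. of_real (exp (- Y \<omega>) / Z) * iexp (v * Y \<omega>) \<partial>M)"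
      unfolding L_def by (subst integral_distr) auto
    also have "\<dots> = (\<integral>\<omega>. exp (- (Complex 1 (- v) * of_real (Y \<omega>))) / Z \<partial>M)"
      by (intro Bochner_Integration.integral_cong) (auto simp: Complex_eq exp_of_real[symmetric] exp_add[symmetric] algebra_simps mult_exp_exp)
    also have "\<dots> = (\<integral>\<omega>. exp (- (Complex 1 (- v) * of_real (Y \<omega>))) \<partial>M) / Z" by simp
    also have "\<dots> = line_exp n 0 t 1 (- v) / Z"
      using complex_laplace[OF M Y int eq, of "Complex 1 (- v)"] by (simp add: line_exp_def)
    finally show ?thesis .
  qed
  have four2: "(\<integral>x. of_real (exp (- x) * p t x / Z) * iexp (v * x) \<partial>lborel) = line_exp n 0 t 1 (- v) / Z" for v
  proof -
    have "(\<integral>x. of_real (exp (- x) * p t x / Z) * iexp (v * x) \<partial>lborel) = (\<integral>x. of_real (exp (- x) * p t x) * iexp (- ((- v) * x)) / Z \<partial>lborel)"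
      by (intro Bochner_Integration.integral_cong) auto
    also have "\<dots> = (\<integral>x. of_real (exp (- x) * p t x) * iexp (- ((- v) * x)) \<partial>lborel) / Z" by (rule integral_divide_zero)
    also have "\<dots> = line_exp n 0 t 1 (- v) / Z" unfolding p_fourier(2)[OF t] ..
    finally show ?thesis .
  qed
  have h0: "line_exp n 0 t 1 0 = of_real Z" by (simp add: line_exp_def Z_def Complex_eq cZ exp_of_real[symmetric])
  have p0: "0 \<le> p t x" for x by (rule p_nonneg[OF t])
  have total1: "emeasure M1 (space M1) = 1"
  proof -
    have iL: "integrable L (\<lambda>x. exp (- x) / Z)" unfolding L_def using int[of 1] by (subst integrable_distr_eq) auto
    have "complex_of_real (\<integral>x. exp (- x) / Z \<partial>L) = 1"
      using four[of 0] h0 Z by (simp flip: integral_complex_of_real)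
    then have "(\<integral>x. exp (- x) / Z \<partial>L) = 1" by (simp only: of_real_eq_1_iff)
    then have "(\<integral>\<^sup>+x. ennreal (exp (- x) / Z) \<partial>L) = 1" using Z by (subst nn_integral_eq_integral[OF iL]) auto
    then show ?thesis unfolding M1_def by (simp add: emeasure_density cong: nn_integral_cong)
  qed
  have total2: "emeasure M2 (space M2) = 1"
  proof -
    have iL: "integrable lborel (\<lambda>x. exp (- x) * p t x / Z)" using p_fourier(1)[OF t] by (rule integrable_divide_zero)
    have "complex_of_real (\<integral>x. exp (- x) * p t x / Z \<partial>lborel) = (\<integral>x. of_real (exp (- x) * p t x / Z) * iexp (0 * x) \<partial>lborel)"
      unfolding integral_complex_of_real[symmetric] by simp
    also have "\<dots> = 1" unfolding four2 using h0 Z by simp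
    finally have "(\<integral>x. exp (- x) * p t x / Z \<partial>lborel) = 1" by (simp only: of_real_eq_1_iff)
    then have "(\<integral>\<^sup>+x. ennreal (exp (- x) * p t x / Z) \<partial>lborel) = 1" using Z p0 by (subst nn_integral_eq_integral[OF iL]) auto
    then show ?thesis unfolding M2_def by (simp add: emeasure_density cong: nn_integral_cong)
  qed
  have "M1 = M2"
  proof (rule Levy_uniqueness)
    show "real_distribution M1"
      by (intro real_distribution.intro prob_spaceI total1 real_distribution_axioms.intro) (auto simp: M1_def L_def)
    show "real_distribution M2"
      by (intro real_distribution.intro prob_spaceI total2 real_distribution_axioms.intro) (auto simp: M2_def)
    show "char M1 = char M2"
    proof
      fix v
      have "char M1 v = (\<integral>x. (exp (- x) / Z) *\<^sub>R iexp (v * x) \<partial>L)"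
        unfolding char_def M1_def using Z by (subst integral_density) auto
      also have "\<dots> = line_exp n 0 t 1 (- v) / Z" using four[of v] by (simp add: scaleR_conv_of_real)
      finally have 1: "char M1 v = line_exp n 0 t 1 (- v) / Z" .
      have "char M2 v = (\<integral>x. (exp (- x) * p t x / Z) *\<^sub>R iexp (v * x) \<partial>lborel)"
        unfolding char_def M2_def using Z p0 by (subst integral_density) auto
      also have "\<dots> = line_exp n 0 t 1 (- v) / Z" using four2[of v] by (simp add: scaleR_conv_of_real)
      finally show "char M1 v = char M2 v" using 1 by simp
    qed
  qed
  then have "density M1 (\<lambda>x. ennreal (Z * exp x)) = density M2 (\<lambda>x. ennreal (Z * exp x))" by simp
  moreover have "density M1 (\<lambda>x. ennreal (Z * exp x)) = L"
  proof -
    have "density M1 (\<lambda>x. ennreal (Z * exp x)) = density L (\<lambda>x. ennreal (exp (- x) / Z) * ennreal (Z * exp x))"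
      unfolding M1_def by (rule density_density_eq) auto
    also have "\<dots> = density L (\<lambda>x. 1)"
      using Z by (intro density_cong) (auto simp: ennreal_mult[symmetric] exp_minus)
    finally show ?thesis by (simp add: density_1)
  qed
  moreover have "density M2 (\<lambda>x. ennreal (Z * exp x)) = density lborel (\<lambda>x. ennreal (p t x))"
  proof -
    have "density M2 (\<lambda>x. ennreal (Z * exp x)) = density lborel (\<lambda>x. ennreal (exp (- x) * p t x / Z) * ennreal (Z * exp x))"
      unfolding M2_def by (rule density_density_eq) auto
    also have "\<dots> = density lborel (\<lambda>x. ennreal (p t x))"
      using Z p0 by (intro density_cong) (auto simp: ennreal_mult[symmetric] exp_minus field_simps)
    finally show ?thesis .
  qed
  ultimately have "L = density lborel (\<lambda>x. ennreal (p t x))" by simp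
  moreover have "distr M lborel Y = L" unfolding L_def by (rule distr_cong) auto
  ultimately show ?thesis unfolding distributed_def by simp
qed

lemma continuous_AE_eq:
  fixes f g :: "real \<Rightarrow> real"
  assumes f: "continuous_on UNIV f" and g: "continuous_on UNIV g" and ae: "AE x in lborel. f x = g x"
  shows "f = g"
proof (rule ext, rule ccontr)
  fix x assume ne: "f x \<noteq> g x"
  have "open {x. f x \<noteq> g x}" by (rule open_Collect_neq[OF f g])
  then obtain e where e: "0 < e" "ball x e \<subseteq> {x. f x \<noteq> g x}" using ne openE by blast
  have "AE y in lborel. y \<notin> ball x e" using ae by eventually_elim (use e in auto)
  then have "emeasure lborel (ball x e) = 0"
    by (subst (asm) AE_iff_measurable[where N="ball x e"]) auto
  then have "emeasure lborel {x - e<..<x + e} = 0" by (simp add: ball_eq_greaterThanLessThan)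
  then show False using e by simp
qed

lemma continuous_density_eq:
  assumes M: "prob_space M" and f: "continuous_on UNIV f" "\<And>x. 0 \<le> f x" and d: "distributed M lborel Y (\<lambda>x. ennreal (f x))"
  shows "continuous_density M Y = f"
  unfolding continuous_density_def
proof (rule the_equality)
  show "continuous_on UNIV f \<and> (\<forall>x. 0 \<le> f x) \<and> distributed M lborel Y (\<lambda>x. ennreal (f x))" using f d by simp
  fix g assume g: "continuous_on UNIV g \<and> (\<forall>x. 0 \<le> g x) \<and> distributed M lborel Y (\<lambda>x. ennreal (g x))"
  have [measurable]: "f \<in> borel_measurable borel" "g \<in> borel_measurable borel"
    using f g by (auto intro: borel_measurable_continuous_onI)
  have "density lborel (\<lambda>x. ennreal (g x)) = density lborel (\<lambda>x. ennreal (f x))"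
    using d g by (simp add: distributed_def)
  then have "AE x in lborel. ennreal (g x) = ennreal (f x)"
    by (intro sigma_finite_measure.density_unique[OF lborel.sigma_finite_measure_axioms]) auto
  then have "AE x in lborel. g x = f x" by eventually_elim (use f g in auto)
  then show "g = f" using f g by (intro continuous_AE_eq) auto
qed

section \<open>The Levy density of a process without Gaussian part\<close>

text \<open>For \<open>u > 0\<close> the derivative is \<open>\<phi>'(u) = -b +
  \<integral>\<^bsub>y<1\<^esub> y (1 - exp (-u y)) n(y) dy - \<integral>\<^bsub>y\<ge>1\<^esub> y
  exp (-u y) n(y) dy\<close>. As \<open>u\<close> decreases to zero, the left side and the first
  integral vanish, and the second integral increases to the first moment of the large jumps. So this
  moment is finite and equal to \<open>-b\<close>, which turns the exponent into the fully
  compensated one. That one is positive on \<open>(0,\<infinity>)\<close> because infinite variation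
  rules out \<open>n = 0\<close>.\<close>

lemma levy_density_of_characteristics:
  assumes ch: "has_characteristics M X \<phi> 0 b \<nu>" and uv: "unbounded_variation 0 \<nu>"
    and d0: "(deriv \<phi> \<longlongrightarrow> 0) (at_right 0)" and am: "has_almost_monotone_density \<nu>"
  obtains n C0 where "levy_density n" "\<And>u. 0 \<le> u \<Longrightarrow> \<phi> u = psi n u" "1 \<le> C0" 
    "\<And>x y. 0 < x \<Longrightarrow> x \<le> y \<Longrightarrow> n y \<le> C0 * n x" "\<And>v. 0 < v \<Longrightarrow> 0 < psi n v"
proof -
  obtain n0 C0 where n0[measurable]: "n0 \<in> borel_measurable borel" and n0_nn: "\<And>x. 0 < x \<Longrightarrow> 0 \<le> n0 x"
    and nu0: "\<nu> = density lborel (\<lambda>x. ennreal (n0 x) * indicator {0<..} x)" and C0: "1 \<le> C0"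
    and mono: "\<And>x y. 0 < x \<Longrightarrow> x \<le> y \<Longrightarrow> n0 y \<le> C0 * n0 x"
    using am unfolding has_almost_monotone_density_def by blast
  define n where "n y = (if 0 < y then n0 y else 0)" for y
  have n_m[measurable]: "n \<in> borel_measurable borel" unfolding n_def[abs_def] by measurable
  have n_nn: "0 \<le> n y" for y using n0_nn by (simp add: n_def)
  have n_z: "y \<le> 0 \<Longrightarrow> n y = 0" for y by (simp add: n_def)
  have nu: "\<nu> = density lborel (\<lambda>x. ennreal (n x))"
    unfolding nu0 by (rule density_cong) (auto simp: n_def indicator_def)
  define q where "q y = n y * min 1 (y\<^sup>2)" for y
  have q_m[measurable]: "q \<in> borel_measurable borel" unfolding q_def[abs_def] by measurable
  have q_nn: "0 \<le> q y" for y by (simp add: q_def n_nn)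
  have q_int: "integrable lborel q"
  proof (rule integrableI_nonneg)
    have "(\<integral>\<^sup>+x. ennreal (q x) \<partial>lborel) = (\<integral>\<^sup>+x\<in>{0<..}. ennreal (min 1 (x\<^sup>2)) \<partial>\<nu>)"
      unfolding nu by (subst nn_integral_density) (auto intro!: nn_integral_cong simp: q_def ennreal_mult n_nn n_z indicator_def)
    also have "\<dots> < \<infinity>" using ch unfolding has_characteristics_def positive_levy_measure_def by blast
    finally show "(\<integral>\<^sup>+x. ennreal (q x) \<partial>lborel) < \<infinity>" .
  qed (simp_all add: q_nn)
  let ?I = "\<lambda>y::real. if y < 1 then 1 else 0 :: real"
  let ?g = "\<lambda>u y. n y * (exp (- u * y) - 1 + u * y * ?I y)"
  have phi: "\<phi> u = - b * u + (\<integral>y. ?g u y \<partial>lborel)" if "0 \<le> u" for u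
  proof -
    have "(LINT x:{0<..}|\<nu>. (exp (- u * x) - 1 + u * x * ?I x)) = (\<integral>y. n y *\<^sub>R (indicator {0<..} y *\<^sub>R (exp (- u * y) - 1 + u * y * ?I y)) \<partial>lborel)"
      unfolding set_lebesgue_integral_def nu by (rule integral_density) (auto simp: n_nn)
    also have "\<dots> = (\<integral>y. ?g u y \<partial>lborel)"
      by (intro Bochner_Integration.integral_cong) (auto simp: n_z indicator_def)
    finally show ?thesis using ch that unfolding has_characteristics_def levy_khintchine_exponent_def by simp
  qed
  have g_int: "integrable lborel (?g u)" if "0 \<le> u" for u
  proof (rule Bochner_Integration.integrable_bound)
    show "integrable lborel (\<lambda>y. (u\<^sup>2 + 1) * q y)" using q_int by simp
    show "AE y in lborel. norm (?g u y) \<le> norm ((u\<^sup>2 + 1) * q y)"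
    proof (rule AE_I2)
      fix y
      have "\<bar>exp (- u * y) - 1 + u * y * ?I y\<bar> \<le> (u\<^sup>2 + 1) * min 1 (y\<^sup>2)" if y: "0 < y"
      proof (cases "y < 1")
        case True
        have y2: "y\<^sup>2 \<le> 1" using True y by (simp add: power_le_one)
        have "exp (- (u * y)) - 1 + u * y \<le> (u * y)\<^sup>2 / 2" using exp_remainder_le_quadratic[of "u * y"] that y \<open>0 \<le> u\<close> by simp
        also have "\<dots> \<le> (u\<^sup>2 + 1) * y\<^sup>2" by (simp add: power_mult_distrib distrib_right)
        finally show ?thesis using True y2 exp_remainder_nonneg[of "u * y"] by (simp add: min_def)
      next
        case False
        have y2: "1 \<le> y\<^sup>2" using False by simp
        have "exp (- (u * y)) \<le> 1" using y \<open>0 \<le> u\<close> by simp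
        then have "\<bar>exp (- (u * y)) - 1\<bar> \<le> 1" using exp_ge_zero[of "- (u * y)"] by linarith
        then show ?thesis using False y2 by (simp add: min_def add_increasing)
      qed
      then have "n y * \<bar>exp (- u * y) - 1 + u * y * ?I y\<bar> \<le> n y * ((u\<^sup>2 + 1) * min 1 (y\<^sup>2))"
        using n_nn[of y] n_z[of y] by (cases "0 < y") (auto intro!: mult_left_mono)
      then show "norm (?g u y) \<le> norm ((u\<^sup>2 + 1) * q y)"
        using n_nn[of y] by (simp add: abs_mult q_def mult_ac)
    qed
  qed measurable
  have dphi: "(\<phi> has_real_derivative (- b + (\<integral>y. n y * (y * (?I y - exp (- u * y))) \<partial>lborel))) (at u)"
    and d_int: "integrable lborel (\<lambda>y. n y * (y * (?I y - exp (- u * y))))" if u: "0 < u" for u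
  proof -
    let ?c = "2 * u + 2 / u"
    have bd: "\<bar>n y * (y * (?I y - exp (- x * y)))\<bar> \<le> ?c * q y" if x: "u / 2 < x" "x < 2 * u" for x y
    proof (cases "0 < y")
      case True
      have "\<bar>y * (?I y - exp (- x * y))\<bar> \<le> ?c * min 1 (y\<^sup>2)"
      proof (cases "y < 1")
        case y1: True
        have y2: "y\<^sup>2 \<le> 1" using y1 True by (simp add: power_le_one)
        have xy: "0 \<le> x * y" using x u True by simp
        have "0 \<le> 1 - exp (- (x * y))" "1 - exp (- (x * y)) \<le> x * y" using xy exp_remainder_nonneg[of "x * y"] by auto
        then have "\<bar>y * (1 - exp (- (x * y)))\<bar> \<le> y * (x * y)" using True by (simp add: abs_mult)
        also have "\<dots> \<le> ?c * y\<^sup>2"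
        proof -
          have "x * y\<^sup>2 \<le> ?c * y\<^sup>2" using x u by (intro mult_right_mono) (auto intro: add_increasing2)
          then show ?thesis by (simp add: power2_eq_square mult_ac)
        qed
        finally show ?thesis using y1 y2 by (simp add: min_def)
      next
        case y1: False
        have y2: "1 \<le> y\<^sup>2" using y1 by simp
        have "(x * y) * exp (- (x * y)) \<le> 1" using x u True by (intro mult_exp_minus_le) auto
        then have "y * exp (- (x * y)) \<le> 1 / x" using x u by (simp add: field_simps)
        also have "\<dots> \<le> 1 / (u / 2)" using x u by (intro divide_left_mono) auto
        also have "\<dots> \<le> ?c" using u by simp
        finally have "y * exp (- (x * y)) \<le> ?c" .
        then show ?thesis using y1 y2 True by (simp add: min_def abs_mult)
      qed
      then have "n y * \<bar>y * (?I y - exp (- x * y))\<bar> \<le> n y * (?c * min 1 (y\<^sup>2))" using n_nn by (intro mult_left_mono) auto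
      then show ?thesis using n_nn[of y] by (simp add: abs_mult q_def mult_ac)
    next
      case False
      then show ?thesis using q_nn[of y] u by (simp add: n_z)
    qed
    show d_int: "integrable lborel (\<lambda>y. n y * (y * (?I y - exp (- u * y))))"
      by (rule Bochner_Integration.integrable_bound[OF integrable_mult_right[OF q_int, of ?c]])
         (use bd[of u] u q_nn in \<open>auto simp: abs_mult\<close>)
    have "((\<lambda>u. \<integral>y. ?g u y \<partial>lborel) has_real_derivative (\<integral>y. n y * (y * (?I y - exp (- u * y))) \<partial>lborel)) (at u)"
    proof (rule has_field_derivative_integral[where S="{u / 2<..<2 * u}" and D="\<lambda>y. ?c * q y"])
      show "integrable lborel (\<lambda>y. ?c * q y)" using q_int by simp
      fix x y assume x: "x \<in> {u / 2<..<2 * u}"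
      show "integrable lborel (?g x)" by (rule g_int) (use x u in auto)
      show "((\<lambda>x. ?g x y) has_real_derivative n y * (y * (?I y - exp (- x * y)))) (at x)"
        by (auto intro!: derivative_eq_intros simp: algebra_simps)
      show "norm (n y * (y * (?I y - exp (- x * y)))) \<le> ?c * q y" using bd[of x y] x by simp
    qed (use u in auto)
    then have "((\<lambda>u. - b * u + (\<integral>y. ?g u y \<partial>lborel)) has_real_derivative (- b + (\<integral>y. n y * (y * (?I y - exp (- u * y))) \<partial>lborel))) (at u)"
      by (auto intro!: derivative_eq_intros)
    then show "(\<phi> has_real_derivative (- b + (\<integral>y. n y * (y * (?I y - exp (- u * y))) \<partial>lborel))) (at u)"
      by (rule has_field_derivative_transform_within_open[where S="{0<..}"]) (use u phi in auto)
  qed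
  (* The jumps below 1, for which psi1_tendsto_0 applies. *)
  define ns where "ns y = n y * ?I y" for y
  have ns_m[measurable]: "ns \<in> borel_measurable borel" unfolding ns_def[abs_def] by measurable
  interpret NS: levy_density ns
  proof
    show "integrable lborel (\<lambda>y. ns y * min y (y\<^sup>2))"
    proof (rule Bochner_Integration.integrable_bound[OF q_int])
      show "AE y in lborel. norm (ns y * min y (y\<^sup>2)) \<le> norm (q y)"
      proof (rule AE_I2)
        fix y show "norm (ns y * min y (y\<^sup>2)) \<le> norm (q y)"
        proof (cases "0 < y \<and> y < 1")
          case True
          then have "min y (y\<^sup>2) = y\<^sup>2" "min 1 (y\<^sup>2) = y\<^sup>2" using min_linear_quadratic[of y] by (auto simp: power_le_one min_def)
          then show ?thesis using True by (simp add: ns_def q_def)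
        next
          case False
          then show ?thesis by (auto simp: ns_def n_z)
        qed
      qed
    qed measurable
  qed (auto simp: ns_def n_nn n_z)
  define u where "u k = inverse (real (Suc k))" for k
  have u0: "0 < u k" for k by (simp add: u_def)
  have ulim: "u \<longlonglongrightarrow> 0" unfolding u_def[abs_def] by (rule LIMSEQ_inverse_real_of_nat)
  (* The integrand of the first moment of the jumps of size at least 1, and its exponentially damped
     versions. *)
  define nl where "nl y = n y * (y * (1 - ?I y))" for y
  define h where "h k y = nl y * exp (- (u k * y))" for k y
  have [measurable]: "nl \<in> borel_measurable borel" "h k \<in> borel_measurable borel" for k
    unfolding nl_def[abs_def] h_def[abs_def] by measurable
  have nl_nn: "0 \<le> nl y" for y using n_nn[of y] n_z[of y] by (auto simp: nl_def)
  have i1: "integrable lborel (\<lambda>y. ns y * (y * (1 - exp (- (u k * y)))))" for k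
    using NS.integrable_psi1[of "u k"] u0[of k] by simp
  have split: "h k y = ns y * (y * (1 - exp (- (u k * y)))) - n y * (y * (?I y - exp (- u k * y)))" for k y
    by (simp add: h_def nl_def ns_def)
  have h_int: "integrable lborel (h k)" for k
    unfolding split by (intro Bochner_Integration.integrable_diff i1 d_int u0)
  have "(\<integral>y. h k y \<partial>lborel) = psi1 ns (u k) - (deriv \<phi> (u k) + b)" for k
    unfolding split psi1_def DERIV_imp_deriv[OF dphi[OF u0]]
    by (subst Bochner_Integration.integral_diff[OF i1 d_int[OF u0]]) simp
  moreover have "(\<lambda>k. psi1 ns (u k) - (deriv \<phi> (u k) + b)) \<longlonglongrightarrow> 0 - (0 + b)"
  proof -
    have fl: "filterlim u (at_right 0) sequentially"
      using ulim u0 by (auto simp: filterlim_at less_imp_neq[OF u0, symmetric] intro!: always_eventually)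
    show ?thesis
      by (intro tendsto_intros filterlim_compose[OF NS.psi1_tendsto_0 fl] filterlim_compose[OF d0 fl])
  qed
  ultimately have hlim: "(\<lambda>k. \<integral>y. h k y \<partial>lborel) \<longlonglongrightarrow> - b" by simp
  have udec: "u (Suc k) \<le> u k" for k unfolding u_def by (intro le_imp_inverse_le) auto
  have mono_h: "mono (\<lambda>k. h k y)" for y
  proof (rule incseq_SucI)
    fix k
    show "h k y \<le> h (Suc k) y"
    proof (cases "0 < y")
      case True
      have "u (Suc k) * y \<le> u k * y" using udec True by (intro mult_right_mono) auto
      then show ?thesis unfolding h_def using nl_nn by (intro mult_left_mono) auto
    next
      case False then show ?thesis by (simp add: h_def nl_def n_z)
    qed
  qed
  have lim_h: "(\<lambda>k. h k y) \<longlonglongrightarrow> nl y" for y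
  proof -
    have "(\<lambda>k. h k y) \<longlonglongrightarrow> nl y * exp (- (0 * y))" unfolding h_def by (intro tendsto_intros ulim)
    then show ?thesis by simp
  qed
  have h_nn: "0 \<le> h k y" for k y by (simp add: h_def nl_nn)
  note mc = integral_monotone_convergence_nonneg[OF h_int AE_I2[OF mono_h] AE_I2[OF h_nn] AE_I2[OF lim_h] hlim]
  have nl_int: "integrable lborel nl" and nl_b: "(\<integral>y. nl y \<partial>lborel) = - b"
    by (rule mc, simp)+
  have L: "levy_density n"
  proof
    show "integrable lborel (\<lambda>y. n y * min y (y\<^sup>2))"
    proof (rule Bochner_Integration.integrable_bound)
      show "integrable lborel (\<lambda>y. q y + nl y)" using q_int nl_int by simp
      show "AE y in lborel. norm (n y * min y (y\<^sup>2)) \<le> norm (q y + nl y)"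
      proof (rule AE_I2)
        fix y
        have "n y * min y (y\<^sup>2) \<le> q y + nl y \<and> 0 \<le> n y * min y (y\<^sup>2)"
        proof (cases "0 < y")
          case True
          have "min y (y\<^sup>2) \<le> min 1 (y\<^sup>2) + y * (1 - ?I y)"
            using True min_linear_quadratic[of y] by (auto simp: min_def power_le_one)
          then have "n y * min y (y\<^sup>2) \<le> n y * (min 1 (y\<^sup>2) + y * (1 - ?I y))" using n_nn by (intro mult_left_mono) auto
          then show ?thesis using True n_nn[of y] unfolding q_def nl_def distrib_left by simp
        next
          case False then show ?thesis using q_nn[of y] by (simp add: n_z nl_def)
        qed
        then show "norm (n y * min y (y\<^sup>2)) \<le> norm (q y + nl y)" using q_nn[of y] nl_nn[of y] by simp
      qed
    qed measurable
  qed (auto simp: n_nn n_z)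
  interpret LD: levy_density n by (rule L)
  have phi_psi: "\<phi> v = psi n v" if v: "0 \<le> v" for v
  proof -
    have "psi n v = (\<integral>y. ?g v y + v * nl y \<partial>lborel)"
      unfolding psi_def by (intro Bochner_Integration.integral_cong) (auto simp: nl_def algebra_simps)
    also have "\<dots> = (\<integral>y. ?g v y \<partial>lborel) + v * (\<integral>y. nl y \<partial>lborel)"
      using g_int[OF v] nl_int by (subst Bochner_Integration.integral_add) auto
    also have "\<dots> = \<phi> v" using phi[OF v] nl_b by simp
    finally show ?thesis by simp
  qed
  have pos: "0 < psi n v" if v: "0 < v" for v
  proof (rule ccontr)
    assume "\<not> 0 < psi n v"
    then have "psi n v = 0" using LD.psi_nonneg[of v] by simp
    moreover have iv: "integrable lborel (\<lambda>y. n y * (exp (- (v * y)) - 1 + v * y))" using LD.integrable_psi v by simp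
    ultimately have "AE y in lborel. n y * (exp (- (v * y)) - 1 + v * y) = 0"
      unfolding psi_def by (subst (asm) integral_nonneg_eq_0_iff_AE[OF iv]) (auto intro!: mult_nonneg_nonneg n_nn exp_remainder_nonneg)
    then have ae: "AE y in lborel. n y = 0"
    proof eventually_elim
      case (elim y)
      show ?case
      proof (cases "0 < y")
        case True
        then have "0 < min (v * y) ((v * y)\<^sup>2)" using v by simp
        moreover have "min (v * y) ((v * y)\<^sup>2) \<le> 4 * (exp (- (v * y)) - 1 + v * y)" using v True by (intro exp_remainder_ge) simp
        ultimately have "0 < 4 * (exp (- (v * y)) - 1 + v * y)" by (rule less_le_trans)
        then have "exp (- (v * y)) - 1 + v * y \<noteq> 0" by auto
        then show ?thesis using elim by simp
      qed (simp add: n_z)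
    qed
    have "(\<integral>\<^sup>+x\<in>{0<..<1}. ennreal x \<partial>\<nu>) = (\<integral>\<^sup>+x. ennreal (n x) * (ennreal x * indicator {0<..<1} x) \<partial>lborel)"
      unfolding nu by (rule nn_integral_density) auto
    also have "\<dots> = (\<integral>\<^sup>+x. 0 \<partial>(lborel :: real measure))"
      by (rule nn_integral_cong_AE) (use ae in eventually_elim, simp)
    finally show False using uv by (simp add: unbounded_variation_def)
  qed
  show ?thesis
  proof (rule that[OF L phi_psi C0 _ pos])
    fix x y :: real assume "0 < x" "x \<le> y"
    then show "n y \<le> C0 * n x" using mono[of x y] by (simp add: n_def)
  qed
qed

section \<open>The two-sided estimate\<close>

lemma (in levy_density) deriv_eq_psi1:
  assumes "\<And>u. 0 \<le> u \<Longrightarrow> \<phi> u = psi n u" "0 < v"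
  shows "deriv \<phi> v = psi1 n v"
proof (rule DERIV_imp_deriv)
  show "(\<phi> has_real_derivative psi1 n v) (at v)"
    by (rule has_field_derivative_transform_within_open[OF psi_deriv[OF assms(2)], where S="{0<..}"]) (use assms in auto)
qed

lemma (in levy_density) deriv_deriv_eq_psi2:
  assumes "\<And>u. 0 \<le> u \<Longrightarrow> \<phi> u = psi n u" "0 < v"
  shows "deriv (deriv \<phi>) v = psi2 n v"
proof (rule DERIV_imp_deriv)
  show "(deriv \<phi> has_real_derivative psi2 n v) (at v)"
    by (rule has_field_derivative_transform_within_open[OF psi1_deriv[OF assms(2)], where S="{0<..}"])
       (use assms deriv_eq_psi1[OF assms(1)] in auto)
qed

lemma (in scaling_density) exists_psi1_eq: assumes b: "0 < b" shows "\<exists>w>0. psi1 n w = b"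
proof -
  have "\<forall>\<^sub>F v in at_right 0. psi1 n v < b" using order_tendstoD(2)[OF psi1_tendsto_0 b] .
  then obtain d where d: "0 < d" "\<And>v. 0 < v \<Longrightarrow> v < d \<Longrightarrow> psi1 n v < b" by (auto simp: eventually_at_right_field)
  define v where "v = min 1 (d / 2)"
  have v: "0 < v" "v \<le> 1" "psi1 n v \<le> b" using d by (auto simp: v_def intro!: less_imp_le d(2))
  obtain R where R: "1 \<le> R" "b * R \<le> psi n R" using psi_superlinear[of 1 b] by auto
  have "0 < R" using R by simp
  then have "b * R \<le> R * psi1 n R" using R(2) psi_le_psi1[of R] by linarith
  then have "R * b \<le> R * psi1 n R" by (subst mult.commute)
  then have hi: "b \<le> psi1 n R" by (rule mult_left_le_imp_le) (use R in simp)
  have cont: "continuous_on {v..R} (psi1 n)"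
    using v by (intro continuous_at_imp_continuous_on ballI DERIV_isCont[OF psi1_deriv]) auto
  obtain w where "v \<le> w" "psi1 n w = b" using IVT'[OF v(3) hi _ cont] v R by auto
  then show ?thesis using v by (intro exI[of _ w]) auto
qed

lemma (in scaling_density) halfline_inv_psi:
  assumes "\<And>u. 0 \<le> u \<Longrightarrow> \<phi> u = psi n u" "0 < r"
  shows "halfline_inv \<phi> (psi n r) = r"
proof (rule the_inv_into_f_eq)
  show "inj_on \<phi> {0..}"
  proof (rule linorder_inj_onI)
    fix x y :: real assume xy: "x < y" "x \<in> {0..}" "y \<in> {0..}"
    have "psi n x < psi n y"
    proof (cases "x = 0")
      case True then show ?thesis using psi_pos[of y] xy by simp
    next
      case False then show ?thesis using xy by (intro psi_strict_mono) auto
    qed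
    then show "\<phi> x \<noteq> \<phi> y" using assms(1) xy by auto
  qed auto
qed (use assms in auto)

lemma (in scaling_density) halfline_inv_psi1:
  assumes "\<And>u. 0 \<le> u \<Longrightarrow> f u = psi1 n u" "0 < w"
  shows "halfline_inv f (psi1 n w) = w"
proof (rule the_inv_into_f_eq)
  show "inj_on f {0..}"
  proof (rule linorder_inj_onI)
    fix x y :: real assume xy: "x < y" "x \<in> {0..}" "y \<in> {0..}"
    have "psi1 n x < psi1 n y"
    proof (cases "x = 0")
      case True
      have "0 < y * psi1 n y" using psi_le_psi1[of y] psi_pos[of y] xy True by auto
      then show ?thesis using True xy by (simp add: zero_less_mult_iff)
    next
      case False then show ?thesis using xy by (intro psi1_strict_mono) auto
    qed
    then show "f x \<noteq> f y" using assms(1) xy by auto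
  qed auto
qed (use assms in auto)

theorem theorem5p3:
  fixes M :: "'a measure" and X :: "real \<Rightarrow> 'a \<Rightarrow> real"
    and \<phi> :: "real \<Rightarrow> real" and \<sigma> b :: real and \<nu> :: "real measure"
    and \<alpha> \<beta> c C x0 :: real
    and p :: "real \<Rightarrow> real \<Rightarrow> real"
  assumes "spectrally_positive_levy_process M X"
    and "has_characteristics M X \<phi> \<sigma> b \<nu>"
    and "unbounded_variation \<sigma> \<nu>"
    and "theta1 \<phi> = 0"
    and "(deriv \<phi> \<longlongrightarrow> 0) (at_right 0)"
    and "\<sigma> = 0"
    and "\<phi> \<in> WLSC \<alpha> c x0 \<inter> WUSC \<beta> C x0"
    and "0 < c" "c \<le> 1" "1 \<le> C" "0 \<le> x0"
    and "1 < \<alpha>" "\<alpha> \<le> \<beta>" "\<beta> < 2"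
    and "has_almost_monotone_density \<nu>"
  defines "p \<equiv> \<lambda>t. continuous_density M (X t)"
  shows "\<exists>x1::ereal. 0 < x1 \<and> (x0 = 0 \<longrightarrow> x1 = \<infinity>) \<and>
    (\<exists>k1>0. \<exists>k2>0. \<forall>t x. 0 < t \<longrightarrow> ereal t < 1 / ereal (Phi \<phi> x0) \<longrightarrow> ereal x < x1 \<longrightarrow>
      (let r = halfline_inv \<phi> (1 / t);
           w = halfline_inv (deriv0 \<phi>) (- x / t);
           q = (if x * r \<le> -1 then
                  (t * deriv (deriv \<phi>) w) powr (- 1 / 2) * exp (- t * (w * deriv0 \<phi> w - \<phi> w))
                else if x * r \<le> 1 then r
                else t * inverse x * \<phi> (1 / x))
       in k1 * q \<le> p t x \<and> p t x \<le> k2 * q))"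
proof -
  have ch: "has_characteristics M X \<phi> 0 b \<nu>" and uv: "unbounded_variation 0 \<nu>"
    using assms(2,3) \<open>\<sigma> = 0\<close> by auto
  obtain n C0 where L: "levy_density n" and phi: "\<And>u. 0 \<le> u \<Longrightarrow> \<phi> u = psi n u" and C0: "1 \<le> C0" 
    and am: "\<And>x y. 0 < x \<Longrightarrow> x \<le> y \<Longrightarrow> n y \<le> C0 * n x" and pos: "\<And>v. 0 < v \<Longrightarrow> 0 < psi n v"
    by (rule levy_density_of_characteristics[OF ch uv assms(5) assms(15)], rule that; blast)
  interpret levy_density n by (rule L)
  have x0_nn: "0 \<le> x0" by fact
  interpret S: scaling_density n \<alpha> c \<beta> C x0 C0
  proof
    fix u x :: real assume u: "1 \<le> u" and x: "x0 < x"
    have x': "0 \<le> x" "0 \<le> u * x" using x x0_nn u by auto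
    have "c * u powr \<alpha> * \<phi> x \<le> \<phi> (u * x)" "\<phi> (u * x) \<le> C * u powr \<beta> * \<phi> x"
      using assms(7) u x by (auto simp: WLSC_def WUSC_def)
    then show "c * u powr \<alpha> * psi n x \<le> psi n (u * x)" "psi n (u * x) \<le> C * u powr \<beta> * psi n x"
      using phi x' by auto
  qed (use assms C0 am pos in auto)
  have d1: "deriv \<phi> v = psi1 n v" if "0 < v" for v by (rule deriv_eq_psi1[OF phi that])
  have d2: "deriv (deriv \<phi>) v = psi2 n v" if "0 < v" for v by (rule deriv_deriv_eq_psi2[OF phi that])
  have d0: "deriv0 \<phi> v = psi1 n v" if "0 \<le> v" for v
  proof (cases "v = 0")
    case True
    have "Lim (at_right 0) (deriv \<phi>) = 0" by (rule tendsto_Lim[OF _ assms(5)]) simp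
    then show ?thesis using True by (simp add: deriv0_def)
  next
    case False
    then show ?thesis using d1 that by (simp add: deriv0_def)
  qed
  have M: "prob_space M" using assms(1) by (simp add: spectrally_positive_levy_process_def levy_process_def)
  have p_eq: "p t = S.p t" if t: "0 < t" for t
  proof -
    have "X t \<in> borel_measurable M"
      using assms(1) t by (simp add: spectrally_positive_levy_process_def levy_process_def)
    moreover have "integrable M (\<lambda>\<omega>. exp (- u * X t \<omega>))" "(\<integral>\<omega>. exp (- u * X t \<omega>) \<partial>M) = exp (t * psi n u)" if "0 \<le> u" for u
    proof -
      have "integrable M (\<lambda>\<omega>. exp (- u * X t \<omega>)) \<and> (LINT \<omega>|M. exp (- u * X t \<omega>)) = exp (t * \<phi> u)"
        using ch t that unfolding has_characteristics_def has_laplace_exponent_def by auto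
      then show "integrable M (\<lambda>\<omega>. exp (- u * X t \<omega>))" "(\<integral>\<omega>. exp (- u * X t \<omega>) \<partial>M) = exp (t * psi n u)"
        using phi[OF that] by auto
    qed
    ultimately have "distributed M lborel (X t) (\<lambda>x. ennreal (S.p t x))" by (rule S.distributed_p[OF M _ t])
    then show ?thesis
      unfolding p_def by (intro continuous_density_eq[OF M S.p_continuous[OF t] S.p_nonneg[OF t]])
  qed
  obtain \<Theta> a1 a2 where Th: "1 \<le> \<Theta>" and a: "0 < a1" "0 < a2" and core:
    "\<And>t r w x. 0 < t \<Longrightarrow> 0 < r \<Longrightarrow> t * psi n r = 1 \<Longrightarrow> \<Theta> * x0 < r \<Longrightarrow>
     (x * r \<le> -1 \<longrightarrow> 0 < w \<and> t * psi1 n w = - x) \<Longrightarrow> (1 < x * r \<longrightarrow> \<Theta> * x * x0 < 1) \<Longrightarrow>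
     a1 * S.target t r w x \<le> S.p t x \<and> S.p t x \<le> a2 * S.target t r w x"
    using S.core_estimate by blast
  obtain b1 b2 where bb: "0 < b1" "0 < b2" and loc:
    "\<And>t r w x. 0 < x0 \<Longrightarrow> 0 < t \<Longrightarrow> t < 1 / Phi \<phi> x0 \<Longrightarrow> 0 < r \<Longrightarrow> t * psi n r = 1 \<Longrightarrow> r \<le> \<Theta> * x0 \<Longrightarrow>
     (x * r \<le> -1 \<longrightarrow> 0 < w \<and> t * psi1 n w = - x) \<Longrightarrow> x * r \<le> 1 \<Longrightarrow>
     b1 * S.target t r w x \<le> S.p t x \<and> S.p t x \<le> b2 * S.target t r w x"
  proof (cases "0 < x0")
    case True
    have "0 < Phi \<phi> x0" using True d2[OF True] psi2_pos[OF True pos[OF True]] by (simp add: Phi_def)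
    then have T: "0 < 1 / Phi \<phi> x0" by simp
    obtain b1 b2 where "0 < b1" "0 < b2" and
      "\<forall>t r w x. 0 < t \<longrightarrow> t \<le> 1 / Phi \<phi> x0 \<longrightarrow> 0 < r \<longrightarrow> t * psi n r = 1 \<longrightarrow> r \<le> \<Theta> * x0 \<longrightarrow>
       (x * r \<le> -1 \<longrightarrow> 0 < w \<and> t * psi1 n w = - x) \<longrightarrow> x * r \<le> 1 \<longrightarrow>
       b1 * S.target t r w x \<le> S.p t x \<and> S.p t x \<le> b2 * S.target t r w x"
      using S.local_estimate[OF True Th T] by blast
    then show ?thesis using that[of b1 b2] by (auto dest: less_imp_le)
  next
    case False
    then show ?thesis using that[of 1 1] by auto
  qed
  (* With this bound on x, the case 1 < x r can only occur if Theta * x0 < r. *)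
  define x1 :: ereal where "x1 = (if x0 = 0 then \<infinity> else ereal (1 / (\<Theta> * x0)))"
  have x1: "0 < x1" "x0 = 0 \<longrightarrow> x1 = \<infinity>" using Th x0_nn by (auto simp: x1_def)
  have k: "0 < min a1 b1" "0 < max a2 b2" using a bb by auto
  show ?thesis
  proof (rule exI[of _ x1], intro conjI, rule x1(1), rule x1(2), rule exI[of _ "min a1 b1"], rule conjI[OF k(1)],
      rule exI[of _ "max a2 b2"], rule conjI[OF k(2)], intro allI impI)
    fix t x
    assume t: "0 < t" and tT: "ereal t < 1 / ereal (Phi \<phi> x0)" and xx: "ereal x < x1"
    have xs: "\<Theta> * x * x0 < 1"
    proof (cases "x0 = 0")
      case False
      then have "0 < \<Theta> * x0" using Th x0_nn by simp
      moreover have "x < 1 / (\<Theta> * x0)" using xx False by (simp add: x1_def)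
      ultimately have "x * (\<Theta> * x0) < 1" by (simp add: pos_less_divide_eq)
      then show ?thesis by (simp add: mult_ac)
    qed simp
    obtain r where r: "0 < r" "psi n r = 1 / t" using S.exists_psi_eq[of "1 / t"] t by auto
    have tr: "t * psi n r = 1" using r t by simp
    have ri: "halfline_inv \<phi> (1 / t) = r" using S.halfline_inv_psi[OF phi r(1)] r(2) by simp
    define w where "w = halfline_inv (deriv0 \<phi>) (- x / t)"
    have w: "0 < w \<and> t * psi1 n w = - x" if "x * r \<le> -1"
    proof -
      have "x < 0" using that r(1) by (smt (verit) mult_nonneg_nonneg)
      then have "0 < - x / t" using t by (simp add: divide_neg_pos)
      then obtain v where v: "0 < v" "psi1 n v = - x / t" using S.exists_psi1_eq by blast
      have "w = v" unfolding w_def v(2)[symmetric] by (rule S.halfline_inv_psi1[OF d0 v(1)])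
      then show ?thesis using v t by simp
    qed
    have q: "(if x * r \<le> -1 then (t * deriv (deriv \<phi>) w) powr (- 1 / 2) * exp (- t * (w * deriv0 \<phi> w - \<phi> w))
                else if x * r \<le> 1 then r else t * inverse x * \<phi> (1 / x)) = S.target t r w x"
    proof (cases "x * r \<le> -1")
      case True
      then have w0: "0 < w" using w by blast
      then show ?thesis using True by (simp add: S.target_def S.left_target_def d2 d0 phi)
    next
      case False
      show ?thesis
      proof (cases "x * r \<le> 1")
        case x2: False
        then have "0 < x" using r(1) by (smt (verit) mult_nonpos_nonneg)
        then show ?thesis using False x2 phi[of "1 / x"] by (simp add: S.target_def)
      qed (use False in \<open>simp add: S.target_def\<close>)
    qed
    have q0: "0 \<le> S.target t r w x"
    proof (cases "1 < x * r")
      case True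
      then have "0 < x" using r(1) by (smt (verit) mult_nonpos_nonneg)
      then show ?thesis using True t psi_nonneg by (simp add: S.target_def)
    next
      case False
      then show ?thesis using r(1) by (simp add: S.target_def S.left_target_def)
    qed
    have le: "min a1 b1 * S.target t r w x \<le> a1 * S.target t r w x" "min a1 b1 * S.target t r w x \<le> b1 * S.target t r w x"
      "a2 * S.target t r w x \<le> max a2 b2 * S.target t r w x" "b2 * S.target t r w x \<le> max a2 b2 * S.target t r w x"
      using q0 by (auto intro!: mult_right_mono)
    have "min a1 b1 * S.target t r w x \<le> S.p t x \<and> S.p t x \<le> max a2 b2 * S.target t r w x"
    proof (cases "\<Theta> * x0 < r")
      case True
      have "a1 * S.target t r w x \<le> S.p t x \<and> S.p t x \<le> a2 * S.target t r w x"
        by (rule core[OF t r(1) tr True]) (use w xs in auto)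
      then show ?thesis using le by linarith
    next
      case False
      then have x0p: "0 < x0" using r(1) x0_nn Th by (cases "x0 = 0") auto
      have "Phi \<phi> x0 \<noteq> 0" using x0p d2[OF x0p] psi2_pos[OF x0p pos[OF x0p]] by (simp add: Phi_def)
      then have tT': "t < 1 / Phi \<phi> x0" using tT by (simp add: one_ereal_def)
      have "x * r \<le> 1"
      proof (cases "0 \<le> x")
        case True
        have "x * r \<le> x * (\<Theta> * x0)" using True False by (intro mult_left_mono) auto
        then show ?thesis using xs by (simp add: mult_ac)
      next
        case False
        then have "x * r \<le> 0" using r(1) by (intro mult_nonpos_nonneg) auto
        then show ?thesis by simp
      qed
      then have "b1 * S.target t r w x \<le> S.p t x \<and> S.p t x \<le> b2 * S.target t r w x"
        by (intro loc[OF x0p t tT' r(1) tr]) (use w False in auto)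
      then show ?thesis using le by linarith
    qed
    then show "let r = halfline_inv \<phi> (1 / t); w = halfline_inv (deriv0 \<phi>) (- x / t);
           q = (if x * r \<le> -1 then
                  (t * deriv (deriv \<phi>) w) powr (- 1 / 2) * exp (- t * (w * deriv0 \<phi> w - \<phi> w))
                else if x * r \<le> 1 then r
                else t * inverse x * \<phi> (1 / x))
       in min a1 b1 * q \<le> p t x \<and> p t x \<le> max a2 b2 * q"
      unfolding Let_def ri w_def[symmetric] q p_eq[OF t] .
  qed
qed

end
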